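(* Let $q,\mathbf{t}$ be generic. (i) For every $\lambda\in\Lambda^+$ the space $\mathcal{A}_+(\lambda)$ is spanned by the symmetric Koornwinder polynomial $P_\lambda^+$. (ii) For $\lambda\in\Lambda^+$, the space $\mathcal{A}_-(\lambda)$ is one-dimensional if $\lambda\in\Lambda^{++}$ and zero-dimensional otherwise. For $\lambda\in\Lambda^{++}$ there exists a unique $P_\lambda^-\in\mathcal{A}_-(\lambda)$ of the form $P_\lambda^-=x^\lambda+\sum_{\mu\prec\lambda}e_\mu x^\mu$ for certain constants $e_\mu\in\mathbb{C}$. (iii) The expressions for $P_\lambda^+$ ($\lambda\in\Lambda^+$) and for $P_\lambda^-$ ($\lambda\in\Lambda^{++}$) as linear combinations of the non-symmetric Koornwinder polynomials $P_\mu$ ($\mu\in W\lambda$) are $$P_\lambda^{\pm}=\sum_{\mu\in W\lambda}c_{\lambda,\mu}^{\pm}P_\mu,$$ where for $\mu\in W\lambda$ $$c_{\lambda,\mu}^{\pm}=(\pm1)^{l(w_\mu)}\,\tilde t_{w_\mu}^{-2}\prod_{\alpha\in\Sigma^+,\ \langle\mu,\alpha\rangle<0}\widetilde v_{\pm\alpha}(\gamma_\mu)=(\pm1)^{l(w_\mu)}\,\tilde t_{w_\mu}^{-2}\prod_{\alpha\in\Sigma^+\cap w_\mu^{-1}\Sigma^-}\widetilde v_{\pm\alpha}(\gamma_\lambda^{-1}).$$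
   Context: Root data. Let $n\ge 2$, $V=\mathbb{R}^n$ with standard scalar product $\langle\cdot,\cdot\rangle$ and orthonormal basis $\epsilon_1,\dots,\epsilon_n$, $\Lambda=\bigoplus_i\mathbb{Z}\epsilon_i$, $\lambda_i=\langle\lambda,\epsilon_i\rangle$. Let $\widehat V=V\oplus\mathbb{R}\delta$ with $\langle\cdot,\cdot\rangle$ extended so that $\delta$ lies in the radical; $f^\vee=2f/\langle f,f\rangle$, $s_f(g)=g-\langle g,f^\vee\rangle f$. $\Sigma^+=\{2\epsilon_i\}_i\cup\{\epsilon_i\pm\epsilon_j\}_{i<j}$, $\Sigma^-=-\Sigma^+$, $\Sigma=\Sigma^+\cup\Sigma^-$; $R=\{\alpha+m\delta:\alpha\in\Sigma,m\in\mathbb{Z}\}$. Simple roots $a_0=\delta-2\epsilon_1$, $a_i=\epsilon_i-\epsilon_{i+1}$ ($1\le i<n$), $a_n=2\epsilon_n$; $s_i=s_{a_i}$; $\mathcal{W}=\langle s_0,\dots,s_n\rangle$ (a Coxeter group on these generators, length function $l$), $W=\langle s_1,\dots,s_n\rangle$; $\mathcal{W}=W\ltimes\tau(\Lambda)$ with $\tau(\lambda)f=f+\langle\lambda,f\rangle\delta$. Parameters. $q\in\mathbb{C}\setminus\{0\}$ with a fixed square root $q^{1/2}$, and $\mathbf{t}$ consists of nonzero complex numbers $t_0,t,t_n,t_0^\vee,t_n^\vee$; all are generic, i.e. outside a countable union of proper algebraic hypersurfaces (in particular $q$ is not a root of unity, the points $\gamma_\lambda$ below are mutually distinct and all denominators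 are nonzero). $t_i=t$ for $1\le i<n$. Put $t_{\pm\epsilon_i\pm\epsilon_j+m\delta}=t$ ($i<j$); $t_{\pm2\epsilon_i+m\delta}=t_0$ for $m$ odd, $t_n$ for $m$ even; $t_{\pm\epsilon_i+\frac m2\delta}=t_0^\vee$ for $m$ odd, $t_n^\vee$ for $m$ even ($m\in\mathbb{Z}$); $t_f=1$ for all other $f\in\widehat V$. Operators. $\mathcal{A}=\mathbb{C}[x_1^{\pm1},\dots,x_n^{\pm1}]$, $x^\lambda=\prod_ix_i^{\lambda_i}$, $x^{\lambda+c\delta}=q^cx^\lambda$; $\mathcal{W}$ acts on $\mathcal{A}$ by algebra automorphisms with $w(x^\lambda)=x^{w\lambda}$. For $\beta\in R$, $v_\beta(x)=v_\beta(x;\mathbf{t};q)=\dfrac{(1-t_\beta t_{\beta/2}x^{\beta/2})(1+t_\beta t_{\beta/2}^{-1}x^{\beta/2})}{1-x^\beta}$. $T_i=t_i+t_i^{-1}v_{a_i}(x)(s_i-1)\in\mathrm{End}_{\mathbb{C}}(\mathcal{A})$ ($0\le i\le n$); these satisfy the braid relations of $\mathcal W$ (and $(T_i-t_i)(T_i+t_i^{-1})=0$), so $T_w=T_{i_1}\cdots T_{i_r}$ is well defined for a reduced expression $w=s_{i_1}\cdots s_{i_r}\in\mathcal{W}$. Non-symmetric Koornwinder polynomials. $\Lambda^+=\{\lambda\in\Lambda:\lambda_1\ge\dots\ge\lambda_n\ge0\}$. $Y^\lambda=T_{\tau(\lambda)}$ for $\lambda\in\Lambda^+$, $Y^{\mu-\nu}=Y^\mu(Y^\nu)^{-1}$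 for $\mu,\nu\in\Lambda^+$ (well defined, commuting); $f(Y)=\sum c_\lambda Y^\lambda$ for $f=\sum c_\lambda x^\lambda\in\mathcal{A}$. $\lambda^+$ is the unique element of $W\lambda\cap\Lambda^+$ and $w_\lambda\in W$ is the element of minimal length with $w_\lambda\lambda^+=\lambda$. $\lambda\le\mu$ means $\mu-\lambda$ is a nonnegative integer combination of $a_1,\dots,a_{n-1},\epsilon_n$; $\lambda\preceq\mu$ means $\lambda^+<\mu^+$, or $\lambda^+=\mu^+$ and $\lambda\le\mu$; $\lambda\prec\mu$ means $\lambda\preceq\mu$, $\lambda\ne\mu$. For $y\in(\mathbb{C}\setminus\{0\})^n$, $f(y)$ is the value at $x=y$; $y^{-1}$ is componentwise inverse. With $\varepsilon(m)=1$ for $m\ge0$ and $-1$ for $m<0$, put $\rho_l(\lambda)=\sum_i\varepsilon(\lambda_i)\epsilon_i$, $\rho_m(\lambda)=\sum_{i<j}[\varepsilon(\lambda_i-\lambda_j)(\epsilon_i-\epsilon_j)+\varepsilon(\lambda_i+\lambda_j)(\epsilon_i+\epsilon_j)]$, and let $\gamma_\lambda\in(\mathbb{C}\setminus\{0\})^n$ have $i$-th component $(t_0t_n)^{\rho_l(\lambda)_i}t^{\rho_m(\lambda)_i}q^{\lambda_i}$. $P_\lambda$ ($\lambda\in\Lambda$) is the unique element of $\mathcal{A}$ of the form $x^\lambda+\sum_{\mu\prec\lambda}c_{\lambda,\mu}x^\mu$ with $f(Y)P_\lambda=f(\gamma_\lambda)P_\lambda$ for all $f\in\mathcal{A}$.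 Symmetric Koornwinder polynomials. $\mathcal{A}^W$ is the algebra of $W$-invariants, $m_\lambda=\sum_{\mu\in W\lambda}x^\mu$. For $\lambda\in\Lambda^+$, $P_\lambda^+$ is the unique element of $\mathcal{A}^W$ of the form $m_\lambda+\sum_{\mu\in\Lambda^+,\mu<\lambda}c_{\lambda,\mu}m_\mu$ with $f(Y)P_\lambda^+=f(\gamma_\lambda)P_\lambda^+$ for all $f\in\mathcal{A}^W$. Spaces. For $\lambda\in\Lambda^+$: $\mathcal{A}(\lambda)=\mathrm{span}\{P_\mu:\mu\in W\lambda\}$, $\mathcal{A}_\pm(\lambda)=\{f\in\mathcal{A}(\lambda): T_if=\pm t_i^{\pm1}f,\ i=1,\dots,n\}$. $\Lambda^{++}=\kappa+\Lambda^+$ with $\kappa=\frac12\sum_{\alpha\in\Sigma^+}\alpha=(n,n-1,\dots,1)$. Dual parameters. $\tilde{\mathbf{t}}$ is obtained from $\mathbf{t}$ by $\tilde t_0=t_n^\vee$, $\tilde t_n^\vee=t_0$, $\tilde t=t$, $\tilde t_n=t_n$, $\tilde t_0^\vee=t_0^\vee$; $\widetilde v_\beta(x)=v_\beta(x;\tilde{\mathbf{t}};q)$; $\tilde t_w=\tilde t_{i_1}\cdots\tilde t_{i_r}$ for a reduced expression $w=s_{i_1}\cdots s_{i_r}$ (with $\tilde t_i=t$ for $1\le i<n$). *)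

theory Defs
  imports Complex_Main "HOL-Library.Poly_Mapping" "HOL-Library.Countable_Set"
begin

section \<open>Parameters\<close>

text \<open>The parameters \<open>(q, t)\<close>, with \<open>q\<close> given through its chosen square root. The field
  \<open>tmid\<close> is the parameter written \<open>t\<close> without index; \<open>t0v\<close> and \<open>tnv\<close> are the parameters
  with a check.\<close>

record kparams =
  qhalf :: complex
  t0 :: complex
  tmid :: complex
  tn :: complex
  t0v :: complex
  tnv :: complex

definition qpar :: "kparams \<Rightarrow> complex" where
  "qpar p = (qhalf p)\<^sup>2"

definition nonzero_params :: "kparams \<Rightarrow> bool" where
  "nonzero_params p \<longleftrightarrow> qhalf p \<noteq> 0 \<and> t0 p \<noteq> 0 \<and> tmid p \<noteq> 0 \<and> tn p \<noteq> 0 \<and> t0v p \<noteq> 0 \<and> tnv p \<noteq> 0"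

definition dual_params :: "kparams \<Rightarrow> kparams" where
  "dual_params p = p\<lparr>t0 := tnv p, tnv := t0 p\<rparr>"

text \<open>A polynomial in variables indexed by \<open>nat\<close> is a finitely supported map from exponent
  vectors to coefficients.\<close>

definition mpoly_eval :: "((nat \<Rightarrow>\<^sub>0 nat) \<Rightarrow>\<^sub>0 complex) \<Rightarrow> complex list \<Rightarrow> complex" where
  "mpoly_eval F z =
    (\<Sum>m\<in>Poly_Mapping.keys F. Poly_Mapping.lookup F m *
       (\<Prod>i\<in>Poly_Mapping.keys m. (z ! i) ^ Poly_Mapping.lookup m i))"

text \<open>Points of complex affine 6-space are lists of length 6. (Nonzero constants \<open>F\<close> are
  allowed and give the empty set.)\<close>

definition proper_hypersurface :: "complex list set \<Rightarrow> bool" where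
  "proper_hypersurface H \<longleftrightarrow>
    (\<exists>F :: (nat \<Rightarrow>\<^sub>0 nat) \<Rightarrow>\<^sub>0 complex.
       F \<noteq> 0 \<and> (\<forall>m\<in>Poly_Mapping.keys F. Poly_Mapping.keys m \<subseteq> {..<6}) \<and>
       H = {z. length z = 6 \<and> mpoly_eval F z = 0})"

definition param_point :: "kparams \<Rightarrow> complex list" where
  "param_point p = [qpar p, t0 p, tmid p, tn p, t0v p, tnv p]"


section \<open>Lattice and affine roots\<close>

text \<open>The pair \<open>(\<lambda>, m)\<close> stands for
  \<open>\<lambda> + m\<delta>\<close>; all roots, and all vectors on which the affine Weyl group has to act, lie in
  this integral form of \<open>V \<oplus> \<real>\<delta>\<close>. The linear order on
  \<open>lattice_vec\<close> that comes with \<open>Poly_Mapping\<close> is not used. Weights \<open>\<lambda>\<close> are called \<open>la\<close> below.\<close>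

type_synonym lattice_vec = "nat \<Rightarrow>\<^sub>0 int"
type_synonym affine_vec = "lattice_vec \<times> int"

definition Lam :: "nat \<Rightarrow> lattice_vec set" where
  "Lam n = {la. Poly_Mapping.keys la \<subseteq> {1..n}}"

definition ip :: "lattice_vec \<Rightarrow> lattice_vec \<Rightarrow> int" where
  "ip la \<mu> = (\<Sum>i\<in>Poly_Mapping.keys la. Poly_Mapping.lookup la i * Poly_Mapping.lookup \<mu> i)"

definition eps :: "nat \<Rightarrow> lattice_vec" where
  "eps i = Poly_Mapping.single i 1"

definition long_pos :: "nat \<Rightarrow> lattice_vec set" where
  "long_pos n = {frag_cmul 2 (eps i) |i. i \<in> {1..n}}"

definition mid_pos :: "nat \<Rightarrow> lattice_vec set" where
  "mid_pos n = {eps i + eps j |i j. 1 \<le> i \<and> i < j \<and> j \<le> n} \<union>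
               {eps i - eps j |i j. 1 \<le> i \<and> i < j \<and> j \<le> n}"

definition Sigma_pos :: "nat \<Rightarrow> lattice_vec set" where
  "Sigma_pos n = long_pos n \<union> mid_pos n"

definition Sigma_neg :: "nat \<Rightarrow> lattice_vec set" where
  "Sigma_neg n = uminus ` Sigma_pos n"

definition long_roots :: "nat \<Rightarrow> lattice_vec set" where
  "long_roots n = long_pos n \<union> uminus ` long_pos n"

definition mid_roots :: "nat \<Rightarrow> lattice_vec set" where
  "mid_roots n = mid_pos n \<union> uminus ` mid_pos n"

definition simple_root :: "nat \<Rightarrow> nat \<Rightarrow> affine_vec" where
  "simple_root n i =
    (if i = 0 then (frag_cmul (- 2) (eps 1), 1)
     else if i < n then (eps i - eps (Suc i), 0)
     else (frag_cmul 2 (eps n), 0))"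

text \<open>The reflection \<open>s\<^sub>f\<close>. For a root \<open>f\<close> and integral \<open>g\<close> the number
  \<open>\<langle>g, f\<^sup>\<or>\<rangle> = 2\<langle>g, f\<rangle> / \<langle>f, f\<rangle>\<close> is an integer, so the division is exact.\<close>

definition refl :: "affine_vec \<Rightarrow> affine_vec \<Rightarrow> affine_vec" where
  "refl f g =
    (let k = (2 * ip (fst g) (fst f)) div ip (fst f) (fst f)
     in (fst g - frag_cmul k (fst f), snd g - k * snd f))"


section \<open>The affine Weyl group\<close>

definition srefl :: "nat \<Rightarrow> nat \<Rightarrow> affine_vec \<Rightarrow> affine_vec" where
  "srefl n i = refl (simple_root n i)"

definition word_elt :: "nat \<Rightarrow> nat list \<Rightarrow> affine_vec \<Rightarrow> affine_vec" where
  "word_elt n is = foldr (\<lambda>i w. srefl n i \<circ> w) is id"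

text \<open>The generators are involutions, so the products of words form the group they generate.
  \<open>finW\<close> is \<open>W\<close>; the affine Weyl group is the range of \<open>word_elt n\<close> on words over \<open>{0..n}\<close>.\<close>

definition finW :: "nat \<Rightarrow> (affine_vec \<Rightarrow> affine_vec) set" where
  "finW n = word_elt n ` {is. set is \<subseteq> {1..n}}"

definition len :: "nat \<Rightarrow> (affine_vec \<Rightarrow> affine_vec) \<Rightarrow> nat" where
  "len n w = (LEAST r. \<exists>is. set is \<subseteq> {0..n} \<and> length is = r \<and> word_elt n is = w)"

definition reduced_expr :: "nat \<Rightarrow> (affine_vec \<Rightarrow> affine_vec) \<Rightarrow> nat list \<Rightarrow> bool" where
  "reduced_expr n w is \<longleftrightarrow> set is \<subseteq> {0..n} \<and> word_elt n is = w \<and> length is = len n w"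

text \<open>Only used where, by the braid relations, the outcome does not depend on the choice.\<close>

definition some_reduced :: "nat \<Rightarrow> (affine_vec \<Rightarrow> affine_vec) \<Rightarrow> nat list" where
  "some_reduced n w = (SOME is. reduced_expr n w is)"

definition tau :: "lattice_vec \<Rightarrow> affine_vec \<Rightarrow> affine_vec" where
  "tau la f = (fst f, snd f + ip la (fst f))"

definition orbit :: "nat \<Rightarrow> lattice_vec \<Rightarrow> lattice_vec set" where
  "orbit n la = {fst (w (la, 0)) |w. w \<in> finW n}"

definition Lam_plus :: "nat \<Rightarrow> lattice_vec set" where
  "Lam_plus n =
    {la \<in> Lam n.
       (\<forall>i j. 1 \<le> i \<and> i \<le> j \<and> j \<le> n \<longrightarrow> Poly_Mapping.lookup la j \<le> Poly_Mapping.lookup la i) \<and>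
       (\<forall>i\<in>{1..n}. 0 \<le> Poly_Mapping.lookup la i)}"

definition kappa :: "nat \<Rightarrow> lattice_vec" where
  "kappa n = (\<Sum>i=1..n. frag_cmul (int (n + 1 - i)) (eps i))"

definition Lam_plusplus :: "nat \<Rightarrow> lattice_vec set" where
  "Lam_plusplus n = (\<lambda>\<mu>. kappa n + \<mu>) ` Lam_plus n"

definition dom_rep :: "nat \<Rightarrow> lattice_vec \<Rightarrow> lattice_vec" where
  "dom_rep n la = (THE \<mu>. \<mu> \<in> orbit n la \<and> \<mu> \<in> Lam_plus n)"

definition w_min :: "nat \<Rightarrow> lattice_vec \<Rightarrow> affine_vec \<Rightarrow> affine_vec" where
  "w_min n la =
    (THE w. w \<in> finW n \<and> w (dom_rep n la, 0) = (la, 0) \<and>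
       (\<forall>w'\<in>finW n. w' (dom_rep n la, 0) = (la, 0) \<longrightarrow> len n w \<le> len n w'))"

definition dom_le :: "nat \<Rightarrow> lattice_vec \<Rightarrow> lattice_vec \<Rightarrow> bool" where
  "dom_le n la \<mu> \<longleftrightarrow>
    (\<exists>k :: nat \<Rightarrow> nat. \<mu> - la =
       (\<Sum>i\<in>{1..<n}. frag_cmul (int (k i)) (fst (simple_root n i))) + frag_cmul (int (k n)) (eps n))"

definition dom_less :: "nat \<Rightarrow> lattice_vec \<Rightarrow> lattice_vec \<Rightarrow> bool" where
  "dom_less n la \<mu> \<longleftrightarrow> dom_le n la \<mu> \<and> la \<noteq> \<mu>"

definition prec_eq :: "nat \<Rightarrow> lattice_vec \<Rightarrow> lattice_vec \<Rightarrow> bool" where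
  "prec_eq n la \<mu> \<longleftrightarrow>
    dom_less n (dom_rep n la) (dom_rep n \<mu>) \<or> (dom_rep n la = dom_rep n \<mu> \<and> dom_le n la \<mu>)"

definition prec :: "nat \<Rightarrow> lattice_vec \<Rightarrow> lattice_vec \<Rightarrow> bool" where
  "prec n la \<mu> \<longleftrightarrow> prec_eq n la \<mu> \<and> la \<noteq> \<mu>"


section \<open>Laurent polynomials\<close>

text \<open>The algebra \<open>\<A>\<close> of Laurent polynomials in \<open>x\<^sub>1, \<dots>, x\<^sub>n\<close> is the subalgebra
  \<open>laurent_alg n\<close> of the Laurent polynomials in countably many variables.\<close>

type_synonym laurent = "lattice_vec \<Rightarrow>\<^sub>0 complex"

definition laurent_alg :: "nat \<Rightarrow> laurent set" where
  "laurent_alg n = {f. Poly_Mapping.keys f \<subseteq> Lam n}"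

definition lscale :: "complex \<Rightarrow> laurent \<Rightarrow> laurent" where
  "lscale c f = Poly_Mapping.single 0 c * f"

global_interpretation laurent: vector_space lscale
  by unfold_locales
    (simp_all add: lscale_def algebra_simps single_add mult_single flip: mult.assoc)

definition xmon :: "lattice_vec \<Rightarrow> laurent" where
  "xmon la = Poly_Mapping.single la 1"

text \<open>\<open>x\<^bsup>\<lambda> + m\<delta>\<^esup> = q\<^sup>m x\<^sup>\<lambda>\<close>\<close>

definition xaff :: "kparams \<Rightarrow> affine_vec \<Rightarrow> laurent" where
  "xaff p f = lscale (qpar p powi snd f) (xmon (fst f))"

definition act :: "kparams \<Rightarrow> (affine_vec \<Rightarrow> affine_vec) \<Rightarrow> laurent \<Rightarrow> laurent" where
  "act p w f =
    (\<Sum>la\<in>Poly_Mapping.keys f. lscale (Poly_Mapping.lookup f la) (xaff p (w (la, 0))))"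

definition laurent_eval :: "laurent \<Rightarrow> (nat \<Rightarrow> complex) \<Rightarrow> complex" where
  "laurent_eval f y =
    (\<Sum>la\<in>Poly_Mapping.keys f. Poly_Mapping.lookup f la *
       (\<Prod>i\<in>Poly_Mapping.keys la. y i powi Poly_Mapping.lookup la i))"

definition invariants :: "kparams \<Rightarrow> nat \<Rightarrow> laurent set" where
  "invariants p n = {f \<in> laurent_alg n. \<forall>w\<in>finW n. act p w f = f}"

definition orbit_sum :: "nat \<Rightarrow> lattice_vec \<Rightarrow> laurent" where
  "orbit_sum n la = (\<Sum>\<mu>\<in>orbit n la. xmon \<mu>)"


section \<open>The functions \<open>v\<^sub>\<beta>\<close>\<close>

text \<open>For \<open>\<beta> = \<alpha> + m\<delta> \<in> R\<close>, \<open>t_root\<close> and \<open>t_half_root\<close> are the labels \<open>t\<^sub>\<beta>\<close> and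
  \<open>t\<close> with index \<open>\<beta>/2\<close>. If \<open>\<alpha> = \<plusminus>2\<epsilon>\<^sub>i\<close> then \<open>\<beta>/2 = \<plusminus>\<epsilon>\<^sub>i + (m/2)\<delta>\<close>; otherwise \<open>\<beta>/2\<close>
  carries the trivial label.\<close>

definition t_root :: "kparams \<Rightarrow> nat \<Rightarrow> affine_vec \<Rightarrow> complex" where
  "t_root p n \<beta> =
    (if fst \<beta> \<in> long_roots n then (if odd (snd \<beta>) then t0 p else tn p)
     else if fst \<beta> \<in> mid_roots n then tmid p
     else 1)"

definition t_half_root :: "kparams \<Rightarrow> nat \<Rightarrow> affine_vec \<Rightarrow> complex" where
  "t_half_root p n \<beta> =
    (if fst \<beta> \<in> long_roots n then (if odd (snd \<beta>) then t0v p else tnv p) else 1)"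

text \<open>\<open>x\<^bsup>\<beta>/2\<^esup>\<close> for \<open>\<beta> = \<plusminus>2\<epsilon>\<^sub>i + m\<delta>\<close>, which is where the square root of \<open>q\<close> enters.\<close>

definition xaff_half :: "kparams \<Rightarrow> affine_vec \<Rightarrow> laurent" where
  "xaff_half p \<beta> = lscale (qhalf p powi snd \<beta>) (xmon (Poly_Mapping.map (\<lambda>k. k div 2) (fst \<beta>)))"

text \<open>Numerator and denominator of \<open>v\<^sub>\<beta>\<close>. For \<open>\<beta> = \<plusminus>\<epsilon>\<^sub>i \<plusminus> \<epsilon>\<^sub>j + m\<delta>\<close> the monomial
  \<open>x\<^bsup>\<beta>/2\<^esup>\<close> is not in \<open>\<A>\<close>, but the label of \<open>\<beta>/2\<close> is \<open>1\<close> and the numerator is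
  \<open>(1 - t\<^sub>\<beta> x\<^bsup>\<beta>/2\<^esup>)(1 + t\<^sub>\<beta> x\<^bsup>\<beta>/2\<^esup>) = 1 - t\<^sub>\<beta>\<^sup>2 x\<^sup>\<beta>\<close>.\<close>

definition v_num :: "kparams \<Rightarrow> nat \<Rightarrow> affine_vec \<Rightarrow> laurent" where
  "v_num p n \<beta> =
    (if fst \<beta> \<in> long_roots n then
       (1 - lscale (t_root p n \<beta> * t_half_root p n \<beta>) (xaff_half p \<beta>)) *
       (1 + lscale (t_root p n \<beta> * inverse (t_half_root p n \<beta>)) (xaff_half p \<beta>))
     else 1 - lscale ((t_root p n \<beta>)\<^sup>2) (xaff p \<beta>))"

definition v_den :: "kparams \<Rightarrow> affine_vec \<Rightarrow> laurent" where
  "v_den p \<beta> = 1 - xaff p \<beta>"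

definition v_val :: "kparams \<Rightarrow> nat \<Rightarrow> affine_vec \<Rightarrow> (nat \<Rightarrow> complex) \<Rightarrow> complex" where
  "v_val p n \<beta> y = laurent_eval (v_num p n \<beta>) y / laurent_eval (v_den p \<beta>) y"


section \<open>The operators \<open>T\<close> and \<open>Y\<close>\<close>

definition t_simple :: "kparams \<Rightarrow> nat \<Rightarrow> nat \<Rightarrow> complex" where
  "t_simple p n i = (if i = 0 then t0 p else if i < n then tmid p else tn p)"

text \<open>The Laurent polynomial \<open>v\<^bsub>a\<^esub>(x) (s f - f)\<close>, for \<open>a = a\<^sub>i\<close> and \<open>s = s\<^sub>i\<close>, is the exact quotient in the
  integral domain of Laurent polynomials.\<close>

definition T_op :: "kparams \<Rightarrow> nat \<Rightarrow> nat \<Rightarrow> laurent \<Rightarrow> laurent" where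
  "T_op p n i f =
    lscale (t_simple p n i) f +
    lscale (inverse (t_simple p n i))
      (THE g. v_den p (simple_root n i) * g =
              v_num p n (simple_root n i) * (act p (srefl n i) f - f))"

definition T_elt :: "kparams \<Rightarrow> nat \<Rightarrow> (affine_vec \<Rightarrow> affine_vec) \<Rightarrow> laurent \<Rightarrow> laurent" where
  "T_elt p n w = foldr (\<lambda>i S. T_op p n i \<circ> S) (some_reduced n w) id"

text \<open>The choice of \<open>\<mu>, \<nu> \<in> \<Lambda>\<^sup>+\<close> with \<open>\<lambda> = \<mu> - \<nu>\<close> does not matter.\<close>

definition Y_op :: "kparams \<Rightarrow> nat \<Rightarrow> lattice_vec \<Rightarrow> laurent \<Rightarrow> laurent" where
  "Y_op p n la =
    (let (\<mu>, \<nu>) = (SOME (\<mu>, \<nu>). \<mu> \<in> Lam_plus n \<and> \<nu> \<in> Lam_plus n \<and> la = \<mu> - \<nu>)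
     in T_elt p n (tau \<mu>) \<circ> inv_into (laurent_alg n) (T_elt p n (tau \<nu>)))"

definition fY :: "kparams \<Rightarrow> nat \<Rightarrow> laurent \<Rightarrow> laurent \<Rightarrow> laurent" where
  "fY p n f g =
    (\<Sum>la\<in>Poly_Mapping.keys f. lscale (Poly_Mapping.lookup f la) (Y_op p n la g))"


section \<open>Koornwinder polynomials\<close>

text \<open>Note that \<open>\<epsilon>(0) = 1\<close>.\<close>

definition sgn1 :: "int \<Rightarrow> int" where
  "sgn1 m = (if 0 \<le> m then 1 else - 1)"

definition rho_l :: "nat \<Rightarrow> lattice_vec \<Rightarrow> lattice_vec" where
  "rho_l n la = (\<Sum>i\<in>{1..n}. frag_cmul (sgn1 (Poly_Mapping.lookup la i)) (eps i))"

definition rho_m :: "nat \<Rightarrow> lattice_vec \<Rightarrow> lattice_vec" where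
  "rho_m n la =
    (\<Sum>(i, j)\<in>{(i, j). 1 \<le> i \<and> i < j \<and> j \<le> n}.
       frag_cmul (sgn1 (Poly_Mapping.lookup la i - Poly_Mapping.lookup la j)) (eps i - eps j) +
       frag_cmul (sgn1 (Poly_Mapping.lookup la i + Poly_Mapping.lookup la j)) (eps i + eps j))"

definition gam :: "kparams \<Rightarrow> nat \<Rightarrow> lattice_vec \<Rightarrow> nat \<Rightarrow> complex" where
  "gam p n la i =
    (t0 p * tn p) powi Poly_Mapping.lookup (rho_l n la) i *
    tmid p powi Poly_Mapping.lookup (rho_m n la) i *
    qpar p powi Poly_Mapping.lookup la i"

text \<open>\<open>f\<close> is of the form \<open>x\<^sup>\<lambda> + \<Sum>\<^bsub>\<mu> \<prec> \<lambda>\<^esub> c\<^sub>\<mu> x\<^sup>\<mu>\<close>.\<close>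

definition prec_monic :: "nat \<Rightarrow> lattice_vec \<Rightarrow> laurent \<Rightarrow> bool" where
  "prec_monic n la f \<longleftrightarrow> f - xmon la \<in> laurent.span (xmon ` {\<mu> \<in> Lam n. prec n \<mu> la})"

definition Pns :: "kparams \<Rightarrow> nat \<Rightarrow> lattice_vec \<Rightarrow> laurent" where
  "Pns p n la =
    (THE P. P \<in> laurent_alg n \<and> prec_monic n la P \<and>
       (\<forall>f\<in>laurent_alg n. fY p n f P = lscale (laurent_eval f (gam p n la)) P))"

definition Pplus :: "kparams \<Rightarrow> nat \<Rightarrow> lattice_vec \<Rightarrow> laurent" where
  "Pplus p n la =
    (THE P. P \<in> invariants p n \<and>
       P - orbit_sum n la \<in> laurent.span (orbit_sum n ` {\<mu> \<in> Lam_plus n. dom_less n \<mu> la}) \<and>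
       (\<forall>f\<in>invariants p n. fY p n f P = lscale (laurent_eval f (gam p n la)) P))"

definition A_orb :: "kparams \<Rightarrow> nat \<Rightarrow> lattice_vec \<Rightarrow> laurent set" where
  "A_orb p n la = laurent.span (Pns p n ` orbit n la)"

definition A_plus :: "kparams \<Rightarrow> nat \<Rightarrow> lattice_vec \<Rightarrow> laurent set" where
  "A_plus p n la = {f \<in> A_orb p n la. \<forall>i\<in>{1..n}. T_op p n i f = lscale (t_simple p n i) f}"

definition A_minus :: "kparams \<Rightarrow> nat \<Rightarrow> lattice_vec \<Rightarrow> laurent set" where
  "A_minus p n la =
    {f \<in> A_orb p n la. \<forall>i\<in>{1..n}. T_op p n i f = - lscale (inverse (t_simple p n i)) f}"

definition Pminus :: "kparams \<Rightarrow> nat \<Rightarrow> lattice_vec \<Rightarrow> laurent" where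
  "Pminus p n la = (THE P. P \<in> A_minus p n la \<and> prec_monic n la P)"


section \<open>Expansion coefficients\<close>

definition t_elt :: "kparams \<Rightarrow> nat \<Rightarrow> (affine_vec \<Rightarrow> affine_vec) \<Rightarrow> complex" where
  "t_elt p n w = (\<Prod>i\<leftarrow>some_reduced n w. t_simple p n i)"

text \<open>The two expressions for the coefficients; \<open>s\<close> is the sign, \<open>1\<close> or \<open>-1\<close>.\<close>

definition coeff_at_mu :: "kparams \<Rightarrow> nat \<Rightarrow> int \<Rightarrow> lattice_vec \<Rightarrow> complex" where
  "coeff_at_mu p n s \<mu> =
    of_int s ^ len n (w_min n \<mu>) * t_elt (dual_params p) n (w_min n \<mu>) powi (- 2) *
    (\<Prod>\<alpha>\<in>{\<alpha> \<in> Sigma_pos n. ip \<mu> \<alpha> < 0}.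
       v_val (dual_params p) n (frag_cmul s \<alpha>, 0) (gam p n \<mu>))"

definition coeff_at_lambda ::
  "kparams \<Rightarrow> nat \<Rightarrow> int \<Rightarrow> lattice_vec \<Rightarrow> lattice_vec \<Rightarrow> complex" where
  "coeff_at_lambda p n s la \<mu> =
    of_int s ^ len n (w_min n \<mu>) * t_elt (dual_params p) n (w_min n \<mu>) powi (- 2) *
    (\<Prod>\<alpha>\<in>{\<alpha> \<in> Sigma_pos n. fst (w_min n \<mu> (\<alpha>, 0)) \<in> Sigma_neg n}.
       v_val (dual_params p) n (frag_cmul s \<alpha>, 0) (\<lambda>i. inverse (gam p n la i)))"

end

theory Submission
  imports Defs "HOL-Library.Product_Plus"
begin

text \<open>Let \<open>E\<^sub>\<mu>\<close> denote the non-symmetric polynomials. On the span of \<open>E\<^sub>x\<close>, \<open>x \<in> W\<lambda>\<close>, the operator \<open>T\<^sub>i\<close> is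
  made of blocks: if \<open>s\<^sub>i x = x\<close> then \<open>T\<^sub>i E\<^sub>x = t\<^sub>i E\<^sub>x\<close>, and otherwise \<open>T\<^sub>i\<close> preserves the plane of \<open>E\<^sub>x\<close> and
  \<open>E\<^bsub>s\<^sub>i x\<^esub>\<close> and has both eigenvalues \<open>t\<^sub>i\<close> and \<open>-1/t\<^sub>i\<close> there. So \<open>T\<^sub>i f = t\<^sub>i f\<close> amounts to one ratio of
  coefficients for every such pair, and \<open>T\<^sub>i f = -f/t\<^sub>i\<close> to another ratio together with the vanishing of
  the coefficients of all \<open>E\<^sub>x\<close> with \<open>s\<^sub>i x = x\<close>. Every \<open>x\<close> in the orbit is reached from \<open>\<lambda>\<close> by simple
  reflections that go down, so the solution is determined by its coefficient at \<open>E\<^sub>\<lambda>\<close>, and multiplying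
  the ratios along such a path gives the coefficients in the theorem (\<open>T_eigen_iff\<close>, \<open>cf_step\<close>). Some
  \<open>s\<^sub>i\<close> fixes a point of the orbit exactly when \<open>\<lambda> \<notin> \<Lambda>\<^sup>+\<^sup>+\<close>, which settles the dimension in the
  antisymmetric case. In the symmetric case the solution is \<open>W\<close>-invariant, since \<open>T\<^sub>i f = t\<^sub>i f\<close> means
  \<open>s\<^sub>i f = f\<close>, and it is the symmetric polynomial because invariant functions of \<open>Y\<close> separate the orbits.

  The blocks come from the relations between \<open>T\<^sub>i\<close> and the \<open>Y\<^sup>\<nu>\<close>. A suitable combination
  \<open>(T\<^sub>i - d) E\<^sub>\<mu>\<close> is a joint eigenvector of all \<open>Y\<^sup>\<nu>\<close> for the reflected point \<open>s\<^sub>i \<gamma>\<^sub>\<mu>\<close> (\<open>intertwine\<close>). If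
  \<open>s\<^sub>i \<mu> \<noteq> \<mu>\<close> this point is \<open>\<gamma>\<close> at \<open>s\<^sub>i \<mu>\<close>, so the combination is a multiple of \<open>E\<^bsub>s\<^sub>i \<mu>\<^esub>\<close>, and if
  \<open>s\<^sub>i \<mu> = \<mu>\<close> it is no spectral point at all, so the combination vanishes. It is enough to see how \<open>T\<^sub>i\<close> moves past
  the fundamental translations, and only one of them fails to commute with it. Its relation
  follows from multiplicativity of \<open>T\<^sub>w\<close> on products with additive lengths; for \<open>i = n\<close> this uses a
  factorization of the translation that contains \<open>s\<^sub>0\<close> (\<open>om_n_factorization\<close>).

  The \<open>E\<^sub>\<mu>\<close> exist because each \<open>Y\<^sup>\<nu>\<close> with dominant \<open>\<nu>\<close> is triangular for \<open>\<preceq>\<close> with diagonal entries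
  \<open>\<gamma>\<^sub>\<mu>\<^sup>\<nu>\<close> (\<open>Y_triangular\<close>), and these entries separate finitely many weights for a suitable
  \<open>\<nu>\<close>. Triangularity holds for \<open>T\<^sub>w\<close> whenever all inversions of \<open>w\<close> have a negative gradient, as is
  the case for dominant translations.

  Below this lie the affine Weyl group as a Coxeter group and the Hecke relations of the
  \<open>T\<^sub>i\<close>. The group is handled through an integral linear function that is positive on the positive roots: it
  gives the exchange property, descents, and Matsumoto's theorem on reduced words. The relations of
  the \<open>T\<^sub>i\<close> are verified by evaluating Laurent polynomials at points, where they become identities of
  rational functions in the coordinates.

  Genericity means that \<open>t\<^sub>0\<^sup>b t\<^sub>n\<^sup>c t\<^sup>d q\<^sup>e = \<plusminus>1\<close> only for \<open>b = c = d = e = 0\<close>, which excludes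
  countably many hypersurfaces given by binomials.\<close>

section \<open>Lattice vectors and affine vectors\<close>

abbreviation lk :: "('a \<Rightarrow>\<^sub>0 'b::zero) \<Rightarrow> 'a \<Rightarrow> 'b" where "lk \<equiv> Poly_Mapping.lookup"
abbreviation keys :: "('a \<Rightarrow>\<^sub>0 'b::zero) \<Rightarrow> 'a set" where "keys \<equiv> Poly_Mapping.keys"

lemma lk_eps [simp]: "lk (eps i) j = (if i = j then 1 else 0)"
  by (auto simp: eps_def lookup_single when_def)

lemma ip_superset: "finite S \<Longrightarrow> keys u \<subseteq> S \<Longrightarrow> ip u v = (\<Sum>i\<in>S. lk u i * lk v i)"
  unfolding ip_def by (rule sum.mono_neutral_left) (auto simp: in_keys_iff)

lemma ip_add_left [simp]: "ip (u + v) w = ip u w + ip v w"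
proof -
  let ?S = "keys u \<union> keys v"
  have "ip (u + v) w = (\<Sum>i\<in>?S. lk (u + v) i * lk w i)"
    by (rule ip_superset) (use keys_add[of u v] in auto)
  moreover have "ip u w = (\<Sum>i\<in>?S. lk u i * lk w i)" by (rule ip_superset) auto
  moreover have "ip v w = (\<Sum>i\<in>?S. lk v i * lk w i)" by (rule ip_superset) auto
  ultimately show ?thesis by (simp add: lookup_add algebra_simps sum.distrib)
qed

lemma ip_commute: "ip u v = ip v u"
proof -
  let ?S = "keys u \<union> keys v"
  have "ip u v = (\<Sum>i\<in>?S. lk u i * lk v i)" by (rule ip_superset) auto
  moreover have "ip v u = (\<Sum>i\<in>?S. lk v i * lk u i)" by (rule ip_superset) auto
  ultimately show ?thesis by (simp add: mult.commute)
qed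

lemma ip_add_right [simp]: "ip u (v + w) = ip u v + ip u w"
  by (metis ip_add_left ip_commute)

lemma ip_zero [simp]: "ip 0 v = 0" "ip v 0 = 0"
  by (simp_all add: ip_def)

lemma ip_uminus [simp]: "ip (- u) v = - ip u v" "ip u (- v) = - ip u v"
  using ip_add_left[of u "- u" v] ip_add_right[of u v "- v"] by auto

lemma ip_diff [simp]: "ip (u - v) w = ip u w - ip v w" "ip w (u - v) = ip w u - ip w v"
  using ip_add_left[of u "- v" w] ip_add_right[of w u "- v"] by auto

lemma ip_cmul [simp]: "ip (frag_cmul k u) v = k * ip u v" "ip u (frag_cmul k v) = k * ip u v"
proof -
  have *: "ip (frag_cmul k u) v = k * ip u v" for u v
  proof -
    have "ip (frag_cmul k u) v = (\<Sum>i\<in>keys u. lk (frag_cmul k u) i * lk v i)"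
      by (rule ip_superset) (auto dest: keys_cmul[THEN subsetD])
    then show ?thesis by (simp add: ip_def sum_distrib_left mult.assoc)
  qed
  show "ip (frag_cmul k u) v = k * ip u v" by (rule *)
  show "ip u (frag_cmul k v) = k * ip u v" by (metis * ip_commute)
qed

lemma ip_eps [simp]: "ip (eps i) v = lk v i" "ip v (eps i) = lk v i"
proof -
  have "ip (eps i) v = lk v i" for v by (simp add: ip_def eps_def)
  then show "ip (eps i) v = lk v i" "ip v (eps i) = lk v i" by (simp_all add: ip_commute[of v])
qed

lemma ip_sum: "ip (sum f A) v = (\<Sum>a\<in>A. ip (f a) v)" "ip v (sum f A) = (\<Sum>a\<in>A. ip v (f a))"
  by (induction A rule: infinite_finite_induct) auto

lemma cmul_uminus [simp]: "frag_cmul k (- v) = - frag_cmul k v"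
  by (rule poly_mapping_eqI) simp

lemma Lam_iff: "v \<in> Lam n \<longleftrightarrow> (\<forall>i. lk v i \<noteq> 0 \<longrightarrow> 1 \<le> i \<and> i \<le> n)"
  by (auto simp: Lam_def in_keys_iff)

lemma Lam_add [intro]: "u \<in> Lam n \<Longrightarrow> v \<in> Lam n \<Longrightarrow> u + v \<in> Lam n"
  unfolding Lam_iff lookup_add by (metis add.right_neutral)

lemma Lam_uminus [intro]: "u \<in> Lam n \<Longrightarrow> - u \<in> Lam n"
  by (auto simp: Lam_iff)

lemma Lam_diff [intro]: "u \<in> Lam n \<Longrightarrow> v \<in> Lam n \<Longrightarrow> u - v \<in> Lam n"
  using Lam_add[of u n "- v"] by auto

lemma Lam_cmul [intro]: "u \<in> Lam n \<Longrightarrow> frag_cmul k u \<in> Lam n"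
  by (auto simp: Lam_iff)

lemma Lam_zero [simp]: "0 \<in> Lam n"
  by (auto simp: Lam_iff)

lemma Lam_sum [intro]: "(\<And>a. a \<in> A \<Longrightarrow> f a \<in> Lam n) \<Longrightarrow> sum f A \<in> Lam n"
  by (induction A rule: infinite_finite_induct) auto

lemma Lam_eps [intro]: "1 \<le> i \<Longrightarrow> i \<le> n \<Longrightarrow> eps i \<in> Lam n"
  by (auto simp: Lam_iff)

lemma Lam_eqI: "u \<in> Lam n \<Longrightarrow> v \<in> Lam n \<Longrightarrow> (\<And>i. 1 \<le> i \<Longrightarrow> i \<le> n \<Longrightarrow> lk u i = lk v i) \<Longrightarrow> u = v"
  by (rule poly_mapping_eqI) (metis Lam_iff)

lemma ip_Lam: "u \<in> Lam n \<Longrightarrow> ip u v = (\<Sum>i=1..n. lk u i * lk v i)"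
  by (rule ip_superset) (auto simp: Lam_def)

definition iscale :: "int \<Rightarrow> affine_vec \<Rightarrow> affine_vec" where
  "iscale k f = (frag_cmul k (fst f), k * snd f)"

lemma fst_iscale [simp]: "fst (iscale k f) = frag_cmul k (fst f)"
  and snd_iscale [simp]: "snd (iscale k f) = k * snd f"
  by (simp_all add: iscale_def)

lemma iscale_simps [simp]: "iscale 0 f = 0" "iscale 1 f = f" "iscale (- 1) f = - f"
  "iscale k (iscale l f) = iscale (k * l) f" "iscale k 0 = 0"
  by (simp_all add: prod_eq_iff)

lemma iscale_add: "iscale (k + l) f = iscale k f + iscale l f"
  "iscale k (f + g) = iscale k f + iscale k g"
  by (simp_all add: prod_eq_iff frag_cmul_distrib frag_cmul_distrib2 algebra_simps)

lemma iscale_uminus: "iscale (- k) f = - iscale k f" "iscale k (- f) = - iscale k f"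
  by (simp_all add: prod_eq_iff)

lemma iscale_diff: "iscale (k - l) f = iscale k f - iscale l f"
  using iscale_add(1)[of k "- l" f] by (simp add: iscale_uminus)

lemma refl_iscale: "refl f g = g - iscale ((2 * ip (fst g) (fst f)) div ip (fst f) (fst f)) f"
  by (simp add: refl_def Let_def prod_eq_iff)

section \<open>The reflections in the simple roots\<close>

text \<open>The pairing \<open>\<langle>v, a\<^sub>i\<^sup>\<or>\<rangle>\<close> with a simple coroot.\<close>

definition cpair :: "nat \<Rightarrow> nat \<Rightarrow> lattice_vec \<Rightarrow> int" where
  "cpair n i v = (if i = 0 then - lk v 1 else if i < n then lk v i - lk v (Suc i) else lk v n)"

lemma cpair_add [simp]: "cpair n i (u + v) = cpair n i u + cpair n i v"
  by (simp add: cpair_def lookup_add)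
lemma cpair_uminus [simp]: "cpair n i (- v) = - cpair n i v"
  by (simp add: cpair_def)
lemma cpair_diff [simp]: "cpair n i (u - v) = cpair n i u - cpair n i v"
  by (simp add: cpair_def lookup_minus)
lemma cpair_cmul [simp]: "cpair n i (frag_cmul k v) = k * cpair n i v"
  by (simp add: cpair_def algebra_simps)
lemma cpair_zero [simp]: "cpair n i 0 = 0"
  by (simp add: cpair_def)

locale rank =
  fixes n :: nat
  assumes n2: "2 \<le> n"
begin

abbreviation "a \<equiv> simple_root n"
abbreviation "s \<equiv> srefl n"
abbreviation "cp \<equiv> cpair n"

lemma simple_root_Lam [simp]: "i \<le> n \<Longrightarrow> fst (a i) \<in> Lam n"
  using n2 by (auto simp: simple_root_def intro!: Lam_eps Lam_diff Lam_cmul simp del: minus_frag_cmul)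

lemma ip_simple: "i \<le> n \<Longrightarrow> 2 * ip v (fst (a i)) = cp i v * ip (fst (a i)) (fst (a i))"
  using n2 by (auto simp: simple_root_def cpair_def lookup_minus)

lemma ip_simple_pos: "i \<le> n \<Longrightarrow> ip (fst (a i)) (fst (a i)) > 0"
  using n2 by (auto simp: simple_root_def lookup_minus)

lemma s_def: "i \<le> n \<Longrightarrow> s i f = f - iscale (cp i (fst f)) (a i)"
  unfolding srefl_def refl_iscale using ip_simple[of i "fst f"] ip_simple_pos[of i] by simp

lemma cp_simple [simp]: "i \<le> n \<Longrightarrow> cp i (fst (a i)) = 2"
  using n2 by (auto simp: simple_root_def cpair_def lookup_minus)

lemma fst_s: "i \<le> n \<Longrightarrow> fst (s i f) = fst f - frag_cmul (cp i (fst f)) (fst (a i))"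
  by (simp add: s_def)

lemma snd_s: "i \<le> n \<Longrightarrow> snd (s i f) = snd f - cp i (fst f) * snd (a i)"
  by (simp add: s_def)

lemma s_s [simp]: "i \<le> n \<Longrightarrow> s i (s i f) = f"
  by (simp add: s_def iscale_diff algebra_simps)
     (simp add: iscale_add(1)[symmetric])

lemma s_add: "i \<le> n \<Longrightarrow> s i (f + g) = s i f + s i g"
  by (simp add: s_def iscale_add algebra_simps)

lemma s_simple [simp]: "i \<le> n \<Longrightarrow> s i (a i) = - a i"
  by (simp add: s_def) (simp add: prod_eq_iff frag_cmul_distrib2 poly_mapping_eq_iff fun_eq_iff lookup_minus)

lemma s_delta: "i \<le> n \<Longrightarrow> s i (0, 1) = (0, 1)"
  by (simp add: s_def)

lemma s_ip: "i \<le> n \<Longrightarrow> ip (fst (s i f)) (fst (s i g)) = ip (fst f) (fst g)"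
proof -
  assume i: "i \<le> n"
  let ?N = "ip (fst (a i)) (fst (a i))"
  have "2 * (cp i (fst f) * ip (fst g) (fst (a i)) + cp i (fst g) * ip (fst f) (fst (a i)))
      = cp i (fst f) * (2 * ip (fst g) (fst (a i))) + cp i (fst g) * (2 * ip (fst f) (fst (a i)))"
    by (simp add: algebra_simps)
  also have "\<dots> = 2 * (cp i (fst f) * cp i (fst g) * ?N)"
    using ip_simple[OF i, of "fst f"] ip_simple[OF i, of "fst g"] by (simp add: algebra_simps)
  finally show ?thesis
    using i by (simp add: fst_s algebra_simps ip_commute[of "fst (a i)" "fst g"])
qed

definition units :: "lattice_vec set" where
  "units = {eps i |i. 1 \<le> i \<and> i \<le> n} \<union> {- eps i |i. 1 \<le> i \<and> i \<le> n}"

lemma s_units: "i \<le> n \<Longrightarrow> e \<in> units \<Longrightarrow> fst (s i (e, m)) \<in> units"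
proof -
  assume i: "i \<le> n" and "e \<in> units"
  then obtain j where j: "1 \<le> j" "j \<le> n" and e: "e = eps j \<or> e = - eps j"
    by (auto simp: units_def)
  let ?j = "if 1 \<le> i \<and> i < n then (if j = i then Suc i else if j = Suc i then i else j) else j"
  have "fst (s i (eps j, m)) = eps ?j \<or> fst (s i (eps j, m)) = - eps ?j" for m
    using i j n2
    by (auto simp: fst_s simple_root_def cpair_def poly_mapping_eq_iff fun_eq_iff lookup_minus)
  moreover have "1 \<le> ?j" "?j \<le> n" using i j by auto
  moreover have "fst (s i (- eps j, m)) = - fst (s i (eps j, m))"
    using i by (simp add: fst_s)
  ultimately show ?thesis using e by (fastforce simp: units_def)
qed

end

section \<open>The affine Weyl group\<close>

context rank
begin

definition affW :: "(affine_vec \<Rightarrow> affine_vec) set" where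
  "affW = word_elt n ` {is. set is \<subseteq> {0..n}}"

lemma word_elt_Nil [simp]: "word_elt n [] = id"
  and word_elt_Cons [simp]: "word_elt n (i # is) = s i \<circ> word_elt n is"
  by (simp_all add: word_elt_def)

lemma word_elt_append: "word_elt n (is @ js) = word_elt n is \<circ> word_elt n js"
  by (induction "is") (auto simp: comp_assoc)

lemma word_elt_rev:
  "set is \<subseteq> {0..n} \<Longrightarrow> word_elt n is (word_elt n (rev is) f) = f"
  by (induction "is" arbitrary: f) (auto simp: word_elt_append)

lemma word_elt_rev':
  "set is \<subseteq> {0..n} \<Longrightarrow> word_elt n (rev is) (word_elt n is f) = f"
  using word_elt_rev[of "rev is"] by simp

lemma affW_induct [consumes 1, case_names id step]:
  assumes "w \<in> affW" "P id" "\<And>i w. i \<le> n \<Longrightarrow> w \<in> affW \<Longrightarrow> P w \<Longrightarrow> P (s i \<circ> w)"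
  shows "P w"
proof -
  have "set is \<subseteq> {0..n} \<Longrightarrow> P (word_elt n is)" for "is"
    by (induction "is") (use assms(2,3) in \<open>auto simp: affW_def\<close>)
  then show ?thesis using assms(1) by (auto simp: affW_def)
qed

lemma id_affW [simp]: "id \<in> affW"
  unfolding affW_def by (rule image_eqI[of _ _ "[]"]) auto

lemma s_affW [simp]: "i \<le> n \<Longrightarrow> s i \<in> affW"
  unfolding affW_def by (rule image_eqI[of _ _ "[i]"]) auto

lemma comp_affW [intro, simp]: "u \<in> affW \<Longrightarrow> v \<in> affW \<Longrightarrow> u \<circ> v \<in> affW"
  unfolding affW_def
proof clarify
  fix "is" js assume "set is \<subseteq> {0..n}" "set js \<subseteq> {0..n}"
  then show "word_elt n is \<circ> word_elt n js \<in> word_elt n ` {is. set is \<subseteq> {0..n}}"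
    by (intro image_eqI[of _ _ "is @ js"]) (auto simp: word_elt_append)
qed

lemma affW_bij: "w \<in> affW \<Longrightarrow> bij w"
proof (induction rule: affW_induct)
  case (step i w)
  have "bij (s i)" using step(1) by (intro o_bij[of "s i"]) (auto simp: fun_eq_iff)
  then show ?case using step bij_comp by blast
qed (simp only: bij_id)

lemma inv_word_elt: "set is \<subseteq> {0..n} \<Longrightarrow> inv (word_elt n is) = word_elt n (rev is)"
  by (rule inv_equality) (auto simp: word_elt_rev word_elt_rev')

lemma inv_affW [simp, intro]: "w \<in> affW \<Longrightarrow> inv w \<in> affW"
  unfolding affW_def by (force simp: inv_word_elt intro!: image_eqI[of _ _ "rev _"])

lemma inv_s [simp]: "i \<le> n \<Longrightarrow> inv (s i) = s i"
  by (rule inv_equality) auto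

lemma inv_comp_s: "i \<le> n \<Longrightarrow> w \<in> affW \<Longrightarrow> inv (s i \<circ> w) = inv w \<circ> s i"
  using o_inv_distrib[of "s i" w] affW_bij[of "s i"] affW_bij[of w] by simp

lemma inv_affW_cancel [simp]: "w \<in> affW \<Longrightarrow> inv w (w f) = f" "w \<in> affW \<Longrightarrow> w (inv w f) = f"
  using affW_bij[of w] by (auto simp: bij_is_inj bij_is_surj surj_f_inv_f)

lemma affW_add: "w \<in> affW \<Longrightarrow> w (f + g) = w f + w g"
  by (induction arbitrary: f g rule: affW_induct) (auto simp: s_add)

lemma affW_zero: "w \<in> affW \<Longrightarrow> w 0 = 0"
  using affW_add[of w 0 0] by simp

lemma affW_uminus: "w \<in> affW \<Longrightarrow> w (- f) = - w f"
  using affW_add[of w f "- f"] affW_zero[of w] by (simp add: eq_neg_iff_add_eq_0 add.commute)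

lemma affW_diff: "w \<in> affW \<Longrightarrow> w (f - g) = w f - w g"
  using affW_add[of w f "- g"] affW_uminus[of w g] by simp

lemma affW_iscale: "w \<in> affW \<Longrightarrow> w (iscale k f) = iscale k (w f)"
proof -
  assume w: "w \<in> affW"
  have *: "w (iscale (int m) f) = iscale (int m) (w f)" for m
    by (induction m) (use w in \<open>auto simp: iscale_add affW_add affW_zero\<close>)
  show ?thesis
  proof (cases "0 \<le> k")
    case True then show ?thesis using *[of "nat k"] by simp
  next
    case False
    then have k: "k = - int (nat (- k))" by simp
    show ?thesis by (subst (1 2) k) (simp only: iscale_uminus affW_uminus[OF w] *)
  qed
qed

lemma affW_delta: "w \<in> affW \<Longrightarrow> w (0, 1) = (0, 1)"
  by (induction rule: affW_induct) (auto simp: s_delta)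

lemma affW_level: "w \<in> affW \<Longrightarrow> w (v, m) = (fst (w (v, 0)), m + snd (w (v, 0)))"
proof -
  assume w: "w \<in> affW"
  have "(v, m) = (v, 0) + iscale m (0, 1)" by (simp add: iscale_def)
  then have "w (v, m) = w (v, 0) + iscale m (0, 1)"
    using w affW_add[of w "(v, 0)" "iscale m (0, 1)"] affW_iscale[of w m "(0, 1)"] affW_delta[of w] by simp
  then show ?thesis by (simp add: prod_eq_iff)
qed

lemma affW_ip: "w \<in> affW \<Longrightarrow> ip (fst (w f)) (fst (w g)) = ip (fst f) (fst g)"
  by (induction rule: affW_induct) (auto simp: s_ip)

lemma affW_units: "w \<in> affW \<Longrightarrow> e \<in> units \<Longrightarrow> fst (w (e, m)) \<in> units"
proof (induction arbitrary: e m rule: affW_induct)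
  case (step i w)
  then show ?case by (cases "w (e, m)") (metis comp_apply fst_conv s_units)
qed auto

lemma affW_refl_conj: "w \<in> affW \<Longrightarrow> refl (w f) (w g) = w (refl f g)"
  by (simp add: refl_iscale affW_diff affW_iscale affW_ip)

lemma fst_affW_uminus: "w \<in> affW \<Longrightarrow> fst (w (- v, 0)) = - fst (w (v, 0))"
  using affW_uminus[of w "(v, 0)"] by simp

section \<open>Roots and the height function\<close>

text \<open>Every root is a sum of two signed unit vectors, and it is twice one exactly when it is long.
  Elements of the Weyl group permute the signed unit vectors, so this description makes the
  invariance of the root system and of its two lengths immediate.\<close>

definition roots :: "lattice_vec set" where
  "roots = {e + e' |e e'. e \<in> units \<and> e' \<in> units \<and> e + e' \<noteq> 0}"

definition affroots :: "affine_vec set" where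
  "affroots = {f. fst f \<in> roots}"

text \<open>A linear function that is positive on exactly the positive affine roots: the coefficient
  of \<open>\<delta>\<close> exceeds the largest value on a finite root, and the values on the signed
  unit vectors are the odd numbers between \<open>1 - 2n\<close> and \<open>2n - 1\<close>, each taken once.
  The simple roots are the roots of height 2.\<close>

definition fht :: "lattice_vec \<Rightarrow> int" where
  "fht v = (\<Sum>j=1..n. (2 * (int n - int j) + 1) * lk v j)"

definition ht :: "affine_vec \<Rightarrow> int" where
  "ht f = 4 * int n * snd f + fht (fst f)"

lemma fht_add [simp]: "fht (u + v) = fht u + fht v"
  by (simp add: fht_def lookup_add distrib_left sum.distrib)
lemma fht_zero [simp]: "fht 0 = 0"
  by (simp add: fht_def)
lemma fht_uminus [simp]: "fht (- v) = - fht v"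
  using fht_add[of v "- v"] by simp
lemma fht_diff [simp]: "fht (u - v) = fht u - fht v"
  using fht_add[of u "- v"] by simp
lemma fht_cmul [simp]: "fht (frag_cmul k v) = k * fht v"
  by (simp add: fht_def sum_distrib_left mult_ac)
lemma fht_eps: "1 \<le> i \<Longrightarrow> i \<le> n \<Longrightarrow> fht (eps i) = 2 * (int n - int i) + 1"
proof -
  assume "1 \<le> i" "i \<le> n"
  then have "i \<in> {1..n}" by simp
  have "fht (eps i) = (\<Sum>j\<in>{1..n}. if i = j then 2 * (int n - int j) + 1 else 0)"
    unfolding fht_def by (rule sum.cong) auto
  then show ?thesis using \<open>i \<in> {1..n}\<close> by (simp add: sum.delta)
qed

lemma ht_add [simp]: "ht (f + g) = ht f + ht g"
  by (simp add: ht_def algebra_simps)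
lemma ht_uminus [simp]: "ht (- f) = - ht f"
  by (simp add: ht_def)
lemma ht_diff [simp]: "ht (f - g) = ht f - ht g"
  by (simp add: ht_def algebra_simps)
lemma ht_iscale [simp]: "ht (iscale k f) = k * ht f"
  by (simp add: ht_def algebra_simps)

lemma ht_simple [simp]: "i \<le> n \<Longrightarrow> ht (a i) = 2"
  using n2 by (auto simp: ht_def simple_root_def fht_eps)

lemma units_uminus: "e \<in> units \<Longrightarrow> - e \<in> units"
  by (auto simp: units_def)

lemma fht_units: 
  assumes "e \<in> units" shows "odd (fht e)" "\<bar>fht e\<bar> \<le> 2 * int n - 1"
  using assms by (auto simp: units_def fht_eps)

lemma fht_units_inj: 
  assumes "e \<in> units" "e' \<in> units" "fht e = fht e'" shows "e = e'"
proof -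
  obtain i j where "1 \<le> i" "i \<le> n" "1 \<le> j" "j \<le> n" "e = eps i \<or> e = - eps i" "e' = eps j \<or> e' = - eps j"
    using assms(1,2) by (auto simp: units_def)
  moreover from this have "i = j" using assms(3) by (auto simp: fht_eps)
  ultimately show ?thesis using assms(3) by (auto simp: fht_eps)
qed

lemma roots_uminus: "\<alpha> \<in> roots \<Longrightarrow> - \<alpha> \<in> roots"
proof -
  assume "\<alpha> \<in> roots"
  then obtain e e' where "e \<in> units" "e' \<in> units" "e + e' \<noteq> 0" "\<alpha> = e + e'" by (auto simp: roots_def)
  then have "- e \<in> units" "- e' \<in> units" "(- e) + (- e') \<noteq> 0" "- \<alpha> = (- e) + (- e')"
    by (auto simp: units_uminus add_eq_0_iff)
  then show ?thesis unfolding roots_def by blast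
qed

lemma affroots_uminus: "f \<in> affroots \<Longrightarrow> - f \<in> affroots"
  by (simp add: affroots_def roots_uminus)

lemma fht_roots:
  assumes "\<alpha> \<in> roots" shows "even (fht \<alpha>)" "fht \<alpha> \<noteq> 0" "\<bar>fht \<alpha>\<bar> \<le> 4 * int n - 2"
proof -
  obtain e e' where e: "e \<in> units" "e' \<in> units" "e + e' \<noteq> 0" "\<alpha> = e + e'"
    using assms by (auto simp: roots_def)
  show "even (fht \<alpha>)" "\<bar>fht \<alpha>\<bar> \<le> 4 * int n - 2"
    using e fht_units[of e] fht_units[of e'] by auto
  show "fht \<alpha> \<noteq> 0"
    using e fht_units_inj[of e "- e'"] units_uminus[of e'] by (auto simp: add_eq_0_iff2)
qed

lemma ht_roots:
  assumes "f \<in> affroots" shows "even (ht f)" "ht f \<noteq> 0"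
    "ht f > 0 \<longleftrightarrow> snd f > 0 \<or> snd f = 0 \<and> fht (fst f) > 0"
proof -
  have \<alpha>: "fst f \<in> roots" using assms by (simp add: affroots_def)
  note 1 = fht_roots[OF \<alpha>]
  show "even (ht f)" using 1 by (simp add: ht_def)
  consider "snd f > 0" | "snd f = 0" | "snd f < 0" by linarith
  then have "ht f \<noteq> 0 \<and> (ht f > 0 \<longleftrightarrow> snd f > 0 \<or> snd f = 0 \<and> fht (fst f) > 0)"
  proof cases
    case 1
    then have "4 * int n * snd f \<ge> 4 * int n * 1" by (intro mult_left_mono) auto
    then show ?thesis using fht_roots[OF \<alpha>] 1 unfolding ht_def by linarith
  next
    case 2 then show ?thesis using fht_roots[OF \<alpha>] by (simp add: ht_def)
  next
    case 3
    then have "4 * int n * snd f \<le> 4 * int n * (- 1)" by (intro mult_left_mono) auto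
    then show ?thesis using fht_roots[OF \<alpha>] 3 unfolding ht_def by linarith
  qed
  then show "ht f \<noteq> 0" "ht f > 0 \<longleftrightarrow> snd f > 0 \<or> snd f = 0 \<and> fht (fst f) > 0" by auto
qed

lemma affW_roots:
  assumes "w \<in> affW" "f \<in> affroots" shows "w f \<in> affroots"
proof -
  obtain e e' where e: "e \<in> units" "e' \<in> units" "e + e' \<noteq> 0" "fst f = e + e'"
    using assms(2) by (auto simp: affroots_def roots_def)
  have "f = (e, snd f) + (e', 0)" using e by (simp add: prod_eq_iff)
  then have f: "fst (w f) = fst (w (e, snd f)) + fst (w (e', 0))"
    using affW_add[OF assms(1), of "(e, snd f)" "(e', 0)"] by simp
  have "fst (w f) \<noteq> 0"
  proof
    assume 0: "fst (w f) = 0"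
    then have "w f = iscale (snd (w f)) (0, 1)" by (simp add: prod_eq_iff)
    then have "w f = w (iscale (snd (w f)) (0, 1))"
      using assms(1) by (metis affW_delta affW_iscale)
    then have "f = iscale (snd (w f)) (0, 1)" using affW_bij[OF assms(1)] by (metis bij_pointE)
    then show False using e by (metis fst_iscale fst_conv frag_cmul_zero2)
  qed
  then show ?thesis using f affW_units[OF assms(1)] e unfolding affroots_def roots_def by auto
qed

lemma simple_affroots [simp]: "i \<le> n \<Longrightarrow> a i \<in> affroots"
proof -
  assume i: "i \<le> n"
  define e e' where "e = (if i = 0 then - eps 1 else eps i)"
    and "e' = (if i = 0 then - eps 1 else if i < n then - eps (Suc i) else eps n)"
  have "e \<in> units" "e' \<in> units" using i n2 by (auto simp: e_def e'_def units_def)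
  moreover have "fst (a i) = e + e'" using i
    by (auto simp: simple_root_def e_def e'_def poly_mapping_eq_iff fun_eq_iff lookup_add lookup_minus)
  moreover have "fst (a i) \<noteq> 0" using ip_simple_pos[OF i] by auto
  ultimately show ?thesis unfolding affroots_def roots_def by auto
qed

lemma ht2_simple:
  assumes "f \<in> affroots" "ht f = 2" shows "\<exists>i\<le>n. f = a i"
proof -
  obtain e e' where e: "e \<in> units" "e' \<in> units" "e + e' \<noteq> 0" "fst f = e + e'"
    using assms(1) by (auto simp: affroots_def roots_def)
  have b: "\<bar>fht e\<bar> \<le> 2 * int n - 1" "\<bar>fht e'\<bar> \<le> 2 * int n - 1" using fht_units e by auto
  have eq: "4 * int n * snd f + fht e + fht e' = 2" using assms(2) e by (simp add: ht_def)
  have "snd f < 2"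
  proof (rule ccontr)
    assume "\<not> ?thesis" then have "4 * int n * snd f \<ge> 4 * int n * 2" by (intro mult_left_mono) auto
    then show False using eq b n2 by linarith
  qed
  moreover have "snd f \<ge> 0"
    using ht_roots(3)[OF assms(1)] assms(2) by auto
  ultimately consider (one) "snd f = 1" | (zero) "snd f = 0" by linarith
  then show ?thesis
  proof cases
    case one
    then have "fht e + fht e' = 2 - 4 * int n" using eq by simp
    then have "fht e = 1 - 2 * int n" "fht e' = 1 - 2 * int n" using b by linarith+
    moreover have "fht (- eps 1) = 1 - 2 * int n" "- eps 1 \<in> units" using n2 by (auto simp: fht_eps units_def)
    ultimately have "e = - eps 1" "e' = - eps 1" using fht_units_inj e by metis+
    then have "f = a 0" using one e
      by (simp add: prod_eq_iff simple_root_def poly_mapping_eq_iff fun_eq_iff lookup_minus lookup_add)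
    then show ?thesis by auto
  next
    case zero
    have *: "\<exists>i\<le>n. f = a i" if E: "E \<in> units" "E' \<in> units" "fst f = E + E'" "fht E > 0" for E E'
    proof -
      obtain j where j: "1 \<le> j" "j \<le> n" "E = eps j" using E by (auto simp: units_def fht_eps)
      let ?e = "if j < n then - eps (Suc j) else eps n"
      have "fht E + fht E' = 2" using eq zero e E by (metis (no_types, lifting) add.left_neutral add.assoc fht_add mult_zero_right)
      then have "fht E' = fht ?e" using j by (auto simp: fht_eps)
      moreover have "?e \<in> units" using j by (auto simp: units_def)
      ultimately have "E' = ?e" using fht_units_inj E by blast
      then have "f = a j" using E j zero
        by (auto simp: prod_eq_iff simple_root_def poly_mapping_eq_iff fun_eq_iff lookup_minus lookup_add)
      then show ?thesis using j by auto
    qed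
    have "fht e > 0 \<or> fht e' > 0" using eq zero by auto
    then show ?thesis using *[of e e'] *[of e' e] e by (auto simp: add.commute)
  qed
qed

lemma cp_roots_le2: "f \<in> affroots \<Longrightarrow> i \<le> n \<Longrightarrow> cp i (fst f) \<le> 2"
  by (auto simp: affroots_def roots_def units_def cpair_def lookup_add lookup_minus split: if_splits)

lemma cp_simple_nonpos: "i \<le> n \<Longrightarrow> j \<le> n \<Longrightarrow> i \<noteq> j \<Longrightarrow> cp i (fst (a j)) \<le> 0"
  using n2 by (auto simp: cpair_def simple_root_def lookup_minus)

text \<open>A simple reflection lowers the height of a root by at most 4, and it lowers the height of a
  simple root only when it negates that root. Heights of roots are even and not zero, so a root of
  height 4 cannot be lowered by 4.\<close>

lemma s_pos:
  assumes "i \<le> n" "f \<in> affroots" "ht f > 0" "f \<noteq> a i"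
  shows "ht (s i f) > 0"
proof -
  have h: "ht (s i f) = ht f - 2 * cp i (fst f)" using assms(1) by (simp add: s_def)
  have r: "s i f \<in> affroots" using affW_roots[of "s i" f] assms by simp
  show ?thesis
  proof (cases "ht f = 2")
    case True
    then obtain j where "j \<le> n" "f = a j" using ht2_simple assms by blast
    moreover have "i \<noteq> j" using calculation assms by auto
    ultimately have "cp i (fst f) \<le> 0" using cp_simple_nonpos[of i j] assms by auto
    then show ?thesis using h True by simp
  next
    case False
    then have "ht f \<ge> 4" using ht_roots(1)[OF assms(2)] assms(3) by presburger
    then have "ht (s i f) \<ge> 0" using h cp_roots_le2[of f i] assms by simp
    then show ?thesis using ht_roots(2)[OF r] by simp
  qed
qed

end

section \<open>Length and descents\<close>

context rank
begin

text \<open>The exchange property for an arbitrary positive root \<open>\<beta>\<close> rather than a simple one: walking along the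
  word, \<open>\<beta>\<close> must at some letter be the simple root of that letter, since a simple reflection makes no
  other positive root negative; conjugating the reflection back shows that it deletes this letter.\<close>

lemma exchange:
  assumes "set is \<subseteq> {0..n}" "\<beta> \<in> affroots" "ht \<beta> > 0" "ht (word_elt n (rev is) \<beta>) < 0"
  shows "\<exists>js. set js \<subseteq> {0..n} \<and> Suc (length js) = length is \<and> word_elt n js = refl \<beta> \<circ> word_elt n is"
  using assms
proof (induction "is" arbitrary: \<beta>)
  case Nil then show ?case by simp
next
  case (Cons i "is")
  have i: "i \<le> n" and "set is \<subseteq> {0..n}" using Cons by auto
  show ?case
  proof (cases "\<beta> = a i")
    case True
    have "refl \<beta> \<circ> word_elt n (i # is) = word_elt n is"
      using i unfolding True srefl_def[symmetric] by (auto simp: fun_eq_iff)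
    then show ?thesis using \<open>set is \<subseteq> {0..n}\<close> by (intro exI[of _ "is"] conjI) (simp, simp, rule sym)
  next
    case False
    have "s i \<beta> \<in> affroots" using affW_roots[of "s i"] i Cons by simp
    moreover have "ht (s i \<beta>) > 0" using s_pos i Cons False by auto
    moreover have "ht (word_elt n (rev is) (s i \<beta>)) < 0"
      using Cons.prems(4) by (simp add: word_elt_append)
    ultimately obtain js where js: "set js \<subseteq> {0..n}" "Suc (length js) = length is"
        "word_elt n js = refl (s i \<beta>) \<circ> word_elt n is"
      using Cons \<open>set is \<subseteq> {0..n}\<close> by metis
    have "refl (s i \<beta>) f = s i (refl \<beta> (s i f))" for f
      using affW_refl_conj[of "s i" \<beta> "s i f"] i by simp
    then have "word_elt n (i # js) = refl \<beta> \<circ> word_elt n (i # is)"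
      using js i by (auto simp: fun_eq_iff)
    then show ?thesis using js i by (intro exI[of _ "i # js"]) auto
  qed
qed

lemma len_le: "set is \<subseteq> {0..n} \<Longrightarrow> len n (word_elt n is) \<le> length is"
  unfolding len_def by (rule Least_le) auto

lemma reduced_exists:
  assumes "w \<in> affW" shows "\<exists>is. reduced_expr n w is"
proof -
  have "\<exists>r is. set is \<subseteq> {0..n} \<and> length is = r \<and> word_elt n is = w"
    using assms by (auto simp: affW_def)
  then have "\<exists>is. set is \<subseteq> {0..n} \<and> length is = len n w \<and> word_elt n is = w"
    unfolding len_def by (rule LeastI_ex)
  then show ?thesis by (auto simp: reduced_expr_def)
qed

lemma reduced_affW: "reduced_expr n w is \<Longrightarrow> w \<in> affW"
  by (auto simp: reduced_expr_def affW_def)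

lemma some_reduced: "w \<in> affW \<Longrightarrow> reduced_expr n w (some_reduced n w)"
  unfolding some_reduced_def by (rule someI_ex) (rule reduced_exists)

lemma len_id [simp]: "len n id = 0"
  using len_le[of "[]"] by simp

lemma len_0: "w \<in> affW \<Longrightarrow> len n w = 0 \<Longrightarrow> w = id"
  using reduced_exists[of w] by (auto simp: reduced_expr_def)

text \<open>A left descent, expressed by roots; \<open>len_desc\<close> and \<open>len_asc\<close> show that it compares the lengths of
  \<open>w\<close> and \<open>s\<^sub>i w\<close>.\<close>

definition desc :: "(affine_vec \<Rightarrow> affine_vec) \<Rightarrow> nat \<Rightarrow> bool" where
  "desc w i \<longleftrightarrow> ht (inv w (a i)) < 0"

lemma not_desc: "w \<in> affW \<Longrightarrow> i \<le> n \<Longrightarrow> \<not> desc w i \<longleftrightarrow> ht (inv w (a i)) > 0"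
  using ht_roots(2)[OF affW_roots[of "inv w" "a i"]] by (auto simp: desc_def)

lemma len_s_le: 
  assumes "w \<in> affW" "i \<le> n" shows "len n (s i \<circ> w) \<le> Suc (len n w)"
proof -
  obtain "is" where "set is \<subseteq> {0..n}" "word_elt n is = w" "length is = len n w"
    using reduced_exists[OF assms(1)] by (auto simp: reduced_expr_def)
  then show ?thesis using len_le[of "i # is"] assms by auto
qed

lemma s_s_comp [simp]: "i \<le> n \<Longrightarrow> s i \<circ> (s i \<circ> w) = w"
  by (auto simp: fun_eq_iff)

lemma len_desc:
  assumes "w \<in> affW" "i \<le> n" "desc w i" shows "len n w = Suc (len n (s i \<circ> w))"
proof -
  obtain "is" where is': "set is \<subseteq> {0..n}" "word_elt n is = w" "length is = len n w"
    using reduced_exists[OF assms(1)] by (auto simp: reduced_expr_def)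
  have "ht (word_elt n (rev is) (a i)) < 0"
    using assms is' inv_word_elt[of "is"] by (auto simp: desc_def)
  then obtain js where "set js \<subseteq> {0..n}" "Suc (length js) = length is" "word_elt n js = s i \<circ> w"
    using exchange[of "is" "a i"] is' assms(2) unfolding srefl_def[symmetric] by auto
  then have "Suc (len n (s i \<circ> w)) \<le> len n w" using len_le[of js] is' by simp
  moreover have "len n w \<le> Suc (len n (s i \<circ> w))"
    using len_s_le[of "s i \<circ> w" i] assms by simp
  ultimately show ?thesis by simp
qed

lemma desc_s: "w \<in> affW \<Longrightarrow> i \<le> n \<Longrightarrow> desc (s i \<circ> w) i \<longleftrightarrow> \<not> desc w i"
  using not_desc[of w i] by (simp add: desc_def inv_comp_s affW_uminus)

lemma len_asc:
  assumes "w \<in> affW" "i \<le> n" "\<not> desc w i" shows "len n (s i \<circ> w) = Suc (len n w)"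
  using len_desc[of "s i \<circ> w" i] assms desc_s[of w i] by simp

lemma reduced_cons:
  assumes "w \<in> affW" "i \<le> n" "desc w i" "reduced_expr n (s i \<circ> w) p"
  shows "reduced_expr n w (i # p)"
  using assms len_desc[OF assms(1-3)] by (auto simp: reduced_expr_def)

lemma reduced_consD:
  assumes "reduced_expr n w (i # p)"
  shows "desc w i" "reduced_expr n (s i \<circ> w) p" "i \<le> n" "w \<in> affW"
proof -
  show w: "w \<in> affW" using assms reduced_affW by blast
  show i: "i \<le> n" using assms by (auto simp: reduced_expr_def)
  have p: "word_elt n p = s i \<circ> w" "set p \<subseteq> {0..n}" "Suc (length p) = len n w"
    using assms i by (auto simp: reduced_expr_def)
  show d: "desc w i"
  proof (rule ccontr)
    assume "\<not> ?thesis"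
    then have "len n (s i \<circ> w) = Suc (len n w)" using len_asc w i by simp
    then show False using len_le[of p] p by simp
  qed
  show "reduced_expr n (s i \<circ> w) p" using p len_desc[OF w i d] by (simp add: reduced_expr_def)
qed

section \<open>Reduced words are connected by braid moves\<close>

definition commuting :: "nat \<Rightarrow> nat \<Rightarrow> bool" where
  "commuting i j \<longleftrightarrow> i + 2 \<le> j \<and> j \<le> n"
definition braid3 :: "nat \<Rightarrow> nat \<Rightarrow> bool" where
  "braid3 i j \<longleftrightarrow> 1 \<le> i \<and> j = Suc i \<and> j < n"
definition braid4 :: "nat \<Rightarrow> nat \<Rightarrow> bool" where
  "braid4 i j \<longleftrightarrow> j = Suc i \<and> (i = 0 \<or> j = n)"

text \<open>Equality in the braid monoid. The congruence is closed under common letters on the left only, since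
  the moves themselves carry an arbitrary tail.\<close>

inductive braid_eq :: "nat list \<Rightarrow> nat list \<Rightarrow> bool" where
  refl: "braid_eq u u"
| sym: "braid_eq u v \<Longrightarrow> braid_eq v u"
| trans: "braid_eq u v \<Longrightarrow> braid_eq v w \<Longrightarrow> braid_eq u w"
| cons: "braid_eq u v \<Longrightarrow> braid_eq (i # u) (i # v)"
| b2: "commuting i j \<Longrightarrow> braid_eq (i # j # u) (j # i # u)"
| b3: "braid3 i j \<Longrightarrow> braid_eq (i # j # i # u) (j # i # j # u)"
| b4: "braid4 i j \<Longrightarrow> braid_eq (i # j # i # j # u) (j # i # j # i # u)"

lemma cp_commuting: "commuting i j \<Longrightarrow> cp i (fst (a j)) = 0 \<and> cp j (fst (a i)) = 0"
  by (auto simp: commuting_def cpair_def simple_root_def lookup_minus)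
lemma cp_braid3: "braid3 i j \<Longrightarrow> cp i (fst (a j)) = - 1 \<and> cp j (fst (a i)) = - 1"
  by (auto simp: braid3_def cpair_def simple_root_def lookup_minus)
lemma cp_braid4: "braid4 i j \<Longrightarrow> (cp i (fst (a j)) = - 1 \<and> cp j (fst (a i)) = - 2) \<or>
   (cp i (fst (a j)) = - 2 \<and> cp j (fst (a i)) = - 1)"
  using n2 by (auto simp: braid4_def cpair_def simple_root_def lookup_minus)

lemma s_comm: "i \<le> n \<Longrightarrow> j \<le> n \<Longrightarrow> commuting i j \<Longrightarrow> s i (s j f) = s j (s i f)"
  using cp_commuting[of i j] by (simp add: s_def)

lemma s_braid3: "i \<le> n \<Longrightarrow> j \<le> n \<Longrightarrow> braid3 i j \<Longrightarrow> s i (s j (s i f)) = s j (s i (s j f))"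
  using cp_braid3[of i j]
  by (simp add: s_def prod_eq_iff poly_mapping_eq_iff fun_eq_iff lookup_minus lookup_add algebra_simps)

lemma s_braid4:
  assumes "i \<le> n" "j \<le> n" "braid4 i j"
  shows "s i (s j (s i (s j f))) = s j (s i (s j (s i f)))"
  using cp_braid4[OF assms(3)] assms(1,2)
  by (elim disjE)
     (simp_all add: s_def prod_eq_iff poly_mapping_eq_iff fun_eq_iff lookup_minus lookup_add algebra_simps)

lemma ht_inv_s_comp:
  assumes "w \<in> affW" "i \<le> n"
  shows "ht (inv (s i \<circ> w) f) = ht (inv w f) - cp i (fst f) * ht (inv w (a i))"
  unfolding inv_comp_s[OF assms(2,1)] using assms
  by (simp add: s_def affW_diff[OF inv_affW] affW_iscale[OF inv_affW])

text \<open>If both \<open>s\<^sub>i\<close> and \<open>s\<^sub>j\<close> shorten \<open>w\<close>, then \<open>w\<close> has reduced words that begin with the two alternating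
  words for the longest element of \<open>\<langle>s\<^sub>i, s\<^sub>j\<rangle>\<close> and agree afterwards: the inversions met while stripping
  the letters are positive combinations of the two given ones.\<close>

lemma two_descents_aux:
  assumes w: "w \<in> affW" and d: "desc w i" "desc w j" and ij: "i < j" "j \<le> n"
  shows "\<exists>p p'. reduced_expr n w (i # p) \<and> reduced_expr n w (j # p') \<and> braid_eq (i # p) (j # p')"
proof -
  have i: "i \<le> n" and j: "j \<le> n" using ij by auto
  let ?A = "ht (inv w (a i))" and ?B = "ht (inv w (a j))"
  have neg: "?A < 0" "?B < 0" using d by (auto simp: desc_def)
  have sW: "s i \<in> affW" "s j \<in> affW" using i j by auto
  have "commuting i j \<or> braid3 i j \<or> braid4 i j"
    using ij unfolding commuting_def braid3_def braid4_def by presburger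
  then consider (2) "commuting i j" | (3) "braid3 i j" | (4) "braid4 i j" by blast
  then show ?thesis
  proof cases
    case 2
    obtain x where x: "reduced_expr n (s j \<circ> (s i \<circ> w)) x"
      using reduced_exists[OF comp_affW[OF sW(2) comp_affW[OF sW(1) w]]] by blast
    have eq: "s j \<circ> (s i \<circ> w) = s i \<circ> (s j \<circ> w)" 
      by (rule ext) (simp only: comp_apply, rule s_comm[OF i j 2, symmetric])
    have "desc (s i \<circ> w) j" "desc (s j \<circ> w) i"
      unfolding desc_def ht_inv_s_comp[OF w i] ht_inv_s_comp[OF w j] using neg cp_commuting[OF 2] by simp_all
    then have "reduced_expr n w (i # j # x)" "reduced_expr n w (j # i # x)"
      using x[unfolded eq] x w sW i j d by - (intro reduced_cons comp_affW; assumption)+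
    then show ?thesis using b2[OF 2] by blast
  next
    case 3
    obtain x where x: "reduced_expr n (s i \<circ> (s j \<circ> (s i \<circ> w))) x"
      using reduced_exists[OF comp_affW[OF sW(1) comp_affW[OF sW(2) comp_affW[OF sW(1) w]]]] by blast
    have eq: "s i \<circ> (s j \<circ> (s i \<circ> w)) = s j \<circ> (s i \<circ> (s j \<circ> w))"
      by (rule ext) (simp only: comp_apply, rule s_braid3[OF i j 3])
    have "desc (s i \<circ> w) j" "desc (s j \<circ> w) i"
      "desc (s j \<circ> (s i \<circ> w)) i" "desc (s i \<circ> (s j \<circ> w)) j"
      unfolding desc_def ht_inv_s_comp[OF comp_affW[OF sW(1) w] j] ht_inv_s_comp[OF comp_affW[OF sW(2) w] i]
        ht_inv_s_comp[OF w i] ht_inv_s_comp[OF w j]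
      using neg cp_braid3[OF 3] i j by simp_all
    then have "reduced_expr n w (i # j # i # x)" "reduced_expr n w (j # i # j # x)"
      using x[unfolded eq] x w sW i j d by - (intro reduced_cons comp_affW; assumption)+
    then show ?thesis using b3[OF 3] by blast
  next
    case 4
    obtain x where x: "reduced_expr n (s j \<circ> (s i \<circ> (s j \<circ> (s i \<circ> w)))) x"
      using reduced_exists[OF comp_affW[OF sW(2) comp_affW[OF sW(1) comp_affW[OF sW(2) comp_affW[OF sW(1) w]]]]]
      by blast
    have eq: "s j \<circ> (s i \<circ> (s j \<circ> (s i \<circ> w))) = s i \<circ> (s j \<circ> (s i \<circ> (s j \<circ> w)))"
      by (rule ext) (simp only: comp_apply, rule s_braid4[OF i j 4, symmetric])
    have "desc (s i \<circ> w) j" "desc (s j \<circ> w) i"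
      "desc (s j \<circ> (s i \<circ> w)) i" "desc (s i \<circ> (s j \<circ> w)) j"
      "desc (s i \<circ> (s j \<circ> (s i \<circ> w))) j" "desc (s j \<circ> (s i \<circ> (s j \<circ> w))) i"
      unfolding desc_def ht_inv_s_comp[OF comp_affW[OF sW(2) comp_affW[OF sW(1) w]] i]
        ht_inv_s_comp[OF comp_affW[OF sW(1) comp_affW[OF sW(2) w]] j]
        ht_inv_s_comp[OF comp_affW[OF sW(1) w] j] ht_inv_s_comp[OF comp_affW[OF sW(2) w] i]
        ht_inv_s_comp[OF w i] ht_inv_s_comp[OF w j]
      using neg cp_braid4[OF 4] i j by auto
    then have "reduced_expr n w (i # j # i # j # x)" "reduced_expr n w (j # i # j # i # x)"
      using x[unfolded eq] x w sW i j d by - (intro reduced_cons comp_affW; assumption)+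
    then show ?thesis using b4[OF 4] by blast
  qed
qed

lemma two_descents:
  assumes "w \<in> affW" "desc w i" "desc w j" "i \<noteq> j" "i \<le> n" "j \<le> n"
  shows "\<exists>p p'. reduced_expr n w (i # p) \<and> reduced_expr n w (j # p') \<and> braid_eq (i # p) (j # p')"
  using two_descents_aux[of w i j] two_descents_aux[of w j i] assms braid_eq.sym
  by (metis linorder_neqE_nat)

text \<open>Matsumoto's theorem, by induction on the length: words with equal first letters are compared by
  the induction hypothesis, and for different first letters one passes through the two words
  provided by \<open>two_descents\<close>.\<close>

theorem reduced_words_braid_eq:
  "reduced_expr n w is \<Longrightarrow> reduced_expr n w js \<Longrightarrow> braid_eq is js"
proof (induction "length is" arbitrary: w "is" js)
  case 0
  then have "is = []" "js = []" by (metis reduced_expr_def length_0_conv)+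
  then show ?case by (simp only: braid_eq.refl)
next
  case (Suc k)
  obtain i is' where is': "is = i # is'" using Suc.hyps(2) by (cases "is") auto
  have "length js = length is" using Suc by (simp add: reduced_expr_def)
  then obtain j js' where js': "js = j # js'" using is' by (cases js) auto
  note I = reduced_consD[OF Suc.prems(1)[unfolded is']]
  note J = reduced_consD[OF Suc.prems(2)[unfolded js']]
  have len: "length is' = k" "length js' = k" using Suc is' js' \<open>length js = _\<close> by auto
  show ?case
  proof (cases "i = j")
    case True
    then show ?thesis using Suc.hyps(1)[of is' "s i \<circ> w" js'] I J len is' js' by (auto intro: braid_eq.cons)
  next
    case False
    then obtain p p' where p: "reduced_expr n w (i # p)" "reduced_expr n w (j # p')" "braid_eq (i # p) (j # p')"
      using two_descents[of w i j] I J by auto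
    have "braid_eq is' p" using Suc.hyps(1)[of is' "s i \<circ> w" p] I len reduced_consD(2)[OF p(1)] by auto
    moreover have "braid_eq js' p'" using Suc.hyps(1)[of js' "s j \<circ> w" p'] J len reduced_consD(2)[OF p(2)] by auto
    ultimately show ?thesis using p(3) is' js' by (metis braid_eq.cons braid_eq.trans braid_eq.sym)
  qed
qed

section \<open>Additivity of the length\<close>

text \<open>No inversion of \<open>w'\<close> is undone by \<open>w\<close>. This is the form in which additivity of lengths can be
  checked on roots.\<close>

definition additive :: "(affine_vec \<Rightarrow> affine_vec) \<Rightarrow> (affine_vec \<Rightarrow> affine_vec) \<Rightarrow> bool" where
  "additive w w' \<longleftrightarrow> (\<forall>\<beta>\<in>affroots. ht \<beta> > 0 \<longrightarrow> ht (w' \<beta>) < 0 \<longrightarrow> ht (w (w' \<beta>)) < 0)"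

lemma len_inv_asc:
  assumes "w \<in> affW" "i \<le> n" "ht (w (a i)) > 0" shows "len n (w \<circ> s i) = Suc (len n w)"
proof -
  have le: "len n u \<le> len n (inv u)" if u: "u \<in> affW" for u
  proof -
    obtain "is" where is': "set is \<subseteq> {0..n}" "word_elt n is = inv u" "length is = len n (inv u)"
      using reduced_exists[OF inv_affW[OF u]] unfolding reduced_expr_def by blast
    have "word_elt n (rev is) = u" using inv_word_elt[OF is'(1)] is' u affW_bij by (metis inv_inv_eq)
    then show ?thesis using len_le[of "rev is"] is' by auto
  qed
  have inv: "len n (inv u) = len n u" if "u \<in> affW" for u
    using le[OF that] le[of "inv u"] that affW_bij by (simp add: inv_inv_eq)
  have "inv (w \<circ> s i) = s i \<circ> inv w"
    using o_inv_distrib[of w "s i"] affW_bij[of "s i"] affW_bij[of w] assms by simp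
  moreover have "\<not> desc (inv w) i"
    using assms affW_bij[of w] by (simp add: desc_def inv_inv_eq)
  then have "len n (s i \<circ> inv w) = Suc (len n (inv w))" using len_asc assms by simp
  ultimately show ?thesis using inv[of w] inv[of "w \<circ> s i"] assms by simp
qed

text \<open>One letter \<open>s\<^sub>i\<close> at a time is moved from the left end of \<open>w'\<close> to the right end of \<open>w\<close>. The condition at
  the inversion of \<open>w'\<close> belonging to that letter says that \<open>w\<close> becomes longer, and the condition
  at the other inversions is inherited.\<close>

theorem len_additive:
  assumes "w \<in> affW" "w' \<in> affW" "additive w w'" shows "len n (w \<circ> w') = len n w + len n w'"
  using assms
proof (induction "len n w'" arbitrary: w w')
  case 0
  then have "w' = id" using len_0[of w'] by metis
  then show ?case by (simp only: comp_id len_id add_0_right)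
next
  case (Suc k)
  obtain q where q: "reduced_expr n w' q" using reduced_exists[OF Suc.prems(2)] by blast
  then have "length q = Suc k" using Suc.hyps(2) by (simp only: reduced_expr_def)
  then obtain i p where "q = i # p" by (cases q) auto
  with q have "reduced_expr n w' (i # p)" by simp
  note R = reduced_consD[OF this]
  define u where "u = s i \<circ> w'"
  have w'f: "w' f = s i (u f)" for f using R(3) by (simp add: u_def)
  have uW: "u \<in> affW" unfolding u_def using R(3,4) by (intro comp_affW s_affW)
  have lu: "len n w' = Suc (len n u)" unfolding u_def by (rule len_desc[OF R(4,3,1)])
  have "\<not> desc u i" unfolding u_def using R(1) desc_s[OF R(4,3)] by blast
  then have pos: "ht (inv u (a i)) > 0" using not_desc[OF uW R(3)] by blast
  have r: "inv u (a i) \<in> affroots" by (rule affW_roots[OF inv_affW[OF uW] simple_affroots[OF R(3)]])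
  have neg: "w' (inv u (a i)) = - a i" using uW R(3) by (simp add: w'f)
  then have "ht (w' (inv u (a i))) < 0" using R(3) by simp
  then have "ht (w (w' (inv u (a i)))) < 0"
    using Suc.prems(3) r pos unfolding additive_def by blast
  then have "ht (w (a i)) > 0" unfolding neg affW_uminus[OF Suc.prems(1)] by simp
  then have lw: "len n (w \<circ> s i) = Suc (len n w)" by (rule len_inv_asc[OF Suc.prems(1) R(3)])
  have "additive (w \<circ> s i) u"
    unfolding additive_def
  proof (intro ballI impI)
    fix b assume b: "b \<in> affroots" "ht b > 0" "ht (u b) < 0"
    have "u b \<noteq> - a i"
    proof
      assume "u b = - a i"
      then have "u (- b) = a i" by (simp add: affW_uminus[OF uW])
      then have "inv u (a i) = - b" using inv_affW_cancel(1)[OF uW, of "- b"] by simp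
      then show False using pos b(2) by simp
    qed
    then have ne: "- u b \<noteq> a i" by (metis minus_minus)
    have "- u b \<in> affroots" by (rule affroots_uminus[OF affW_roots[OF uW b(1)]])
    then have "ht (s i (- u b)) > 0" using s_pos[OF R(3) _ _ ne] b(3) by simp
    then have "ht (w' b) < 0" by (simp add: w'f affW_uminus[OF s_affW[OF R(3)]])
    then show "ht ((w \<circ> s i) (u b)) < 0"
      using Suc.prems(3) b(1,2) unfolding additive_def by (simp add: w'f)
  qed
  then have "len n ((w \<circ> s i) \<circ> u) = len n (w \<circ> s i) + len n u"
    using Suc.hyps(1)[of u "w \<circ> s i"] Suc.hyps(2) lu uW R(3) Suc.prems(1) by (metis Suc_inject comp_affW s_affW)
  moreover have "(w \<circ> s i) \<circ> u = w \<circ> w'" by (auto simp: w'f)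
  ultimately show ?case using lw lu by (metis add_Suc add_Suc_right)
qed

lemma reduced_append:
  assumes "w \<in> affW" "w' \<in> affW" "additive w w'" "reduced_expr n w is" "reduced_expr n w' js"
  shows "reduced_expr n (w \<circ> w') (is @ js)"
  using assms len_additive[OF assms(1-3)] by (auto simp: reduced_expr_def word_elt_append)

lemma additive_s: "w \<in> affW \<Longrightarrow> i \<le> n \<Longrightarrow> \<not> desc w i \<Longrightarrow> additive (s i) w"
  unfolding additive_def
proof (intro ballI impI)
  fix \<beta> assume w: "w \<in> affW" "i \<le> n" "\<not> desc w i" and b: "\<beta> \<in> affroots" "ht \<beta> > 0" "ht (w \<beta>) < 0"
  have "- w \<beta> \<noteq> a i"
  proof
    assume "- w \<beta> = a i"
    then have "inv w (a i) = - \<beta>" using w(1) by (metis affW_uminus inv_affW_cancel(1))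
    then show False using w b not_desc[OF w(1,2)] by simp
  qed
  then have "ht (s i (- w \<beta>)) > 0" using s_pos[of i "- w \<beta>"] w b affroots_uminus affW_roots by auto
  then show "ht (s i (w \<beta>)) < 0" using w by (simp add: affW_uminus)
qed

section \<open>Translations\<close>

lemma tau_apply: "tau v (u, m) = (u, m + ip v u)"
  by (simp add: tau_def)

lemma tau_comp: "tau u \<circ> tau v = tau (u + v)"
  by (auto simp: tau_def)

lemma tau_zero: "tau 0 = id"
  by (auto simp: tau_def)

lemma finW_affW: "w \<in> finW n \<Longrightarrow> w \<in> affW"
  unfolding finW_def affW_def by (auto intro!: imageI)

lemma id_finW [simp]: "id \<in> finW n"
  unfolding finW_def by (rule image_eqI[of _ _ "[]"]) auto

lemma s_finW [simp]: "1 \<le> i \<Longrightarrow> i \<le> n \<Longrightarrow> s i \<in> finW n"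
  unfolding finW_def by (rule image_eqI[of _ _ "[i]"]) auto

lemma comp_finW: "u \<in> finW n \<Longrightarrow> v \<in> finW n \<Longrightarrow> u \<circ> v \<in> finW n"
  unfolding finW_def
proof clarify
  fix "is" js assume "set is \<subseteq> {1..n}" "set js \<subseteq> {1..n}"
  then show "word_elt n is \<circ> word_elt n js \<in> word_elt n ` {is. set is \<subseteq> {1..n}}"
    by (intro image_eqI[of _ _ "is @ js"]) (auto simp: word_elt_append)
qed

lemma inv_finW: "w \<in> finW n \<Longrightarrow> inv w \<in> finW n"
  unfolding finW_def
proof clarify
  fix "is" assume "set is \<subseteq> {1..n}"
  then show "inv (word_elt n is) \<in> word_elt n ` {is. set is \<subseteq> {1..n}}"
    by (intro image_eqI[of _ _ "rev is"] inv_word_elt) auto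
qed

text \<open>The reflection in \<open>2\<epsilon>\<^sub>j\<close>. It lies in \<open>W\<close>, and together with its affine companion it produces the
  translation by \<open>\<epsilon>\<^sub>j\<close>.\<close>

definition flip :: "nat \<Rightarrow> affine_vec \<Rightarrow> affine_vec" where
  "flip j f = (fst f - frag_cmul (2 * lk (fst f) j) (eps j), snd f)"

lemma flip_finW:
  assumes "1 \<le> j" "j \<le> n" shows "flip j \<in> finW n"
proof -
  have "k < n \<Longrightarrow> flip (n - k) \<in> finW n" for k
  proof (induction k)
    case 0
    have "flip n = s n" using n2
      by (simp add: fun_eq_iff flip_def s_def prod_eq_iff simple_root_def cpair_def mult.commute)
    then show ?case using n2 by simp
  next
    case (Suc k)
    define m where "m = n - Suc k"
    have m: "n - k = Suc m" "m < n" "1 \<le> m" using Suc by (auto simp: m_def)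
    have "flip m = s m \<circ> flip (Suc m) \<circ> s m"
    proof
      fix f :: affine_vec
      show "flip m f = (s m \<circ> flip (Suc m) \<circ> s m) f"
        using m by (auto simp: flip_def s_def prod_eq_iff simple_root_def cpair_def
            poly_mapping_eq_iff fun_eq_iff lookup_minus)
    qed
    moreover have "s m \<in> finW n" "flip (Suc m) \<in> finW n" using m Suc by simp_all
    ultimately show ?case unfolding m_def[symmetric] by (metis comp_finW)
  qed
  from this[of "n - j"] show ?thesis using assms by simp
qed

lemma tau_eps_affW:
  assumes "1 \<le> j" "j \<le> n" shows "tau (eps j) \<in> affW"
proof -
  define R where "R j f = (fst f - frag_cmul (2 * lk (fst f) j) (eps j), snd f + lk (fst f) j)"
    for j and f :: affine_vec
  have R: "R (Suc k) \<in> affW" if "Suc k \<le> n" for k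
    using that
  proof (induction k)
    case 0
    have "R (Suc 0) = s 0"
      by (simp add: fun_eq_iff R_def s_def prod_eq_iff simple_root_def cpair_def mult.commute)
    then show ?case by simp
  next
    case (Suc k)
    have "R (Suc (Suc k)) = s (Suc k) \<circ> R (Suc k) \<circ> s (Suc k)"
    proof
      fix f :: affine_vec
      show "R (Suc (Suc k)) f = (s (Suc k) \<circ> R (Suc k) \<circ> s (Suc k)) f"
        using Suc by (auto simp: R_def s_def prod_eq_iff simple_root_def cpair_def
            poly_mapping_eq_iff fun_eq_iff lookup_minus)
    qed
    moreover have "s (Suc k) \<in> affW" using Suc by (intro s_affW) simp
    moreover have "R (Suc k) \<in> affW" using Suc by simp
    ultimately show ?case by (metis comp_affW)
  qed
  have "tau (eps j) = flip j \<circ> R j"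
    by (auto simp: flip_def R_def tau_def prod_eq_iff poly_mapping_eq_iff fun_eq_iff lookup_minus)
  moreover have "R j \<in> affW" using R[of "j - 1"] assms by simp
  moreover have "flip j \<in> affW" using flip_finW finW_affW assms by blast
  ultimately show ?thesis by (metis comp_affW)
qed

lemma tau_uminus: "inv (tau v) = tau (- v)"
  by (rule inv_equality) (auto simp: tau_def)

lemma Lam_decomp: "v \<in> Lam n \<Longrightarrow> v = (\<Sum>i=1..n. frag_cmul (lk v i) (eps i))"
proof (rule Lam_eqI)
  fix j assume "1 \<le> j" "j \<le> n"
  have "(\<Sum>i=1..n. lk v i * lk (eps i) j) = (\<Sum>i=1..n. if i = j then lk v i else 0)"
    by (rule sum.cong) auto
  then show "lk v j = lk (\<Sum>i=1..n. frag_cmul (lk v i) (eps i)) j"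
    using \<open>1 \<le> j\<close> \<open>j \<le> n\<close> by (simp add: lookup_sum)
qed (auto intro!: Lam_sum Lam_cmul Lam_eps)

lemma tau_affW: 
  assumes "v \<in> Lam n" shows "tau v \<in> affW"
proof -
  have nat: "tau (frag_cmul (int k) u) \<in> affW" if "tau u \<in> affW" for k u
  proof (induction k)
    case 0 show ?case by (simp only: of_nat_0 frag_cmul_zero tau_zero id_affW)
  next
    case (Suc k)
    have "tau (frag_cmul (int (Suc k)) u) = tau u \<circ> tau (frag_cmul (int k) u)"
      by (simp only: tau_comp) (simp add: frag_cmul_distrib)
    then show ?case using comp_affW[OF that Suc] by (simp only:)
  qed
  have cm: "tau (frag_cmul k u) \<in> affW" if "tau u \<in> affW" for k u
  proof (cases "0 \<le> k")
    case True then show ?thesis using nat[OF that, of "nat k"] by simp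
  next
    case False
    then have "frag_cmul k u = - frag_cmul (int (nat (- k))) u" by (simp add: poly_mapping_eq_iff fun_eq_iff)
    then show ?thesis using inv_affW[OF nat[OF that, of "nat (- k)"]] tau_uminus by metis
  qed
  have "finite A \<Longrightarrow> A \<subseteq> {1..n} \<Longrightarrow> tau (\<Sum>i\<in>A. frag_cmul (lk v i) (eps i)) \<in> affW" for A
  proof (induction A rule: finite_induct)
    case empty show ?case by (simp only: sum.empty tau_zero id_affW)
  next
    case (insert i A)
    then have "tau (frag_cmul (lk v i) (eps i)) \<circ> tau (\<Sum>i\<in>A. frag_cmul (lk v i) (eps i)) \<in> affW"
      by (intro comp_affW cm tau_eps_affW) auto
    then show ?case by (simp only: tau_comp sum.insert[OF insert(1,2)])
  qed
  from this[of "{1..n}"] show ?thesis using Lam_decomp[OF assms] by simp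
qed

text \<open>Elements that fix the level act on translations through their linear part.\<close>

lemma tau_conj: "w \<in> affW \<Longrightarrow> (\<And>u. snd (w (u, 0)) = 0) \<Longrightarrow> w \<circ> tau v = tau (fst (w (v, 0))) \<circ> w"
proof
  fix f :: affine_vec assume w: "w \<in> affW" and 0: "\<And>u. snd (w (u, 0)) = 0"
  have L: "w (u, m) = (fst (w (u, 0)), m)" for u m using affW_level[OF w, of u m] 0 by simp
  obtain u m where f: "f = (u, m)" by (cases f)
  have "(w \<circ> tau v) f = (fst (w (u, 0)), m + ip v u)"
    unfolding f comp_apply tau_apply by (rule L)
  also have "ip v u = ip (fst (w (v, 0))) (fst (w (u, 0)))" using affW_ip[OF w, of "(v, 0)" "(u, 0)"] by simp
  also have "(fst (w (u, 0)), m + \<dots>) = (tau (fst (w (v, 0))) \<circ> w) f"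
    unfolding f comp_apply L[of u m] tau_apply ..
  finally show "(w \<circ> tau v) f = (tau (fst (w (v, 0))) \<circ> w) f" .
qed

end

section \<open>Laurent polynomials and their values\<close>

abbreviation sg :: "'a \<Rightarrow> 'b \<Rightarrow> 'a \<Rightarrow>\<^sub>0 'b::zero" where "sg \<equiv> Poly_Mapping.single"

lemma lk_lscale [simp]: "lk (lscale c f) v = c * lk f v"
  unfolding lscale_def mult_map_scale_conv_mult[symmetric]
  by transfer (simp add: when_def)

lemma lscale_sg [simp]: "lscale c (sg v b) = sg v (c * b)"
  by (rule poly_mapping_eqI) (simp add: lookup_single when_def)

lemma lscale_lscale [simp]: "lscale c (lscale d f) = lscale (c * d) f"
  by (rule poly_mapping_eqI) simp

lemma lscale_add: "lscale c (f + g) = lscale c f + lscale c g"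
  by (rule poly_mapping_eqI) (simp add: lookup_add algebra_simps)
lemma lscale_add_left: "lscale (c + d) f = lscale c f + lscale d f"
  by (rule poly_mapping_eqI) (simp add: lookup_add algebra_simps)
lemma lscale_diff: "lscale c (f - g) = lscale c f - lscale c g"
  by (rule poly_mapping_eqI) (simp add: lookup_minus algebra_simps)
lemma lscale_diff_left: "lscale (c - d) f = lscale c f - lscale d f"
  by (rule poly_mapping_eqI) (simp add: lookup_minus algebra_simps)
lemma lscale_uminus: "lscale c (- f) = - lscale c f" "lscale (- c) f = - lscale c f"
  by (rule poly_mapping_eqI, simp)+
lemma lscale_simps [simp]: "lscale 1 f = f" "lscale 0 f = 0" "lscale c 0 = 0"
  by (rule poly_mapping_eqI, simp)+
lemma lscale_sum: "lscale c (sum f A) = (\<Sum>a\<in>A. lscale c (f a))"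
  by (rule poly_mapping_eqI) (simp add: lookup_sum sum_distrib_left)
lemma lscale_mult: "lscale c f * g = lscale c (f * g)" "g * lscale c f = lscale c (g * f)"
  by (simp_all add: lscale_def mult_ac)

lemma xmon_sg: "xmon v = sg v 1"
  by (simp add: xmon_def)

lemma pm_decomp:
  fixes f :: "'a \<Rightarrow>\<^sub>0 'b::comm_monoid_add"
  shows "f = (\<Sum>v\<in>keys f. sg v (lk f v))"
proof (rule poly_mapping_eqI)
  fix u
  have "(\<Sum>v\<in>keys f. lk (sg v (lk f v)) u) = (\<Sum>v\<in>keys f. if v = u then lk f v else 0)"
    by (rule sum.cong) (auto simp: lookup_single when_def)
  then show "lk f u = lk (\<Sum>v\<in>keys f. sg v (lk f v)) u"
    by (simp add: lookup_sum in_keys_iff)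
qed

lemma pm_induct [case_names zero sg add]:
  fixes f :: "'a \<Rightarrow>\<^sub>0 'b::comm_monoid_add"
  assumes "P 0" "\<And>v c. P (sg v c)" "\<And>f g. P f \<Longrightarrow> P g \<Longrightarrow> P (f + g)"
  shows "P f"
proof -
  have "P (\<Sum>v\<in>A. sg v (lk f v))" for A
    by (induction A rule: infinite_finite_induct) (use assms in auto)
  then show ?thesis by (subst pm_decomp)
qed

lemma keys_minus: "keys (f - g) \<subseteq> keys f \<union> keys (g :: 'a \<Rightarrow>\<^sub>0 'b::ab_group_add)"
  by (auto simp: in_keys_iff lookup_minus)

lemma keys_lscale: "keys (lscale c f) \<subseteq> keys f"
  by (auto simp: in_keys_iff)

lemma keys_sum: "keys (sum f A) \<subseteq> (\<Union>a\<in>A. keys (f a))"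
  by (induction A rule: infinite_finite_induct) (use keys_add in fastforce)+

text \<open>Evaluation is handled through the values of monomials, on which the affine structure acts.\<close>

definition mon :: "(nat \<Rightarrow> complex) \<Rightarrow> lattice_vec \<Rightarrow> complex" where
  "mon y v = (\<Prod>i\<in>keys v. y i powi lk v i)"

definition nzp :: "(nat \<Rightarrow> complex) \<Rightarrow> bool" where
  "nzp y \<longleftrightarrow> (\<forall>i. y i \<noteq> 0)"

lemma powi_prod: "(\<Prod>i\<in>A. f i :: complex) powi k = (\<Prod>i\<in>A. f i powi k)"
  by (induction A rule: infinite_finite_induct) (auto simp: power_int_mult_distrib)

lemma powi_sum: "z \<noteq> 0 \<Longrightarrow> (z :: complex) powi (\<Sum>i\<in>A. f i) = (\<Prod>i\<in>A. z powi f i)"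
  by (induction A rule: infinite_finite_induct) (auto simp: power_int_add)

lemma mon_superset: "finite S \<Longrightarrow> keys v \<subseteq> S \<Longrightarrow> mon y v = (\<Prod>i\<in>S. y i powi lk v i)"
  unfolding mon_def by (rule prod.mono_neutral_left) (auto simp: in_keys_iff)

lemma mon_zero [simp]: "mon y 0 = 1"
  by (simp add: mon_def)

lemma mon_eps [simp]: "mon y (eps i) = y i"
  by (simp add: mon_def eps_def)

lemma mon_nz [simp]: "nzp y \<Longrightarrow> mon y v \<noteq> 0"
  by (auto simp: mon_def nzp_def)

lemma mon_add: "nzp y \<Longrightarrow> mon y (u + v) = mon y u * mon y v"
proof -
  assume y: "nzp y"
  let ?S = "keys u \<union> keys v"
  have "mon y (u + v) = (\<Prod>i\<in>?S. y i powi lk (u + v) i)"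
    by (rule mon_superset) (use keys_add[of u v] in auto)
  moreover have "mon y u = (\<Prod>i\<in>?S. y i powi lk u i)" by (rule mon_superset) auto
  moreover have "mon y v = (\<Prod>i\<in>?S. y i powi lk v i)" by (rule mon_superset) auto
  ultimately show ?thesis using y by (simp add: lookup_add power_int_add nzp_def prod.distrib)
qed

lemma mon_uminus: "mon y (- v) = inverse (mon y v)"
proof -
  have "mon y (- v) = (\<Prod>i\<in>keys v. y i powi lk (- v) i)"
    by (rule mon_superset) (auto simp: in_keys_iff)
  then show ?thesis by (simp add: mon_def power_int_minus prod_inversef[unfolded comp_def])
qed

lemma mon_diff: "nzp y \<Longrightarrow> mon y (u - v) = mon y u / mon y v"
  using mon_add[of y u "- v"] by (simp add: mon_uminus divide_inverse)

lemma mon_cmul: "mon y (frag_cmul k v) = mon y v powi k"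
proof -
  have "mon y (frag_cmul k v) = (\<Prod>i\<in>keys v. y i powi lk (frag_cmul k v) i)"
    by (rule mon_superset) (auto dest: keys_cmul[THEN subsetD])
  then show ?thesis
    by (simp add: mon_def powi_prod mult.commute[of k] power_int_mult)
qed

text \<open>A homomorphism from the lattice to the nonzero complex numbers is determined by its values
  on the \<open>\<epsilon>\<^sub>i\<close>.\<close>

lemma lattice_hom_eq:
  fixes F G :: "lattice_vec \<Rightarrow> complex"
  assumes "\<And>u v. F (u - v) = F u / F v" "\<And>u v. G (u - v) = G u / G v"
    "F 0 = 1" "G 0 = 1" "\<And>i. F (eps i) = G (eps i)"
  shows "F v = G v"
proof (rule frag_induction[of v UNIV "\<lambda>v. F v = G v"])
  show "F (frag_of x) = G (frag_of x)" for x using assms(5)[of x] by (simp add: eps_def)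
qed (use assms(1-4) in auto)

abbreviation ev :: "laurent \<Rightarrow> (nat \<Rightarrow> complex) \<Rightarrow> complex" where "ev \<equiv> laurent_eval"

lemma ev_def: "ev f y = (\<Sum>v\<in>keys f. lk f v * mon y v)"
  by (simp add: laurent_eval_def mon_def)

lemma ev_add: "ev (f + g) y = ev f y + ev g y"
  unfolding ev_def by (rule setsum_keys_plus_distrib) (auto simp: algebra_simps)

lemma ev_zero [simp]: "ev 0 y = 0"
  by (simp add: ev_def)

lemma ev_sg [simp]: "ev (sg v c) y = c * mon y v"
  by (simp add: ev_def)

lemma ev_one [simp]: "ev 1 y = 1"
  using ev_sg[of 0 1 y] by simp

lemma ev_uminus: "ev (- f) y = - ev f y"
  using ev_add[of f "- f" y] by (simp add: eq_neg_iff_add_eq_0 add.commute)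

lemma ev_diff: "ev (f - g) y = ev f y - ev g y"
  using ev_add[of f "- g" y] by (simp add: ev_uminus)

lemma ev_mult: "nzp y \<Longrightarrow> ev (f * g) y = ev f y * ev g y"
proof (induction f rule: pm_induct)
  case (sg v c)
  then show ?case
    by (induction g rule: pm_induct) (auto simp: mult_single mon_add ev_add distrib_left)
qed (auto simp: ev_add distrib_right)

lemma ev_lscale: "ev (lscale c f) y = c * ev f y"
  by (induction f rule: pm_induct) (auto simp: lscale_add ev_add algebra_simps)

lemma ev_prod: "nzp y \<Longrightarrow> ev (prod f A) y = (\<Prod>a\<in>A. ev (f a) y)"
  by (induction A rule: infinite_finite_induct) (auto simp: ev_mult)

text \<open>Finitely many nonzero integral linear forms are nonzero at \<open>(1, B, B\<^sup>2, \<dots>)\<close> for a suitable \<open>B\<close>, because a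
  nonzero polynomial has finitely many roots.\<close>

lemma avoid_forms:
  fixes D :: "lattice_vec set"
  assumes "finite D" "0 \<notin> D"
  shows "\<exists>B::nat. B \<ge> 2 \<and> (\<forall>d\<in>D. (\<Sum>i\<in>keys d. lk d i * int B ^ i) \<noteq> 0)"
proof -
  have fin: "finite {z::real. (\<Sum>i\<le>N. c i * z ^ i) = 0}" if "c k \<noteq> 0" "k \<le> N" for N c and k :: nat
    using polyfun_finite_roots[of c N] that by auto
  have F: "finite {z::real. (\<Sum>i\<in>keys d. of_int (lk d i) * z ^ i) = 0}" if "d \<in> D" for d
  proof -
    define N where "N = Max (keys d)"
    have "d \<noteq> 0" using assms that by auto
    then obtain k where k: "k \<in> keys d" by (metis keys_eq_empty ex_in_conv)
    have "(\<Sum>i\<in>keys d. of_int (lk d i) * z ^ i) = (\<Sum>i\<le>N. of_int (lk d i) * z ^ i)" for z :: real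
      by (rule sum.mono_neutral_left) (auto simp: N_def in_keys_iff)
    then show ?thesis using fin[of "\<lambda>i. of_int (lk d i)" k N] k by (auto simp: N_def in_keys_iff)
  qed
  have "finite (\<Union>d\<in>D. {z::real. (\<Sum>i\<in>keys d. of_int (lk d i) * z ^ i) = 0})"
    using F assms by auto
  then have "finite (real -` (\<Union>d\<in>D. {z::real. (\<Sum>i\<in>keys d. of_int (lk d i) * z ^ i) = 0}))"
    by (rule finite_vimageI) (simp add: inj_on_def)
  then obtain B where B: "B \<notin> (real -` (\<Union>d\<in>D. {z::real. (\<Sum>i\<in>keys d. of_int (lk d i) * z ^ i) = 0})) \<union> {0, 1}"
    using ex_new_if_finite[OF infinite_UNIV_nat] by (meson finite.emptyI finite.insertI finite_UnI)
  show ?thesis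
  proof (intro exI[of _ B] conjI ballI notI)
    fix d assume d: "d \<in> D" "(\<Sum>i\<in>keys d. lk d i * int B ^ i) = 0"
    have "of_int (\<Sum>i\<in>keys d. lk d i * int B ^ i) = (\<Sum>i\<in>keys d. of_int (lk d i) * real B ^ i)" by simp
    then show False using B d by auto
  qed (use B in auto)
qed

text \<open>Along a suitable curve \<open>z \<mapsto> (z, z\<^bsup>B\<^esup>, z\<^bsup>B*B\<^esup>, \<dots>)\<close> the monomials of \<open>f\<close> become distinct powers of \<open>z\<close>, so
  \<open>f\<close> restricts to a nonzero Laurent polynomial in one variable.\<close>

lemma laurent_nonvanishing:
  fixes f :: laurent
  assumes "f \<noteq> 0" shows "\<exists>y. nzp y \<and> ev f y \<noteq> 0"
proof -
  define D where "D = {u - v |u v. u \<in> keys f \<and> v \<in> keys f \<and> u \<noteq> v}"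
  have "D \<subseteq> (\<lambda>(u, v). u - v) ` (keys f \<times> keys f)" unfolding D_def by auto
  then have fD: "finite D" by (rule finite_subset) simp
  have zD: "0 \<notin> D" by (auto simp: D_def)
  obtain B :: nat where B: "\<forall>d\<in>D. (\<Sum>i\<in>keys d. lk d i * int B ^ i) \<noteq> 0"
    using avoid_forms[OF fD zD] by (elim exE conjE)
  define e where "e v = (\<Sum>i\<in>keys v. lk v i * int B ^ i)" for v :: lattice_vec
  have e_sup: "e v = (\<Sum>i\<in>S. lk v i * int B ^ i)" if "finite S" "keys v \<subseteq> S" for v S
    unfolding e_def by (rule sum.mono_neutral_left) (use that in \<open>auto simp: in_keys_iff\<close>)
  have e_diff: "e (u - v) = e u - e v" for u v
    using e_sup[of "keys u \<union> keys v" "u - v"] e_sup[of "keys u \<union> keys v" u] e_sup[of "keys u \<union> keys v" v]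
      keys_minus[of u v] by (simp add: lookup_minus algebra_simps sum_subtractf)
  have inj: "e u \<noteq> e v" if "u \<in> keys f" "v \<in> keys f" "u \<noteq> v" for u v
  proof
    assume "e u = e v" then have "e (u - v) = 0" by (simp add: e_diff)
    moreover have "u - v \<in> D" using that by (auto simp: D_def)
    ultimately show False using B by (simp add: e_def)
  qed
  have ne: "keys f \<noteq> {}" using assms by simp
  define m where "m = Min (e ` keys f)"
  define N where "N = nat (Max (e ` keys f) - m)"
  define g where "g v = nat (e v - m)" for v
  have ge: "e v \<ge> m" "g v \<le> N" if "v \<in> keys f" for v
    using that by (auto simp: m_def g_def N_def intro!: nat_mono)
  have ginj: "inj_on g (keys f)"
  proof (rule inj_onI, rule ccontr)
    fix u v assume uv: "u \<in> keys f" "v \<in> keys f" "g u = g v" "u \<noteq> v"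
    then have "e u = e v" using ge(1)[OF uv(1)] ge(1)[OF uv(2)] by (simp add: g_def)
    then show False using inj uv by blast
  qed
  define c where "c k = (\<Sum>v\<in>{v \<in> keys f. g v = k}. lk f v)" for k
  have cg: "c (g v) = lk f v" if "v \<in> keys f" for v
  proof -
    have "{u \<in> keys f. g u = g v} = {v}" using ginj that by (auto dest: inj_onD)
    then show ?thesis by (simp add: c_def)
  qed
  obtain v0 where v0: "v0 \<in> keys f" using ne by (meson ex_in_conv)
  have "c (g v0) \<noteq> 0" "g v0 \<le> N" using cg ge v0 by (auto simp: in_keys_iff)
  then have "finite {z. (\<Sum>k\<le>N. c k * z ^ k) = 0}" using polyfun_finite_roots[of c N] by auto
  then obtain z where "z \<notin> {z. (\<Sum>k\<le>N. c k * z ^ k) = 0} \<union> {0}"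
    using ex_new_if_finite[OF infinite_UNIV_char_0] by (meson finite.emptyI finite.insertI finite_UnI)
  then have z: "(\<Sum>k\<le>N. c k * z ^ k) \<noteq> 0" "z \<noteq> 0" by auto
  define y where "y i = z ^ (B ^ i)" for i
  have y: "nzp y" using z by (simp add: nzp_def y_def)
  have mon: "mon y v = z powi e v" for v
  proof -
    have "mon y v = (\<Prod>i\<in>keys v. z powi (lk v i * int B ^ i))"
      unfolding mon_def by (rule prod.cong) (simp_all add: y_def power_int_power mult.commute)
    also have "\<dots> = z powi e v"
      unfolding e_def using z by (simp add: powi_sum)
    finally show ?thesis .
  qed
  have "ev f y = (\<Sum>v\<in>keys f. lk f v * (z powi m * z ^ g v))"
    unfolding ev_def
  proof (rule sum.cong)
    fix v assume "v \<in> keys f"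
    then have "e v = m + int (g v)" using ge by (simp add: g_def)
    then show "lk f v * mon y v = lk f v * (z powi m * z ^ g v)"
      using z by (simp add: mon power_int_add)
  qed simp
  also have "\<dots> = z powi m * (\<Sum>v\<in>keys f. lk f v * z ^ g v)"
    by (simp add: sum_distrib_left mult_ac)
  also have "(\<Sum>v\<in>keys f. lk f v * z ^ g v) = (\<Sum>k\<le>N. \<Sum>v\<in>{v \<in> keys f. g v = k}. lk f v * z ^ g v)"
    by (rule sum.group[symmetric]) (use ge in auto)
  also have "\<dots> = (\<Sum>k\<le>N. c k * z ^ k)"
    by (rule sum.cong) (auto simp: c_def sum_distrib_right intro!: sum.cong)
  finally show ?thesis using z y by (intro exI[of _ y]) auto
qed

text \<open>The exceptional points, where denominators vanish, lie on finitely many proper subvarieties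
  \<open>c x\<^sup>v = 1\<close>; multiplying the difference \<open>f - g\<close> by the product of all \<open>1 - c x\<^sup>v\<close> makes it vanish there too.\<close>

lemma laurent_eq_by_values:
  fixes f g :: laurent
  assumes C: "finite C" "\<And>c v. (c, v) \<in> C \<Longrightarrow> v \<noteq> 0"
    and eq: "\<And>y. nzp y \<Longrightarrow> (\<And>c v. (c, v) \<in> C \<Longrightarrow> c * mon y v \<noteq> 1) \<Longrightarrow> ev f y = ev g y"
  shows "f = g"
proof (rule ccontr)
  assume "f \<noteq> g"
  define h where "h = (\<Prod>(c, v)\<in>C. 1 - sg v c)"
  have "1 - sg v c \<noteq> 0" if "(c, v) \<in> C" for c v
  proof
    assume "1 - sg v c = 0"
    then have "lk (1 - sg v c) 0 = 0" by simp
    then show False using C(2)[OF that] by (simp add: lookup_minus lookup_single when_def)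
  qed
  then have "h \<noteq> 0" using C(1) by (auto simp: h_def)
  then have "(f - g) * h \<noteq> 0" using \<open>f \<noteq> g\<close> by simp
  then obtain y where y: "nzp y" "ev ((f - g) * h) y \<noteq> 0" using laurent_nonvanishing by blast
  then have "ev f y \<noteq> ev g y" "ev h y \<noteq> 0" by (auto simp: ev_mult ev_diff)
  moreover have "ev h y = (\<Prod>(c, v)\<in>C. 1 - c * mon y v)"
    using y(1) by (simp add: h_def ev_prod ev_diff case_prod_unfold)
  ultimately have "\<forall>(c, v)\<in>C. 1 - c * mon y v \<noteq> 0" using C(1) by (auto simp: prod_zero_iff)
  then show False using eq[OF y(1)] \<open>ev f y \<noteq> ev g y\<close> by fastforce
qed

context rank
begin

lemma mid_not_long: "v \<in> mid_roots n \<Longrightarrow> v \<notin> long_roots n"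
proof
  assume "v \<in> mid_roots n" "v \<in> long_roots n"
  then have "\<bar>\<Sum>i=1..n. lk v i * lk v i\<bar> = 2" "\<bar>\<Sum>i=1..n. lk v i * lk v i\<bar> = 4"
  proof -
    have L: "v \<in> Lam n" if "v \<in> long_roots n"
      using that by (auto simp: long_roots_def long_pos_def intro!: Lam_eps Lam_uminus Lam_cmul simp del: minus_frag_cmul)
    have "ip v v = 4" if "v \<in> long_roots n"
      using that by (auto simp: long_roots_def long_pos_def)
    moreover have "ip v v = 2" if "v \<in> mid_roots n"
      using that by (auto simp: mid_roots_def mid_pos_def lookup_add lookup_minus)
    ultimately show "\<bar>\<Sum>i=1..n. lk v i * lk v i\<bar> = 2" "\<bar>\<Sum>i=1..n. lk v i * lk v i\<bar> = 4"
      using \<open>v \<in> mid_roots n\<close> \<open>v \<in> long_roots n\<close> ip_Lam[OF L, of v] by auto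
  qed
  then show False by simp
qed

lemma simple_mid: "1 \<le> i \<Longrightarrow> i < n \<Longrightarrow> fst (a i) \<in> mid_roots n"
  unfolding mid_roots_def mid_pos_def
  by (intro UnI1 UnI2 CollectI exI[of _ i] exI[of _ "Suc i"]) (simp add: simple_root_def)

lemma simple_long: "fst (a 0) \<in> long_roots n" "fst (a n) \<in> long_roots n"
  using n2 by (force simp: long_roots_def long_pos_def simple_root_def)+

end

section \<open>The action on Laurent polynomials\<close>

locale params = rank +
  fixes p :: kparams
  assumes nz: "nonzero_params p"
begin

abbreviation "q \<equiv> qpar p"
abbreviation "t \<equiv> t_simple p n"
abbreviation "X \<equiv> xaff p"
abbreviation "T \<equiv> T_op p n"

lemma nzs [simp]: "qhalf p \<noteq> 0" "t0 p \<noteq> 0" "tmid p \<noteq> 0" "tn p \<noteq> 0" "t0v p \<noteq> 0" "tnv p \<noteq> 0" "q \<noteq> 0"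
  using nz by (auto simp: nonzero_params_def qpar_def)

lemma t_nz [simp]: "t i \<noteq> 0"
  by (simp add: t_simple_def)

lemma X_sg: "X f = sg (fst f) (q powi snd f)"
  by (simp add: xaff_def xmon_sg)

lemma X_zero [simp]: "X (v, 0) = xmon v"
  by (simp add: X_sg xmon_sg)

lemma X_level: "X (v, m) = lscale (q powi m) (xmon v)"
  by (simp add: X_sg xmon_sg)

lemma X_add: "X (f + g) = X f * X g"
  by (simp add: X_sg mult_single power_int_add)

lemma act_add: "act p w (f + g) = act p w f + act p w g"
  unfolding act_def by (rule setsum_keys_plus_distrib) (auto simp: lscale_add_left)

lemma act_sg: "act p w (sg v c) = lscale c (X (w (v, 0)))"
  by (simp add: act_def)

lemma act_zero [simp]: "act p w 0 = 0"
  by (simp add: act_def)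

lemma act_uminus: "act p w (- f) = - act p w f"
  using act_add[of w f "- f"] by (simp add: eq_neg_iff_add_eq_0 add.commute)

lemma act_diff: "act p w (f - g) = act p w f - act p w g"
  using act_add[of w f "- g"] by (simp add: act_uminus)

lemma act_lscale: "act p w (lscale c f) = lscale c (act p w f)"
  by (induction f rule: pm_induct) (auto simp: act_sg act_add lscale_add)

lemma act_X: "w \<in> affW \<Longrightarrow> act p w (X f) = X (w f)"
proof -
  assume w: "w \<in> affW"
  obtain v m where f: "f = (v, m)" by (cases f)
  show ?thesis unfolding f affW_level[OF w, of v m] X_level[of v m] act_lscale
    by (simp add: xmon_sg act_sg X_sg power_int_add)
qed

lemma act_comp: "w \<in> affW \<Longrightarrow> w' \<in> affW \<Longrightarrow> act p (w \<circ> w') f = act p w (act p w' f)"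
  by (induction f rule: pm_induct) (auto simp: act_sg act_add act_lscale act_X)

text \<open>The action of a simple reflection on points, dual to its action on monomials.\<close>

definition pt :: "nat \<Rightarrow> (nat \<Rightarrow> complex) \<Rightarrow> nat \<Rightarrow> complex" where
  "pt i y = (if i = 0 then y(1 := q / y 1) else if i < n then y(i := y (Suc i), Suc i := y i)
     else y(n := 1 / y n))"

lemma pt_nzp [simp]: "nzp y \<Longrightarrow> nzp (pt i y)"
  by (auto simp: nzp_def pt_def)

lemma ev_X: "ev (X f) y = q powi snd f * mon y (fst f)"
  by (simp add: X_sg)

lemma ev_act:
  assumes "i \<le> n" "nzp y" shows "ev (act p (s i) f) y = ev f (pt i y)"
proof (induction f rule: pm_induct)
  case (sg v c)
  have "ev (X (s i (v, 0))) y = mon (pt i y) v"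
  proof (rule lattice_hom_eq)
    fix u v
    have "s i (u - v, 0) = s i (u, 0) - s i (v, 0)"
      using affW_diff[of "s i" "(u, 0)" "(v, 0)"] assms(1) by simp
    then show "ev (X (s i (u - v, 0))) y = ev (X (s i (u, 0))) y / ev (X (s i (v, 0))) y"
      using assms by (simp add: ev_X mon_diff power_int_diff)
    show "mon (pt i y) (u - v) = mon (pt i y) u / mon (pt i y) v"
      using assms by (simp add: mon_diff)
  next
    fix j
    have "y 1 \<noteq> 0" "y n \<noteq> 0" using assms(2) by (auto simp: nzp_def)
    moreover have "fst (s i (eps j, 0)) =
       (if i = 0 then (if j = 1 then - eps 1 else eps j)
        else if i < n then (if j = i then eps (Suc i) else if j = Suc i then eps i else eps j)
        else if j = n then - eps n else eps j)"
      "snd (s i (eps j, 0)) = (if i = 0 \<and> j = 1 then 1 else 0)"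
      using assms(1) n2 by (auto simp: s_def simple_root_def cpair_def poly_mapping_eq_iff fun_eq_iff lookup_minus)
    ultimately show "ev (X (s i (eps j, 0))) y = mon (pt i y) (eps j)"
      using assms n2 by (auto simp: ev_X pt_def mon_uminus divide_inverse)
  qed (use assms affW_zero[of "s i"] in \<open>auto simp: ev_X zero_prod_def xmon_sg\<close>)
  then show ?case by (simp add: act_sg ev_lscale)
qed (auto simp: act_add ev_add)

section \<open>The operators \<open>T\<^sub>i\<close>\<close>

text \<open>For \<open>i = 0\<close> and \<open>i = n\<close> the numerator of \<open>v\<close> has a middle term, with the coefficient
  \<open>cmid i\<close> and the monomial \<open>half i\<close>.\<close>

definition half :: "nat \<Rightarrow> laurent" where
  "half i = (if i = 0 then sg (- eps 1) (qhalf p) else if i < n then 0 else sg (eps n) 1)"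

definition cmid :: "nat \<Rightarrow> complex" where
  "cmid i = (if i = 0 then t0 p / t0v p - t0 p * t0v p else if i < n then 0 else tn p / tnv p - tn p * tnv p)"

lemma v_num_simple:
  assumes "i \<le> n"
  shows "v_num p n (a i) = 1 + lscale (cmid i) (half i) - lscale ((t i)\<^sup>2) (X (a i))"
proof -
  have e2: "eps j + eps j = frag_cmul 2 (eps j)" "- eps j - eps j = frag_cmul (- 2) (eps j)" for j
    using frag_cmul_distrib[of 1 1 "eps j"] frag_cmul_distrib[of "- 1" "- 1" "eps j"] by simp_all
  have hs: "half i * half i = X (a i)" if "i = 0 \<or> i = n"
    using that n2 e2 by (auto simp: half_def mult_single X_sg simple_root_def qpar_def power2_eq_square)
  have prod: "(1 - lscale (b * c) h) * (1 + lscale (b * inverse c) h) =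
      1 + lscale (b / c - b * c) h - lscale (b\<^sup>2) (h * h)" if "c \<noteq> 0" for b c h
    using that by (simp add: algebra_simps lscale_mult lscale_diff_left power2_eq_square divide_inverse)
  consider "i = 0" | "1 \<le> i" "i < n" | "i = n" using assms by linarith
  then show ?thesis
  proof cases
    case 1
    have "Poly_Mapping.map (\<lambda>k. k div 2) (frag_cmul (- 2) (eps 1)) = - eps 1"
      by (rule poly_mapping_eqI) (simp add: map.rep_eq when_def)
    then have "xaff_half p (a 0) = half 0"
      by (simp add: xaff_half_def simple_root_def half_def xmon_sg)
    then show ?thesis using 1 simple_long hs n2
      by (simp add: v_num_def prod t_root_def t_half_root_def cmid_def t_simple_def)
         (simp add: simple_root_def)
  next
    case 2
    then show ?thesis using simple_mid[of i] mid_not_long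
      by (simp add: v_num_def t_root_def cmid_def t_simple_def)
  next
    case 3
    have "Poly_Mapping.map (\<lambda>k. k div 2) (frag_cmul 2 (eps n)) = eps n"
      by (rule poly_mapping_eqI) (simp add: map.rep_eq when_def)
    then have "xaff_half p (a n) = half n" using n2
      by (simp add: xaff_half_def simple_root_def half_def xmon_sg)
    then show ?thesis using 3 simple_long hs n2
      by (simp add: v_num_def prod t_root_def t_half_root_def cmid_def t_simple_def)
         (simp add: simple_root_def)
  qed
qed

lemma v_den_simple: "v_den p (a i) = 1 - X (a i)"
  by (simp add: v_den_def)

lemma v_den_nz: "i \<le> n \<Longrightarrow> v_den p (a i) \<noteq> 0"
proof
  assume i: "i \<le> n" and "v_den p (a i) = 0"
  then have "lk (v_den p (a i)) 0 = 0" by simp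
  moreover have "fst (a i) \<noteq> 0" using ip_simple_pos[OF i] by auto
  ultimately show False by (simp add: v_den_simple lookup_minus X_sg lookup_single when_def)
qed

text \<open>The divided difference of a monomial is a geometric sum along its root string.\<close>

definition gsum :: "affine_vec \<Rightarrow> nat \<Rightarrow> nat \<Rightarrow> laurent" where
  "gsum f i k = (\<Sum>j<k. X (f + iscale (int j) (a i)))"

lemma gsum_tele: "(1 - X (a i)) * gsum f i k = X f - X (f + iscale (int k) (a i))"
proof (induction k)
  case (Suc k)
  have "X (a i) * X (f + iscale (int k) (a i)) = X (f + iscale (int (Suc k)) (a i))"
    by (simp add: iscale_add add_ac flip: X_add)
  then have "(1 - X (a i)) * X (f + iscale (int k) (a i))
      = X (f + iscale (int k) (a i)) - X (f + iscale (int (Suc k)) (a i))"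
    by (simp only: left_diff_distrib mult_1_left)
  moreover have "gsum f i (Suc k) = gsum f i k + X (f + iscale (int k) (a i))"
    by (simp add: gsum_def)
  ultimately show ?case using Suc by (simp only: distrib_left) simp
qed (simp add: gsum_def)

definition ddiff :: "nat \<Rightarrow> lattice_vec \<Rightarrow> laurent" where
  "ddiff i v = (if cp i v \<ge> 0 then gsum (s i (v, 0)) i (nat (cp i v))
     else - gsum (v, 0) i (nat (- cp i v)))"

lemma ddiff: 
  assumes "i \<le> n" shows "v_den p (a i) * ddiff i v = X (s i (v, 0)) - xmon v"
proof (cases "cp i v \<ge> 0")
  case True
  then show ?thesis using assms gsum_tele[of i "s i (v, 0)" "nat (cp i v)"]
    by (simp add: ddiff_def v_den_simple s_def)
next
  case False
  have "s i (v, 0) = (v, 0) + iscale (int (nat (- cp i v))) (a i)"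
    using False assms by (simp add: s_def iscale_uminus)
  then show ?thesis using False gsum_tele[of i "(v, 0)" "nat (- cp i v)"]
    by (simp add: ddiff_def v_den_simple)
qed

lemma T_exists:
  assumes "i \<le> n" shows "\<exists>g. v_den p (a i) * g = act p (s i) f - f"
proof (induction f rule: pm_induct)
  case zero then show ?case by (intro exI[of _ 0]) simp
next
  case (sg v c)
  have "v_den p (a i) * lscale c (ddiff i v) = act p (s i) (sg v c) - sg v c"
    using ddiff[OF assms, of v] by (simp add: lscale_mult act_sg lscale_diff xmon_sg)
  then show ?case by blast
next
  case (add f g)
  then obtain h h' where "v_den p (a i) * h = act p (s i) f - f" "v_den p (a i) * h' = act p (s i) g - g" by blast
  then have "v_den p (a i) * (h + h') = act p (s i) (f + g) - (f + g)" by (simp add: distrib_left act_add)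
  then show ?case by blast
qed

text \<open>The quotient in the definition of \<open>T\<^sub>i\<close> is unique, so exhibiting any solution \<open>g\<close> computes \<open>T\<^sub>i\<close>.\<close>

lemma T_char:
  assumes "i \<le> n" "v_den p (a i) * g = v_num p n (a i) * (act p (s i) f - f)"
  shows "T i f = lscale (t i) f + lscale (inverse (t i)) g"
proof -
  have "(THE g. v_den p (a i) * g = v_num p n (a i) * (act p (s i) f - f)) = g"
    using assms v_den_nz[OF assms(1)] by (intro the_equality) (auto simp flip: assms(2))
  then show ?thesis by (simp add: T_op_def)
qed

lemma T_ex:
  assumes "i \<le> n"
  obtains g where "v_den p (a i) * g = v_num p n (a i) * (act p (s i) f - f)"
    "T i f = lscale (t i) f + lscale (inverse (t i)) g"
proof -
  obtain h where h: "v_den p (a i) * h = act p (s i) f - f" using T_exists[OF assms] by blast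
  have "v_den p (a i) * (v_num p n (a i) * h) = v_num p n (a i) * (act p (s i) f - f)"
    by (simp add: mult.left_commute[of "v_den p (a i)"] h)
  from that[OF this T_char[OF assms this]] show thesis .
qed

lemma T_add: 
  assumes "i \<le> n" shows "T i (f + g) = T i f + T i g"
proof -
  obtain h h' where h: "v_den p (a i) * h = v_num p n (a i) * (act p (s i) f - f)"
    "T i f = lscale (t i) f + lscale (inverse (t i)) h"
    "v_den p (a i) * h' = v_num p n (a i) * (act p (s i) g - g)"
    "T i g = lscale (t i) g + lscale (inverse (t i)) h'"
    using T_ex[OF assms] by metis
  have "v_den p (a i) * (h + h') = v_num p n (a i) * (act p (s i) (f + g) - (f + g))"
    by (simp only: distrib_left h(1) h(3) act_add) (simp add: algebra_simps)
  from T_char[OF assms this] show ?thesis using h by (simp add: lscale_add algebra_simps)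
qed

lemma T_lscale: 
  assumes "i \<le> n" shows "T i (lscale c f) = lscale c (T i f)"
proof -
  obtain h where h: "v_den p (a i) * h = v_num p n (a i) * (act p (s i) f - f)"
    "T i f = lscale (t i) f + lscale (inverse (t i)) h"
    using T_ex[OF assms] by metis
  have "v_den p (a i) * lscale c h = v_num p n (a i) * (act p (s i) (lscale c f) - lscale c f)"
    using h by (simp add: act_lscale lscale_mult flip: lscale_diff)
  from T_char[OF assms this] show ?thesis using h by (simp add: lscale_add mult.commute)
qed

lemma T_zero [simp]: "i \<le> n \<Longrightarrow> T i 0 = 0"
  using T_lscale[of i 0 0] by simp

lemma T_uminus: "i \<le> n \<Longrightarrow> T i (- f) = - T i f"
  using T_add[of i f "- f"] by (simp add: eq_neg_iff_add_eq_0 add.commute)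

lemma T_diff: "i \<le> n \<Longrightarrow> T i (f - g) = T i f - T i g"
  using T_add[of i f "- g"] by (simp add: T_uminus)

lemma T_sum: "i \<le> n \<Longrightarrow> T i (sum f A) = (\<Sum>x\<in>A. T i (f x))"
  by (induction A rule: infinite_finite_induct) (auto simp: T_add)

text \<open>The lattice points strictly inside the segment from \<open>v\<close> to its reflection. The equation is doubled because
  the middle term of the numerator of \<open>v\<close> shifts exponents by half a root.\<close>

definition between :: "nat \<Rightarrow> lattice_vec \<Rightarrow> lattice_vec \<Rightarrow> bool" where
  "between i v u \<longleftrightarrow> (\<exists>j. 0 < j \<and> j < 2 * \<bar>cp i v\<bar> \<and>
     frag_cmul 2 u = frag_cmul 2 v - frag_cmul (sgn (cp i v) * j) (fst (a i)))"

lemma keys_X: "keys (X f) = {fst f}"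
  by (simp add: X_sg)

lemma keys_half_X: "keys (half i * X f) \<subseteq> {u. frag_cmul 2 u = frag_cmul 2 (fst f) + fst (a i)}"
proof -
  have "frag_cmul 2 (fst f - eps (Suc 0)) = frag_cmul 2 (fst f) + fst (a 0)"
    "frag_cmul 2 (eps n + fst f) = frag_cmul 2 (fst f) + fst (a n)"
    using n2 by (simp_all add: simple_root_def poly_mapping_eq_iff fun_eq_iff lookup_minus lookup_add)
  then show ?thesis using n2
    by (cases "i < n") (auto simp: half_def X_sg mult_single simple_root_def split: if_splits)
qed

text \<open>The quotient defining \<open>T\<^sub>i x\<^sup>v\<close> is a geometric sum along the segment from \<open>v\<close> to \<open>s\<^sub>i v\<close>, multiplied by a
  polynomial of degree two in \<open>x\<^bsup>a/2\<^esup>\<close>, \<open>a = a\<^sub>i\<close>. Only the extreme terms of the product reach the end points.\<close>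

lemma T_xmon:
  assumes "1 \<le> n" "i \<le> n"
  shows "\<exists>r. keys r \<subseteq> {u. between i v u} \<and> T i (xmon v) =
     (if cp i v = 0 then lscale (t i) (xmon v)
      else if cp i v > 0 then lscale (inverse (t i)) (X (s i (v, 0)))
      else lscale (t i) (X (s i (v, 0))) + lscale (t i - inverse (t i)) (xmon v)) + r"
proof -
  define m where "m = cp i v"
  have i: "i \<le> n" by fact
  have Tx: "T i (xmon v) = lscale (t i) (xmon v) + lscale (inverse (t i)) (v_num p n (a i) * ddiff i v)"
  proof (rule T_char[OF i])
    have "v_den p (a i) * (v_num p n (a i) * ddiff i v) = v_num p n (a i) * (v_den p (a i) * ddiff i v)"
      by (simp only: mult.left_commute)
    then show "v_den p (a i) * (v_num p n (a i) * ddiff i v) = v_num p n (a i) * (act p (s i) (xmon v) - xmon v)"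
      unfolding ddiff[OF i] by (simp add: xmon_sg act_sg)
  qed
  define S where "S f k = (\<Sum>j\<in>{1..<k}. X (f + iscale (int j) (a i)))" for f and k :: nat
  define H where "H f k = half i * gsum f i k" for f and k
  have N: "v_num p n (a i) * gsum f i k =
     X f + S f k - lscale ((t i)\<^sup>2) (S f k + X (f + iscale (int k) (a i))) + lscale (cmid i) (H f k)"
    if "k > 0" for f k
  proof -
    have g: "gsum f i k = X f + S f k"
    proof -
      have "{..<k} = insert 0 {1..<k}" using that by auto
      then show ?thesis by (simp add: gsum_def S_def)
    qed
    have "X (a i) * gsum f i k = gsum f i k - (X f - X (f + iscale (int k) (a i)))"
      using gsum_tele[of i f k] by (simp add: algebra_simps)
    then have "X (a i) * gsum f i k = S f k + X (f + iscale (int k) (a i))" using g by simp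
    then have "v_num p n (a i) * gsum f i k = gsum f i k + lscale (cmid i) (H f k)
        - lscale ((t i)\<^sup>2) (S f k + X (f + iscale (int k) (a i)))"
      unfolding v_num_simple[OF i] by (simp add: algebra_simps lscale_mult H_def)
    then show ?thesis using g by (simp add: algebra_simps)
  qed
  have keysS: "keys (S f k) \<subseteq> {u. \<exists>j. 0 < j \<and> j < int k \<and> u = fst f + frag_cmul j (fst (a i))}" for f k
  proof -
    have "keys (S f k) \<subseteq> (\<Union>j\<in>{1..<k}. keys (X (f + iscale (int j) (a i))))"
      unfolding S_def by (rule keys_sum)
    moreover have "\<exists>j'>0. j' < int k \<and> u = fst f + frag_cmul j' (fst (a i))"
      if "j \<in> {1..<k}" "u \<in> keys (X (f + iscale (int j) (a i)))" for j u
      using that by (intro exI[of _ "int j"]) (auto simp: keys_X)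
    ultimately show ?thesis by blast
  qed
  have keysH: "keys (H f k) \<subseteq> {u. \<exists>j. 0 \<le> j \<and> j < int k \<and>
      frag_cmul 2 u = frag_cmul 2 (fst f + frag_cmul j (fst (a i))) + fst (a i)}" for f k
  proof -
    have "keys (H f k) \<subseteq> (\<Union>j\<in>{..<k}. keys (half i * X (f + iscale (int j) (a i))))"
      unfolding H_def gsum_def sum_distrib_left by (rule keys_sum)
    moreover have "\<exists>j'\<ge>0. j' < int k \<and> frag_cmul 2 u = frag_cmul 2 (fst f + frag_cmul j' (fst (a i))) + fst (a i)"
      if "j \<in> {..<k}" "u \<in> keys (half i * X (f + iscale (int j) (a i)))" for j u
      using that keys_half_X[of i "f + iscale (int j) (a i)"] by (intro exI[of _ "int j"]) auto
    ultimately show ?thesis by blast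
  qed
  show ?thesis
  proof (cases "m = 0")
    case True
    then have "ddiff i v = 0" by (simp add: ddiff_def gsum_def m_def)
    then show ?thesis using True Tx by (intro exI[of _ 0]) (simp add: m_def)
  next
    case False
    define k where "k = nat \<bar>m\<bar>"
    define f where "f = (if m > 0 then s i (v, 0) else (v, 0))"
    define sg where "sg = (if m > 0 then 1 else - 1 :: complex)"
    define r where "r = lscale (sg * (inverse (t i) - t i)) (S f k) + lscale (sg * inverse (t i) * cmid i) (H f k)"
    have k: "k > 0" using False by (simp add: k_def)
    have ti: "inverse (t i) * (t i)\<^sup>2 = t i" by (simp add: power2_eq_square)
    have "T i (xmon v) = (if m > 0 then lscale (inverse (t i)) (X (s i (v, 0)))
      else lscale (t i) (X (s i (v, 0))) + lscale (t i - inverse (t i)) (xmon v)) + r"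
    proof (cases "m > 0")
      case True
      have d: "ddiff i v = gsum f i k" using True by (simp add: ddiff_def f_def k_def m_def)
      have e: "f + iscale (int k) (a i) = (v, 0)" using True i by (simp add: f_def k_def s_def m_def)
      have fs: "s i (v, 0) = f" using True by (simp add: f_def)
      show ?thesis using True unfolding Tx d N[OF k] e fs
        by (simp add: lscale_add lscale_diff ti r_def lscale_diff_left sg_def algebra_simps)
    next
      case m: False
      have d: "ddiff i v = - gsum f i k" using m False by (simp add: ddiff_def f_def k_def m_def)
      have e: "f + iscale (int k) (a i) = s i (v, 0)"
        using m False i by (simp add: f_def k_def s_def m_def iscale_uminus)
      have fv: "X f = xmon v" using m by (simp add: f_def)
      show ?thesis using m unfolding Tx d mult_minus_right N[OF k] e fv
        by (simp add: lscale_add lscale_diff lscale_uminus ti r_def lscale_diff_left sg_def algebra_simps)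
    qed
    moreover have "keys r \<subseteq> {u. between i v u}"
    proof -
      have A: "between i v u" if "j > 0" "j < 2 * int k" "frag_cmul 2 u = frag_cmul 2 (fst f) + frag_cmul j (fst (a i))" for j u
      proof (cases "m > 0")
        case True
        have "frag_cmul 2 u = frag_cmul 2 v - frag_cmul (sgn (cp i v) * (2 * int k - j)) (fst (a i))"
          unfolding that(3) using True i
          by (simp add: f_def fst_s m_def k_def poly_mapping_eq_iff fun_eq_iff lookup_minus lookup_add algebra_simps)
        then show ?thesis unfolding between_def using that True
          by (intro exI[of _ "2 * int k - j"]) (auto simp: k_def m_def)
      next
        case F: False
        have "frag_cmul 2 u = frag_cmul 2 v - frag_cmul (sgn (cp i v) * j) (fst (a i))"
          unfolding that(3) using F False by (simp add: f_def m_def)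
        then show ?thesis unfolding between_def using that F False
          by (intro exI[of _ j]) (auto simp: k_def m_def)
      qed
      have B: "keys (S f k) \<subseteq> {u. between i v u}"
      proof
        fix u assume "u \<in> keys (S f k)"
        then obtain j where "0 < j" "j < int k" "u = fst f + frag_cmul j (fst (a i))" using keysS by blast
        then show "u \<in> {u. between i v u}" using A[of "2 * j" u] by (simp add: frag_cmul_distrib2)
      qed
      have C: "keys (H f k) \<subseteq> {u. between i v u}"
      proof
        fix u assume "u \<in> keys (H f k)"
        then obtain j where "0 \<le> j" "j < int k" "frag_cmul 2 u = frag_cmul 2 (fst f + frag_cmul j (fst (a i))) + fst (a i)"
          using keysH by blast
        then show "u \<in> {u. between i v u}" using A[of "2 * j + 1" u]
          by (simp add: frag_cmul_distrib2 frag_cmul_distrib algebra_simps)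
      qed
      have "keys r \<subseteq> keys (S f k) \<union> keys (H f k)"
        unfolding r_def by (rule order_trans[OF keys_add]) (intro Un_mono keys_lscale)
      then show ?thesis using B C by blast
    qed
    ultimately show ?thesis using False by (intro exI[of _ r]) (simp add: m_def)
  qed
qed

end

section \<open>Hecke relations\<close>

lemma kap_inv: "x \<noteq> 0 \<Longrightarrow> x \<noteq> 1 \<Longrightarrow> T / (1 - 1 / x) = T - T / (1 - x :: complex)"
  by (simp add: divide_simps) (simp add: algebra_simps)

lemma lam_inv: "z \<noteq> 0 \<Longrightarrow> z\<^sup>2 \<noteq> 1 \<Longrightarrow> (S + R * (1 / z)) / (1 - (1 / z)\<^sup>2) = S - (S + R * z) / (1 - z\<^sup>2 :: complex)"
  by (simp add: divide_simps power2_eq_square) (simp add: algebra_simps)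

text \<open>The braid relations hold pointwise. After clearing denominators they follow from one
  relation between the coefficients at the positive roots of the rank two system:
  for the roots \<open>\<alpha>, \<beta>, \<alpha> + \<beta>\<close> of type \<open>A\<^sub>2\<close> it is the first assumption below, for type
  \<open>C\<^sub>2\<close> the assumption of the lemma after it. The variables \<open>f\<^sub>k\<close> are the values of a function at
  the points of an orbit.\<close>

lemma braid3_coeffs:
  fixes A B C T t :: complex
  assumes "A * B = C * (A + B - T)"
  shows "A * (B * (A * f0 + (t - A) * f1) + (t - B) * (C * f2 + (t - C) * f3))
     + (t - A) * (C * ((T - A) * f1 + (t - (T - A)) * f0) + (t - C) * (B * f4 + (t - B) * f5))
   = B * (A * (B * f0 + (t - B) * f2) + (t - A) * (C * f1 + (t - C) * f4))
     + (t - B) * (C * ((T - B) * f2 + (t - (T - B)) * f0) + (t - C) * (A * f3 + (t - A) * f5))"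
  using assms by algebra

lemma braid4_coeffs:
  fixes A B C D S T t s :: complex
  assumes "A * C + B * C - C * T = A * D + B * S - B * D"
  shows "(A * (D * (A * (D * f0 + (s - D) * f1) + (t - A) * (C * f2 + (s - C) * f3)) + (s - D) * (B * ((S - D) * f1 + (s - (S - D)) * f0) + (t - B) * (C * f4 + (s - C) * f5))) + (t - A) * (C * ((T - A) * (C * f2 + (s - C) * f3) + (t - (T - A)) * (D * f0 + (s - D) * f1)) + (s - C) * (B * ((S - C) * f3 + (s - (S - C)) * f2) + (t - B) * (D * f6 + (s - D) * f7))))
   = (D * (A * (D * (A * f0 + (t - A) * f2) + (s - D) * (B * f1 + (t - B) * f4)) + (t - A) * (C * ((T - A) * f2 + (t - (T - A)) * f0) + (s - C) * (B * f3 + (t - B) * f6))) + (s - D) * (B * ((S - D) * (B * f1 + (t - B) * f4) + (s - (S - D)) * (A * f0 + (t - A) * f2)) + (t - B) * (C * ((T - B) * f4 + (t - (T - B)) * f1) + (s - C) * (A * f5 + (t - A) * f7))))"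
  using assms by algebra

lemma braid4_rel:
  fixes u v T S R :: complex
  assumes "u \<noteq> 0" "v \<noteq> 0" "u \<noteq> v" "u * v \<noteq> 1" "u\<^sup>2 \<noteq> 1" "v\<^sup>2 \<noteq> 1"
  defines "A \<equiv> T / (1 - u / v)" and "B \<equiv> T / (1 - u * v)"
    and "C \<equiv> (S + R * u) / (1 - u\<^sup>2)" and "D \<equiv> (S + R * v) / (1 - v\<^sup>2)"
  shows "A * C + B * C - C * T = A * D + B * S - B * D"
proof -
  have nz: "1 - u / v \<noteq> 0" "1 - u * v \<noteq> 0" "1 - u\<^sup>2 \<noteq> 0" "1 - v\<^sup>2 \<noteq> 0" "v - u \<noteq> 0" using assms by auto
  have A: "A = T * v / (v - u)" using nz assms(2) by (simp add: A_def field_simps)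
  have "A * C + B * C - C * T - (A * D + B * S - B * D) = 0"
    unfolding A B_def C_def D_def using nz
    by (simp add: divide_simps) (simp add: algebra_simps power2_eq_square)
  then show ?thesis by simp
qed

lemma braid4_points:
  fixes P :: "complex \<Rightarrow> complex \<Rightarrow> nat \<Rightarrow> complex"
  assumes M: "\<And>f u v. u \<noteq> 0 \<Longrightarrow> v \<noteq> 0 \<Longrightarrow> u \<noteq> v \<Longrightarrow>
      ev (M f) (P u v) = T / (1 - u / v) * ev f (P u v) + (t - T / (1 - u / v)) * ev f (P v u)"
    and L: "\<And>f u v. u \<noteq> 0 \<Longrightarrow> v \<noteq> 0 \<Longrightarrow> v\<^sup>2 \<noteq> 1 \<Longrightarrow>
      ev (L f) (P u v) = (S + R * v) / (1 - v\<^sup>2) * ev f (P u v) + (s - (S + R * v) / (1 - v\<^sup>2)) * ev f (P u (1 / v))"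
    and uv: "u \<noteq> 0" "v \<noteq> 0" "u \<noteq> v" "u * v \<noteq> 1" "u\<^sup>2 \<noteq> 1" "v\<^sup>2 \<noteq> 1"
  shows "ev (M (L (M (L f)))) (P u v) = ev (L (M (L (M f)))) (P u v)"
proof -
  define A B C D where "A = T / (1 - u / v)" and "B = T / (1 - u * v)"
    and "C = (S + R * u) / (1 - u\<^sup>2)" and "D = (S + R * v) / (1 - v\<^sup>2)"
  define u' v' where "u' = 1 / u" and "v' = 1 / v"
  have nz: "u' \<noteq> 0" "v' \<noteq> 0" using uv by (auto simp: u'_def v'_def)
  have ii: "1 / u' = u" "1 / v' = v" "1 / u = u'" "1 / v = v'" by (auto simp: u'_def v'_def)
  have ne: "u \<noteq> v'" "v \<noteq> u'" "u' \<noteq> v'" using uv by (auto simp: u'_def v'_def field_simps)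
  have sq: "u'\<^sup>2 \<noteq> 1" "v'\<^sup>2 \<noteq> 1" using uv by (auto simp: u'_def v'_def power_divide)
  have k: "T / (1 - u / v) = A" "T / (1 - v / u) = T - A"
    "T / (1 - u / v') = B" "T / (1 - v' / u) = T - B" "T / (1 - v / u') = B" "T / (1 - u' / v) = T - B"
    "T / (1 - u' / v') = T - A" "T / (1 - v' / u') = A"
    using kap_inv[of "u / v" T] kap_inv[of "u * v" T] uv
    by (simp_all add: A_def B_def u'_def v'_def mult.commute)
  have l: "(S + R * u) / (1 - u\<^sup>2) = C" "(S + R * v) / (1 - v\<^sup>2) = D"
    "(S + R * u') / (1 - u'\<^sup>2) = S - C" "(S + R * v') / (1 - v'\<^sup>2) = S - D"
    using lam_inv[of u S R] lam_inv[of v S R] uv by (simp_all add: C_def D_def u'_def v'_def)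
  note MM = M[OF uv(1,2,3)] M[OF uv(2,1) uv(3)[symmetric]] M[OF uv(1) nz(2) ne(1)] M[OF nz(2) uv(1) ne(1)[symmetric]]
    M[OF uv(2) nz(1) ne(2)] M[OF nz(1) uv(2) ne(2)[symmetric]] M[OF nz(1,2) ne(3)] M[OF nz(2,1) ne(3)[symmetric]]
  note LL = L[OF uv(1,2,6)] L[OF uv(2,1,5)] L[OF uv(1) nz(2) sq(2)] L[OF nz(2) uv(1,5)]
    L[OF uv(2) nz(1) sq(1)] L[OF nz(1) uv(2,6)] L[OF nz(1,2) sq(2)] L[OF nz(2,1) sq(1)]
  show ?thesis
    unfolding MM LL k l ii
    by (rule braid4_coeffs) (use braid4_rel[OF uv, of T S R] in \<open>simp add: A_def B_def C_def D_def\<close>)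
qed

lemma braid3_points:
  fixes P :: "complex \<Rightarrow> complex \<Rightarrow> complex \<Rightarrow> nat \<Rightarrow> complex"
  assumes M: "\<And>f u v w. u \<noteq> 0 \<Longrightarrow> v \<noteq> 0 \<Longrightarrow> w \<noteq> 0 \<Longrightarrow> u \<noteq> v \<Longrightarrow>
      ev (M f) (P u v w) = T / (1 - u / v) * ev f (P u v w) + (t - T / (1 - u / v)) * ev f (P v u w)"
    and L: "\<And>f u v w. u \<noteq> 0 \<Longrightarrow> v \<noteq> 0 \<Longrightarrow> w \<noteq> 0 \<Longrightarrow> v \<noteq> w \<Longrightarrow>
      ev (L f) (P u v w) = T / (1 - v / w) * ev f (P u v w) + (t - T / (1 - v / w)) * ev f (P u w v)"
    and z: "u \<noteq> 0" "v \<noteq> 0" "w \<noteq> 0" and ne: "u \<noteq> v" "v \<noteq> w" "u \<noteq> w"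
  shows "ev (M (L (M f))) (P u v w) = ev (L (M (L f))) (P u v w)"
proof -
  define A B C where "A = T / (1 - u / v)" and "B = T / (1 - v / w)" and "C = T / (1 - u / w)"
  have k: "T / (1 - u / v) = A" "T / (1 - v / w) = B" "T / (1 - u / w) = C"
    "T / (1 - v / u) = T - A" "T / (1 - w / v) = T - B" "T / (1 - w / u) = T - C"
    using kap_inv[of "u / v" T] kap_inv[of "v / w" T] kap_inv[of "u / w" T] z ne
    by (simp_all add: A_def B_def C_def)
  have eqs: "A = T * v / (v - u)" "B = T * w / (w - v)" "C = T * w / (w - u)"
    using z ne by (simp_all add: A_def B_def C_def field_simps)
  have "v - u \<noteq> 0" "w - v \<noteq> 0" "w - u \<noteq> 0" using ne by auto
  then have rel: "A * B = C * (A + B - T)"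
    unfolding eqs by (simp add: divide_simps) (simp add: algebra_simps)
  note MM = M[OF z ne(1)] M[OF z(2,1,3) ne(1)[symmetric]] M[OF z(1,3,2) ne(3)]
    M[OF z(3,1,2) ne(3)[symmetric]] M[OF z(2,3,1) ne(2)] M[OF z(3,2,1) ne(2)[symmetric]]
  note LL = L[OF z ne(2)] L[OF z(1,3,2) ne(2)[symmetric]] L[OF z(2,1,3) ne(3)]
    L[OF z(2,3,1) ne(3)[symmetric]] L[OF z(3,1,2) ne(1)] L[OF z(3,2,1) ne(1)[symmetric]]
  show ?thesis
    unfolding MM LL k by (rule braid3_coeffs[OF rel])
qed

context params
begin

text \<open>The coefficient \<open>t\<^sub>i - t\<^sub>i\<^sup>-\<^sup>1 v\<^bsub>a\<^esub>(y)\<close>, for \<open>a = a\<^sub>i\<close>, of \<open>f(y)\<close> in \<open>(T\<^sub>i f)(y)\<close>, after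
  cancellation. The coefficient of \<open>f(s\<^sub>i y)\<close> is \<open>t\<^sub>i\<close> minus it.\<close>

definition kv :: "nat \<Rightarrow> (nat \<Rightarrow> complex) \<Rightarrow> complex" where
  "kv i y = (if i = 0 then (t0 p - 1 / t0 p + (t0v p - 1 / t0v p) * (qhalf p / y 1)) / (1 - (qhalf p / y 1)\<^sup>2)
     else if i < n then (tmid p - 1 / tmid p) / (1 - y i / y (Suc i))
     else (tn p - 1 / tn p + (tnv p - 1 / tnv p) * y n) / (1 - (y n)\<^sup>2))"

definition rootval :: "nat \<Rightarrow> (nat \<Rightarrow> complex) \<Rightarrow> complex" where
  "rootval i y = (if i = 0 then (qhalf p / y 1)\<^sup>2 else if i < n then y i / y (Suc i) else (y n)\<^sup>2)"

lemma rootval_X: "i \<le> n \<Longrightarrow> nzp y \<Longrightarrow> ev (X (a i)) y = rootval i y"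
  using n2 by (auto simp: ev_X simple_root_def rootval_def mon_cmul mon_diff mon_uminus qpar_def
      power_divide power_int_minus divide_inverse power_mult_distrib power_inverse simp flip: minus_frag_cmul)

lemma ev_T:
  assumes i: "i \<le> n" and y: "nzp y" and r: "rootval i y \<noteq> 1"
  shows "ev (T i f) y = kv i y * ev f y + (t i - kv i y) * ev f (pt i y)"
proof -
  obtain g where g: "v_den p (a i) * g = v_num p n (a i) * (act p (s i) f - f)"
    "T i f = lscale (t i) f + lscale (inverse (t i)) g" using T_ex[OF i] by metis
  define N where "N = 1 + cmid i * ev (half i) y - (t i)\<^sup>2 * rootval i y"
  have "(1 - rootval i y) * ev g y = N * (ev f (pt i y) - ev f y)"
    using arg_cong[OF g(1), of "\<lambda>h. ev h y"] y i
    by (simp add: ev_mult v_den_simple v_num_simple ev_diff ev_add ev_lscale rootval_X ev_act N_def)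
  then have G: "ev g y = N / (1 - rootval i y) * (ev f (pt i y) - ev f y)"
    using r by (simp add: field_simps)
  have y1: "y (Suc 0) \<noteq> 0" using y by (simp add: nzp_def)
  have h: "ev (half i) y = (if i = 0 then qhalf p / y 1 else if i < n then 0 else y n)"
    using i by (simp add: half_def mon_uminus divide_inverse)
  have d: "1 - rootval i y \<noteq> 0" using r by simp
  have K: "kv i y = t i - inverse (t i) * (N / (1 - rootval i y))"
  proof -
    have "t i * (1 - rootval i y) - inverse (t i) * N = kv i y * (1 - rootval i y)"
      using d i n2 unfolding N_def h
      by (auto simp: kv_def rootval_def t_simple_def cmid_def field_simps power2_eq_square)
    then show ?thesis using d by (simp add: field_simps)
  qed
  show ?thesis unfolding K by (simp add: g(2) ev_add ev_lscale G algebra_simps)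
qed

lemma rootval_pt: "i \<le> n \<Longrightarrow> nzp y \<Longrightarrow> rootval i (pt i y) = 1 / rootval i y"
  using n2 by (auto simp: rootval_def pt_def qpar_def nzp_def power_divide divide_simps power2_eq_square)

lemma kv_pt:
  assumes "i \<le> n" "nzp y" "rootval i y \<noteq> 1" shows "kv i (pt i y) = t i - 1 / t i - kv i y"
proof -
  have z: "y 1 \<noteq> 0" "y i \<noteq> 0" "y n \<noteq> 0" "y (Suc i) \<noteq> 0" using assms by (auto simp: nzp_def)
  consider "i = 0" | "i \<noteq> 0" "i < n" | "i = n" using assms by linarith
  then show ?thesis
  proof cases
    case 1
    have "qhalf p / (q / y 1) = 1 / (qhalf p / y 1)" by (simp add: qpar_def power2_eq_square)
    then show ?thesis using 1 z n2 assms lam_inv[of "qhalf p / y 1" "t0 p - 1 / t0 p" "t0v p - 1 / t0v p"]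
      by (simp add: kv_def pt_def rootval_def t_simple_def)
  next
    case 2
    then show ?thesis using z assms kap_inv[of "y i / y (Suc i)" "tmid p - 1 / tmid p"]
      by (simp add: kv_def pt_def rootval_def t_simple_def)
  next
    case 3
    then show ?thesis using z n2 assms lam_inv[of "y n" "tn p - 1 / tn p" "tnv p - 1 / tnv p"]
      by (simp add: kv_def pt_def rootval_def t_simple_def)
  qed
qed

lemma pt_pt: "i \<le> n \<Longrightarrow> nzp y \<Longrightarrow> pt i (pt i y) = y"
  using n2 by (auto simp: pt_def fun_eq_iff nzp_def)

lemma simple_fst_nz: "i \<le> n \<Longrightarrow> fst (a i) \<noteq> 0"
  using ip_simple_pos[of i] by auto

text \<open>Pointwise: the coefficients of \<open>T\<^sub>i\<close> at \<open>y\<close> and at \<open>s\<^sub>i y\<close> add up to \<open>t\<^sub>i - 1/t\<^sub>i\<close> (\<open>kv_pt\<close>), which makes the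
  matrix on the values at these two points satisfy the quadratic relation.\<close>

theorem T_quadratic:
  assumes i: "i \<le> n" shows "T i (T i f) = lscale (t i - 1 / t i) (T i f) + f"
proof (rule laurent_eq_by_values[of "{(q powi snd (a i), fst (a i))}"])
  fix y assume y: "nzp y" and "\<And>c v. (c, v) \<in> {(q powi snd (a i), fst (a i))} \<Longrightarrow> c * mon y v \<noteq> 1"
  then have r: "rootval i y \<noteq> 1" using rootval_X[OF i y] by (simp add: ev_X)
  then have r': "rootval i (pt i y) \<noteq> 1" using rootval_pt[OF i y] by auto
  show "ev (T i (T i f)) y = ev (lscale (t i - 1 / t i) (T i f) + f) y"
    by (simp add: ev_T[OF i y r] ev_T[OF i pt_nzp[OF y] r'] ev_add ev_lscale kv_pt[OF i y r] pt_pt[OF i y])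
       (simp add: field_simps)
qed (use simple_fst_nz[OF i] in auto)

theorem T_braid2:
  assumes "commuting i j" shows "T i (T j f) = T j (T i f)"
proof -
  have i: "i \<le> n" and j: "j \<le> n" and ij: "i + 2 \<le> j" using assms by (auto simp: commuting_def)
  show ?thesis
  proof (rule laurent_eq_by_values[of "{(q powi snd (a i), fst (a i)), (q powi snd (a j), fst (a j))}"])
    fix y assume y: "nzp y"
      and C: "\<And>c v. (c, v) \<in> {(q powi snd (a i), fst (a i)), (q powi snd (a j), fst (a j))} \<Longrightarrow> c * mon y v \<noteq> 1"
    have r: "rootval i y \<noteq> 1" "rootval j y \<noteq> 1"
      using rootval_X[OF i y] rootval_X[OF j y] C[of "q powi snd (a i)" "fst (a i)"] C[of "q powi snd (a j)" "fst (a j)"]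
      by (simp_all add: ev_X)
    have e: "rootval i (pt j y) = rootval i y" "rootval j (pt i y) = rootval j y"
      "kv i (pt j y) = kv i y" "kv j (pt i y) = kv j y" "pt i (pt j y) = pt j (pt i y)"
      using ij j by (auto simp: rootval_def kv_def pt_def fun_eq_iff)
    show "ev (T i (T j f)) y = ev (T j (T i f)) y"
      using e r by (simp add: ev_T[OF i y] ev_T[OF j y] ev_T[OF i pt_nzp[OF y]] ev_T[OF j pt_nzp[OF y]] algebra_simps)
  qed (use simple_fst_nz[OF i] simple_fst_nz[OF j] in auto)
qed

theorem T_braid3:
  assumes "braid3 i j" shows "T i (T j (T i f)) = T j (T i (T j f))"
proof -
  have i: "1 \<le> i" "i < n" and j: "j = Suc i" "j < n" using assms by (auto simp: braid3_def)
  let ?C = "{(1, eps i - eps j), (1, eps j - eps (Suc j)), (1, eps i - eps (Suc j))}"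
  show ?thesis
  proof (rule laurent_eq_by_values[of ?C])
    fix c :: complex and v assume "(c, v) \<in> ?C"
    then have "lk v i \<noteq> 0 \<or> lk v j \<noteq> 0" using j by (auto simp: lookup_minus)
    then show "v \<noteq> 0" by auto
  next
    fix y assume y: "nzp y" and "\<And>c v. (c, v) \<in> ?C \<Longrightarrow> c * mon y v \<noteq> 1"
    then have "mon y (eps i - eps j) \<noteq> 1" "mon y (eps j - eps (Suc j)) \<noteq> 1" "mon y (eps i - eps (Suc j)) \<noteq> 1"
      by (metis insertCI mult_1)+
    then have ne: "y i \<noteq> y j" "y j \<noteq> y (Suc j)" "y i \<noteq> y (Suc j)" using y by (auto simp: mon_diff nzp_def)
    have z: "y i \<noteq> 0" "y j \<noteq> 0" "y (Suc j) \<noteq> 0" using y by (auto simp: nzp_def)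
    define P :: "complex \<Rightarrow> complex \<Rightarrow> complex \<Rightarrow> nat \<Rightarrow> complex" where "P u v w = y(i := u, j := v, Suc j := w)" for u v w
    have nz: "nzp (P u v w)" if "u \<noteq> 0" "v \<noteq> 0" "w \<noteq> 0" for u v w
      using that y by (auto simp: nzp_def P_def)
    have "ev (T i (T j (T i f))) (P (y i) (y j) (y (Suc j))) = ev (T j (T i (T j f))) (P (y i) (y j) (y (Suc j)))"
    proof (rule braid3_points[where T = "tmid p - 1 / tmid p" and t = "tmid p"])
      fix f and u v w :: complex assume *: "u \<noteq> 0" "v \<noteq> 0" "w \<noteq> (0 :: complex)" "u \<noteq> v"
      have "pt i (P u v w) = P v u w" using i j by (auto simp: P_def pt_def fun_eq_iff)
      then show "ev (T i f) (P u v w) = (tmid p - 1 / tmid p) / (1 - u / v) * ev f (P u v w) +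
          (tmid p - (tmid p - 1 / tmid p) / (1 - u / v)) * ev f (P v u w)"
        using ev_T[of i "P u v w" f] nz * i j by (simp add: rootval_def kv_def t_simple_def P_def)
    next
      fix f and u v w :: complex assume *: "u \<noteq> 0" "v \<noteq> 0" "w \<noteq> (0 :: complex)" "v \<noteq> w"
      have "pt j (P u v w) = P u w v" using i j by (auto simp: P_def pt_def fun_eq_iff)
      then show "ev (T j f) (P u v w) = (tmid p - 1 / tmid p) / (1 - v / w) * ev f (P u v w) +
          (tmid p - (tmid p - 1 / tmid p) / (1 - v / w)) * ev f (P u w v)"
        using ev_T[of j "P u v w" f] nz * i j by (simp add: rootval_def kv_def t_simple_def P_def)
    qed (use z ne in auto)
    moreover have "P (y i) (y j) (y (Suc j)) = y" by (auto simp: P_def)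
    ultimately show "ev (T i (T j (T i f))) y = ev (T j (T i (T j f))) y" by simp
  qed simp
qed

lemma T_braid4_n: "T (n - 1) (T n (T (n - 1) (T n f))) = T n (T (n - 1) (T n (T (n - 1) f)))"
proof -
  define i where "i = n - 1"
  have i: "1 \<le> i" "i < n" "Suc i = n" using n2 by (auto simp: i_def)
  let ?C = "{(1, eps i - eps n), (1, eps i + eps n), (1, frag_cmul 2 (eps i)), (1, frag_cmul 2 (eps n))}"
  have "T i (T n (T i (T n f))) = T n (T i (T n (T i f)))"
  proof (rule laurent_eq_by_values[of ?C])
    fix c :: complex and v assume "(c, v) \<in> ?C"
    then have "lk v i \<noteq> 0 \<or> lk v n \<noteq> 0" using i by (auto simp: lookup_minus lookup_add)
    then show "v \<noteq> 0" by auto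
  next
    fix y assume y: "nzp y" and "\<And>c v. (c, v) \<in> ?C \<Longrightarrow> c * mon y v \<noteq> 1"
    then have "mon y (eps i - eps n) \<noteq> 1" "mon y (eps i + eps n) \<noteq> 1"
      "mon y (frag_cmul 2 (eps i)) \<noteq> 1" "mon y (frag_cmul 2 (eps n)) \<noteq> 1"
      by (metis insertCI mult_1)+
    then have ne: "y i \<noteq> y n" "y i * y n \<noteq> 1" "(y i)\<^sup>2 \<noteq> 1" "(y n)\<^sup>2 \<noteq> 1"
      using y by (auto simp: mon_diff mon_add mon_cmul nzp_def)
    have z: "y i \<noteq> 0" "y n \<noteq> 0" using y by (auto simp: nzp_def)
    define P :: "complex \<Rightarrow> complex \<Rightarrow> nat \<Rightarrow> complex" where "P u v = y(i := u, n := v)" for u v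
    have nz: "nzp (P u v)" if "u \<noteq> 0" "v \<noteq> 0" for u v
      using that y by (auto simp: nzp_def P_def)
    have "ev (T i (T n (T i (T n f)))) (P (y i) (y n)) = ev (T n (T i (T n (T i f)))) (P (y i) (y n))"
    proof (rule braid4_points[where T = "tmid p - 1 / tmid p" and t = "tmid p" and S = "tn p - 1 / tn p"
          and R = "tnv p - 1 / tnv p" and s = "tn p"])
      fix f and u v :: complex assume *: "u \<noteq> 0" "v \<noteq> (0 :: complex)" "u \<noteq> v"
      have "pt i (P u v) = P v u" using i by (auto simp: P_def pt_def fun_eq_iff)
      then show "ev (T i f) (P u v) = (tmid p - 1 / tmid p) / (1 - u / v) * ev f (P u v) +
          (tmid p - (tmid p - 1 / tmid p) / (1 - u / v)) * ev f (P v u)"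
        using ev_T[of i "P u v" f] nz * i by (simp add: rootval_def kv_def t_simple_def P_def)
    next
      fix f and u v :: complex assume *: "u \<noteq> 0" "v \<noteq> (0 :: complex)" "v\<^sup>2 \<noteq> 1"
      have "pt n (P u v) = P u (1 / v)" using i n2 by (auto simp: P_def pt_def fun_eq_iff)
      then show "ev (T n f) (P u v) = (tn p - 1 / tn p + (tnv p - 1 / tnv p) * v) / (1 - v\<^sup>2) * ev f (P u v) +
          (tn p - (tn p - 1 / tn p + (tnv p - 1 / tnv p) * v) / (1 - v\<^sup>2)) * ev f (P u (1 / v))"
        using ev_T[of n "P u v" f] nz * n2 by (simp add: rootval_def kv_def t_simple_def P_def)
    qed (use z ne in auto)
    moreover have "P (y i) (y n) = y" by (auto simp: P_def)
    ultimately show "ev (T i (T n (T i (T n f)))) y = ev (T n (T i (T n (T i f)))) y" by simp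
  qed simp
  then show ?thesis by (simp add: i_def)
qed

text \<open>In the coordinates \<open>q\<^bsup>1/2\<^esup>/y\<^sub>2, q\<^bsup>1/2\<^esup>/y\<^sub>1\<close> the operators \<open>T\<^sub>1\<close> and
  \<open>T\<^sub>0\<close> look like \<open>T\<^bsub>n-1\<^esub>\<close> and \<open>T\<^sub>n\<close>.\<close>

lemma T_braid4_0: "T 1 (T 0 (T 1 (T 0 f))) = T 0 (T 1 (T 0 (T 1 f)))"
proof -
  let ?C = "{(1, eps 1 - eps 2), (q, - eps 1 - eps 2), (q, frag_cmul (- 2) (eps 2)), (q, frag_cmul (- 2) (eps 1))}"
  show ?thesis
  proof (rule laurent_eq_by_values[of ?C])
    fix c :: complex and v assume "(c, v) \<in> ?C"
    then have "lk v 1 \<noteq> 0 \<or> lk v 2 \<noteq> 0" by (auto simp: lookup_minus lookup_add)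
    then show "v \<noteq> 0" by auto
  next
    fix y assume y: "nzp y" and C: "\<And>c v. (c, v) \<in> ?C \<Longrightarrow> c * mon y v \<noteq> 1"
    have z: "y 1 \<noteq> 0" "y 2 \<noteq> 0" using y by (auto simp: nzp_def)
    have "1 * mon y (eps 1 - eps 2) \<noteq> 1" "q * mon y (- eps 1 - eps 2) \<noteq> 1"
      "q * mon y (frag_cmul (- 2) (eps 2)) \<noteq> 1" "q * mon y (frag_cmul (- 2) (eps 1)) \<noteq> 1"
      by (rule C; blast)+
    then have ne: "y 1 \<noteq> y 2" "q / (y 1 * y 2) \<noteq> 1" "q / (y 2)\<^sup>2 \<noteq> 1" "q / (y 1)\<^sup>2 \<noteq> 1"
      using y z by (auto simp: mon_diff mon_uminus mon_cmul power_int_minus divide_inverse simp del: minus_frag_cmul)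
    define P :: "complex \<Rightarrow> complex \<Rightarrow> nat \<Rightarrow> complex" where "P u v = y(1 := qhalf p / v, 2 := qhalf p / u)" for u v
    have nz: "nzp (P u v)" if "u \<noteq> 0" "v \<noteq> 0" for u v
      using that y by (auto simp: nzp_def P_def)
    let ?u = "qhalf p / y 2" and ?v = "qhalf p / y 1"
    have "ev (T 1 (T 0 (T 1 (T 0 f)))) (P ?u ?v) = ev (T 0 (T 1 (T 0 (T 1 f)))) (P ?u ?v)"
    proof (rule braid4_points[where T = "tmid p - 1 / tmid p" and t = "tmid p" and S = "t0 p - 1 / t0 p"
          and R = "t0v p - 1 / t0v p" and s = "t0 p"])
      fix f and u v :: complex assume *: "u \<noteq> 0" "v \<noteq> (0 :: complex)" "u \<noteq> v"
      have "pt 1 (P u v) = P v u" using n2 by (auto simp: P_def pt_def fun_eq_iff)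
      then show "ev (T 1 f) (P u v) = (tmid p - 1 / tmid p) / (1 - u / v) * ev f (P u v) +
          (tmid p - (tmid p - 1 / tmid p) / (1 - u / v)) * ev f (P v u)"
        using ev_T[of 1 "P u v" f] nz * n2 
        by (simp add: rootval_def kv_def t_simple_def P_def numeral_2_eq_2)
    next
      fix f and u v :: complex assume *: "u \<noteq> 0" "v \<noteq> (0 :: complex)" "v\<^sup>2 \<noteq> 1"
      have "pt 0 (P u v) = P u (1 / v)" by (auto simp: P_def pt_def fun_eq_iff qpar_def power2_eq_square)
      then show "ev (T 0 f) (P u v) = (t0 p - 1 / t0 p + (t0v p - 1 / t0v p) * v) / (1 - v\<^sup>2) * ev f (P u v) +
          (t0 p - (t0 p - 1 / t0 p + (t0v p - 1 / t0v p) * v) / (1 - v\<^sup>2)) * ev f (P u (1 / v))"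
        using ev_T[of 0 "P u v" f] nz * n2 by (simp add: rootval_def kv_def t_simple_def P_def)
    qed (use z ne in \<open>auto simp: qpar_def power2_eq_square mult.commute\<close>)
    moreover have "P ?u ?v = y" using z by (auto simp: P_def)
    ultimately show "ev (T 1 (T 0 (T 1 (T 0 f)))) y = ev (T 0 (T 1 (T 0 (T 1 f)))) y" by simp
  qed simp
qed

theorem T_braid4:
  assumes "braid4 i j" shows "T i (T j (T i (T j f))) = T j (T i (T j (T i f)))"
  using assms T_braid4_0[of f] T_braid4_n[of f] unfolding braid4_def by auto

section \<open>The operators \<open>T\<^sub>w\<close>\<close>

definition Tword :: "nat list \<Rightarrow> laurent \<Rightarrow> laurent" where
  "Tword is = foldr (\<lambda>i S. T i \<circ> S) is id"

lemma Tword_Nil [simp]: "Tword [] f = f"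
  and Tword_Cons [simp]: "Tword (i # is) f = T i (Tword is f)"
  by (simp_all add: Tword_def)

lemma Tword_append: "Tword (is @ js) f = Tword is (Tword js f)"
  by (induction "is") auto

lemma Tword_braid_eq: "braid_eq is js \<Longrightarrow> Tword is f = Tword js f"
  by (induction rule: braid_eq.induct) (auto intro: T_braid2 T_braid3 T_braid4)

abbreviation "Tw \<equiv> T_elt p n"

lemma Tw_some: "Tw w = Tword (some_reduced n w)"
  by (simp add: T_elt_def Tword_def)

lemma Tw_reduced: "reduced_expr n w is \<Longrightarrow> Tw w f = Tword is f"
  unfolding Tw_some by (rule Tword_braid_eq, rule reduced_words_braid_eq, rule some_reduced)
    (auto dest: reduced_affW)

text \<open>Concatenating reduced words of \<open>w\<close> and \<open>w'\<close> gives a reduced word, and \<open>T\<close> does not depend on the choice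
  of the reduced word by Matsumoto's theorem and the braid relations.\<close>

theorem Tw_mult:
  assumes "w \<in> affW" "w' \<in> affW" "additive w w'" shows "Tw (w \<circ> w') f = Tw w (Tw w' f)"
  using Tw_reduced[OF reduced_append[OF assms some_reduced[OF assms(1)] some_reduced[OF assms(2)]]]
  by (simp add: Tw_some Tword_append)

lemma Tw_id [simp]: "Tw id f = f"
  using Tw_reduced[of id "[]" f] by (simp add: reduced_expr_def)

lemma Tw_s: assumes "i \<le> n" shows "Tw (s i) f = T i f"
proof -
  have "\<not> desc id i" using assms by (simp add: desc_def inv_id)
  then have "len n (s i \<circ> id) = 1" using len_asc[of id i] assms by simp
  then have "reduced_expr n (s i) [i]" using assms by (simp add: reduced_expr_def)
  then show ?thesis using Tw_reduced by force
qed

lemma Tw_asc: "w \<in> affW \<Longrightarrow> i \<le> n \<Longrightarrow> \<not> desc w i \<Longrightarrow> Tw (s i \<circ> w) f = T i (Tw w f)"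
  using Tw_mult[of "s i" w f] additive_s[of w i] by (simp add: Tw_s)

end

section \<open>Orbits and the dominance order\<close>

context rank
begin

lemma finW_snd: "w \<in> finW n \<Longrightarrow> snd (w f) = snd f"
proof -
  have "set is \<subseteq> {1..n} \<Longrightarrow> snd (word_elt n is f) = snd f" for "is"
    by (induction "is") (auto simp: snd_s simple_root_def)
  then show "w \<in> finW n \<Longrightarrow> snd (w f) = snd f" by (auto simp: finW_def)
qed

abbreviation wl :: "(affine_vec \<Rightarrow> affine_vec) \<Rightarrow> lattice_vec \<Rightarrow> lattice_vec" where
  "wl w v \<equiv> fst (w (v, 0))"

lemma finW_apply: "w \<in> finW n \<Longrightarrow> w (v, 0) = (wl w v, 0)"
  using finW_snd[of w "(v, 0)"] by (simp add: prod_eq_iff)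

lemma wl_comp: "w \<in> affW \<Longrightarrow> w' \<in> affW \<Longrightarrow> wl (w \<circ> w') v = wl w (wl w' v)"
  using affW_level[of w "wl w' v" "snd (w' (v, 0))"] by simp

lemma wl_s: "i \<le> n \<Longrightarrow> wl (s i) v = v - frag_cmul (cp i v) (fst (a i))"
  by (simp add: fst_s)

lemma wl_ip: "w \<in> affW \<Longrightarrow> ip (wl w u) (wl w v) = ip u v"
  using affW_ip[of w "(u, 0)" "(v, 0)"] by simp

lemma wl_lin: "w \<in> affW \<Longrightarrow> wl w (u + v) = wl w u + wl w v"
  "w \<in> affW \<Longrightarrow> wl w (u - v) = wl w u - wl w v"
  "w \<in> affW \<Longrightarrow> wl w (frag_cmul k v) = frag_cmul k (wl w v)"
  using affW_add[of w "(u, 0)" "(v, 0)"] affW_diff[of w "(u, 0)" "(v, 0)"] affW_iscale[of w k "(v, 0)"]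
  by (simp_all add: iscale_def)

lemma wl_Lam: "w \<in> affW \<Longrightarrow> v \<in> Lam n \<Longrightarrow> wl w v \<in> Lam n"
proof (induction arbitrary: v rule: affW_induct)
  case (step i w)
  have "wl (s i) (wl w v) \<in> Lam n"
    unfolding wl_s[OF step(1)] by (intro Lam_diff Lam_cmul simple_root_Lam step)
  then show ?case unfolding wl_comp[OF s_affW[OF step(1)] step(2)] .
qed simp

lemma wl_inv: "w \<in> affW \<Longrightarrow> wl (inv w) (wl w v) = v"
  using wl_comp[of "inv w" w v, symmetric] by simp

lemma orbit_def': "orbit n v = (\<lambda>w. wl w v) ` finW n"
  by (auto simp: orbit_def)

lemma orbit_refl [simp]: "v \<in> orbit n v"
  unfolding orbit_def' by (rule image_eqI[of _ _ id]) auto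

lemma orbit_s: "u \<in> orbit n v \<Longrightarrow> 1 \<le> i \<Longrightarrow> i \<le> n \<Longrightarrow> wl (s i) u \<in> orbit n v"
  unfolding orbit_def'
proof clarify
  fix w assume "1 \<le> i" "i \<le> n" "w \<in> finW n"
  then show "wl (s i) (wl w v) \<in> (\<lambda>w. wl w v) ` finW n"
    by (intro image_eqI[of _ _ "s i \<circ> w"]) (simp_all only: wl_comp finW_affW s_affW comp_finW s_finW)
qed

lemma orbit_trans: "u \<in> orbit n v \<Longrightarrow> v \<in> orbit n z \<Longrightarrow> u \<in> orbit n z"
  unfolding orbit_def'
proof clarify
  fix w w' assume "w \<in> finW n" "w' \<in> finW n"
  then show "wl w (wl w' z) \<in> (\<lambda>w. wl w z) ` finW n"
    by (intro image_eqI[of _ _ "w \<circ> w'"]) (simp_all only: wl_comp finW_affW comp_finW)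
qed

lemma orbit_sym: "u \<in> orbit n v \<Longrightarrow> v \<in> orbit n u"
  unfolding orbit_def'
proof clarify
  fix w assume w: "w \<in> finW n"
  then show "v \<in> (\<lambda>w'. wl w' (wl w v)) ` finW n"
    by (intro image_eqI[of _ _ "inv w"]) (simp_all only: wl_inv finW_affW inv_finW)
qed

lemma orbit_eq: "u \<in> orbit n v \<Longrightarrow> orbit n u = orbit n v"
  using orbit_trans orbit_sym by blast

lemma orbit_Lam: "u \<in> orbit n v \<Longrightarrow> v \<in> Lam n \<Longrightarrow> u \<in> Lam n"
  by (auto simp: orbit_def' intro: wl_Lam finW_affW)

text \<open>The linear part of an affine Weyl group element lies in the finite group.\<close>

lemma affW_orbit: "w \<in> affW \<Longrightarrow> wl w v \<in> orbit n v"
proof (induction arbitrary: v rule: affW_induct)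
  case (step i w)
  have "wl (s 0) u \<in> orbit n u" for u
  proof -
    have "wl (s 0) u = wl (flip 1) u"
      by (simp add: wl_s flip_def cpair_def simple_root_def mult.commute)
    then show ?thesis using flip_finW[of 1] n2 by (auto simp: orbit_def')
  qed
  then have "wl (s i) u \<in> orbit n u" for u
    using orbit_s[OF orbit_refl, of i u] step(1) by (cases "i = 0") auto
  moreover have "wl (s i \<circ> w) v = wl (s i) (wl w v)" using step by (intro wl_comp) auto
  ultimately show ?case using step.IH[of v] orbit_trans by metis
qed simp

lemma orbit_ip: "u \<in> orbit n v \<Longrightarrow> ip u u = ip v v"
  by (auto simp: orbit_def' wl_ip finW_affW)

text \<open>Boxes serve to prove finiteness: the Weyl group preserves them.\<close>

definition box :: "int \<Rightarrow> lattice_vec set" where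
  "box B = {v \<in> Lam n. \<forall>i. \<bar>lk v i\<bar> \<le> B}"

lemma finite_box: "finite (box B)"
proof -
  let ?f = "\<lambda>v :: lattice_vec. map (lk v) [1..<Suc n]"
  have "?f ` box B \<subseteq> {xs. set xs \<subseteq> {- B..B} \<and> length xs = n}"
    by (force simp: box_def abs_le_iff)
  moreover have "finite {xs. set xs \<subseteq> {- B..B} \<and> length xs = n}" by (rule finite_lists_length_eq) simp
  moreover have "inj_on ?f (box B)"
  proof (rule inj_onI)
    fix u v assume "u \<in> box B" "v \<in> box B" "?f u = ?f v"
    then show "u = v" by (intro Lam_eqI[of u n v]) (auto simp: box_def map_eq_conv)
  qed
  ultimately show ?thesis using finite_imageD finite_subset by blast
qed

lemma box_orbit: "u \<in> orbit n v \<Longrightarrow> v \<in> box B \<Longrightarrow> u \<in> box B"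
proof -
  have step: "wl (s i) v \<in> box B" if "v \<in> box B" "1 \<le> i" "i \<le> n" for i v
  proof -
    have b: "\<bar>lk v j\<bar> \<le> B" for j using that by (auto simp: box_def)
    have "lk (wl (s i) v) j = (if i < n then (if j = i then lk v (Suc i) else if j = Suc i then lk v i else lk v j)
        else if j = n then - lk v n else lk v j)" for j
      using that by (auto simp: wl_s cpair_def simple_root_def lookup_minus)
    then have "\<bar>lk (wl (s i) v) j\<bar> \<le> B" for j using b by auto
    then show ?thesis using wl_Lam[of "s i" v] that by (auto simp: box_def)
  qed
  have "set is \<subseteq> {1..n} \<Longrightarrow> v \<in> box B \<Longrightarrow> wl (word_elt n is) v \<in> box B" for "is"
  proof (induction "is")
    case (Cons i "is")
    have "word_elt n is \<in> affW" unfolding affW_def by (rule imageI) (use Cons in auto)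
    then have "wl (word_elt n (i # is)) v = wl (s i) (wl (word_elt n is) v)"
      using Cons wl_comp[of "s i" "word_elt n is" v] by simp
    then show ?case using step Cons by simp
  qed simp
  then show "u \<in> orbit n v \<Longrightarrow> v \<in> box B \<Longrightarrow> u \<in> box B" by (auto simp: orbit_def' finW_def)
qed

lemma in_some_box: "v \<in> Lam n \<Longrightarrow> \<exists>B. v \<in> box B"
proof -
  assume "v \<in> Lam n"
  have "\<bar>lk v i\<bar> \<le> (\<Sum>j\<in>keys v. \<bar>lk v j\<bar>)" for i
    by (cases "i \<in> keys v") (auto intro: member_le_sum simp: in_keys_iff sum_nonneg)
  then show ?thesis using \<open>v \<in> Lam n\<close> by (auto simp: box_def)
qed

lemma finite_orbit: "v \<in> Lam n \<Longrightarrow> finite (orbit n v)"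
  using in_some_box[of v] box_orbit finite_box by (metis finite_subset subsetI)

subsection \<open>Dominant elements\<close>

lemma Lam_plus_Lam: "v \<in> Lam_plus n \<Longrightarrow> v \<in> Lam n"
  by (simp add: Lam_plus_def)

lemma Lam_plus_iff: "v \<in> Lam_plus n \<longleftrightarrow> v \<in> Lam n \<and> (\<forall>i. 1 \<le> i \<longrightarrow> i \<le> n \<longrightarrow> cp i v \<ge> 0)"
proof
  assume v: "v \<in> Lam n \<and> (\<forall>i. 1 \<le> i \<longrightarrow> i \<le> n \<longrightarrow> cp i v \<ge> 0)"
  have mono: "lk v (i + k) \<le> lk v i" if "1 \<le> i" "i + k \<le> n" for i k
    using that
  proof (induction k)
    case (Suc k)
    then have "cp (i + k) v \<ge> 0" using v by auto
    then show ?case using Suc by (simp add: cpair_def)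
  qed simp
  have "lk v j \<le> lk v i" if "1 \<le> i" "i \<le> j" "j \<le> n" for i j
    using mono[of i "j - i"] that by simp
  moreover have "lk v n \<ge> 0" using v n2 by (auto simp: cpair_def dest: spec[of _ n])
  ultimately show "v \<in> Lam_plus n" using v unfolding Lam_plus_def by (force intro: order_trans)
qed (use n2 in \<open>auto simp: Lam_plus_def cpair_def\<close>)

lemma Lam_plus_add: "u \<in> Lam_plus n \<Longrightarrow> v \<in> Lam_plus n \<Longrightarrow> u + v \<in> Lam_plus n"
  by (auto simp: Lam_plus_iff intro: add_nonneg_nonneg)

lemma dominant_units:
  assumes "v \<in> Lam_plus n" "e \<in> units" "f \<in> units" "fht f \<le> fht e" shows "ip v f \<le> ip v e"
proof -
  have mono: "lk v j \<le> lk v i" if "1 \<le> i" "i \<le> j" "j \<le> n" for i j using assms(1) that by (auto simp: Lam_plus_def)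
  have pos: "lk v i \<ge> 0" if "1 \<le> i" "i \<le> n" for i using assms(1) that by (auto simp: Lam_plus_def)
  obtain i j where ij: "1 \<le> i" "i \<le> n" "1 \<le> j" "j \<le> n" "e = eps i \<or> e = - eps i" "f = eps j \<or> f = - eps j"
    using assms(2,3) by (auto simp: units_def)
  then show ?thesis using assms(4) mono[of i j] mono[of j i] pos[of i] pos[of j] by (auto simp: fht_eps)
qed

lemma dominant_roots: "v \<in> Lam_plus n \<Longrightarrow> \<alpha> \<in> roots \<Longrightarrow> fht \<alpha> > 0 \<Longrightarrow> ip v \<alpha> \<ge> 0"
proof -
  assume v: "v \<in> Lam_plus n" and "\<alpha> \<in> roots" "fht \<alpha> > 0"
  then obtain e e' where "e \<in> units" "e' \<in> units" "\<alpha> = e + e'" by (auto simp: roots_def)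
  moreover from this have "fht (- e') \<le> fht e" using \<open>fht \<alpha> > 0\<close> by simp
  ultimately show ?thesis using dominant_units[OF v, of e "- e'"] units_uminus by auto
qed

lemma cp_sign: "i \<le> n \<Longrightarrow> sgn (cp i v) = sgn (ip v (fst (a i)))"
proof -
  assume i: "i \<le> n"
  have "sgn (2 * ip v (fst (a i))) = sgn (cp i v)"
    unfolding ip_simple[OF i] sgn_mult using ip_simple_pos[OF i] by simp
  then show ?thesis by (simp add: sgn_mult)
qed

lemma finW_desc_pos: "w \<in> finW n \<Longrightarrow> desc w i \<Longrightarrow> i \<le> n \<Longrightarrow> 1 \<le> i"
proof (rule ccontr)
  assume w: "w \<in> finW n" "desc w i" and "\<not> 1 \<le> i"
  then have i: "i = 0" by simp
  have "inv w (a 0) \<in> affroots" using affW_roots inv_affW finW_affW w by simp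
  moreover have "snd (inv w (a 0)) = 1" using finW_snd[OF inv_finW[OF w(1)]] by (simp add: simple_root_def)
  ultimately have "ht (inv w (a 0)) > 0" using ht_roots(3) by auto
  then show False using w i by (simp add: desc_def)
qed

lemma finW_asc_induct [consumes 1, case_names id step]:
  assumes "w \<in> finW n" "P id"
    "\<And>i w. 1 \<le> i \<Longrightarrow> i \<le> n \<Longrightarrow> w \<in> finW n \<Longrightarrow> \<not> desc w i \<Longrightarrow> P w \<Longrightarrow> P (s i \<circ> w)"
  shows "P w"
  using assms(1)
proof (induction "len n w" arbitrary: w)
  case 0
  then have "w = id" using len_0 finW_affW by metis
  then show ?case using assms(2) by metis
next
  case (Suc k)
  note wW = finW_affW[OF Suc.prems]
  obtain "is" where red: "reduced_expr n w is" using reduced_exists[OF wW] by blast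
  then have "length is = Suc k" using Suc.hyps by (simp only: reduced_expr_def)
  then obtain i p where "is = i # p" by (cases "is") auto
  note R = reduced_consD[OF red[unfolded this]]
  have i: "1 \<le> i" using finW_desc_pos Suc.prems R by blast
  have u: "s i \<circ> w \<in> finW n" using comp_finW s_finW i R Suc.prems by blast
  have "len n (s i \<circ> w) = k" using len_desc[OF wW R(3,1)] Suc.hyps by simp
  then have "P (s i \<circ> w)" using Suc.hyps(1) u by metis
  moreover have "\<not> desc (s i \<circ> w) i" using desc_s wW R by blast
  ultimately have "P (s i \<circ> (s i \<circ> w))" using assms(3) i R u by blast
  then show ?case unfolding s_s_comp[OF R(3)] .
qed

text \<open>Descents of \<open>w\<close> are read off from the image of a dominant weight, up to the weights on a wall.\<close>

lemma asc_cp: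
  assumes "v \<in> Lam_plus n" "w \<in> finW n" "1 \<le> i" "i \<le> n"
  shows "\<not> desc w i \<Longrightarrow> cp i (wl w v) \<ge> 0" "desc w i \<Longrightarrow> cp i (wl w v) \<le> 0"
proof -
  let ?\<alpha> = "wl (inv w) (fst (a i))"
  have wW: "w \<in> affW" "inv w \<in> affW" using finW_affW[OF assms(2)] by auto
  have a: "a i = (fst (a i), 0)" using assms by (auto simp: simple_root_def)
  have e: "inv w (a i) = (?\<alpha>, 0)" using finW_apply[OF inv_finW[OF assms(2)], of "fst (a i)"] a by simp
  have "inv w (a i) \<in> affroots" using affW_roots wW assms by simp
  then have r: "?\<alpha> \<in> roots" by (simp add: affroots_def e)
  have ht: "ht (inv w (a i)) = fht ?\<alpha>" by (simp add: e ht_def)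
  have "ip (wl w v) (fst (a i)) = ip (wl (inv w) (wl w v)) ?\<alpha>" using wl_ip[OF wW(2)] by simp
  then have ip: "ip (wl w v) (fst (a i)) = ip v ?\<alpha>" using wl_inv[OF wW(1)] by simp
  have sg: "sgn (cp i (wl w v)) = sgn (ip v ?\<alpha>)" using cp_sign[of i "wl w v"] ip assms by simp
  show "cp i (wl w v) \<ge> 0" if "\<not> desc w i"
  proof -
    have "fht ?\<alpha> > 0" using not_desc[OF wW(1), of i] that ht assms by simp
    then have "ip v ?\<alpha> \<ge> 0" using dominant_roots assms(1) r by blast
    then show ?thesis using sg by (auto simp: sgn_if split: if_splits)
  qed
  show "cp i (wl w v) \<le> 0" if "desc w i"
  proof -
    have "fht (- ?\<alpha>) > 0" using that ht by (simp add: desc_def)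
    then have "ip v (- ?\<alpha>) \<ge> 0" using dominant_roots assms(1) roots_uminus[OF r] by blast
    then show ?thesis using sg by (auto simp: sgn_if split: if_splits)
  qed
qed

text \<open>Induction on the length of \<open>w\<close> with \<open>\<mu> = w la\<close>: a letter that fixes the weight can be skipped, and any
  other one lowers it.\<close>

lemma orbit_induct [consumes 2, case_names dominant step]:
  assumes "\<mu> \<in> orbit n la" "la \<in> Lam_plus n" "P la"
    "\<And>i \<nu>. 1 \<le> i \<Longrightarrow> i \<le> n \<Longrightarrow> \<nu> \<in> orbit n la \<Longrightarrow> cp i \<nu> > 0 \<Longrightarrow> P \<nu> \<Longrightarrow> P (wl (s i) \<nu>)"
  shows "P \<mu>"
proof -
  obtain w where w: "w \<in> finW n" "\<mu> = wl w la" using assms(1) by (auto simp: orbit_def')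
  from w(1) have "P (wl w la)"
  proof (induction rule: finW_asc_induct)
    case (step i w)
    have e: "wl (s i \<circ> w) la = wl (s i) (wl w la)" using wl_comp finW_affW s_affW step by blast
    have "cp i (wl w la) \<ge> 0" using asc_cp assms(2) step by blast
    moreover have "wl w la \<in> orbit n la" using step by (auto simp: orbit_def')
    moreover have "wl (s i) (wl w la) = wl w la" if "cp i (wl w la) = 0" using that step by (simp add: wl_s)
    ultimately show ?case using assms(4)[of i "wl w la"] step unfolding e by (cases "cp i (wl w la) = 0") auto
  qed (use assms(3) in simp)
  then show ?thesis using w by simp
qed

text \<open>Partial sums are pairings with the fundamental weights \<open>\<epsilon>\<^sub>1 + \<dots> + \<epsilon>\<^sub>k\<close>, and dominance
  compares them.\<close>

definition om :: "nat \<Rightarrow> lattice_vec" where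
  "om k = (\<Sum>j=1..k. eps j)"

lemma lk_om [simp]: "lk (om k) j = (if 1 \<le> j \<and> j \<le> k then 1 else 0)"
proof -
  have "lk (om k) j = (\<Sum>i\<in>{1..k}. if i = j then 1 else 0)" by (simp add: om_def lookup_sum)
  then show ?thesis by simp
qed

lemma om_Suc: "om (Suc k) = om k + eps (Suc k)"
  by (simp add: om_def)

lemma om_0 [simp]: "om 0 = 0"
  by (simp add: om_def)

lemma om_dominant: "k \<le> n \<Longrightarrow> om k \<in> Lam_plus n"
  by (auto simp: Lam_plus_def Lam_iff)

text \<open>Dominance by partial sums. The coefficients of a difference along the simple roots are differences of
  partial sums, so on the lattice this is \<open>dom_le\<close> (\<open>dom_le_dle\<close>), without an existential quantifier.\<close>

definition dle :: "lattice_vec \<Rightarrow> lattice_vec \<Rightarrow> bool" where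
  "dle u v \<longleftrightarrow> (\<forall>k. 1 \<le> k \<longrightarrow> k \<le> n \<longrightarrow> ip (om k) u \<le> ip (om k) v)"

lemma dle_refl [simp]: "dle v v" by (simp add: dle_def)
lemma dle_trans: "dle u v \<Longrightarrow> dle v z \<Longrightarrow> dle u z" by (force simp: dle_def)

lemma dle_antisym: "dle u v \<Longrightarrow> dle v u \<Longrightarrow> u \<in> Lam n \<Longrightarrow> v \<in> Lam n \<Longrightarrow> u = v"
proof (rule Lam_eqI)
  fix i assume "dle u v" "dle v u" "1 \<le> i" "i \<le> n"
  have e: "ip (om k) u = ip (om k) v" if "k \<le> i" for k
  proof (cases "k = 0")
    case False
    then have "1 \<le> k" "k \<le> n" using that \<open>i \<le> n\<close> by auto
    then show ?thesis using \<open>dle u v\<close> \<open>dle v u\<close> unfolding dle_def by (meson order_antisym)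
  qed simp
  obtain j where j: "i = Suc j" using \<open>1 \<le> i\<close> by (cases i) auto
  show "lk u i = lk v i" using e[of "Suc j"] e[of j] unfolding j om_Suc by simp
qed

lemma ip_om_simple: "1 \<le> i \<Longrightarrow> i \<le> n \<Longrightarrow> 1 \<le> k \<Longrightarrow> k \<le> n \<Longrightarrow>
    ip (om k) (fst (a i)) = (if i = k then (if i = n then 2 else 1) else 0)"
  by (auto simp: simple_root_def)

lemma dom_le_dle:
  assumes "u \<in> Lam n" "v \<in> Lam n" shows "dom_le n u v \<longleftrightarrow> dle u v"
proof
  assume "dom_le n u v"
  then obtain k :: "nat \<Rightarrow> nat" where k: "v - u =
       (\<Sum>i\<in>{1..<n}. frag_cmul (int (k i)) (fst (a i))) + frag_cmul (int (k n)) (eps n)"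
    by (auto simp: dom_le_def)
  show "dle u v" unfolding dle_def
  proof (intro allI impI)
    fix j assume j: "1 \<le> j" "j \<le> n"
    have "ip (om j) (v - u) \<ge> 0"
      unfolding k using j n2 by (auto simp: ip_sum ip_om_simple intro!: add_nonneg_nonneg sum_nonneg)
    then show "ip (om j) u \<le> ip (om j) v" by simp
  qed
next
  assume d: "dle u v"
  define c where "c j = ip (om j) (v - u)" for j
  have c: "c j \<ge> 0" if "1 \<le> j" "j \<le> n" for j using d that by (auto simp: dle_def c_def)
  have "v - u = (\<Sum>i\<in>{1..<n}. frag_cmul (c i) (fst (a i))) + frag_cmul (c n) (eps n)" (is "_ = ?R")
  proof (rule dle_antisym)
    have R: "ip (om j) ?R = c j" if j: "1 \<le> j" "j \<le> n" for j
    proof -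
      have "(\<Sum>i\<in>{1..<n}. c i * ip (om j) (fst (a i))) = (\<Sum>i\<in>{1..<n}. if i = j then c i else 0)"
        using j by (intro sum.cong) (auto simp: ip_om_simple)
      then show ?thesis using j by (auto simp: ip_sum)
    qed
    show "dle (v - u) ?R" "dle ?R (v - u)" using R by (auto simp: dle_def c_def)
    show "v - u \<in> Lam n" using assms by auto
    show "?R \<in> Lam n" using n2 by (auto intro!: Lam_add Lam_sum Lam_cmul Lam_eps simple_root_Lam)
  qed
  moreover have "?R = (\<Sum>i\<in>{1..<n}. frag_cmul (int (nat (c i))) (fst (a i))) + frag_cmul (int (nat (c n))) (eps n)"
    using c n2 by (auto intro!: sum.cong)
  ultimately show "dom_le n u v" unfolding dom_le_def by metis
qed

lemma dle_root_string:
  assumes "\<alpha> \<in> roots" "fht \<alpha> < 0" "k \<ge> 0" shows "dle (v + frag_cmul k \<alpha>) v"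
  unfolding dle_def
proof (intro allI impI)
  fix j assume "1 \<le> j" "j \<le> n"
  then have "ip (om j) (- \<alpha>) \<ge> 0" using dominant_roots[OF om_dominant, of j "- \<alpha>"] roots_uminus assms by simp
  then show "ip (om j) (v + frag_cmul k \<alpha>) \<le> ip (om j) v" using assms(3) by (simp add: mult_nonneg_nonpos)
qed

lemma dle_s_down: "1 \<le> i \<Longrightarrow> i \<le> n \<Longrightarrow> cp i v \<ge> 0 \<Longrightarrow> dle (wl (s i) v) v"
  by (auto simp: dle_def wl_s ip_om_simple)

lemma orbit_dle: "la \<in> Lam_plus n \<Longrightarrow> \<mu> \<in> orbit n la \<Longrightarrow> dle \<mu> la"
proof -
  assume "la \<in> Lam_plus n" "\<mu> \<in> orbit n la"
  from this(2,1) show ?thesis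
  proof (induction rule: orbit_induct)
    case (step i \<nu>)
    then have "dle (wl (s i) \<nu>) \<nu>" by (intro dle_s_down) auto
    then show ?case using step dle_trans by blast
  qed simp
qed

lemma dominant_unique:
  assumes "la \<in> Lam_plus n" "\<mu> \<in> Lam_plus n" "\<mu> \<in> orbit n la" shows "\<mu> = la"
  using assms orbit_dle[of la \<mu>] orbit_dle[of \<mu> la] orbit_sym Lam_plus_Lam by (intro dle_antisym) auto

lemma dominant_exists: "v \<in> Lam n \<Longrightarrow> \<exists>\<mu>\<in>orbit n v. \<mu> \<in> Lam_plus n"
proof -
  assume v: "v \<in> Lam n"
  have fin: "finite (orbit n v)" "orbit n v \<noteq> {}" using finite_orbit v orbit_refl by blast+
  have "Max (fht ` orbit n v) \<in> fht ` orbit n v" using fin by (intro Max_in) auto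
  then obtain m where m: "m \<in> orbit n v" and "Max (fht ` orbit n v) = fht m" by blast
  then have max: "fht u \<le> fht m" if "u \<in> orbit n v" for u
    using that fin by (metis Max_ge finite_imageI imageI)
  have "cp i m \<ge> 0" if "1 \<le> i" "i \<le> n" for i
  proof (rule ccontr)
    assume "\<not> ?thesis"
    moreover have "fht (fst (a i)) = 2" using ht_simple[of i] that by (simp add: ht_def simple_root_def split: if_splits)
    ultimately have "fht (wl (s i) m) > fht m" using that by (simp add: wl_s)
    then show False using max[OF orbit_s[OF m that]] by simp
  qed
  then show ?thesis using m orbit_Lam v by (auto simp: Lam_plus_iff)
qed

abbreviation "dr \<equiv> dom_rep n"

lemma dom_rep:
  assumes "v \<in> Lam n" shows "dr v \<in> orbit n v" "dr v \<in> Lam_plus n"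
proof -
  obtain \<mu> where \<mu>: "\<mu> \<in> orbit n v" "\<mu> \<in> Lam_plus n" using dominant_exists[OF assms] by blast
  have "dr v = \<mu>" unfolding dom_rep_def
  proof (rule the_equality)
    fix \<nu> assume "\<nu> \<in> orbit n v \<and> \<nu> \<in> Lam_plus n"
    then show "\<nu> = \<mu>" using dominant_unique[of \<mu> \<nu>] \<mu> orbit_eq by metis
  qed (use \<mu> in simp)
  then show "dr v \<in> orbit n v" "dr v \<in> Lam_plus n" using \<mu> by auto
qed

lemma dr_Lam: "v \<in> Lam n \<Longrightarrow> dr v \<in> Lam n"
  using dom_rep Lam_plus_Lam by blast

lemma dom_rep_eqI: "v \<in> Lam_plus n \<Longrightarrow> u \<in> orbit n v \<Longrightarrow> dr u = v"
  using dominant_unique[of v "dr u"] dom_rep[of u] orbit_Lam Lam_plus_Lam orbit_trans by metis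

lemma dom_rep_orbit: "u \<in> Lam n \<Longrightarrow> v \<in> Lam n \<Longrightarrow> dr u = dr v \<longleftrightarrow> u \<in> orbit n v"
  using dom_rep[of u] dom_rep[of v] dom_rep_eqI[of "dr v" u] by (metis orbit_eq orbit_sym orbit_trans)

subsection \<open>The order on weights\<close>

text \<open>The weights of strictly lower orbits. Together with the lower part of the orbit itself they make up
  the weights below \<open>v\<close> for \<open>\<prec>\<close> (\<open>below_iff\<close>).\<close>

definition low :: "lattice_vec \<Rightarrow> lattice_vec set" where
  "low v = {u \<in> Lam n. dle (dr u) (dr v) \<and> dr u \<noteq> dr v}"

lemma prec_iff:
  assumes "u \<in> Lam n" "v \<in> Lam n"
  shows "prec n u v \<longleftrightarrow> u \<in> low v \<or> (u \<in> orbit n v \<and> dle u v \<and> u \<noteq> v)"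
  using assms dom_le_dle[of u v] dom_le_dle[of "dr u" "dr v"] dom_rep[of u] dom_rep[of v] dom_rep_orbit[of u v]
  by (auto simp: prec_def prec_eq_def dom_less_def low_def Lam_plus_Lam)

lemma low_trans: "u \<in> low v \<Longrightarrow> v \<in> low z \<Longrightarrow> u \<in> low z"
proof -
  assume "u \<in> low v" "v \<in> low z"
  then have 1: "u \<in> Lam n" "dle (dr u) (dr v)" "dle (dr v) (dr z)" "v \<in> Lam n" "dr u \<noteq> dr v"
    by (auto simp: low_def)
  have "dr u \<noteq> dr z"
  proof
    assume "dr u = dr z"
    then have "dr u = dr v" using 1 dr_Lam[of u] dr_Lam[of v] by (intro dle_antisym) auto
    then show False using 1 by simp
  qed
  then show ?thesis using 1 dle_trans[of "dr u" "dr v" "dr z"] by (auto simp: low_def)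
qed

lemma low_orbit: "u \<in> orbit n v \<Longrightarrow> v \<in> Lam n \<Longrightarrow> low u = low v"
  using dom_rep_orbit[of u v] orbit_Lam[of u v] by (simp add: low_def)

lemma orbit_low: "u \<in> orbit n v \<Longrightarrow> v \<in> low z \<Longrightarrow> u \<in> low z"
  using dom_rep_orbit[of u v] orbit_Lam[of u v] by (auto simp: low_def)

lemma low_not_orbit: "v \<in> Lam n \<Longrightarrow> u \<in> low v \<Longrightarrow> u \<notin> orbit n v"
  using dom_rep_orbit[of u v] by (auto simp: low_def)

definition below :: "lattice_vec \<Rightarrow> lattice_vec set" where
  "below v = {u \<in> Lam n. prec n u v}"

lemma below_iff: "v \<in> Lam n \<Longrightarrow> u \<in> below v \<longleftrightarrow> u \<in> low v \<or> (u \<in> orbit n v \<and> dle u v \<and> u \<noteq> v)"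
  using prec_iff[of u v] orbit_Lam[of u v] by (auto simp: below_def low_def)

lemma below_trans: "v \<in> Lam n \<Longrightarrow> z \<in> Lam n \<Longrightarrow> u \<in> below v \<Longrightarrow> v \<in> below z \<Longrightarrow> u \<in> below z"
proof -
  assume v: "v \<in> Lam n" "z \<in> Lam n" and "u \<in> below v" "v \<in> below z"
  then consider "u \<in> low v" "v \<in> low z" | "u \<in> low v" "v \<in> orbit n z" | "u \<in> orbit n v" "v \<in> low z"
    | "u \<in> orbit n v" "dle u v" "u \<noteq> v" "v \<in> orbit n z" "dle v z" "v \<noteq> z" by (auto simp: below_iff)
  then show ?thesis
  proof cases
    case 4
    then have "u \<noteq> z" using dle_antisym[of v z] v by auto
    then show ?thesis using 4 v orbit_trans dle_trans by (auto simp: below_iff)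
  qed (use v low_trans low_orbit orbit_low in \<open>auto simp: below_iff\<close>)
qed

lemma below_irrefl: "v \<notin> below v"
  by (simp add: below_def prec_def)

lemma below_Lam: "u \<in> below v \<Longrightarrow> u \<in> Lam n"
  by (simp add: below_def)

lemma finite_below: "v \<in> Lam n \<Longrightarrow> finite (below v)"
proof -
  assume v: "v \<in> Lam n"
  let ?B = "lk (dr v) 1"
  have "below v \<subseteq> box ?B"
  proof
    fix u assume u: "u \<in> below v"
    then have uL: "u \<in> Lam n" by (rule below_Lam)
    have "dle (dr u) (dr v)" using u v uL dom_rep_orbit[of u v] by (auto simp: below_iff low_def)
    then have "ip (om 1) (dr u) \<le> ip (om 1) (dr v)" using n2 unfolding dle_def by auto
    then have 1: "lk (dr u) 1 \<le> ?B" using om_Suc[of 0] by simp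
    have d: "dr u \<in> Lam_plus n" using dom_rep uL by blast
    have "\<bar>lk (dr u) i\<bar> \<le> ?B" for i
    proof (cases "1 \<le> i \<and> i \<le> n")
      case True
      then have "lk (dr u) i \<le> lk (dr u) 1" "lk (dr u) i \<ge> 0" using d by (auto simp: Lam_plus_def)
      then show ?thesis using 1 by simp
    next
      case False
      then have "lk (dr u) i = 0" using d Lam_plus_Lam Lam_iff by blast
      moreover have "lk (dr u) 1 \<ge> 0" using d n2 by (auto simp: Lam_plus_def)
      ultimately show ?thesis using 1 by simp
    qed
    then have "dr u \<in> box ?B" using d Lam_plus_Lam by (auto simp: box_def)
    then show "u \<in> box ?B" using box_orbit orbit_sym dom_rep uL by blast
  qed
  then show ?thesis using finite_box finite_subset by blast
qed

text \<open>A point strictly inside the segment from \<open>v\<close> to \<open>s\<^sub>i v\<close> lies in a lower orbit: if \<open>w\<close> makes it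
  dominant, then \<open>w\<close> maps both end points below the dominant element of their orbit, and the
  point itself is shorter than the end points.\<close>

lemma segment_low:
  assumes v: "v \<in> Lam n" and i: "i \<le> n" and j: "0 < j" "j < 2 * \<bar>cp i v\<bar>"
    and u: "frag_cmul 2 u = frag_cmul 2 v - frag_cmul (sgn (cp i v) * j) (fst (a i))"
  shows "u \<in> low v"
proof -
  define m where "m = cp i v"
  define c where "c = sgn m * j"
  have uL: "u \<in> Lam n"
  proof -
    have "frag_cmul 2 u \<in> Lam n" unfolding u using v i by (auto intro!: Lam_diff Lam_cmul)
    then show ?thesis by (simp add: Lam_iff)
  qed
  obtain w where w: "w \<in> finW n" "dr u = wl w u" using dom_rep(1)[OF uL] by (auto simp: orbit_def')
  note wW = finW_affW[OF w(1)]
  have o: "wl w v \<in> orbit n v" "wl w (wl (s i) v) \<in> orbit n v"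
    using affW_orbit[OF wW] orbit_trans[OF affW_orbit[OF wW] affW_orbit[of "s i" v]] i by simp_all
  have up: "dle (wl w v) (dr v)" "dle (wl w (wl (s i) v)) (dr v)"
    using o orbit_dle[of "dr v"] dom_rep[OF v] orbit_eq[OF dom_rep(1)[OF v]] by auto
  have "dle (dr u) (dr v)" unfolding dle_def
  proof (intro allI impI)
    fix k assume k: "1 \<le> k" "k \<le> n"
    define \<phi> where "\<phi> x = ip (om k) (wl w x)" for x
    have \<phi>s: "\<phi> (wl (s i) v) = \<phi> v - m * \<phi> (fst (a i))"
      using i by (simp add: wl_s \<phi>_def wl_lin[OF wW] m_def)
    have "2 * \<phi> u = \<phi> (frag_cmul 2 u)" by (simp add: \<phi>_def wl_lin[OF wW])
    also have "\<dots> = 2 * \<phi> v - c * \<phi> (fst (a i))" unfolding u by (simp add: \<phi>_def wl_lin[OF wW] c_def m_def)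
    finally have \<phi>u: "2 * \<phi> u = 2 * \<phi> v - c * \<phi> (fst (a i))" .
    have le: "\<phi> v \<le> ip (om k) (dr v)" "\<phi> (wl (s i) v) \<le> ip (om k) (dr v)" using up k by (auto simp: dle_def \<phi>_def)
    have "\<phi> u \<le> ip (om k) (dr v)"
    proof (cases "m * \<phi> (fst (a i)) \<ge> 0")
      case True
      then have "c * \<phi> (fst (a i)) \<ge> 0" using j by (auto simp: c_def sgn_if zero_le_mult_iff)
      then show ?thesis using \<phi>u le by linarith
    next
      case False
      then have "c * \<phi> (fst (a i)) \<ge> 2 * (m * \<phi> (fst (a i)))"
      proof (cases "m > 0")
        case True
        then have "\<phi> (fst (a i)) \<le> 0" "c \<le> 2 * m" using False j by (auto simp: zero_le_mult_iff c_def m_def)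
        then have "2 * m * \<phi> (fst (a i)) \<le> c * \<phi> (fst (a i))" by (intro mult_right_mono_neg) auto
        then show ?thesis by simp
      next
        case F: False
        then have "\<phi> (fst (a i)) \<ge> 0" "c \<ge> 2 * m" using False j by (auto simp: zero_le_mult_iff c_def m_def sgn_if)
        then have "2 * m * \<phi> (fst (a i)) \<le> c * \<phi> (fst (a i))" by (intro mult_right_mono) auto
        then show ?thesis by simp
      qed
      then show ?thesis using \<phi>u \<phi>s le by linarith
    qed
    then show "ip (om k) (dr u) \<le> ip (om k) (dr v)" using w by (simp add: \<phi>_def)
  qed
  moreover have "dr u \<noteq> dr v"
  proof
    assume "dr u = dr v"
    then have "ip u u = ip v v" using dom_rep_orbit[OF uL v] orbit_ip by simp
    moreover have "4 * ip u u = ip (frag_cmul 2 u) (frag_cmul 2 u)" by simp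
    moreover have "ip (frag_cmul 2 u) (frag_cmul 2 u) =
        4 * ip v v - ip (fst (a i)) (fst (a i)) * (c * (2 * m - c))"
      unfolding u using ip_simple[OF i, of v] by (simp add: c_def m_def algebra_simps ip_commute[of "fst (a i)" v])
    moreover have cm: "c * (2 * m - c) > 0"
    proof -
      have "c * (2 * m - c) = j * (2 * \<bar>m\<bar> - j)" using j by (auto simp: c_def m_def sgn_if abs_if algebra_simps)
      then show ?thesis using j by (simp add: m_def)
    qed
    moreover have "ip (fst (a i)) (fst (a i)) * (c * (2 * m - c)) > 0" by (rule mult_pos_pos[OF ip_simple_pos[OF i] cm])
    ultimately show False by linarith
  qed
  ultimately show ?thesis using uL by (simp add: low_def)
qed

subsection \<open>Positive roots\<close>

section \<open>Root lengths and labels\<close>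

lemma long_roots_iff: "long_roots n = frag_cmul 2 ` units"
proof -
  have "long_pos n = frag_cmul 2 ` {eps i |i. 1 \<le> i \<and> i \<le> n}" by (auto simp: long_pos_def)
  moreover have "uminus ` long_pos n = frag_cmul 2 ` {- eps i |i. 1 \<le> i \<and> i \<le> n}"
  proof -
    have "{- eps i |i. 1 \<le> i \<and> i \<le> n} = uminus ` {eps i |i. 1 \<le> i \<and> i \<le> n}" by blast
    then show ?thesis unfolding calculation image_image by (simp add: image_image)
  qed
  ultimately show ?thesis by (simp add: long_roots_def units_def image_Un)
qed

lemma long_pos_iff: "long_pos n = {\<alpha> \<in> long_roots n. fht \<alpha> > 0}"
proof -
  have "fht \<alpha> > 0" if "\<alpha> \<in> long_pos n" for \<alpha> using that by (auto simp: long_pos_def fht_eps)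
  then show ?thesis by (fastforce simp: long_roots_def)
qed

lemma mid_pos_iff: "mid_pos n = {\<alpha> \<in> mid_roots n. fht \<alpha> > 0}"
proof -
  have "fht \<alpha> > 0" if "\<alpha> \<in> mid_pos n" for \<alpha> using that by (auto simp: mid_pos_def fht_eps)
  then show ?thesis by (fastforce simp: mid_roots_def)
qed

lemma mid_roots_iff: "mid_roots n = {e + e' |e e'. e \<in> units \<and> e' \<in> units \<and> e \<noteq> e' \<and> e \<noteq> - e'}"
proof (intro equalityI subsetI)
  fix \<alpha> assume "\<alpha> \<in> mid_roots n"
  then obtain i j where ij: "1 \<le> i" "i < j" "j \<le> n"
    and \<alpha>: "\<alpha> = eps i + eps j \<or> \<alpha> = eps i - eps j \<or> \<alpha> = - (eps i + eps j) \<or> \<alpha> = - (eps i - eps j)"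
    unfolding mid_roots_def mid_pos_def by blast
  have "- (eps i + eps j) = - eps i + - eps j" "- (eps i - eps j) = - eps i + eps j" "eps i - eps j = eps i + - eps j"
    by simp_all
  then obtain e e' where e: "e = eps i \<or> e = - eps i" "e' = eps j \<or> e' = - eps j" "\<alpha> = e + e'"
    using \<alpha> by metis
  have u: "e \<in> units" "e' \<in> units" using ij e by (auto simp: units_def)
  have "lk e i \<noteq> 0" "lk e' i = 0" "lk (- e') i = 0" using ij e by auto
  then have "e \<noteq> e'" "e \<noteq> - e'" by metis+
  then show "\<alpha> \<in> {e + e' |e e'. e \<in> units \<and> e' \<in> units \<and> e \<noteq> e' \<and> e \<noteq> - e'}" using u e by blast
next
  fix \<alpha> assume "\<alpha> \<in> {e + e' |e e'. e \<in> units \<and> e' \<in> units \<and> e \<noteq> e' \<and> e \<noteq> - e'}"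
  then obtain e e' where e: "\<alpha> = e + e'" "e \<in> units" "e' \<in> units" "e \<noteq> e'" "e \<noteq> - e'" by blast
  have pos: "E + E' \<in> mid_roots n"
    if "1 \<le> i" "i < j" "j \<le> n" "E = eps i \<or> E = - eps i" "E' = eps j \<or> E' = - eps j" for i j E E'
  proof -
    have "eps i + eps j \<in> mid_pos n" "eps i - eps j \<in> mid_pos n" using that by (auto simp: mid_pos_def)
    moreover have "- eps i - eps j = - (eps i + eps j)" "- eps i + eps j = - (eps i - eps j)" by simp_all
    ultimately have "eps i + eps j \<in> mid_roots n" "eps i - eps j \<in> mid_roots n"
      "- eps i - eps j \<in> mid_roots n" "- eps i + eps j \<in> mid_roots n"
      unfolding mid_roots_def by (metis UnI1 UnI2 imageI)+
    then show ?thesis using that by auto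
  qed
  obtain i j where ij: "1 \<le> i" "i \<le> n" "1 \<le> j" "j \<le> n" "e = eps i \<or> e = - eps i" "e' = eps j \<or> e' = - eps j"
    using e by (auto simp: units_def)
  have "i \<noteq> j" using e ij by auto
  then show "\<alpha> \<in> mid_roots n"
    using pos[of i j e e'] pos[of j i e' e] ij e by (metis add.commute linorder_neqE_nat)
qed

lemma roots_iff: "roots = long_roots n \<union> mid_roots n"
proof -
  have d: "frag_cmul 2 e = e + e" for e :: lattice_vec using frag_cmul_distrib[of 1 1 e] by simp
  have nz: "e + e \<noteq> 0" if "e \<in> units" for e
    using fht_units(1)[OF that] unfolding d[symmetric] by auto
  show ?thesis
  proof (intro equalityI subsetI)
    fix \<alpha> assume "\<alpha> \<in> roots"
    then obtain e e' where e: "e \<in> units" "e' \<in> units" "e + e' \<noteq> 0" "\<alpha> = e + e'" unfolding roots_def by blast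
    then have "e \<noteq> - e'" by auto
    show "\<alpha> \<in> long_roots n \<union> mid_roots n"
    proof (cases "e = e'")
      case True
      then have "\<alpha> = frag_cmul 2 e" unfolding d using e by (simp only:)
      then show ?thesis using e(1) unfolding long_roots_iff by blast
    next
      case False
      then show ?thesis using e \<open>e \<noteq> - e'\<close> unfolding mid_roots_iff by blast
    qed
  next
    fix \<alpha> assume "\<alpha> \<in> long_roots n \<union> mid_roots n"
    then show "\<alpha> \<in> roots"
    proof
      assume "\<alpha> \<in> long_roots n"
      then show ?thesis using nz unfolding long_roots_iff d roots_def by blast
    next
      assume "\<alpha> \<in> mid_roots n"
      then obtain e e' where "\<alpha> = e + e'" "e \<in> units" "e' \<in> units" "e \<noteq> - e'" unfolding mid_roots_iff by blast
      then show ?thesis unfolding roots_def by (auto simp: eq_neg_iff_add_eq_0)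
    qed
  qed
qed

lemma Sigma_pos_iff: "Sigma_pos n = {\<alpha> \<in> roots. fht \<alpha> > 0}"
  unfolding Sigma_pos_def long_pos_iff mid_pos_iff roots_iff by auto

lemma Sigma_neg_iff: "Sigma_neg n = {\<alpha> \<in> roots. fht \<alpha> < 0}"
proof -
  have "\<alpha> \<in> uminus ` {\<alpha> \<in> roots. fht \<alpha> > 0}" if "\<alpha> \<in> roots" "fht \<alpha> < 0" for \<alpha>
    using that roots_uminus by (intro image_eqI[of _ _ "- \<alpha>"]) auto
  then show ?thesis unfolding Sigma_neg_def Sigma_pos_iff using roots_uminus by auto
qed

lemma affW_long: "w \<in> affW \<Longrightarrow> fst f \<in> long_roots n \<Longrightarrow> fst (w f) \<in> long_roots n \<and> even (snd (w f) - snd f)"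
proof -
  assume w: "w \<in> affW" and "fst f \<in> long_roots n"
  then obtain e where e: "e \<in> units" "fst f = frag_cmul 2 e" by (auto simp: long_roots_iff)
  have f: "f = iscale 2 (e, 0) + (0, snd f)" using e by (simp add: prod_eq_iff)
  have "w (0, snd f) = (0, snd f)" using affW_level[OF w, of 0 "snd f"] affW_zero[OF w] by (simp add: zero_prod_def)
  then have "w f = iscale 2 (w (e, 0)) + (0, snd f)"
    by (subst f) (simp only: affW_add[OF w] affW_iscale[OF w])
  moreover have "fst (w (e, 0)) \<in> units" using affW_units w e by blast
  ultimately show ?thesis by (auto simp: long_roots_iff)
qed

lemma affW_long_iff: "w \<in> affW \<Longrightarrow> fst (w f) \<in> long_roots n \<longleftrightarrow> fst f \<in> long_roots n"
  using affW_long[of w f] affW_long[of "inv w" "w f"] by auto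

lemma t_root_affW:
  assumes "w \<in> affW" "f \<in> affroots" shows "t_root p n (w f) = t_root p n f"
proof (cases "fst f \<in> long_roots n")
  case True
  then show ?thesis using affW_long[OF assms(1), of f] by (auto simp: t_root_def)
next
  case False
  then have "fst (w f) \<notin> long_roots n" using affW_long_iff assms by blast
  moreover have "fst f \<in> roots" "fst (w f) \<in> roots" using assms affW_roots by (auto simp: affroots_def)
  ultimately show ?thesis using False by (auto simp: t_root_def roots_iff)
qed

end

context params
begin

section \<open>The support of \<open>T\<^sub>i x\<^sup>v\<close>\<close>

lemma between_low: "v \<in> Lam n \<Longrightarrow> i \<le> n \<Longrightarrow> between i v u \<Longrightarrow> u \<in> low v"
  by (auto simp: between_def intro: segment_low)

lemma T_xmon':
  assumes "v \<in> Lam n" "i \<le> n"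
  shows "\<exists>r. keys r \<subseteq> low v \<and> T i (xmon v) =
     (if cp i v = 0 then lscale (t i) (xmon v)
      else if cp i v > 0 then lscale (inverse (t i)) (X (s i (v, 0)))
      else lscale (t i) (X (s i (v, 0))) + lscale (t i - inverse (t i)) (xmon v)) + r"
proof -
  have "{u. between i v u} \<subseteq> low v" using between_low assms by blast
  then show ?thesis using T_xmon[of i v] assms n2 by (meson order_trans one_le_numeral)
qed

lemma keys_T_xmon:
  assumes "v \<in> Lam n" "i \<le> n"
  shows "keys (T i (xmon v)) \<subseteq> {v, wl (s i) v} \<union> low v"
proof -
  obtain r where r: "keys r \<subseteq> low v" "T i (xmon v) =
     (if cp i v = 0 then lscale (t i) (xmon v)
      else if cp i v > 0 then lscale (inverse (t i)) (X (s i (v, 0)))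
      else lscale (t i) (X (s i (v, 0))) + lscale (t i - inverse (t i)) (xmon v)) + r"
    using T_xmon'[OF assms] by blast
  let ?L = "(if cp i v = 0 then lscale (t i) (xmon v)
      else if cp i v > 0 then lscale (inverse (t i)) (X (s i (v, 0)))
      else lscale (t i) (X (s i (v, 0))) + lscale (t i - inverse (t i)) (xmon v))"
  have "keys ?L \<subseteq> {v, wl (s i) v}"
    using keys_add[of "lscale (t i) (X (s i (v, 0)))" "lscale (t i - inverse (t i)) (xmon v)"]
    by (auto simp: X_sg xmon_sg split: if_splits dest!: subsetD)
  moreover have "keys (T i (xmon v)) \<subseteq> keys ?L \<union> keys r" unfolding r(2) by (rule keys_add)
  ultimately show ?thesis using r(1) by blast
qed

lemma T_expand: "i \<le> n \<Longrightarrow> T i f = (\<Sum>v\<in>keys f. lscale (lk f v) (T i (xmon v)))"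
proof -
  assume i: "i \<le> n"
  have "T i f = T i (\<Sum>v\<in>keys f. sg v (lk f v))" by (subst pm_decomp[of f]) simp
  also have "\<dots> = (\<Sum>v\<in>keys f. T i (lscale (lk f v) (xmon v)))" using i by (simp add: T_sum xmon_sg)
  finally show ?thesis using i by (simp add: T_lscale)
qed

lemma keys_T: "i \<le> n \<Longrightarrow> keys (T i f) \<subseteq> (\<Union>v\<in>keys f. keys (T i (xmon v)))"
  unfolding T_expand[of i f] by (rule order_trans[OF keys_sum]) (use keys_lscale in blast)

lemma low_Lam: "low v \<subseteq> Lam n"
  by (auto simp: low_def)

lemma keys_T_Lam: "i \<le> n \<Longrightarrow> keys f \<subseteq> Lam n \<Longrightarrow> keys (T i f) \<subseteq> Lam n"
proof -
  assume i: "i \<le> n" and f: "keys f \<subseteq> Lam n"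
  have "keys (T i (xmon u)) \<subseteq> Lam n" if "u \<in> Lam n" for u
  proof -
    have "wl (s i) u \<in> Lam n" using wl_Lam[of "s i" u] that i by simp
    then show ?thesis using keys_T_xmon[OF that i] low_Lam that by blast
  qed
  then show ?thesis using keys_T[OF i, of f] f by blast
qed

lemma keys_T_low: "i \<le> n \<Longrightarrow> keys f \<subseteq> low v \<Longrightarrow> keys (T i f) \<subseteq> low v"
proof -
  assume i: "i \<le> n" and f: "keys f \<subseteq> low v"
  have "keys (T i (xmon u)) \<subseteq> low v" if "u \<in> low v" for u
  proof -
    have "u \<in> Lam n" using that low_Lam by blast
    then have "keys (T i (xmon u)) \<subseteq> {u, wl (s i) u} \<union> low u" using keys_T_xmon i by blast
    moreover have "wl (s i) u \<in> low v" using orbit_low affW_orbit[of "s i" u] that i by auto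
    moreover have "low u \<subseteq> low v" using low_trans that by blast
    ultimately show ?thesis using that by blast
  qed
  then show ?thesis using keys_T[OF i, of f] f by blast
qed

end

section \<open>Inversions\<close>

context rank
begin

definition Inv :: "(affine_vec \<Rightarrow> affine_vec) \<Rightarrow> affine_vec set" where
  "Inv w = {\<beta> \<in> affroots. ht \<beta> > 0 \<and> ht (w \<beta>) < 0}"

lemma Inv_id: "Inv id = {}"
  by (auto simp: Inv_def)

lemma Inv_s:
  assumes "w \<in> affW" "i \<le> n" "\<not> desc w i"
  shows "Inv (s i \<circ> w) = insert (inv w (a i)) (Inv w)" "inv w (a i) \<notin> Inv w"
proof -
  have pos: "ht (inv w (a i)) > 0" using not_desc assms by blast
  have r: "inv w (a i) \<in> affroots" using affW_roots assms by simp
  show "inv w (a i) \<notin> Inv w" using assms by (simp add: Inv_def)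
  show "Inv (s i \<circ> w) = insert (inv w (a i)) (Inv w)"
  proof (intro equalityI subsetI)
    fix \<beta> assume "\<beta> \<in> Inv (s i \<circ> w)"
    then have b: "\<beta> \<in> affroots" "ht \<beta> > 0" "ht (s i (w \<beta>)) < 0" by (auto simp: Inv_def)
    have wb: "w \<beta> \<in> affroots" using affW_roots assms(1) b(1) by blast
    show "\<beta> \<in> insert (inv w (a i)) (Inv w)"
    proof (cases "w \<beta> = a i")
      case True
      then have "\<beta> = inv w (a i)" using inv_affW_cancel(1)[OF assms(1), of \<beta>] by simp
      then show ?thesis by simp
    next
      case False
      then have "\<not> ht (w \<beta>) > 0" using s_pos[OF assms(2) wb] b by force
      then show ?thesis using ht_roots(2)[OF wb] b by (simp add: Inv_def)
    qed
  next
    fix \<beta> assume "\<beta> \<in> insert (inv w (a i)) (Inv w)"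
    then consider "\<beta> = inv w (a i)" | "\<beta> \<in> Inv w" by blast
    then show "\<beta> \<in> Inv (s i \<circ> w)"
    proof cases
      case 1 then show ?thesis using pos r assms by (simp add: Inv_def)
    next
      case 2 then show ?thesis using additive_s[OF assms] by (simp add: Inv_def additive_def)
    qed
  qed
qed

lemma affW_asc_induct [consumes 1, case_names id step]:
  assumes "w \<in> affW" "P id"
    "\<And>i w. i \<le> n \<Longrightarrow> w \<in> affW \<Longrightarrow> \<not> desc w i \<Longrightarrow> P w \<Longrightarrow> P (s i \<circ> w)"
  shows "P w"
  using assms(1)
proof (induction "len n w" arbitrary: w)
  case 0
  then have "w = id" using len_0 by metis
  then show ?case using assms(2) by metis
next
  case (Suc k)
  obtain "is" where red: "reduced_expr n w is" using reduced_exists[OF Suc.prems] by blast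
  then have "length is = Suc k" using Suc.hyps by (simp only: reduced_expr_def)
  then obtain i p where "is = i # p" by (cases "is") auto
  note R = reduced_consD[OF red[unfolded this]]
  have u: "s i \<circ> w \<in> affW" by (rule comp_affW[OF s_affW[OF R(3)] R(4)])
  have "len n (s i \<circ> w) = k" using len_desc[OF Suc.prems R(3,1)] Suc.hyps by simp
  then have "P (s i \<circ> w)" using Suc.hyps(1) u by metis
  moreover have "\<not> desc (s i \<circ> w) i" using desc_s Suc.prems R by blast
  ultimately have "P (s i \<circ> (s i \<circ> w))" using assms(3) R u by blast
  then show ?case unfolding s_s_comp[OF R(3)] .
qed

text \<open>Along a reduced word every letter adds one inversion.\<close>

lemma finite_Inv: "w \<in> affW \<Longrightarrow> finite (Inv w)"
proof (induction rule: affW_asc_induct)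
  case (step i w)
  show ?case unfolding Inv_s(1)[OF step(2,1,3)] by (rule finite.insertI[OF step.IH])
qed (simp only: Inv_id finite.emptyI)

lemma finite_roots: "finite roots"
proof -
  have "units = eps ` {1..n} \<union> (\<lambda>i. - eps i) ` {1..n}" by (auto simp: units_def)
  then have "finite units" by simp
  moreover have "roots \<subseteq> (\<lambda>(e, e'). e + e') ` (units \<times> units)" by (auto simp: roots_def)
  ultimately show ?thesis using finite_subset by blast
qed

lemma finite_Sigma_pos: "finite (Sigma_pos n)"
  unfolding Sigma_pos_iff using finite_roots by simp

text \<open>An affine root \<open>\<alpha> + m\<delta>\<close> becomes \<open>\<alpha> + (m + \<langle>\<nu>, \<alpha>\<rangle>)\<delta>\<close>, so a positive one can only become negative if its
  gradient \<open>\<alpha>\<close> is negative. At \<open>m = 0\<close> such a root is not positive, and at \<open>m = \<langle>\<nu>, -\<alpha>\<rangle>\<close> its image is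
  \<open>\<alpha>\<close>, which is negative; this explains the range of \<open>m\<close>.\<close>

lemma Inv_tau:
  assumes "\<nu> \<in> Lam_plus n"
  shows "Inv (tau \<nu>) = (\<lambda>(\<alpha>, m). (- \<alpha>, m)) ` (SIGMA \<alpha>:Sigma_pos n. {1..ip \<nu> \<alpha>})"
proof (intro equalityI subsetI)
  fix \<beta> assume b: "\<beta> \<in> Inv (tau \<nu>)"
  obtain \<gamma> m where \<beta>: "\<beta> = (\<gamma>, m)" by (cases \<beta>)
  have r: "\<gamma> \<in> roots" "(\<gamma>, m) \<in> affroots" "(\<gamma>, m + ip \<nu> \<gamma>) \<in> affroots" using b by (auto simp: Inv_def \<beta> affroots_def)
  have h: "m > 0 \<or> m = 0 \<and> fht \<gamma> > 0" using b ht_roots(3)[OF r(2)] by (auto simp: Inv_def \<beta>)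
  have h': "\<not> (m + ip \<nu> \<gamma> > 0 \<or> m + ip \<nu> \<gamma> = 0 \<and> fht \<gamma> > 0)"
    using b ht_roots(3)[OF r(3)] by (auto simp: Inv_def \<beta> tau_apply)
  have neg: "fht \<gamma> < 0"
  proof (rule ccontr)
    assume "\<not> ?thesis"
    then have "fht \<gamma> > 0" using fht_roots(2)[OF r(1)] by simp
    then show False using h h' dominant_roots[OF assms r(1)] by linarith
  qed
  then have "- \<gamma> \<in> Sigma_pos n" using r(1) roots_uminus by (simp add: Sigma_pos_iff)
  moreover have "m \<in> {1..ip \<nu> (- \<gamma>)}" using h h' neg by auto
  ultimately show "\<beta> \<in> (\<lambda>(\<alpha>, m). (- \<alpha>, m)) ` (SIGMA \<alpha>:Sigma_pos n. {1..ip \<nu> \<alpha>})"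
    unfolding \<beta> by (intro image_eqI[of _ _ "(- \<gamma>, m)"]) auto
next
  fix \<beta> assume "\<beta> \<in> (\<lambda>(\<alpha>, m). (- \<alpha>, m)) ` (SIGMA \<alpha>:Sigma_pos n. {1..ip \<nu> \<alpha>})"
  then obtain \<alpha> m where \<beta>: "\<beta> = (- \<alpha>, m)" "\<alpha> \<in> Sigma_pos n" "1 \<le> m" "m \<le> ip \<nu> \<alpha>" by auto
  have r: "(- \<alpha>, m) \<in> affroots" "(- \<alpha>, m - ip \<nu> \<alpha>) \<in> affroots" and f: "fht \<alpha> > 0"
    using \<beta> roots_uminus by (auto simp: Sigma_pos_iff affroots_def)
  have "ht (- \<alpha>, m) > 0" using ht_roots(3)[OF r(1)] \<beta> by simp
  moreover have "ht (- \<alpha>, m - ip \<nu> \<alpha>) < 0" using ht_roots(2,3)[OF r(2)] \<beta> f by force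
  ultimately show "\<beta> \<in> Inv (tau \<nu>)" using r \<beta> by (simp add: Inv_def tau_apply)
qed

lemma rho_m_sum: "rho_m n \<mu> = (\<Sum>\<alpha>\<in>mid_pos n. frag_cmul (sgn1 (ip \<mu> \<alpha>)) \<alpha>)"
proof -
  define P where "P = {(i, j). 1 \<le> i \<and> i < j \<and> j \<le> n}"
  define f g where "f = (\<lambda>(i, j). eps i + eps j :: lattice_vec)" and "g = (\<lambda>(i, j). eps i - eps j :: lattice_vec)"
  have "P \<subseteq> {1..n} \<times> {1..n}" by (auto simp: P_def)
  then have fin: "finite P" by (rule finite_subset) simp
  have mid: "mid_pos n = f ` P \<union> g ` P" by (auto simp: mid_pos_def P_def f_def g_def)
  have f: "inj_on f P"
  proof (rule inj_onI)
    fix x y assume xy: "x \<in> P" "y \<in> P" "f x = f y"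
    obtain i j k l where e: "x = (i, j)" "y = (k, l)" by (cases x, cases y)
    have "lk (f x) i = lk (f y) i" "lk (f x) j = lk (f y) j" using xy by simp_all
    then show "x = y" using xy(1,2) unfolding e by (auto simp: f_def P_def lookup_add split: if_splits)
  qed
  have g: "inj_on g P"
  proof (rule inj_onI)
    fix x y assume xy: "x \<in> P" "y \<in> P" "g x = g y"
    obtain i j k l where e: "x = (i, j)" "y = (k, l)" by (cases x, cases y)
    have "lk (g x) i = lk (g y) i" "lk (g x) j = lk (g y) j" using xy by simp_all
    then show "x = y" using xy(1,2) unfolding e by (auto simp: g_def P_def lookup_minus split: if_splits)
  qed
  have disj: "f ` P \<inter> g ` P = {}"
  proof (intro equalityI subsetI)
    fix z assume "z \<in> f ` P \<inter> g ` P"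
    then obtain i j k l where "(i, j) \<in> P" "(k, l) \<in> P" "z = f (i, j)" "z = g (k, l)" by auto
    then have "lk (f (i, j)) l = lk (g (k, l)) l" "(k, l) \<in> P" by metis+
    then show "z \<in> {}" by (auto simp: f_def g_def P_def lookup_add lookup_minus split: if_splits)
  qed simp
  have "(\<Sum>\<alpha>\<in>mid_pos n. frag_cmul (sgn1 (ip \<mu> \<alpha>)) \<alpha>) =
      (\<Sum>x\<in>P. frag_cmul (sgn1 (ip \<mu> (f x))) (f x)) + (\<Sum>x\<in>P. frag_cmul (sgn1 (ip \<mu> (g x))) (g x))"
    unfolding mid using fin disj f g by (simp add: sum.union_disjoint sum.reindex)
  also have "\<dots> = rho_m n \<mu>"
    unfolding rho_m_def P_def[symmetric] sum.distrib[symmetric]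
    by (rule sum.cong) (auto simp: f_def g_def add.commute)
  finally show ?thesis ..
qed

lemma lk_rho_l: "lk (rho_l n \<mu>) k = (if 1 \<le> k \<and> k \<le> n then sgn1 (lk \<mu> k) else 0)"
proof -
  have "lk (rho_l n \<mu>) k = (\<Sum>i\<in>{1..n}. sgn1 (lk \<mu> i) * (if i = k then 1 else 0))"
    by (simp add: rho_l_def lookup_sum)
  also have "\<dots> = (\<Sum>i\<in>{1..n}. if i = k then sgn1 (lk \<mu> i) else 0)" by (rule sum.cong) auto
  finally show ?thesis by simp
qed

end

context params
begin

lemma t_root_simple: "i \<le> n \<Longrightarrow> t_root p n (a i) = t i"
  using simple_long simple_mid[of i] mid_not_long[of "fst (a i)"] n2
  by (cases "i = 0 \<or> i = n") (auto simp: t_root_def t_simple_def simple_root_def)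

text \<open>The coefficient of the leading term \<open>x\<^bsup>w \<mu>\<^esup>\<close> of \<open>T\<^sub>w x\<^sup>\<mu>\<close>: each letter of a reduced word contributes \<open>t\<^sub>i\<close> or
  its inverse, and the letters correspond to the inversions.\<close>

definition cc :: "(affine_vec \<Rightarrow> affine_vec) \<Rightarrow> lattice_vec \<Rightarrow> complex" where
  "cc w \<mu> = (\<Prod>\<beta>\<in>Inv w. if ip \<mu> (fst \<beta>) > 0 then inverse (t_root p n \<beta>) else t_root p n \<beta>)"

lemma cc_s:
  assumes "w \<in> affW" "i \<le> n" "\<not> desc w i"
  shows "cc (s i \<circ> w) \<mu> = (if ip \<mu> (fst (inv w (a i))) > 0 then inverse (t i) else t i) * cc w \<mu>"
proof -
  have "t_root p n (inv w (a i)) = t i"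
    using t_root_affW[of "inv w" "a i" p] assms t_root_simple by simp
  then show ?thesis unfolding cc_def Inv_s(1)[OF assms]
    using finite_Inv[OF assms(1)] Inv_s(2)[OF assms] by simp
qed

section \<open>Triangularity\<close>

text \<open>Where the monomials of \<open>T\<^sub>w x\<^sup>\<mu>\<close> other than \<open>x\<^bsup>w \<mu>\<^esup>\<close> can lie.\<close>

definition trail :: "(affine_vec \<Rightarrow> affine_vec) \<Rightarrow> lattice_vec \<Rightarrow> lattice_vec set" where
  "trail w \<mu> = {wl w \<nu> |\<nu>. \<nu> \<in> orbit n \<mu> \<and> dle \<nu> \<mu> \<and> \<nu> \<noteq> \<mu>} \<union> low \<mu>"

text \<open>One step of the induction. Apart from its leading term, \<open>T\<^sub>i\<close> can only produce the monomial
  of \<open>u \<nu>\<close> itself, and \<open>u \<nu> = s\<^sub>i u \<nu>'\<close> for the reflection \<open>\<nu>'\<close> of \<open>\<nu>\<close> in the inversion \<open>u\<^sup>-\<^sup>1 a\<^sub>i\<close>.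
  Since that root has a negative gradient, \<open>\<nu>'\<close> is below \<open>\<nu>\<close> whenever the term occurs.\<close>

lemma T_trail_step:
  assumes u: "u \<in> affW" and i: "i \<le> n" and neg: "fht (fst (inv u (a i))) < 0"
    and \<mu>: "\<mu> \<in> Lam n" and \<nu>: "\<nu> \<in> orbit n \<mu>"
  shows "keys (T i (X (u (\<nu>, 0))) - lscale (if ip \<nu> (fst (inv u (a i))) > 0 then inverse (t i) else t i)
      (X (s i (u (\<nu>, 0))))) \<subseteq> {wl (s i \<circ> u) \<nu>' |\<nu>'. \<nu>' \<in> orbit n \<mu> \<and> dle \<nu>' \<nu> \<and> \<nu>' \<noteq> \<nu>} \<union> low \<mu>"
    (is "keys ?D \<subseteq> ?S")
proof -
  define v k where "v = wl u \<nu>" and "k = snd (u (\<nu>, 0))"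
  define m where "m = cp i v"
  define \<beta> where "\<beta> = inv u (a i)"
  have uv: "u (\<nu>, 0) = (v, k)" by (simp add: v_def k_def)
  have vo: "v \<in> orbit n \<mu>" unfolding v_def using affW_orbit[OF u] \<nu> orbit_trans by blast
  have vL: "v \<in> Lam n" using orbit_Lam vo \<mu> by blast
  have lowv: "low v = low \<mu>" using low_orbit vo \<mu> by blast
  obtain r where r: "keys r \<subseteq> low v" "T i (xmon v) =
     (if m = 0 then lscale (t i) (xmon v)
      else if m > 0 then lscale (inverse (t i)) (X (s i (v, 0)))
      else lscale (t i) (X (s i (v, 0))) + lscale (t i - inverse (t i)) (xmon v)) + r"
    using T_xmon'[OF vL i] unfolding m_def by blast
  have wb: "wl u (fst \<beta>) = fst (a i)"
  proof -
    have "u \<beta> = (wl u (fst \<beta>), snd \<beta> + snd (u (fst \<beta>, 0)))" using affW_level[OF u, of "fst \<beta>" "snd \<beta>"] by simp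
    moreover have "u \<beta> = a i" unfolding \<beta>_def by (rule inv_affW_cancel(2)[OF u])
    ultimately show ?thesis by (metis fst_conv)
  qed
  have "ip v (fst (a i)) = ip \<nu> (fst \<beta>)" using wl_ip[OF u, of \<nu> "fst \<beta>"] wb by (simp add: v_def)
  then have sg: "sgn m = sgn (ip \<nu> (fst \<beta>))" using cp_sign[OF i, of v] by (simp add: m_def)
  have Xu: "T i (X (v, k)) = lscale (q powi k) (T i (xmon v))" using i by (simp add: X_level T_lscale)
  have Xs: "X (s i (v, k)) = lscale (q powi k) (X (s i (v, 0)))"
  proof -
    have "s i (v, k) = (wl (s i) v, k + snd (s i (v, 0)))" using affW_level[of "s i" v k] i by simp
    then show ?thesis by (simp add: X_sg power_int_add)
  qed
  have D: "?D = lscale (q powi k) (T i (xmon v) - lscale (if m > 0 then inverse (t i) else t i) (X (s i (v, 0))))"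
    using sg unfolding uv Xu Xs \<beta>_def[symmetric] by (auto simp: lscale_diff mult.commute sgn_if split: if_splits)
  show ?thesis
  proof (cases "m < 0")
    case False
    have "T i (xmon v) - lscale (if m > 0 then inverse (t i) else t i) (X (s i (v, 0))) = r"
    proof (cases "m = 0")
      case True
      then have "s i (v, 0) = (v, 0)" using i by (simp add: s_def m_def)
      then show ?thesis using r(2) True by simp
    qed (use r(2) False in auto)
    then have "?D = lscale (q powi k) r" unfolding D by simp
    then have "keys ?D \<subseteq> low \<mu>" using keys_lscale[of _ r] r(1) lowv by auto
    then show ?thesis by blast
  next
    case True
    define \<nu>' where "\<nu>' = wl (inv u) (wl (s i) v)"
    have iu: "inv u \<in> affW" using u by simp
    have "wl (inv u) (fst (a i)) = fst \<beta>" using wl_inv[OF u, of "fst \<beta>"] wb by simp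
    moreover have "wl (inv u) v = \<nu>" using wl_inv[OF u] by (simp add: v_def)
    ultimately have \<nu>': "\<nu>' = \<nu> + frag_cmul (- m) (fst \<beta>)"
      unfolding \<nu>'_def wl_s[OF i] wl_lin[OF iu] by (simp add: m_def)
    have \<beta>r: "fst \<beta> \<in> roots" "fht (fst \<beta>) < 0"
      using affW_roots[OF iu simple_affroots[OF i]] neg by (auto simp: \<beta>_def affroots_def)
    have "dle \<nu>' \<nu>" unfolding \<nu>' by (rule dle_root_string[OF \<beta>r]) (use True in simp)
    moreover have "\<nu>' \<noteq> \<nu>" using \<nu>' True \<beta>r(2) by auto
    moreover have "\<nu>' \<in> orbit n \<mu>"
      unfolding \<nu>'_def using affW_orbit[OF iu] affW_orbit[OF s_affW[OF i]] vo orbit_trans by blast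
    moreover have "wl (s i \<circ> u) \<nu>' = v"
    proof -
      have "wl u \<nu>' = wl (s i) v" unfolding \<nu>'_def using wl_inv[OF iu, of "wl (s i) v"] affW_bij[OF u] by (simp add: inv_inv_eq)
      then show ?thesis unfolding wl_comp[OF s_affW[OF i] u] using wl_inv[OF s_affW[OF i], of v] i by simp
    qed
    ultimately have vS: "v \<in> ?S" by blast
    have "T i (xmon v) - lscale (if m > 0 then inverse (t i) else t i) (X (s i (v, 0)))
        = lscale (t i - inverse (t i)) (xmon v) + r" using r(2) True by simp
    then have D2: "?D = lscale (q powi k) (lscale (t i - inverse (t i)) (xmon v) + r)" unfolding D by simp
    have "keys ?D \<subseteq> keys (lscale (t i - inverse (t i)) (xmon v) + r)" unfolding D2 by (rule keys_lscale)
    also have "\<dots> \<subseteq> {v} \<union> low \<mu>"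
    proof -
      have "keys (lscale (t i - inverse (t i)) (xmon v)) \<subseteq> {v}" by (simp add: xmon_sg)
      then show ?thesis using keys_add[of "lscale (t i - inverse (t i)) (xmon v)" r] r(1) lowv by blast
    qed
    also have "\<dots> \<subseteq> ?S" using vS by blast
    finally show ?thesis .
  qed
qed

text \<open>Induction along a reduced word, with \<open>T_trail_step\<close> applied to the leading term and to every lower
  term of the same orbit.\<close>

lemma Tw_triangular:
  assumes "w \<in> affW" "\<And>\<beta>. \<beta> \<in> Inv w \<Longrightarrow> fht (fst \<beta>) < 0" "\<mu> \<in> Lam n"
  shows "keys (Tw w (xmon \<mu>) - lscale (cc w \<mu>) (X (w (\<mu>, 0)))) \<subseteq> trail w \<mu>"
  using assms(1,2)
proof (induction rule: affW_asc_induct)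
  case id
  have "Tw id (xmon \<mu>) - lscale (cc id \<mu>) (X (id (\<mu>, 0))) = 0"
    unfolding Tw_id cc_def Inv_id id_apply by simp
  then show ?case by (simp only: keys_zero empty_subsetI)
next
  case (step i u)
  note S = step.hyps(1,2,3)
  have i: "i \<le> n" and u: "u \<in> affW" using S by auto
  define c where "c = cc u \<mu>"
  define r where "r = Tw u (xmon \<mu>) - lscale c (X (u (\<mu>, 0)))"
  have neg: "fht (fst (inv u (a i))) < 0" 
    by (rule step.prems) (simp only: Inv_s(1)[OF u i S(3)] insertI1)
  have r: "keys r \<subseteq> trail u \<mu>"
    unfolding r_def c_def
  proof (rule step.IH)
    fix \<beta> assume "\<beta> \<in> Inv u"
    then show "fht (fst \<beta>) < 0" by (intro step.prems) (simp only: Inv_s(1)[OF u i S(3)] insertI2)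
  qed
  define f where "f = (if ip \<mu> (fst (inv u (a i))) > 0 then inverse (t i) else t i)"
  define D where "D = T i (X (u (\<mu>, 0))) - lscale f (X (s i (u (\<mu>, 0))))"
  have Dk: "keys D \<subseteq> trail (s i \<circ> u) \<mu>"
    unfolding D_def f_def trail_def by (rule T_trail_step[OF u i neg assms(3) orbit_refl])
  have Tr: "keys (T i r) \<subseteq> trail (s i \<circ> u) \<mu>"
  proof -
    have "keys (T i (xmon y)) \<subseteq> trail (s i \<circ> u) \<mu>" if y: "y \<in> trail u \<mu>" for y
    proof (cases "y \<in> low \<mu>")
      case True
      then have "keys (T i (xmon y)) \<subseteq> low \<mu>" by (intro keys_T_low i) (simp add: xmon_sg)
      then show ?thesis by (auto simp: trail_def)
    next
      case False
      then obtain \<nu> where \<nu>: "y = wl u \<nu>" "\<nu> \<in> orbit n \<mu>" "dle \<nu> \<mu>" "\<nu> \<noteq> \<mu>" using y by (auto simp: trail_def)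
      define k where "k = snd (u (\<nu>, 0))"
      define g where "g = (if ip \<nu> (fst (inv u (a i))) > 0 then inverse (t i) else t i)"
      define E where "E = T i (X (u (\<nu>, 0))) - lscale g (X (s i (u (\<nu>, 0))))"
      have "keys E \<subseteq> {wl (s i \<circ> u) \<nu>' |\<nu>'. \<nu>' \<in> orbit n \<mu> \<and> dle \<nu>' \<nu> \<and> \<nu>' \<noteq> \<nu>} \<union> low \<mu>"
        unfolding E_def g_def by (rule T_trail_step[OF u i neg assms(3) \<nu>(2)])
      also have "\<dots> \<subseteq> trail (s i \<circ> u) \<mu>"
      proof -
        have "\<nu>' \<noteq> \<mu> \<and> dle \<nu>' \<mu>" if "dle \<nu>' \<nu>" "\<nu>' \<in> orbit n \<mu>" "\<nu>' \<noteq> \<nu>" for \<nu>'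
          using that \<nu> dle_trans dle_antisym[of \<nu> \<mu>] orbit_Lam assms(3) by blast
        then show ?thesis unfolding trail_def by blast
      qed
      finally have E: "keys E \<subseteq> trail (s i \<circ> u) \<mu>" .
      have "X (u (\<nu>, 0)) = lscale (q powi k) (xmon y)"
        using X_level[of "wl u \<nu>" k] by (simp add: k_def \<nu>(1))
      then have "lscale (q powi k) (T i (xmon y)) = E + lscale g (X (s i (u (\<nu>, 0))))"
        using i by (simp add: E_def T_lscale)
      then have "T i (xmon y) = lscale (inverse (q powi k)) (E + lscale g (X (s i (u (\<nu>, 0)))))"
        by (metis lscale_lscale left_inverse lscale_simps(1) nzs(7) power_int_not_zero)
      then have "keys (T i (xmon y)) \<subseteq> keys (E + lscale g (X (s i (u (\<nu>, 0)))))" using keys_lscale by metis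
      also have "\<dots> \<subseteq> keys E \<union> keys (X (s i (u (\<nu>, 0))))"
        using keys_add[of E "lscale g (X (s i (u (\<nu>, 0))))"] keys_lscale[of g "X (s i (u (\<nu>, 0)))"] by blast
      also have "keys (X (s i (u (\<nu>, 0)))) \<subseteq> trail (s i \<circ> u) \<mu>"
        using \<nu> by (auto simp: keys_X trail_def)
      finally show ?thesis using E by blast
    qed
    then show ?thesis using keys_T[OF i, of r] r by blast
  qed
  have "Tw (s i \<circ> u) (xmon \<mu>) = T i (lscale c (X (u (\<mu>, 0))) + r)"
    using Tw_asc[of u i "xmon \<mu>"] step.hyps by (simp add: r_def)
  also have "\<dots> = lscale c (D + lscale f (X (s i (u (\<mu>, 0))))) + T i r"
    using i by (simp add: T_add T_lscale D_def)
  finally have e: "Tw (s i \<circ> u) (xmon \<mu>) = lscale c (D + lscale f (X (s i (u (\<mu>, 0))))) + T i r" .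
  have "Tw (s i \<circ> u) (xmon \<mu>) - lscale (cc (s i \<circ> u) \<mu>) (X ((s i \<circ> u) (\<mu>, 0))) = lscale c D + T i r"
    unfolding e cc_s[OF u i S(3)] comp_apply by (simp add: lscale_add f_def c_def mult.commute)
  moreover have "keys (lscale c D + T i r) \<subseteq> trail (s i \<circ> u) \<mu>"
    using keys_add[of "lscale c D" "T i r"] keys_lscale[of c D] Dk Tr by blast
  ultimately show ?case by (simp only:)
qed

lemma prod_alternating:
  fixes A B :: complex
  shows "(\<Prod>m\<in>{1..2 * int c}. if odd m then A else B) = (A * B) ^ c"
proof (induction c)
  case (Suc c)
  have "{1..2 * int (Suc c)} = insert (2 * int c + 2) (insert (2 * int c + 1) {1..2 * int c})" by auto
  then show ?case using Suc by simp
qed simp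

lemma gam_mon: "mon (gam p n \<mu>) v =
    (t0 p * tn p) powi ip (rho_l n \<mu>) v * tmid p powi ip (rho_m n \<mu>) v * q powi ip \<mu> v"
proof (rule lattice_hom_eq)
  have "nzp (gam p n \<mu>)" by (simp add: nzp_def gam_def)
  then show "mon (gam p n \<mu>) (u - v) = mon (gam p n \<mu>) u / mon (gam p n \<mu>) v" for u v by (rule mon_diff)
qed (simp_all add: power_int_diff gam_def)

lemma gam_nzp [simp]: "nzp (gam p n \<mu>)"
  by (simp add: nzp_def gam_def)

text \<open>For a long root the levels \<open>1, \<dots>, 2\<nu>\<^sub>i\<close> carry the labels \<open>t\<^sub>0\<close> and \<open>t\<^sub>n\<close> equally often, which gives
  \<open>(t\<^sub>0 t\<^sub>n)\<close> to the power \<open>\<plusminus>\<nu>\<^sub>i\<close>; the other roots give powers of \<open>t\<close>.\<close>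

lemma cc_tau:
  assumes \<nu>: "\<nu> \<in> Lam_plus n"
  shows "cc (tau \<nu>) \<mu> * q powi ip \<nu> \<mu> = mon (gam p n \<mu>) \<nu>"
proof -
  have sgn: "ip \<nu> \<alpha> \<ge> 0" if "\<alpha> \<in> Sigma_pos n" for \<alpha>
    using dominant_roots[OF \<nu>] that by (simp add: Sigma_pos_iff)
  define F where "F \<alpha> m = t_root p n (- \<alpha>, m) powi sgn1 (ip \<mu> \<alpha>)" for \<alpha> m
  have "cc (tau \<nu>) \<mu> = (\<Prod>x\<in>(SIGMA \<alpha>:Sigma_pos n. {1..ip \<nu> \<alpha>}). F (fst x) (snd x))"
    unfolding cc_def Inv_tau[OF \<nu>]
    by (subst prod.reindex) (auto simp: inj_on_def F_def sgn1_def power_int_minus intro!: prod.cong)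
  also have "\<dots> = (\<Prod>\<alpha>\<in>Sigma_pos n. \<Prod>m\<in>{1..ip \<nu> \<alpha>}. F \<alpha> m)"
    using finite_Sigma_pos by (subst prod.Sigma) (auto simp: case_prod_unfold)
  also have "Sigma_pos n = long_pos n \<union> mid_pos n" by (simp add: Sigma_pos_def)
  also have "(\<Prod>\<alpha>\<in>long_pos n \<union> mid_pos n. \<Prod>m\<in>{1..ip \<nu> \<alpha>}. F \<alpha> m) =
      (\<Prod>\<alpha>\<in>long_pos n. \<Prod>m\<in>{1..ip \<nu> \<alpha>}. F \<alpha> m) * (\<Prod>\<alpha>\<in>mid_pos n. \<Prod>m\<in>{1..ip \<nu> \<alpha>}. F \<alpha> m)"
  proof (rule prod.union_disjoint)
    show "finite (long_pos n)" "finite (mid_pos n)" using finite_Sigma_pos by (auto simp: Sigma_pos_def)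
    show "long_pos n \<inter> mid_pos n = {}" using mid_not_long by (auto simp: long_pos_iff mid_pos_iff)
  qed
  also have "(\<Prod>\<alpha>\<in>mid_pos n. \<Prod>m\<in>{1..ip \<nu> \<alpha>}. F \<alpha> m) = (\<Prod>\<alpha>\<in>mid_pos n. tmid p powi (sgn1 (ip \<mu> \<alpha>) * ip \<nu> \<alpha>))"
  proof (rule prod.cong)
    fix \<alpha> assume a: "\<alpha> \<in> mid_pos n"
    have "- \<alpha> \<in> mid_roots n" using a roots_uminus by (auto simp: mid_roots_def)
    then have "t_root p n (- \<alpha>, m) = tmid p" for m using mid_not_long by (simp add: t_root_def)
    moreover have "ip \<nu> \<alpha> \<ge> 0" using sgn a by (simp add: Sigma_pos_def)
    ultimately show "(\<Prod>m\<in>{1..ip \<nu> \<alpha>}. F \<alpha> m) = tmid p powi (sgn1 (ip \<mu> \<alpha>) * ip \<nu> \<alpha>)"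
      by (simp add: F_def power_int_mult) (metis int_nat_eq power_int_of_nat)
  qed simp
  also have "\<dots> = tmid p powi ip (rho_m n \<mu>) \<nu>"
    unfolding rho_m_sum by (simp add: ip_sum powi_sum ip_commute[of \<nu>])
  also have "(\<Prod>\<alpha>\<in>long_pos n. \<Prod>m\<in>{1..ip \<nu> \<alpha>}. F \<alpha> m) =
      (\<Prod>i\<in>{1..n}. \<Prod>m\<in>{1..ip \<nu> (frag_cmul 2 (eps i))}. F (frag_cmul 2 (eps i)) m)"
  proof -
    have "long_pos n = (\<lambda>i. frag_cmul 2 (eps i)) ` {1..n}" by (auto simp: long_pos_def)
    moreover have "inj_on (\<lambda>i. frag_cmul 2 (eps i)) {1..n}"
    proof (rule inj_onI)
      fix i j assume "frag_cmul 2 (eps i) = frag_cmul 2 (eps j)"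
      then have "lk (frag_cmul 2 (eps i)) i = lk (frag_cmul 2 (eps j)) i" by simp
      then show "i = j" by (simp split: if_splits)
    qed
    ultimately show ?thesis by (simp add: prod.reindex)
  qed
  also have "\<dots> = (\<Prod>i\<in>{1..n}. (t0 p * tn p) powi (sgn1 (lk \<mu> i) * lk \<nu> i))"
  proof (rule prod.cong)
    fix i assume i: "i \<in> {1..n}"
    have "- eps i \<in> units" using i by (auto simp: units_def)
    then have l: "frag_cmul (- 2) (eps i) \<in> long_roots n" unfolding long_roots_iff
      by (intro image_eqI[of _ _ "- eps i"]) auto
    define \<sigma> where "\<sigma> = sgn1 (lk \<mu> i)"
    have s2: "sgn1 (2 * lk \<mu> i) = \<sigma>" by (simp add: sgn1_def \<sigma>_def)
    have F: "F (frag_cmul 2 (eps i)) m = (if odd m then t0 p powi \<sigma> else tn p powi \<sigma>)" for m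
      using l by (simp add: F_def t_root_def s2)
    have "lk \<nu> i \<ge> 0" using \<nu> i by (auto simp: Lam_plus_def)
    then have c: "lk \<nu> i = int (nat (lk \<nu> i))" by simp
    have "(\<Prod>m\<in>{1..2 * int (nat (lk \<nu> i))}. if odd m then t0 p powi \<sigma> else tn p powi \<sigma>)
        = (t0 p * tn p) powi (\<sigma> * int (nat (lk \<nu> i)))"
      by (simp only: prod_alternating power_int_mult power_int_mult_distrib[of "t0 p" "tn p"] power_int_of_nat)
    then show "(\<Prod>m\<in>{1..ip \<nu> (frag_cmul 2 (eps i))}. F (frag_cmul 2 (eps i)) m) = (t0 p * tn p) powi (sgn1 (lk \<mu> i) * lk \<nu> i)"
      using c by (simp add: F \<sigma>_def)
  qed simp
  also have "\<dots> = (t0 p * tn p) powi ip (rho_l n \<mu>) \<nu>"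
  proof -
    have "rho_l n \<mu> \<in> Lam n" unfolding Lam_iff lk_rho_l by auto
    then have "ip (rho_l n \<mu>) \<nu> = (\<Sum>i=1..n. sgn1 (lk \<mu> i) * lk \<nu> i)"
      by (subst ip_Lam) (auto simp: lk_rho_l intro!: sum.cong)
    then show ?thesis by (simp add: powi_sum)
  qed
  finally show ?thesis by (simp add: gam_mon ip_commute[of \<nu>])
qed

text \<open>A dominant translation has only inversions with negative gradients and acts trivially on gradients,
  so \<open>Tw_triangular\<close> applies and its leading monomial is \<open>x\<^sup>\<mu>\<close> again.\<close>

theorem Y_triangular:
  assumes "\<nu> \<in> Lam_plus n" "\<mu> \<in> Lam n"
  shows "keys (Tw (tau \<nu>) (xmon \<mu>) - lscale (mon (gam p n \<mu>) \<nu>) (xmon \<mu>)) \<subseteq> below \<mu>"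
proof -
  have tW: "tau \<nu> \<in> affW" using tau_affW Lam_plus_Lam assms by blast
  have "fht (fst \<beta>) < 0" if "\<beta> \<in> Inv (tau \<nu>)" for \<beta>
    using that unfolding Inv_tau[OF assms(1)] by (auto simp: Sigma_pos_iff)
  from Tw_triangular[OF tW this assms(2)]
  have "keys (Tw (tau \<nu>) (xmon \<mu>) - lscale (cc (tau \<nu>) \<mu>) (X (tau \<nu> (\<mu>, 0)))) \<subseteq> trail (tau \<nu>) \<mu>" .
  moreover have "trail (tau \<nu>) \<mu> \<subseteq> below \<mu>"
    using below_iff[OF assms(2)] by (auto simp: trail_def tau_apply)
  moreover have "lscale (cc (tau \<nu>) \<mu>) (X (tau \<nu> (\<mu>, 0))) = lscale (mon (gam p n \<mu>) \<nu>) (xmon \<mu>)"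
    by (simp add: tau_apply X_level flip: cc_tau[OF assms(1)])
  ultimately show ?thesis by simp
qed

end

section \<open>Relations between the \<open>T\<^sub>i\<close> and the translations\<close>

context rank
begin

lemma additive_right: 
  assumes "w \<in> affW" "i \<le> n" "ht (w (a i)) > 0" shows "additive w (s i)"
  unfolding additive_def
proof (intro ballI impI)
  fix \<beta> assume b: "\<beta> \<in> affroots" "ht \<beta> > 0" "ht (s i \<beta>) < 0"
  then have "\<beta> = a i" using s_pos[OF assms(2) b(1,2)] by force
  then show "ht (w (s i \<beta>)) < 0" using assms by (simp add: affW_uminus)
qed

lemma additive_tau:
  assumes "\<nu> \<in> Lam_plus n" "\<nu>' \<in> Lam_plus n" shows "additive (tau \<nu>) (tau \<nu>')"
proof -
  have "Inv (tau \<nu>') \<subseteq> Inv (tau (\<nu> + \<nu>'))"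
    unfolding Inv_tau[OF assms(2)] Inv_tau[OF Lam_plus_add[OF assms]]
    using dominant_roots[OF assms(1)] by (fastforce simp: Sigma_pos_iff)
  then show ?thesis
    unfolding additive_def tau_comp[symmetric] Inv_def by (auto simp flip: tau_comp)
qed

lemma tau_simple: "1 \<le> i \<Longrightarrow> i \<le> n \<Longrightarrow> tau v (a i) = (fst (a i), ip v (fst (a i)))"
  by (cases "a i") (auto simp: tau_apply simple_root_def split: if_splits)

lemma snd_simple: "1 \<le> i \<Longrightarrow> i \<le> n \<Longrightarrow> snd (a i) = 0"
  by (auto simp: simple_root_def)

lemma fht_simple: "1 \<le> i \<Longrightarrow> i \<le> n \<Longrightarrow> fht (fst (a i)) = 2"
  using ht_simple[of i] by (simp add: ht_def snd_simple)

lemma cp_zero_iff: "i \<le> n \<Longrightarrow> cp i v = 0 \<longleftrightarrow> ip v (fst (a i)) = 0"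
  using cp_sign[of i v] by (metis sgn_0_0)

lemma s_tau:
  assumes "1 \<le> i" "i \<le> n" shows "s i \<circ> tau v = tau (wl (s i) v) \<circ> s i"
  by (rule tau_conj) (use assms finW_snd[OF s_finW[OF assms]] in auto)

lemma desc_tau:
  assumes "1 \<le> i" "i \<le> n" "v \<in> Lam n"
  shows "desc (tau v) i \<longleftrightarrow> ip v (fst (a i)) > 0"
proof -
  have r: "(fst (a i), - ip v (fst (a i))) \<in> affroots" using simple_affroots[OF assms(2)] by (simp add: affroots_def)
  have "inv (tau v) (a i) = (fst (a i), - ip v (fst (a i)))"
    using tau_simple[OF assms(1,2), of "- v"] by (simp add: tau_uminus)
  then show ?thesis unfolding desc_def using ht_roots(2,3)[OF r] fht_simple[OF assms(1,2)] by auto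
qed

lemma tau_pos:
  assumes "1 \<le> i" "i \<le> n" "ip v (fst (a i)) \<ge> 0" shows "ht (tau v (a i)) > 0"
proof -
  have r: "(fst (a i), ip v (fst (a i))) \<in> affroots" using simple_affroots[OF assms(2)] by (simp add: affroots_def)
  show ?thesis unfolding tau_simple[OF assms(1,2)] using ht_roots(3)[OF r] fht_simple[OF assms(1,2)] assms(3) by auto
qed

lemma om_Lam: "k \<le> n \<Longrightarrow> om k \<in> Lam n"
  using om_dominant Lam_plus_Lam by blast

lemma ht_level: "ht (v, m + k) = ht (v, m) + 4 * int n * k"
  by (simp add: ht_def algebra_simps)

text \<open>Lengths add in \<open>\<tau>(\<omega>\<^sub>i) s\<^sub>i \<tau>(\<omega>\<^sub>i)\<close> because \<open>\<langle>\<omega>\<^sub>i, a\<^sub>i\<rangle> = 1\<close>. This fails for \<open>i = n\<close>, where the pairing is 2.\<close>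

lemma additive_om:
  assumes i: "1 \<le> i" "i < n" shows "additive (tau (om i)) (s i \<circ> tau (om i))"
  unfolding additive_def
proof (intro ballI impI)
  have il: "i \<le> n" using i by simp
  fix \<beta> assume b: "\<beta> \<in> affroots" "ht \<beta> > 0" "ht ((s i \<circ> tau (om i)) \<beta>) < 0"
  obtain \<alpha> m where \<beta>: "\<beta> = (\<alpha>, m)" by (cases \<beta>)
  define \<alpha>' M where "\<alpha>' = wl (s i) \<alpha>" and "M = m + ip (om i) \<alpha>"
  have V: "(s i \<circ> tau (om i)) \<beta> = (\<alpha>', M)"
    using affW_level[of "s i" \<alpha> M] finW_snd[of "s i" "(\<alpha>, 0)"] i by (simp add: \<beta> tau_apply \<alpha>'_def M_def)
  have r: "\<alpha> \<in> roots" "(\<alpha>, 0) \<in> affroots" using b \<beta> by (auto simp: affroots_def)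
  have r': "\<alpha>' \<in> roots" "(\<alpha>', M) \<in> affroots"
    using affW_roots[of "s i" "(\<alpha>, 0)"] r il by (auto simp: \<alpha>'_def affroots_def)
  have W: "tau (om i) ((s i \<circ> tau (om i)) \<beta>) = (\<alpha>', M + ip (om i) \<alpha>')" unfolding V by (simp add: tau_apply)
  show "ht (tau (om i) ((s i \<circ> tau (om i)) \<beta>)) < 0"
  proof (cases "fht \<alpha>' < 0")
    case True
    then have "ip (om i) \<alpha>' \<le> 0" using dominant_roots[OF om_dominant[OF il], of "- \<alpha>'"] roots_uminus r' by simp
    then have "4 * int n * ip (om i) \<alpha>' \<le> 0" by (simp add: mult_nonneg_nonpos)
    then show ?thesis using b(3)[unfolded V] unfolding W ht_level by linarith
  next
    case False
    then have pos: "fht \<alpha>' > 0" using fht_roots(2)[OF r'(1)] by simp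
    have M: "M < 0"
    proof -
      have "\<not> ht (\<alpha>', M) > 0" using b(3) V by simp
      then show ?thesis using ht_roots(3)[OF r'(2)] pos by auto
    qed
    have mp: "m > 0 \<or> m = 0 \<and> fht \<alpha> > 0" using b ht_roots(3)[OF b(1)] by (simp add: \<beta>)
    have "fht \<alpha> < 0"
    proof (rule ccontr)
      assume "\<not> ?thesis"
      then have "fht \<alpha> > 0" using fht_roots(2)[OF r(1)] by simp
      then have "ip (om i) \<alpha> \<ge> 0" using dominant_roots[OF om_dominant[OF il]] r by blast
      then show False using M mp by (auto simp: M_def)
    qed
    then have m1: "m \<ge> 1" using mp by auto
    have "- (\<alpha>, 0 :: int) = a i"
    proof (rule ccontr)
      assume ne: "- (\<alpha>, 0 :: int) \<noteq> a i"
      have "ht (- (\<alpha>, 0 :: int)) > 0" using \<open>fht \<alpha> < 0\<close> by (simp add: ht_def)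
      then have "ht (s i (- (\<alpha>, 0))) > 0" using s_pos[OF il _ _ ne] affroots_uminus[OF r(2)] by simp
      moreover have "s i (- (\<alpha>, 0)) = - (\<alpha>', 0)"
        using affW_uminus[of "s i" "(\<alpha>, 0)"] finW_apply[of "s i" \<alpha>] i by (simp add: \<alpha>'_def)
      ultimately show False using pos by (simp add: ht_def)
    qed
    then have "\<alpha> = - fst (a i)" by (metis fst_uminus fst_conv minus_minus)
    then have "ip (om i) \<alpha> = - 1" using ip_om_simple[of i i] i by simp
    then show ?thesis using M m1 by (simp add: M_def)
  qed
qed

text \<open>The cyclic permutation \<open>s\<^bsub>n-1\<^esub> \<dots> s\<^sub>1\<close>.\<close>

lemma cyclic_exists:
  "Suc k \<le> n \<Longrightarrow> \<exists>g\<in>finW n. wl g (eps 1) = eps (Suc k) \<and> (\<forall>j. 1 \<le> j \<longrightarrow> j \<le> k \<longrightarrow> wl g (eps (Suc j)) = eps j) \<and>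
     (\<forall>j>Suc k. wl g (eps j) = eps j)"
proof (induction k)
  case 0
  show ?case by (intro bexI[of _ id]) auto
next
  case (Suc k)
  then obtain g where g: "g \<in> finW n" "wl g (eps 1) = eps (Suc k)"
    "\<And>j. 1 \<le> j \<Longrightarrow> j \<le> k \<Longrightarrow> wl g (eps (Suc j)) = eps j" "\<And>j. j > Suc k \<Longrightarrow> wl g (eps j) = eps j" by auto
  have gW: "g \<in> affW" using finW_affW g(1) .
  have sW: "s (Suc k) \<in> affW" using Suc by (intro s_affW) simp
  have c: "wl (s (Suc k) \<circ> g) v = wl (s (Suc k)) (wl g v)" for v by (rule wl_comp[OF sW gW])
  have sw: "wl (s (Suc k)) (eps j) = (if j = Suc k then eps (Suc (Suc k)) else if j = Suc (Suc k) then eps (Suc k) else eps j)" for j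
    using Suc.prems by (auto simp: wl_s simple_root_def cpair_def)
  show ?case
  proof (intro bexI[of _ "s (Suc k) \<circ> g"] conjI allI impI)
    show "s (Suc k) \<circ> g \<in> finW n" using comp_finW[OF s_finW g(1)] Suc.prems by simp
    show "wl (s (Suc k) \<circ> g) (eps 1) = eps (Suc (Suc k))" unfolding c g(2) sw by simp
    fix j assume j: "1 \<le> j" "j \<le> Suc k"
    show "wl (s (Suc k) \<circ> g) (eps (Suc j)) = eps j"
    proof (cases "j \<le> k")
      case True then show ?thesis unfolding c g(3)[OF j(1) True] sw by simp
    next
      case False then have "j = Suc k" using j by simp
      then show ?thesis unfolding c using g(4)[of "Suc j"] sw by simp
    qed
  next
    fix j assume "j > Suc (Suc k)"
    then show "wl (s (Suc k) \<circ> g) (eps j) = eps j" unfolding c using g(4)[of j] sw by simp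
  qed
qed

text \<open>Lengths add in the product \<open>s\<^sub>n \<tau>(\<omega>\<^sub>n) = g s\<^sub>0 h\<close>, in which \<open>g\<close> is the cyclic permutation taking
  \<open>\<epsilon>\<^sub>1\<close> to \<open>\<epsilon>\<^sub>n\<close>, and deleting \<open>s\<^sub>0\<close> leaves \<open>\<tau>(\<omega>\<^bsub>n-1\<^esub>)\<close>. So \<open>Y\<close> at \<open>\<omega>\<^sub>n\<close> and at \<open>\<omega>\<^bsub>n-1\<^esub>\<close> differ by \<open>T\<^sub>n\<close> and a
  conjugate of \<open>T\<^sub>0\<close>.\<close>

lemma om_n_factorization:
  obtains g h where "g \<in> affW" "h \<in> affW" "g \<circ> h = tau (om (n - 1))" "additive g h"
    "g \<circ> (s 0 \<circ> h) = s n \<circ> tau (om n)" "additive g (s 0 \<circ> h)" "\<not> desc h 0"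
proof -
  obtain g where g: "g \<in> finW n" "wl g (eps 1) = eps n" "\<And>j. 1 \<le> j \<Longrightarrow> j < n \<Longrightarrow> wl g (eps (Suc j)) = eps j"
    using cyclic_exists[of "n - 1"] n2 by force
  have gW: "g \<in> affW" using finW_affW g(1) .
  have iW: "inv g \<in> affW" "inv g \<in> finW n" using gW inv_finW g(1) by auto
  define G where "G v = wl (inv g) v" for v
  have Gn: "G (eps n) = eps 1" unfolding G_def using wl_inv[OF gW, of "eps 1"] g(2) by simp
  have Gj: "G (eps j) = eps (Suc j)" if "1 \<le> j" "j < n" for j
    unfolding G_def using wl_inv[OF gW, of "eps (Suc j)"] g(3)[OF that] by simp
  have G_minus: "G (- v) = - G v" for v
    using fst_affW_uminus[OF iW(1), of v] by (simp add: G_def)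
  have ig: "inv g (v, m) = (G v, m)" for v m
    using affW_level[OF iW(1), of v m] finW_snd[OF iW(2), of "(v, 0)"] by (simp add: G_def)
  have gG: "g (G v, m) = (v, m)" for v m using inv_affW_cancel(2)[OF gW, of "(v, m)"] ig by simp
  have G_Lam: "G v \<in> roots" if "v \<in> roots" for v
    using affW_roots[OF iW(1), of "(v, 0)"] that ig by (simp add: affroots_def)
  \<comment> \<open>The inverse of \<open>g\<close> moves \<open>\<epsilon>\<^sub>n\<close> to the front, so it only makes the roots \<open>\<epsilon>\<^sub>i - \<epsilon>\<^sub>n\<close> negative.\<close>
  have Gpos: "fht (G \<alpha>) > 0" if r: "\<alpha> \<in> roots" and h: "fht \<alpha> > 0" "lk \<alpha> n \<ge> 0" for \<alpha>
  proof -
    obtain e e' where e: "e \<in> units" "e' \<in> units" "\<alpha> = e + e'" using r unfolding roots_def by blast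
    have GE: "fht (G E) > 0" if "E = eps i" "1 \<le> i" "i \<le> n" for E i
      using that Gn Gj[of i] n2 by (cases "i = n") (auto simp: fht_eps)
    have *: "fht (G (E + E')) > 0" if E: "E \<in> units" "E' \<in> units" "fht (E + E') > 0" "lk (E + E') n \<ge> 0" "fht E > 0" for E E'
    proof -
      obtain i where i: "1 \<le> i" "i \<le> n" "E = eps i" using E by (auto simp: units_def fht_eps)
      obtain j where j: "1 \<le> j" "j \<le> n" "E' = eps j \<or> E' = - eps j" using E by (auto simp: units_def)
      have lin: "G (E + E') = G E + G E'" unfolding G_def by (rule wl_lin(1)[OF iW(1)])
      show ?thesis
      proof (cases "E' = eps j")
        case True then show ?thesis using GE i j lin by (simp add: add_pos_pos)
      next
        case False
        then have e': "E' = - eps j" using j by simp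
        have "i < j" using E(3) i j by (simp add: e' fht_eps)
        moreover have "j < n" using E(4) i j \<open>i < j\<close> by (cases "j = n") (auto simp: e' lookup_add lookup_minus)
        ultimately show ?thesis using lin i j Gj[of i] Gj[of j] by (simp add: e' G_minus fht_eps)
      qed
    qed
    have "fht e > 0 \<or> fht e' > 0" using h e by auto
    then show ?thesis using *[of e e'] *[of e' e] h e by (auto simp: add.commute)
  qed
  define h where "h = inv g \<circ> tau (om (n - 1))"
  have tW: "tau (om k) \<in> affW" if "k \<le> n" for k using tau_affW om_Lam that by blast
  have hW: "h \<in> affW" unfolding h_def by (rule comp_affW[OF iW(1) tW]) simp
  have gh: "g \<circ> h = tau (om (n - 1))" by (rule ext) (simp add: h_def gW)
  have hb: "h (v, m) = (G v, m + ip (om (n - 1)) v)" for v m by (simp add: h_def tau_apply ig)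
  have omn: "om n = om (n - 1) + eps n" using om_Suc[of "n - 1"] n2 by simp
  have sn: "s n (v, m) = (v - frag_cmul (2 * lk v n) (eps n), m)" for v m
    using n2 by (simp add: s_def prod_eq_iff simple_root_def cpair_def mult.commute)
  have G1: "lk (G v) 1 = lk v n" for v
  proof -
    have "ip (G v) (G (eps n)) = ip v (eps n)" unfolding G_def by (rule wl_ip[OF iW(1)])
    then show ?thesis by (simp add: Gn)
  qed
  have s0h: "s 0 (h (v, m)) = inv g ((s n \<circ> tau (om n)) (v, m))" for v m
  proof -
    have "s 0 (h (v, m)) = (G v - frag_cmul (2 * lk v n) (eps 1), m + ip (om (n - 1)) v + lk v n)"
      unfolding hb using G1[of v] by (simp add: s_def prod_eq_iff simple_root_def cpair_def mult.commute)
    moreover have "G (v - frag_cmul (2 * lk v n) (eps n)) = G v - frag_cmul (2 * lk v n) (eps 1)"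
      using wl_lin(2,3)[OF iW(1)] Gn by (simp add: G_def)
    ultimately show ?thesis by (simp add: tau_apply sn ig omn add.assoc)
  qed
  have V: "g \<circ> (s 0 \<circ> h) = s n \<circ> tau (om n)"
  proof
    fix f show "(g \<circ> (s 0 \<circ> h)) f = (s n \<circ> tau (om n)) f"
      using s0h[of "fst f" "snd f"] inv_affW_cancel(2)[OF gW] by simp
  qed
  have "additive g h" unfolding additive_def
  proof (intro ballI impI)
    fix \<beta> assume b: "\<beta> \<in> affroots" "ht \<beta> > 0" "ht (h \<beta>) < 0"
    obtain \<alpha> m where \<beta>: "\<beta> = (\<alpha>, m)" by (cases \<beta>)
    define M where "M = m + ip (om (n - 1)) \<alpha>"
    have r: "\<alpha> \<in> roots" "(\<alpha>, m) \<in> affroots" "(\<alpha>, M) \<in> affroots" "(G \<alpha>, M) \<in> affroots"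
      using b \<beta> G_Lam by (auto simp: affroots_def)
    have e: "h \<beta> = (G \<alpha>, M)" "g (h \<beta>) = (\<alpha>, M)" using hb \<beta> gG by (simp_all add: M_def)
    show "ht (g (h \<beta>)) < 0"
    proof (rule ccontr)
      assume "\<not> ?thesis"
      then have "ht (\<alpha>, M) > 0" using ht_roots(2)[OF r(3)] e by simp
      moreover have "\<not> ht (G \<alpha>, M) > 0" using b(3) e by simp
      ultimately have M0: "M = 0" "fht \<alpha> > 0" "\<not> fht (G \<alpha>) > 0"
        using ht_roots(3)[OF r(3)] ht_roots(3)[OF r(4)] by auto
      have "ip (om (n - 1)) \<alpha> \<ge> 0" using dominant_roots[OF om_dominant r(1)] M0 by simp
      moreover have "m \<ge> 0" using b(2) ht_roots(3)[OF r(2)] \<beta> by auto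
      ultimately have z: "ip (om (n - 1)) \<alpha> = 0" using M0 by (simp add: M_def)
      have "ip (om n) \<alpha> \<ge> 0" using dominant_roots[OF om_dominant r(1)] M0 by simp
      then have "lk \<alpha> n \<ge> 0" using z by (simp add: omn)
      then show False using Gpos[OF r(1)] M0 by blast
    qed
  qed
  moreover have "additive g (s 0 \<circ> h)" unfolding additive_def
  proof (intro ballI impI)
    fix \<beta> assume b: "\<beta> \<in> affroots" "ht \<beta> > 0" "ht ((s 0 \<circ> h) \<beta>) < 0"
    obtain \<alpha> m where \<beta>: "\<beta> = (\<alpha>, m)" by (cases \<beta>)
    define \<alpha>' M where "\<alpha>' = wl (s n) \<alpha>" and "M = m + ip (om n) \<alpha>"
    have sb: "(s n \<circ> tau (om n)) \<beta> = (\<alpha>', M)" by (simp add: \<beta> tau_apply sn \<alpha>'_def M_def)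
    have r: "\<alpha> \<in> roots" "(\<alpha>, m) \<in> affroots" using b \<beta> by (auto simp: affroots_def)
    have r': "\<alpha>' \<in> roots"
      using affW_roots[of "s n" "(\<alpha>, 0)"] r by (simp add: affroots_def \<alpha>'_def)
    then have r'': "(\<alpha>', M) \<in> affroots" "(G \<alpha>', M) \<in> affroots" using G_Lam by (auto simp: affroots_def)
    have e: "(s 0 \<circ> h) \<beta> = (G \<alpha>', M)" using s0h[of \<alpha> m] sb ig by (simp add: \<beta>)
    have e2: "g ((s 0 \<circ> h) \<beta>) = (\<alpha>', M)" unfolding e by (rule gG)
    show "ht (g ((s 0 \<circ> h) \<beta>)) < 0"
    proof (rule ccontr)
      assume "\<not> ?thesis"
      then have "ht (\<alpha>', M) > 0" using ht_roots(2)[OF r''(1)] e2 by simp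
      moreover have "\<not> ht (G \<alpha>', M) > 0" using b(3) e by simp
      ultimately have M0: "M = 0" "fht \<alpha>' > 0" "\<not> fht (G \<alpha>') > 0"
        using ht_roots(3)[OF r''(1)] ht_roots(3)[OF r''(2)] by auto
      have neg: "lk \<alpha>' n < 0" using Gpos[OF r'] M0 by force
      have "wl (s n) (om n) = om (n - 1) - eps n"
        by (rule poly_mapping_eqI) (use n2 in \<open>auto simp: sn lookup_minus\<close>)
      then have "ip (om n) \<alpha> = ip (om (n - 1)) \<alpha>' - lk \<alpha>' n"
        using wl_ip[of "s n" "om n" \<alpha>] by (simp add: \<alpha>'_def[symmetric])
      moreover have "ip (om (n - 1)) \<alpha>' \<ge> 0" using dominant_roots[OF om_dominant r'] M0 by simp
      moreover have "m \<ge> 0" using b(2) ht_roots(3)[OF r(2)] \<beta> by auto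
      ultimately show False using neg M0 by (simp add: M_def)
    qed
  qed
  moreover have "\<not> desc h 0"
  proof -
    have "h (- frag_cmul 2 (eps n), 1) = a 0"
    proof -
      have "G (- frag_cmul 2 (eps n)) = - frag_cmul 2 (eps 1)"
        using wl_lin(3)[OF iW(1), of 2 "eps n"] Gn by (simp add: G_minus G_def[symmetric] del: minus_frag_cmul)
      then show ?thesis unfolding hb using n2 by (simp add: simple_root_def)
    qed
    then have "inv h (a 0) = (- frag_cmul 2 (eps n), 1)" using inv_affW_cancel(1)[OF hW] by metis
    then show ?thesis using n2 by (simp add: desc_def ht_def fht_eps del: minus_frag_cmul)
  qed
  ultimately show thesis using that[OF gW hW gh _ V] by blast
qed

end

context params
begin

lemma Tword_lin:
  assumes "set is \<subseteq> {0..n}"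
  shows "Tword is (f + g) = Tword is f + Tword is g" "Tword is (lscale c f) = lscale c (Tword is f)"
  using assms by (induction "is") (auto simp: T_add T_lscale)

lemma some_reduced_set: "w \<in> affW \<Longrightarrow> set (some_reduced n w) \<subseteq> {0..n}"
  using some_reduced[of w] by (simp add: reduced_expr_def)

lemma Tw_add: "w \<in> affW \<Longrightarrow> Tw w (f + g) = Tw w f + Tw w g"
  and Tw_lscale: "w \<in> affW \<Longrightarrow> Tw w (lscale c f) = lscale c (Tw w f)"
  by (simp_all add: Tw_some Tword_lin some_reduced_set)

lemma Tw_zero: "w \<in> affW \<Longrightarrow> Tw w 0 = 0"
  using Tw_lscale[of w 0 0] by simp

lemma Tw_uminus: "w \<in> affW \<Longrightarrow> Tw w (- f) = - Tw w f"
  using Tw_lscale[of w "- 1" f] by (simp add: lscale_uminus)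

lemma Tw_diff: "w \<in> affW \<Longrightarrow> Tw w (f - g) = Tw w f - Tw w g"
  using Tw_add[of w f "- g"] Tw_uminus[of w g] by simp

lemma Tw_sum: "w \<in> affW \<Longrightarrow> Tw w (sum f A) = (\<Sum>x\<in>A. Tw w (f x))"
  by (induction A rule: infinite_finite_induct) (auto simp: Tw_add Tw_zero)

definition Tinv :: "nat \<Rightarrow> laurent \<Rightarrow> laurent" where
  "Tinv i f = T i f - lscale (t i - 1 / t i) f"

lemma T_Tinv: "i \<le> n \<Longrightarrow> T i (Tinv i f) = f"
  using T_quadratic[of i f] by (simp add: Tinv_def T_diff T_lscale)

lemma Tinv_T: "i \<le> n \<Longrightarrow> Tinv i (T i f) = f"
  using T_quadratic[of i f] by (simp add: Tinv_def)

lemma Tinv_Lam: "i \<le> n \<Longrightarrow> keys f \<subseteq> Lam n \<Longrightarrow> keys (Tinv i f) \<subseteq> Lam n"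
  unfolding Tinv_def using keys_minus[of "T i f" "lscale (t i - 1 / t i) f"] keys_T_Lam[of i f] keys_lscale[of _ f] by blast

lemma Tword_bij: "set is \<subseteq> {0..n} \<Longrightarrow>
    \<exists>S. (\<forall>f. S (Tword is f) = f \<and> Tword is (S f) = f \<and> (keys f \<subseteq> Lam n \<longrightarrow> keys (S f) \<subseteq> Lam n))"
proof (induction "is")
  case (Cons i "is")
  then obtain S where S: "\<And>f. S (Tword is f) = f" "\<And>f. Tword is (S f) = f" "\<And>f. keys f \<subseteq> Lam n \<Longrightarrow> keys (S f) \<subseteq> Lam n"
    by auto
  have i: "i \<le> n" using Cons by simp
  show ?case by (rule exI[of _ "\<lambda>f. S (Tinv i f)"]) (simp add: S Tinv_T[OF i] T_Tinv[OF i] Tinv_Lam[OF i])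
qed (auto intro: exI[of _ id])

lemma Tw_bij: "w \<in> affW \<Longrightarrow>
    \<exists>S. (\<forall>f. S (Tw w f) = f \<and> Tw w (S f) = f \<and> (keys f \<subseteq> Lam n \<longrightarrow> keys (S f) \<subseteq> Lam n))"
  unfolding Tw_some by (rule Tword_bij) (rule some_reduced_set)

abbreviation Y :: "lattice_vec \<Rightarrow> laurent \<Rightarrow> laurent" where "Y \<nu> \<equiv> Tw (tau \<nu>)"

lemma Y_add: "\<nu> \<in> Lam_plus n \<Longrightarrow> \<nu>' \<in> Lam_plus n \<Longrightarrow> Y (\<nu> + \<nu>') f = Y \<nu> (Y \<nu>' f)"
  using Tw_mult[of "tau \<nu>" "tau \<nu>'" f] additive_tau[of \<nu> \<nu>'] tau_affW Lam_plus_Lam by (simp only: tau_comp)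

lemma Y_commute: "\<nu> \<in> Lam_plus n \<Longrightarrow> \<nu>' \<in> Lam_plus n \<Longrightarrow> Y \<nu> (Y \<nu>' f) = Y \<nu>' (Y \<nu> f)"
  using Y_add[of \<nu> \<nu>' f] Y_add[of \<nu>' \<nu> f] by (simp only: add.commute)

lemma Y_T_right:
  assumes "1 \<le> i" "i \<le> n" "\<nu> \<in> Lam n" "ip \<nu> (fst (a i)) \<ge> 0"
  shows "Tw (tau \<nu> \<circ> s i) f = Y \<nu> (T i f)"
  using Tw_mult[OF tau_affW[OF assms(3)] s_affW[OF assms(2)] additive_right[OF tau_affW[OF assms(3)] assms(2) tau_pos[OF assms(1,2,4)]]]
    Tw_s[OF assms(2)] by (simp only:)

text \<open>Both sides are \<open>T\<close> of the element \<open>s\<^sub>i \<tau>(\<nu>) = \<tau>(\<nu>) s\<^sub>i\<close>, which is longer than \<open>\<tau>(\<nu>)\<close>.\<close>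

lemma T_Y_commute:
  assumes i: "1 \<le> i" "i \<le> n" and \<nu>: "\<nu> \<in> Lam n" "ip \<nu> (fst (a i)) = 0"
  shows "T i (Y \<nu> f) = Y \<nu> (T i f)"
proof -
  have "cp i \<nu> = 0" using cp_zero_iff \<nu> i by blast
  then have "wl (s i) \<nu> = \<nu>" using i by (simp add: wl_s)
  then have e: "s i \<circ> tau \<nu> = tau \<nu> \<circ> s i" using s_tau[OF i, of \<nu>] by (simp only:)
  have "T i (Y \<nu> f) = Tw (s i \<circ> tau \<nu>) f"
    using Tw_asc[OF tau_affW[OF \<nu>(1)] i(2)] desc_tau[OF i \<nu>(1)] \<nu>(2) by (metis less_irrefl)
  then show ?thesis unfolding e using Y_T_right[OF i \<nu>(1)] \<nu>(2) by simp
qed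

lemma Y_desc:
  assumes i: "1 \<le> i" "i \<le> n" and \<nu>: "\<nu> \<in> Lam n" "ip \<nu> (fst (a i)) > 0"
  shows "Y \<nu> f = T i (Tw (s i \<circ> tau \<nu>) f)"
proof -
  have tW: "tau \<nu> \<in> affW" using tau_affW \<nu> by blast
  have "desc (tau \<nu>) i" using desc_tau i \<nu> by blast
  then have "\<not> desc (s i \<circ> tau \<nu>) i" using desc_s tW i by blast
  then have "Tw (s i \<circ> (s i \<circ> tau \<nu>)) f = T i (Tw (s i \<circ> tau \<nu>) f)"
    by (rule Tw_asc[OF comp_affW[OF s_affW[OF i(2)] tW] i(2)])
  then show ?thesis unfolding s_s_comp[OF i(2)] .
qed

text \<open>The Bernstein relation between \<open>T\<^sub>i\<close> and \<open>Y\<close> at \<open>\<omega>\<^sub>i\<close>, from the two factorizations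
  \<open>\<tau>(\<omega>\<^sub>i) (s\<^sub>i \<tau>(\<omega>\<^sub>i)) = \<tau>(\<omega>\<^bsub>i-1\<^esub> + \<omega>\<^bsub>i+1\<^esub>) s\<^sub>i\<close> with additive lengths.\<close>

lemma om_relation:
  assumes i: "1 \<le> i" "i < n"
  shows "Y (om i) (Tinv i (Y (om i) f)) = Y (om (i - 1)) (Y (om (Suc i)) (T i f))"
proof -
  have il: "i \<le> n" using i by simp
  have oL: "om i \<in> Lam n" using om_Lam il by blast
  have tW: "tau (om i) \<in> affW" using tau_affW oL by blast
  have "Y (om i) f = T i (Tw (s i \<circ> tau (om i)) f)"
    using Y_desc[OF i(1) il oL] ip_om_simple[of i i] i by simp
  then have "Tinv i (Y (om i) f) = Tw (s i \<circ> tau (om i)) f" using Tinv_T[OF il] by simp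
  then have "Y (om i) (Tinv i (Y (om i) f)) = Tw (tau (om i) \<circ> (s i \<circ> tau (om i))) f"
    using Tw_mult[OF tW comp_affW[OF s_affW[OF il] tW] additive_om[OF i]] by simp
  also have "tau (om i) \<circ> (s i \<circ> tau (om i)) = tau (om (i - 1) + om (Suc i)) \<circ> s i"
  proof -
    have "om i + wl (s i) (om i) = om (i - 1) + om (Suc i)"
    proof -
      have "cp i (om i) = 1" using i by (simp add: cpair_def)
      then have "wl (s i) (om i) = om i - (eps i - eps (Suc i))" using i by (simp add: wl_s simple_root_def)
      moreover have "om i = om (i - 1) + eps i" using om_Suc[of "i - 1"] i by simp
      ultimately show ?thesis by (simp add: om_Suc)
    qed
    then show ?thesis unfolding s_tau[OF i(1) il] comp_assoc[symmetric] tau_comp by simp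
  qed
  also have "Tw (tau (om (i - 1) + om (Suc i)) \<circ> s i) f = Y (om (i - 1) + om (Suc i)) (T i f)"
  proof (rule Y_T_right[OF i(1) il])
    show "om (i - 1) + om (Suc i) \<in> Lam n" using om_Lam i by (intro Lam_add) auto
    show "ip (om (i - 1) + om (Suc i)) (fst (a i)) \<ge> 0"
      using ip_om_simple[of i "i - 1"] ip_om_simple[of i "Suc i"] i by (cases "i = 1") auto
  qed
  also have "\<dots> = Y (om (i - 1)) (Y (om (Suc i)) (T i f))"
    using i by (intro Y_add om_dominant) auto
  finally show ?thesis .
qed

text \<open>The operator \<open>U\<close> is \<open>T\<^sub>g T\<^sub>0 T\<^sub>g\<^sup>-\<^sup>1\<close>. Only its quadratic relation matters afterwards, so it is left abstract.\<close>

lemma om_n_relation: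
  obtains U where "\<And>f. Y (om n) f = T n (U (Y (om (n - 1)) f))"
    "\<And>f. U (U f) = lscale (t0 p - 1 / t0 p) (U f) + f"
    "\<And>f g. U (f + g) = U f + U g" "\<And>c f. U (lscale c f) = lscale c (U f)"
proof -
  obtain g h where gh: "g \<in> affW" "h \<in> affW" "g \<circ> h = tau (om (n - 1))" "additive g h"
    "g \<circ> (s 0 \<circ> h) = s n \<circ> tau (om n)" "additive g (s 0 \<circ> h)" "\<not> desc h 0"
    using om_n_factorization by blast
  obtain S where S: "\<And>f. S (Tw g f) = f" "\<And>f. Tw g (S f) = f" using Tw_bij[OF gh(1)] by blast
  define U where "U f = Tw g (T 0 (S f))" for f
  have Sadd: "S (f + f') = S f + S f'" for f f' by (metis S Tw_add[OF gh(1)])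
  have Ssc: "S (lscale c f) = lscale c (S f)" for c f by (metis S Tw_lscale[OF gh(1)])
  show thesis
  proof (rule that[of U])
    fix f
    have "Y (om n) f = T n (Tw (s n \<circ> tau (om n)) f)"
      using Y_desc[of n "om n"] om_Lam[of n] ip_om_simple[of n n] n2 by simp
    also have "\<dots> = T n (Tw g (Tw (s 0 \<circ> h) f))"
      unfolding gh(5)[symmetric] using Tw_mult[OF gh(1) comp_affW[OF s_affW gh(2)] gh(6)] by simp
    also have "\<dots> = T n (Tw g (T 0 (Tw h f)))" using Tw_asc[OF gh(2) _ gh(7)] by simp
    also have "\<dots> = T n (U (Tw g (Tw h f)))" by (simp add: U_def S)
    also have "Tw g (Tw h f) = Y (om (n - 1)) f" using Tw_mult[OF gh(1,2,4)] gh(3) by metis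
    finally show "Y (om n) f = T n (U (Y (om (n - 1)) f))" .
    show "U (U f) = lscale (t0 p - 1 / t0 p) (U f) + f"
      using T_quadratic[of 0 "S f"] gh(1) by (simp add: U_def S Tw_add Tw_lscale t_simple_def)
  qed (simp_all add: U_def Sadd Ssc T_add T_lscale Tw_add Tw_lscale gh(1))
qed

end

section \<open>The spectral points\<close>

context rank
begin

lemma wl_s_perm:
  assumes i: "1 \<le> i" "i \<le> n" and A: "A = long_pos n \<or> A = mid_pos n"
  shows "bij_betw (wl (s i)) (A - {fst (a i)}) (A - {fst (a i)})"
proof -
  have sW: "s i \<in> affW" using i by simp
  have inv: "wl (s i) (wl (s i) v) = v" for v using wl_inv[OF sW, of v] i by simp
  have in_roots: "\<alpha> \<in> roots" "fht \<alpha> > 0" if "\<alpha> \<in> A" for \<alpha>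
    using that A by (auto simp: long_pos_iff mid_pos_iff roots_iff)
  have ai: "a i = (fst (a i), 0)" using snd_simple[OF i] by (simp add: prod_eq_iff)
  have maps: "wl (s i) \<alpha> \<in> A - {fst (a i)}" if \<alpha>: "\<alpha> \<in> A - {fst (a i)}" for \<alpha>
  proof -
    have r: "(\<alpha>, 0) \<in> affroots" "ht (\<alpha>, 0) > 0" using in_roots \<alpha> by (auto simp: affroots_def ht_def)
    have ne: "(\<alpha>, 0) \<noteq> a i" using \<alpha> by (metis Diff_iff fst_conv insertI1)
    have "ht (s i (\<alpha>, 0)) > 0" by (rule s_pos[OF i(2) r ne])
    then have pos: "fht (wl (s i) \<alpha>) > 0" using finW_snd[OF s_finW[OF i], of "(\<alpha>, 0)"] by (simp add: ht_def)
    have "wl (s i) \<alpha> \<in> roots" using affW_roots[OF sW r(1)] by (simp add: affroots_def)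
    moreover have l: "wl (s i) \<alpha> \<in> long_roots n \<longleftrightarrow> \<alpha> \<in> long_roots n"
      using affW_long_iff[OF sW, of "(\<alpha>, 0)"] by simp
    ultimately have m: "wl (s i) \<alpha> \<in> mid_roots n" if "\<alpha> \<notin> long_roots n" using that by (simp add: roots_iff)
    have "wl (s i) \<alpha> \<in> A"
      using A
    proof
      assume "A = long_pos n"
      then show ?thesis using \<alpha> l pos by (simp add: long_pos_iff)
    next
      assume "A = mid_pos n"
      then show ?thesis using \<alpha> m pos mid_not_long by (simp add: mid_pos_iff)
    qed
    moreover have "wl (s i) \<alpha> \<noteq> fst (a i)"
    proof
      assume "wl (s i) \<alpha> = fst (a i)"
      then have "\<alpha> = wl (s i) (fst (a i))" using inv[of \<alpha>] by simp
      also have "\<dots> = - fst (a i)" using i ai s_simple[of i] by (metis fst_uminus)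
      finally show False using in_roots(2)[of \<alpha>] \<alpha> fht_simple[OF i] by simp
    qed
    ultimately show ?thesis by blast
  qed
  have img: "wl (s i) ` (A - {fst (a i)}) \<subseteq> A - {fst (a i)}" by (rule image_subsetI) (rule maps)
  show ?thesis
    by (rule bij_betw_byWitness[where f' = "wl (s i)", OF _ _ img img]) (simp_all add: inv)
qed

lemma wl_s_simple: "1 \<le> i \<Longrightarrow> i \<le> n \<Longrightarrow> wl (s i) (fst (a i)) = - fst (a i)"
  by (rule poly_mapping_eqI) (simp add: wl_s lookup_minus)

lemma wl_s_s: "1 \<le> i \<Longrightarrow> i \<le> n \<Longrightarrow> wl (s i) (wl (s i) v) = v"
  using wl_inv[of "s i" v] by simp

lemma ip_wl_s: "1 \<le> i \<Longrightarrow> i \<le> n \<Longrightarrow> ip (wl (s i) u) v = ip u (wl (s i) v)"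
  using wl_ip[of "s i" u "wl (s i) v"] wl_s_s[of i v] by simp

lemma wl_sum: "w \<in> affW \<Longrightarrow> wl w (sum f A) = (\<Sum>x\<in>A. wl w (f x))"
proof (induction A rule: infinite_finite_induct)
  case (insert x A)
  then show ?case by (simp add: wl_lin)
qed (use affW_zero[of w] in \<open>simp_all add: zero_prod_def\<close>)

text \<open>The vectors \<open>\<rho>\<^sub>l(\<mu>)\<close> and \<open>\<rho>\<^sub>m(\<mu>)\<close> are sums of positive roots with signs, and a simple reflection permutes
  all positive roots but one; the exceptional root changes sign unless \<open>\<mu>\<close> is orthogonal to it.\<close>

lemma rho_m_s:
  assumes i: "1 \<le> i" "i \<le> n"
  shows "wl (s i) (rho_m n (wl (s i) \<mu>)) = rho_m n \<mu> - (if i < n \<and> cp i \<mu> = 0 then frag_cmul 2 (fst (a i)) else 0)"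
proof -
  have sW: "s i \<in> affW" using i by simp
  let ?f = "\<lambda>\<mu> \<alpha>. frag_cmul (sgn1 (ip \<mu> \<alpha>)) \<alpha>"
  define R where "R = (\<Sum>\<alpha>\<in>mid_pos n - {fst (a i)}. ?f \<mu> \<alpha>)"
  have fin: "finite (mid_pos n)" using finite_Sigma_pos by (simp add: Sigma_pos_def)
  have img: "wl (s i) (?f (wl (s i) \<mu>) \<alpha>) = ?f \<mu> (wl (s i) \<alpha>)" for \<alpha>
    using wl_lin(3)[OF sW] ip_wl_s[OF i] by simp
  have R': "(\<Sum>\<alpha>\<in>mid_pos n - {fst (a i)}. wl (s i) (?f (wl (s i) \<mu>) \<alpha>)) = R"
    unfolding img R_def by (rule sum.reindex_bij_betw[OF wl_s_perm[OF i]]) simp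
  show ?thesis
  proof (cases "i < n")
    case True
    have "fst (a i) \<in> mid_roots n" using simple_mid[OF i(1) True] .
    then have am: "fst (a i) \<in> mid_pos n" using fht_simple[OF i] by (simp add: mid_pos_iff)
    have 1: "rho_m n \<mu> = ?f \<mu> (fst (a i)) + R"
      unfolding rho_m_sum R_def by (rule sum.remove[OF fin am])
    have 2: "wl (s i) (rho_m n (wl (s i) \<mu>)) = ?f \<mu> (- fst (a i)) + R"
    proof -
      have "wl (s i) (rho_m n (wl (s i) \<mu>)) = (\<Sum>\<alpha>\<in>mid_pos n. wl (s i) (?f (wl (s i) \<mu>) \<alpha>))"
        unfolding rho_m_sum by (rule wl_sum[OF sW])
      also have "\<dots> = wl (s i) (?f (wl (s i) \<mu>) (fst (a i))) + R"
        unfolding R'[symmetric] by (rule sum.remove[OF fin am])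
      finally show ?thesis unfolding img wl_s_simple[OF i] .
    qed
    have "cp i \<mu> = 0 \<longleftrightarrow> ip \<mu> (fst (a i)) = 0" using cp_zero_iff i by blast
    then show ?thesis unfolding 1 2 using True
      by (auto simp: sgn1_def poly_mapping_eq_iff fun_eq_iff lookup_add lookup_minus)
  next
    case False
    have "fst (a i) \<notin> mid_pos n"
      using False i simple_long mid_not_long by (auto simp: mid_pos_iff)
    then have "mid_pos n - {fst (a i)} = mid_pos n" by blast
    then show ?thesis using R' R_def False unfolding rho_m_sum wl_sum[OF sW] by simp
  qed
qed

lemma rho_l_s:
  assumes i: "1 \<le> i" "i \<le> n"
  shows "wl (s i) (rho_l n (wl (s i) \<mu>)) = rho_l n \<mu> - (if i = n \<and> cp i \<mu> = 0 then fst (a i) else 0)"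
proof (rule poly_mapping_eqI)
  fix k
  show "lk (wl (s i) (rho_l n (wl (s i) \<mu>))) k = lk (rho_l n \<mu> - (if i = n \<and> cp i \<mu> = 0 then fst (a i) else 0)) k"
    using i n2 by (auto simp: wl_s lookup_minus lk_rho_l cpair_def simple_root_def sgn1_def)
qed

end

context params
begin

abbreviation "gm \<equiv> gam p n"

text \<open>Off the walls the spectral points are permuted by simple reflections, \<open>\<gamma>\<^bsub>s\<^sub>i \<mu>\<^esub> = s\<^sub>i \<gamma>\<^sub>\<mu>\<close>.\<close>

lemma gm_s:
  assumes i: "1 \<le> i" "i \<le> n" and c: "cp i \<mu> \<noteq> 0"
  shows "mon (gm (wl (s i) \<mu>)) v = mon (gm \<mu>) (wl (s i) v)"
proof -
  have "wl (s i) (rho_m n (wl (s i) \<mu>)) = rho_m n \<mu>" "wl (s i) (rho_l n (wl (s i) \<mu>)) = rho_l n \<mu>"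
    using rho_m_s[OF i, of \<mu>] rho_l_s[OF i, of \<mu>] c by simp_all
  then have "ip (rho_m n (wl (s i) \<mu>)) v = ip (rho_m n \<mu>) (wl (s i) v)"
    "ip (rho_l n (wl (s i) \<mu>)) v = ip (rho_l n \<mu>) (wl (s i) v)"
    using ip_wl_s[OF i, of _ "wl (s i) v"] wl_s_s[OF i] by metis+
  then show ?thesis unfolding gam_mon using ip_wl_s[OF i] by simp
qed

text \<open>On a wall the spectral point is not fixed by \<open>s\<^sub>i\<close>, because its value at the root \<open>a\<^sub>i\<close> is not 1. The value
  is the one at which the diagonal coefficient of \<open>T\<^sub>i\<close> below becomes \<open>t\<^sub>i\<close> (\<open>dg_orth\<close>).\<close>

lemma gm_orth:
  assumes i: "1 \<le> i" "i \<le> n" and c: "cp i \<mu> = 0"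
  shows "i < n \<Longrightarrow> mon (gm \<mu>) (fst (a i)) = (tmid p)\<^sup>2" "i = n \<Longrightarrow> mon (gm \<mu>) (eps n) = t0 p * tn p"
proof -
  have e: "wl (s i) \<mu> = \<mu>" using c i by (simp add: wl_s)
  have ip: "ip (wl (s i) v) (fst (a i)) = - ip v (fst (a i))" for v
    using ip_wl_s[OF i, of v "fst (a i)"] wl_s_simple[OF i] by simp
  have ip0: "ip \<mu> (fst (a i)) = 0" using c cp_zero_iff i by blast
  have m: "2 * ip (rho_m n \<mu>) (fst (a i)) = (if i < n then 2 * ip (fst (a i)) (fst (a i)) else 0)"
    using ip[of "rho_m n \<mu>"] rho_m_s[OF i, of \<mu>] c e by (auto split: if_splits)
  have l: "2 * ip (rho_l n \<mu>) (fst (a i)) = (if i = n then ip (fst (a i)) (fst (a i)) else 0)"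
    using ip[of "rho_l n \<mu>"] rho_l_s[OF i, of \<mu>] c e by (auto split: if_splits)
  show "mon (gm \<mu>) (fst (a i)) = (tmid p)\<^sup>2" if "i < n"
  proof -
    have "ip (fst (a i)) (fst (a i)) = 2" using i that by (simp add: simple_root_def lookup_minus)
    then show ?thesis using m l ip0 that by (simp add: gam_mon)
  qed
  show "mon (gm \<mu>) (eps n) = t0 p * tn p" if "i = n"
  proof -
    have a: "fst (a i) = frag_cmul 2 (eps n)" using that n2 by (simp add: simple_root_def)
    then have "lk (rho_m n \<mu>) n = 0" "lk (rho_l n \<mu>) n = 1" "lk \<mu> n = 0" using m l ip0 that by simp_all
    then show ?thesis by (subst gam_mon) simp
  qed
qed

lemma mon_pt: "1 \<le> i \<Longrightarrow> i \<le> n \<Longrightarrow> nzp y \<Longrightarrow> mon (pt i y) v = mon y (wl (s i) v)"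
proof -
  assume i: "1 \<le> i" "i \<le> n" and y: "nzp y"
  have "mon (pt i y) v = ev (act p (s i) (sg v 1)) y" using ev_act[OF i(2) y, of "sg v 1"] by simp
  also have "\<dots> = mon y (wl (s i) v)" using finW_snd[OF s_finW[OF i], of "(v, 0)"] by (simp add: act_sg ev_lscale ev_X)
  finally show ?thesis .
qed

end

section \<open>The eigenbasis\<close>

text \<open>Squaring excludes both values \<open>1\<close> and \<open>-1\<close>: spectral values are compared with each other, and \<open>t\<^sub>i\<^sup>2\<close> and the
  denominators at long roots must avoid \<open>-1\<close> and \<open>1\<close>.\<close>

locale generic = params +
  assumes gen: "\<And>b c d e :: int. (b, c, d, e) \<noteq> (0, 0, 0, 0) \<Longrightarrow>
    (t0 p powi b * tn p powi c * tmid p powi d * q powi e)\<^sup>2 \<noteq> 1"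
begin

text \<open>Different exponents of \<open>q\<close> suffice, whatever the exponents of the other parameters.\<close>

lemma gm_distinct:
  assumes "ip \<mu> v \<noteq> ip la u" shows "mon (gm \<mu>) v \<noteq> mon (gm la) u"
proof
  assume eq: "mon (gm \<mu>) v = mon (gm la) u"
  define b d e where "b = ip (rho_l n \<mu>) v - ip (rho_l n la) u" and "d = ip (rho_m n \<mu>) v - ip (rho_m n la) u"
    and "e = ip \<mu> v - ip la u"
  have "t0 p powi b * tn p powi b * tmid p powi d * q powi e = mon (gm \<mu>) v / mon (gm la) u"
    by (simp add: gam_mon b_def d_def e_def power_int_diff power_int_mult_distrib field_simps)
  also have "\<dots> = 1" using eq by simp
  finally show False using gen[of b b d e] assms by (simp add: e_def)
qed

text \<open>The weight \<open>\<nu> = (B\<^sup>n, \<dots>, B\<^sup>2, B)\<close> is dominant, and its pairings are linear forms in powers of \<open>B\<close> with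
  the coordinates of \<open>d\<close> in reverse order.\<close>

lemma dominant_separating:
  assumes "finite D" "D \<subseteq> Lam n" "0 \<notin> D" shows "\<exists>\<nu>\<in>Lam_plus n. \<forall>d\<in>D. ip d \<nu> \<noteq> 0"
proof -
  define rv :: "lattice_vec \<Rightarrow> lattice_vec" where "rv d = (\<Sum>j=1..n. frag_cmul (lk d j) (eps (n + 1 - j)))" for d
  have lk_rv: "lk (rv d) i = (if 1 \<le> i \<and> i \<le> n then lk d (n + 1 - i) else 0)" for d i
  proof -
    have "lk (rv d) i = (\<Sum>j\<in>{1..n}. lk d j * (if n + 1 - j = i then 1 else 0))" by (simp add: rv_def lookup_sum)
    also have "\<dots> = (\<Sum>j\<in>{1..n}. if j = n + 1 - i then (if 1 \<le> i then lk d (n + 1 - i) else 0) else 0)"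
      by (rule sum.cong) auto
    finally show ?thesis by auto
  qed
  have inj: "rv d \<noteq> 0" if d: "d \<in> D" for d
  proof
    assume "rv d = 0"
    then have z: "lk (rv d) i = 0" for i by simp
    have "d = 0"
    proof (rule Lam_eqI[of _ n])
      fix i assume "1 \<le> i" "i \<le> n"
      then have "lk (rv d) (n + 1 - i) = lk d i" unfolding lk_rv by auto
      then show "lk d i = lk 0 i" using z by simp
    qed (use d assms in auto)
    then show False using d assms(3) by simp
  qed
  have "finite (rv ` D)" "0 \<notin> rv ` D" using assms(1) inj by (auto simp: image_iff)
  from avoid_forms[OF this] obtain B :: nat where B: "B \<ge> 2" "\<forall>d\<in>rv ` D. (\<Sum>i\<in>keys d. lk d i * int B ^ i) \<noteq> 0"
    by blast
  define \<nu> where "\<nu> = (\<Sum>j=1..n. frag_cmul (int B ^ (n + 1 - j)) (eps j))"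
  have lk_nu: "lk \<nu> i = (if 1 \<le> i \<and> i \<le> n then int B ^ (n + 1 - i) else 0)" for i
  proof -
    have "lk \<nu> i = (\<Sum>j\<in>{1..n}. int B ^ (n + 1 - j) * (if j = i then 1 else 0))" by (simp add: \<nu>_def lookup_sum)
    also have "\<dots> = (\<Sum>j\<in>{1..n}. if j = i then int B ^ (n + 1 - j) else 0)" by (rule sum.cong) auto
    finally show ?thesis by simp
  qed
  have "\<nu> \<in> Lam_plus n"
    using B(1) by (auto simp: Lam_plus_def Lam_iff lk_nu intro!: power_increasing)
  moreover have "ip d \<nu> \<noteq> 0" if d: "d \<in> D" for d
  proof -
    have "(\<Sum>i\<in>keys (rv d). lk (rv d) i * int B ^ i) = (\<Sum>i\<in>{1..n}. lk (rv d) i * int B ^ i)"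
      by (rule sum.mono_neutral_left) (auto simp: in_keys_iff lk_rv split: if_splits)
    also have "\<dots> = (\<Sum>i\<in>{1..n}. lk d (n + 1 - i) * int B ^ i)" by (rule sum.cong) (auto simp: lk_rv)
    also have "\<dots> = (\<Sum>i\<in>{1..n}. lk d i * int B ^ (n + 1 - i))"
      by (rule sum.reindex_bij_witness[of _ "\<lambda>i. n + 1 - i" "\<lambda>i. n + 1 - i"]) auto
    also have "\<dots> = ip d \<nu>" using ip_Lam[of d n \<nu>] d assms(2) by (auto simp: lk_nu intro!: sum.cong)
    finally show ?thesis using B(2) d by auto
  qed
  ultimately show ?thesis by blast
qed

lemma tau_W: "\<nu> \<in> Lam_plus n \<Longrightarrow> tau \<nu> \<in> affW"
  using tau_affW Lam_plus_Lam by blast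

text \<open>Only the term with exponent \<open>x\<close> contributes to the coefficient at a maximal exponent \<open>x\<close>, so triangular operators act
  there by their diagonal entry.\<close>

lemma lk_Y_maximal:
  assumes \<nu>: "\<nu> \<in> Lam_plus n" and f: "keys f \<subseteq> Lam n" and max: "\<And>y. y \<in> keys f \<Longrightarrow> x \<notin> below y"
  shows "lk (Y \<nu> f) x = mon (gm x) \<nu> * lk f x"
proof -
  have W: "tau \<nu> \<in> affW" using tau_W \<nu> .
  have "Y \<nu> f = Y \<nu> (\<Sum>v\<in>keys f. lscale (lk f v) (xmon v))" by (subst pm_decomp[of f]) (simp add: xmon_sg)
  also have "\<dots> = (\<Sum>v\<in>keys f. lscale (lk f v) (Y \<nu> (xmon v)))" using W by (simp add: Tw_sum Tw_lscale)
  finally have "lk (Y \<nu> f) x = (\<Sum>v\<in>keys f. lk f v * lk (Y \<nu> (xmon v)) x)" by (simp add: lookup_sum)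
  also have "\<dots> = (\<Sum>v\<in>keys f. if v = x then mon (gm x) \<nu> * lk f x else 0)"
  proof (rule sum.cong)
    fix v assume v: "v \<in> keys f"
    have "x \<notin> keys (Y \<nu> (xmon v) - lscale (mon (gm v) \<nu>) (xmon v))"
      using Y_triangular[OF \<nu>, of v] f max[OF v] v by blast
    then have "lk (Y \<nu> (xmon v)) x = mon (gm v) \<nu> * lk (xmon v) x" by (simp add: in_keys_iff lookup_minus)
    then show "lk f v * lk (Y \<nu> (xmon v)) x = (if v = x then mon (gm x) \<nu> * lk f x else 0)"
      by (auto simp: xmon_sg lookup_single)
  qed simp
  also have "\<dots> = mon (gm x) \<nu> * lk f x" by (simp add: in_keys_iff)
  finally show ?thesis .
qed

lemma exists_maximal:
  assumes "finite S" "S \<noteq> {}" "S \<subseteq> Lam n" shows "\<exists>x\<in>S. \<forall>y\<in>S. x \<notin> below y"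
proof -
  have "Max ((\<lambda>x. card (below x)) ` S) \<in> (\<lambda>x. card (below x)) ` S" using assms by (intro Max_in) auto
  then obtain x where x: "x \<in> S" "Max ((\<lambda>x. card (below x)) ` S) = card (below x)" by blast
  have "x \<notin> below y" if y: "y \<in> S" for y
  proof
    assume xy: "x \<in> below y"
    have "below x \<subset> below y"
      using xy below_trans[of x y] below_irrefl[of x] assms(3) x(1) y by blast
    then have "card (below x) < card (below y)" using finite_below assms(3) y by (intro psubset_card_mono) auto
    moreover have "card (below y) \<le> card (below x)" unfolding x(2)[symmetric] using y assms(1) by (intro Max_ge) auto
    ultimately show False by simp
  qed
  then show ?thesis using x(1) by blast
qed

text \<open>Finite lower sets for \<open>\<prec>\<close>; the polynomials supported on such a set form a space that is stable under
  all \<open>Y\<^sup>\<nu>\<close>.\<close>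

definition closed :: "lattice_vec set \<Rightarrow> bool" where
  "closed S \<longleftrightarrow> finite S \<and> S \<subseteq> Lam n \<and> (\<forall>x\<in>S. below x \<subseteq> S)"

lemma closed_below: "la \<in> Lam n \<Longrightarrow> closed (below la)"
  unfolding closed_def using finite_below below_Lam below_trans by blast

lemma closed_down: "la \<in> Lam n \<Longrightarrow> closed (insert la (below la))"
  using closed_below[of la] unfolding closed_def by blast

lemma closed_UN: "finite I \<Longrightarrow> (\<And>i. i \<in> I \<Longrightarrow> closed (F i)) \<Longrightarrow> closed (\<Union>i\<in>I. F i)"
  unfolding closed_def by blast

lemma closed_exists: "keys f \<subseteq> Lam n \<Longrightarrow> \<exists>S. closed S \<and> keys f \<subseteq> S"
proof -
  assume f: "keys f \<subseteq> Lam n"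
  have "closed (\<Union>v\<in>keys f. insert v (below v))"
    by (rule closed_UN) (use f closed_down in auto)
  then show ?thesis by blast
qed

lemma closed_remove: "closed S \<Longrightarrow> (\<And>y. y \<in> S \<Longrightarrow> x \<notin> below y) \<Longrightarrow> closed (S - {x})"
  unfolding closed_def by blast

lemma keys_Y_closed: "closed S \<Longrightarrow> \<nu> \<in> Lam_plus n \<Longrightarrow> keys f \<subseteq> S \<Longrightarrow> keys (Y \<nu> f) \<subseteq> S"
proof -
  assume S: "closed S" and \<nu>: "\<nu> \<in> Lam_plus n" and f: "keys f \<subseteq> S"
  have "Y \<nu> f = Y \<nu> (\<Sum>v\<in>keys f. lscale (lk f v) (xmon v))" by (subst pm_decomp[of f]) (simp add: xmon_sg)
  then have e: "Y \<nu> f = (\<Sum>v\<in>keys f. lscale (lk f v) (Y \<nu> (xmon v)))" using tau_W[OF \<nu>] by (simp add: Tw_sum Tw_lscale)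
  have "keys (Y \<nu> (xmon v)) \<subseteq> S" if v: "v \<in> S" for v
  proof -
    have vL: "v \<in> Lam n" "below v \<subseteq> S" using v S by (auto simp: closed_def)
    have "keys (Y \<nu> (xmon v)) \<subseteq> {v} \<union> keys (Y \<nu> (xmon v) - lscale (mon (gm v) \<nu>) (xmon v))"
      by (auto simp: in_keys_iff lookup_minus xmon_sg lookup_single when_def split: if_splits)
    then show ?thesis using Y_triangular[OF \<nu> vL(1)] vL v by blast
  qed
  moreover have "keys (Y \<nu> f) \<subseteq> (\<Union>v\<in>keys f. keys (lscale (lk f v) (Y \<nu> (xmon v))))" unfolding e by (rule keys_sum)
  ultimately show ?thesis using f keys_lscale by blast
qed

text \<open>A triangular operator minus a number different from all its diagonal entries is surjective: remove
  a maximal exponent of the right-hand side and continue with a smaller lower set.\<close>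

lemma resolvent_exists:
  assumes \<nu>: "\<nu> \<in> Lam_plus n"
  shows "closed S \<Longrightarrow> (\<And>x. x \<in> S \<Longrightarrow> mon (gm x) \<nu> \<noteq> \<kappa>) \<Longrightarrow> keys b \<subseteq> S \<Longrightarrow>
    \<exists>e. keys e \<subseteq> S \<and> Y \<nu> e - lscale \<kappa> e = b"
proof (induction "card S" arbitrary: S b)
  case 0
  then have "b = 0" by (simp add: closed_def)
  then show ?case using tau_W[OF \<nu>] by (intro exI[of _ 0]) (simp add: Tw_zero)
next
  case (Suc k)
  have S: "finite S" "S \<subseteq> Lam n" using Suc.prems by (auto simp: closed_def)
  have ne: "S \<noteq> {}" using Suc.hyps by auto
  obtain x where x: "x \<in> S" "\<And>y. y \<in> S \<Longrightarrow> x \<notin> below y" using exists_maximal[OF S(1) ne S(2)] by blast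
  define e1 where "e1 = lscale (lk b x / (mon (gm x) \<nu> - \<kappa>)) (xmon x)"
  have e1: "keys e1 \<subseteq> S" using x keys_lscale[of _ "xmon x"] by (auto simp: e1_def xmon_sg)
  define b' where "b' = b - (Y \<nu> e1 - lscale \<kappa> e1)"
  have e1l: "lk e1 x = lk b x / (mon (gm x) \<nu> - \<kappa>)" by (simp add: e1_def xmon_sg)
  have "lk (Y \<nu> e1) x = mon (gm x) \<nu> * lk e1 x"
    using lk_Y_maximal[OF \<nu>, of e1 x] e1 S x(2) by blast
  then have "lk b' x = lk b x - (mon (gm x) \<nu> - \<kappa>) * lk e1 x" by (simp add: b'_def lookup_minus lookup_add algebra_simps)
  also have "\<dots> = 0" using Suc.prems(2)[OF x(1)] by (simp add: e1l)
  finally have z: "x \<notin> keys b'" by (simp add: in_keys_iff)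
  have "keys b' \<subseteq> keys b \<union> (keys (Y \<nu> e1) \<union> keys (lscale \<kappa> e1))"
    unfolding b'_def using keys_minus[of b "Y \<nu> e1 - lscale \<kappa> e1"] keys_minus[of "Y \<nu> e1" "lscale \<kappa> e1"] by blast
  also have "\<dots> \<subseteq> S" using keys_Y_closed[OF Suc.prems(1) \<nu> e1] keys_lscale[of \<kappa> e1] e1 Suc.prems(3) by blast
  finally have b': "keys b' \<subseteq> S - {x}" using z by blast
  have "closed (S - {x})" using closed_remove Suc.prems(1) x(2) by blast
  moreover have "k = card (S - {x})" using Suc.hyps x S by simp
  ultimately obtain e' where e': "keys e' \<subseteq> S - {x}" "Y \<nu> e' - lscale \<kappa> e' = b'"
    using Suc.hyps(1)[of "S - {x}" b'] Suc.prems(2) b' by blast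
  show ?case
  proof (intro exI[of _ "e1 + e'"] conjI)
    show "keys (e1 + e') \<subseteq> S" using keys_add[of e1 e'] e1 e' by blast
    show "Y \<nu> (e1 + e') - lscale \<kappa> (e1 + e') = b"
      using e'(2) tau_W[OF \<nu>] by (simp add: b'_def Tw_add lscale_add algebra_simps)
  qed
qed

lemma no_eigenvector:
  assumes \<nu>: "\<nu> \<in> Lam_plus n" and f: "keys f \<subseteq> S" "S \<subseteq> Lam n" "\<And>x. x \<in> S \<Longrightarrow> mon (gm x) \<nu> \<noteq> \<kappa>"
    and e: "Y \<nu> f = lscale \<kappa> f"
  shows "f = 0"
proof (rule ccontr)
  assume "f \<noteq> 0"
  then have ne: "keys f \<noteq> {}" by simp
  have kL: "keys f \<subseteq> Lam n" using f by blast
  obtain x where x: "x \<in> keys f" "\<And>y. y \<in> keys f \<Longrightarrow> x \<notin> below y"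
    using exists_maximal[OF finite_keys ne kL] by blast
  have "\<kappa> * lk f x = mon (gm x) \<nu> * lk f x" using lk_Y_maximal[OF \<nu>, of f x] f x(2) e by auto
  moreover have "x \<in> S" using f(1) x(1) by blast
  ultimately show False using f(3) x(1) by (auto simp: in_keys_iff)
qed

text \<open>An eigenvector of a single \<open>Y\<^sup>\<nu>\<close> whose eigenvalue at \<open>la\<close> is simple below \<open>la\<close>; commuting operators
  preserve it up to a lower term, which must then vanish.\<close>

lemma eigenvector_exists:
  assumes la: "la \<in> Lam n"
  shows "\<exists>E. keys (E - xmon la) \<subseteq> below la \<and> (\<forall>\<nu>\<in>Lam_plus n. Y \<nu> E = lscale (mon (gm la) \<nu>) E)"
proof -
  define D where "D = (\<lambda>\<mu>. \<mu> - la) ` below la"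
  have "finite D" "D \<subseteq> Lam n" "0 \<notin> D"
    using finite_below[OF la] below_Lam la below_irrefl by (auto simp: D_def)
  then obtain \<nu> where \<nu>: "\<nu> \<in> Lam_plus n" "\<forall>d\<in>D. ip d \<nu> \<noteq> 0" using dominant_separating by blast
  define \<kappa> where "\<kappa> = mon (gm la) \<nu>"
  have sep: "mon (gm x) \<nu> \<noteq> \<kappa>" if "x \<in> below la" for x
    unfolding \<kappa>_def by (rule gm_distinct) (use \<nu>(2) that in \<open>auto simp: D_def\<close>)
  have cl: "closed (below la)" by (rule closed_below[OF la])
  obtain e where e: "keys e \<subseteq> below la" "Y \<nu> e - lscale \<kappa> e = Y \<nu> (xmon la) - lscale \<kappa> (xmon la)"
    using resolvent_exists[OF \<nu>(1) cl sep, of "Y \<nu> (xmon la) - lscale \<kappa> (xmon la)"] Y_triangular[OF \<nu>(1) la] by (auto simp: \<kappa>_def)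
  define E where "E = xmon la - e"
  have YE: "Y \<nu> E = lscale \<kappa> E"
    using e(2) tau_W[OF \<nu>(1)] by (simp add: E_def Tw_diff lscale_diff algebra_simps)
  have kE: "keys (E - xmon la) \<subseteq> below la" using e(1) by (auto simp: E_def in_keys_iff)
  have "Y \<nu>' E = lscale (mon (gm la) \<nu>') E" if \<nu>': "\<nu>' \<in> Lam_plus n" for \<nu>'
  proof -
    define F where "F = Y \<nu>' E - lscale (mon (gm la) \<nu>') E"
    have W: "tau \<nu>' \<in> affW" "tau \<nu> \<in> affW" using tau_W \<nu>' \<nu> by auto
    have F: "F = (Y \<nu>' (xmon la) - lscale (mon (gm la) \<nu>') (xmon la)) - (Y \<nu>' e - lscale (mon (gm la) \<nu>') e)"
      using W by (simp add: F_def E_def Tw_diff lscale_diff algebra_simps)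
    have "keys (Y \<nu>' e - lscale (mon (gm la) \<nu>') e) \<subseteq> below la"
      using keys_minus[of "Y \<nu>' e" "lscale (mon (gm la) \<nu>') e"] keys_Y_closed[OF cl \<nu>' e(1)]
        keys_lscale[of "mon (gm la) \<nu>'" e] e(1) by blast
    then have kF: "keys F \<subseteq> below la"
      unfolding F using Y_triangular[OF \<nu>' la]
        keys_minus[of "Y \<nu>' (xmon la) - lscale (mon (gm la) \<nu>') (xmon la)" "Y \<nu>' e - lscale (mon (gm la) \<nu>') e"] by blast
    have YF: "Y \<nu> F = lscale \<kappa> F"
      using W YE by (simp add: F_def Tw_diff Tw_lscale lscale_diff Y_commute[OF \<nu>(1) \<nu>'] mult.commute)
    have "F = 0" by (rule no_eigenvector[OF \<nu>(1) kF _ _ YF]) (use below_Lam sep in auto)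
    then show ?thesis by (simp add: F_def)
  qed
  then show ?thesis using kE by blast
qed

text \<open>The polynomial \<open>E\<^sub>\<mu>\<close>. It satisfies the description of the non-symmetric Koornwinder polynomial, and
  \<open>Pns_En\<close> proves that the description determines it.\<close>

definition En :: "lattice_vec \<Rightarrow> laurent" where
  "En la = (SOME E. keys (E - xmon la) \<subseteq> below la \<and> (\<forall>\<nu>\<in>Lam_plus n. Y \<nu> E = lscale (mon (gm la) \<nu>) E))"

lemma En: 
  assumes "la \<in> Lam n"
  shows "keys (En la - xmon la) \<subseteq> below la" "\<nu> \<in> Lam_plus n \<Longrightarrow> Y \<nu> (En la) = lscale (mon (gm la) \<nu>) (En la)"
  using someI_ex[OF eigenvector_exists[OF assms]] unfolding En_def[symmetric] by auto

lemma keys_En: "la \<in> Lam n \<Longrightarrow> keys (En la) \<subseteq> insert la (below la)"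
proof -
  assume la: "la \<in> Lam n"
  have "keys (En la) \<subseteq> {la} \<union> keys (En la - xmon la)"
    by (auto simp: in_keys_iff lookup_minus xmon_sg lookup_single when_def split: if_splits)
  then show ?thesis using En(1)[OF la] by blast
qed

lemma lk_En: "la \<in> Lam n \<Longrightarrow> lk (En la) la = 1"
proof -
  assume la: "la \<in> Lam n"
  then have "la \<notin> keys (En la - xmon la)" using En(1)[OF la] below_irrefl by blast
  then show ?thesis by (simp add: in_keys_iff lookup_minus xmon_sg)
qed

lemma lk_En_0: "la \<in> Lam n \<Longrightarrow> x \<noteq> la \<Longrightarrow> x \<notin> below la \<Longrightarrow> lk (En la) x = 0"
  using keys_En[of la] by (auto simp: in_keys_iff)

lemma keys_En_Lam: "la \<in> Lam n \<Longrightarrow> keys (En la) \<subseteq> Lam n"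
  using keys_En[of la] below_Lam by blast

text \<open>The \<open>E\<^sub>\<mu>\<close>, \<open>\<mu> \<in> S\<close>, are unitriangular with respect to the monomials, hence a basis of the polynomials
  supported on the lower set \<open>S\<close>.\<close>

lemma En_expand:
  "closed S \<Longrightarrow> keys f \<subseteq> S \<Longrightarrow> \<exists>d. f = (\<Sum>\<mu>\<in>S. lscale (d \<mu>) (En \<mu>))"
proof (induction "card S" arbitrary: S f)
  case 0
  then have "S = {}" by (simp add: closed_def)
  then show ?case using 0 by simp
next
  case (Suc k)
  have S: "finite S" "S \<subseteq> Lam n" using Suc.prems by (auto simp: closed_def)
  have ne: "S \<noteq> {}" using Suc.hyps by auto
  obtain x where x: "x \<in> S" "\<And>y. y \<in> S \<Longrightarrow> x \<notin> below y" using exists_maximal[OF S(1) ne S(2)] by blast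
  have xL: "x \<in> Lam n" using x S by blast
  define f' where "f' = f - lscale (lk f x) (En x)"
  have "keys f' \<subseteq> S"
  proof -
    have "below x \<subseteq> S" using Suc.prems(1) x(1) by (simp add: closed_def)
    then have "keys (lscale (lk f x) (En x)) \<subseteq> S"
      using keys_lscale[of "lk f x" "En x"] keys_En[OF xL] x(1) by blast
    then show ?thesis
      unfolding f'_def using keys_minus[of f "lscale (lk f x) (En x)"] Suc.prems(2) by blast
  qed
  moreover have "x \<notin> keys f'" by (simp add: f'_def in_keys_iff lookup_minus lk_En[OF xL])
  ultimately have f': "keys f' \<subseteq> S - {x}" by blast
  have "closed (S - {x})" using closed_remove Suc.prems(1) x(2) by blast
  moreover have "k = card (S - {x})" using Suc.hyps x S by simp
  ultimately obtain d where d: "f' = (\<Sum>\<mu>\<in>S - {x}. lscale (d \<mu>) (En \<mu>))" using Suc.hyps(1) f' by metis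
  have "f = (\<Sum>\<mu>\<in>S. lscale ((d(x := lk f x)) \<mu>) (En \<mu>))"
  proof -
    have "(\<Sum>\<mu>\<in>S - {x}. lscale ((d(x := lk f x)) \<mu>) (En \<mu>)) = f'"
      unfolding d by (rule sum.cong) auto
    then show ?thesis unfolding sum.remove[OF S(1) x(1)] by (simp add: f'_def)
  qed
  then show ?case by blast
qed

lemma En_independent:
  assumes "finite M" "M \<subseteq> Lam n" "(\<Sum>\<mu>\<in>M. lscale (d \<mu>) (En \<mu>)) = 0" "\<mu> \<in> M"
  shows "d \<mu> = 0"
proof (rule ccontr)
  assume "d \<mu> \<noteq> 0"
  define N where "N = {\<mu> \<in> M. d \<mu> \<noteq> 0}"
  have N: "finite N" "N \<noteq> {}" "N \<subseteq> Lam n" using assms \<open>d \<mu> \<noteq> 0\<close> by (auto simp: N_def)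
  obtain x where x: "x \<in> N" "\<And>y. y \<in> N \<Longrightarrow> x \<notin> below y" using exists_maximal[OF N] by blast
  have "0 = (\<Sum>\<mu>\<in>M. d \<mu> * lk (En \<mu>) x)" using arg_cong[OF assms(3), of "\<lambda>f. lk f x"] by (simp add: lookup_sum)
  also have "\<dots> = (\<Sum>\<mu>\<in>M. if \<mu> = x then d x else 0)"
  proof (rule sum.cong)
    fix \<mu> assume "\<mu> \<in> M"
    then have "\<mu> \<in> Lam n" using assms by blast
    then show "d \<mu> * lk (En \<mu>) x = (if \<mu> = x then d x else 0)"
      using lk_En[of \<mu>] lk_En_0[of \<mu> x] x(2)[of \<mu>] \<open>\<mu> \<in> M\<close> by (auto simp: N_def)
  qed simp
  also have "\<dots> = d x" using x assms(1) by (simp add: N_def)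
  finally show False using x by (simp add: N_def)
qed

text \<open>The spectrum is simple: in the expansion of \<open>G\<close> two basis vectors with nonzero coefficients would
  have the same spectral values.\<close>

lemma joint_eigenvector:
  assumes G: "keys G \<subseteq> Lam n" "\<And>\<nu>. \<nu> \<in> Lam_plus n \<Longrightarrow> Y \<nu> G = lscale (mon \<chi> \<nu>) G"
  shows "G = 0 \<or> (\<exists>\<mu>\<in>Lam n. (\<forall>\<nu>\<in>Lam_plus n. mon (gm \<mu>) \<nu> = mon \<chi> \<nu>) \<and> (\<exists>c. G = lscale c (En \<mu>)))"
proof (cases "G = 0")
  case False
  obtain S where S: "closed S" "keys G \<subseteq> S" using closed_exists G(1) by blast
  have SL: "finite S" "S \<subseteq> Lam n" using S by (auto simp: closed_def)
  obtain d where d: "G = (\<Sum>\<mu>\<in>S. lscale (d \<mu>) (En \<mu>))" using En_expand S by blast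
  have ch: "d \<mu> \<noteq> 0 \<Longrightarrow> mon (gm \<mu>) \<nu> = mon \<chi> \<nu>" if \<mu>: "\<mu> \<in> S" and \<nu>: "\<nu> \<in> Lam_plus n" for \<mu> \<nu>
  proof -
    have "Y \<nu> G = (\<Sum>\<mu>\<in>S. lscale (d \<mu>) (Y \<nu> (En \<mu>)))"
      unfolding d using tau_W[OF \<nu>] by (simp add: Tw_sum Tw_lscale)
    also have "\<dots> = (\<Sum>\<mu>\<in>S. lscale (d \<mu> * mon (gm \<mu>) \<nu>) (En \<mu>))"
      using En(2) \<nu> SL by (intro sum.cong) auto
    finally have "Y \<nu> G - lscale (mon \<chi> \<nu>) G = (\<Sum>\<mu>\<in>S. lscale (d \<mu> * (mon (gm \<mu>) \<nu> - mon \<chi> \<nu>)) (En \<mu>))"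
      by (subst (2) d) (simp add: lscale_sum sum_subtractf[symmetric] lscale_diff_left algebra_simps)
    then have "(\<Sum>\<mu>\<in>S. lscale (d \<mu> * (mon (gm \<mu>) \<nu> - mon \<chi> \<nu>)) (En \<mu>)) = 0" using G(2)[OF \<nu>] by simp
    from En_independent[OF SL this \<mu>] show "d \<mu> \<noteq> 0 \<Longrightarrow> mon (gm \<mu>) \<nu> = mon \<chi> \<nu>" by simp
  qed
  have "\<exists>\<mu>\<in>S. d \<mu> \<noteq> 0"
  proof (rule ccontr)
    assume "\<not> ?thesis"
    then have "G = 0" unfolding d by simp
    then show False using False by simp
  qed
  then obtain \<mu> where \<mu>: "\<mu> \<in> S" "d \<mu> \<noteq> 0" by blast
  have uniq: "x = \<mu>" if x: "x \<in> S" "d x \<noteq> 0" for x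
  proof (rule ccontr)
    assume "x \<noteq> \<mu>"
    moreover have "x \<in> Lam n" "\<mu> \<in> Lam n" using SL x \<mu> by auto
    ultimately obtain k where k: "k \<le> n" "ip x (om k) \<noteq> ip \<mu> (om k)"
      using dle_antisym[of x \<mu>] unfolding dle_def by (metis ip_commute order_refl)
    then have "mon (gm x) (om k) \<noteq> mon (gm \<mu>) (om k)" by (intro gm_distinct)
    then show False using ch x \<mu> om_dominant k by metis
  qed
  have "G = lscale (d \<mu>) (En \<mu>)"
  proof -
    have "(\<Sum>x\<in>S - {\<mu>}. lscale (d x) (En x)) = 0" by (rule sum.neutral) (use uniq in auto)
    then show ?thesis unfolding d sum.remove[OF SL(1) \<mu>(1)] by simp
  qed
  then show ?thesis using ch \<mu> SL by blast
qed simp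

text \<open>Every dominant weight is a sum of fundamental ones: subtract the longest \<open>\<omega>\<^sub>k\<close> whose coordinates are all
  positive in \<open>\<nu>\<close>.\<close>

lemma Y_fundamental:
  assumes \<chi>: "nzp \<chi>" and G: "\<And>k. 1 \<le> k \<Longrightarrow> k \<le> n \<Longrightarrow> Y (om k) G = lscale (mon \<chi> (om k)) G"
  shows "\<nu> \<in> Lam_plus n \<Longrightarrow> Y \<nu> G = lscale (mon \<chi> \<nu>) G"
proof (induction "nat (lk \<nu> 1)" arbitrary: \<nu>)
  case 0
  have "lk \<nu> 1 \<ge> 0" using 0 n2 by (auto simp: Lam_plus_def)
  then have z: "lk \<nu> 1 = 0" using 0 by simp
  have "\<nu> = 0"
  proof (rule Lam_eqI[of _ n])
    fix i assume "1 \<le> i" "i \<le> n"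
    then have "lk \<nu> i \<le> lk \<nu> 1" "lk \<nu> i \<ge> 0" using 0 by (auto simp: Lam_plus_def)
    then show "lk \<nu> i = lk 0 i" using z by simp
  qed (use 0 Lam_plus_Lam in auto)
  then show ?case unfolding \<open>\<nu> = 0\<close> tau_zero Tw_id by simp
next
  case (Suc m)
  define J where "J = {j. 1 \<le> j \<and> j \<le> n \<and> lk \<nu> j > 0}"
  define k where "k = Max J"
  have "1 \<in> J" using Suc.hyps n2 by (auto simp: J_def)
  moreover have "J \<subseteq> {1..n}" by (auto simp: J_def)
  then have fJ: "finite J" by (rule finite_subset) simp
  ultimately have k: "k \<in> J" "\<And>j. j \<in> J \<Longrightarrow> j \<le> k" unfolding k_def by (auto intro: Max_in Max_ge)
  have mono: "lk \<nu> j \<le> lk \<nu> i" "lk \<nu> j \<ge> 0" if "1 \<le> i" "i \<le> j" "j \<le> n" for i j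
    using Suc.prems that by (auto simp: Lam_plus_def)
  have kn: "1 \<le> k" "k \<le> n" "lk \<nu> k > 0" using k(1) by (auto simp: J_def)
  have pos: "lk \<nu> j > 0" if "1 \<le> j" "j \<le> k" for j using mono(1)[of j k] kn that by simp
  have zero: "lk \<nu> j = 0" if "k < j" "j \<le> n" for j
    using k(2)[of j] mono(2)[of j j] that by (force simp: J_def)
  have "\<nu> - om k \<in> Lam_plus n"
    unfolding Lam_plus_def
  proof (intro CollectI conjI allI impI ballI)
    show "\<nu> - om k \<in> Lam n" using Lam_plus_Lam[OF Suc.prems] om_Lam[OF kn(2)] by blast
    fix i j assume ij: "1 \<le> i \<and> i \<le> j \<and> j \<le> n"
    show "lk (\<nu> - om k) j \<le> lk (\<nu> - om k) i"
      using mono(1)[of i j] pos[of i] zero[of j] ij by (auto simp: lookup_minus)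
  next
    fix i assume "i \<in> {1..n}"
    then show "0 \<le> lk (\<nu> - om k) i" using pos[of i] mono(2)[of i i] by (auto simp: lookup_minus)
  qed
  moreover have "m = nat (lk (\<nu> - om k) 1)" using Suc.hyps(2) kn by (auto simp: lookup_minus)
  ultimately have IH: "Y (\<nu> - om k) G = lscale (mon \<chi> (\<nu> - om k)) G" and d: "\<nu> - om k \<in> Lam_plus n"
    using Suc.hyps(1) by blast+
  have "Y \<nu> G = Y (om k) (Y (\<nu> - om k) G)"
    using Y_add[OF om_dominant[OF kn(2)] d] by simp
  also have "\<dots> = lscale (mon \<chi> (\<nu> - om k) * mon \<chi> (om k)) G"
    unfolding IH using G[OF kn(1,2)] tau_W[OF om_dominant[OF kn(2)]] by (simp add: Tw_lscale)
  also have "mon \<chi> (\<nu> - om k) * mon \<chi> (om k) = mon \<chi> \<nu>" using mon_add[OF \<chi>, of "\<nu> - om k" "om k"] by simp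
  finally show ?case .
qed

section \<open>The action of \<open>T\<^sub>i\<close> on the eigenbasis\<close>

text \<open>The diagonal coefficient of \<open>T\<^sub>i\<close> on \<open>E\<^sub>\<mu>\<close>.\<close>

definition dg :: "nat \<Rightarrow> lattice_vec \<Rightarrow> complex" where
  "dg i \<mu> = (if i < n then (tmid p - 1 / tmid p) / (1 - 1 / mon (gm \<mu>) (fst (a i)))
     else (tn p - 1 / tn p + (t0 p - 1 / t0 p) / mon (gm \<mu>) (eps n)) / (1 - 1 / (mon (gm \<mu>) (eps n))\<^sup>2))"

lemma gen_mono_ne:
  assumes "(b, c, d, e) \<noteq> (0 :: int, 0 :: int, 0 :: int, 0 :: int)"
  shows "t0 p powi b * tn p powi c * tmid p powi d * q powi e \<noteq> 1"
    "t0 p powi b * tn p powi c * tmid p powi d * q powi e \<noteq> - 1"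
  using gen[OF assms] by auto

lemma gm_simple_ne:
  assumes i: "1 \<le> i" "i \<le> n"
  shows "i < n \<Longrightarrow> mon (gm \<mu>) (fst (a i)) \<noteq> 1" "i = n \<Longrightarrow> (mon (gm \<mu>) (eps n))\<^sup>2 \<noteq> 1"
proof -
  show "mon (gm \<mu>) (fst (a i)) \<noteq> 1" if "i < n"
  proof (cases "cp i \<mu> = 0")
    case True
    then show ?thesis using gm_orth(1)[OF i] that gen_mono_ne(1)[of 0 0 2 0] by simp
  next
    case False
    then have "ip \<mu> (fst (a i)) \<noteq> 0" using cp_zero_iff i by blast
    then show ?thesis using gm_distinct[of \<mu> "fst (a i)" 0 0] by simp
  qed
  show "(mon (gm \<mu>) (eps n))\<^sup>2 \<noteq> 1" if "i = n"
  proof (cases "cp i \<mu> = 0")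
    case True
    then show ?thesis using gm_orth(2)[OF i] that gen[of 1 1 0 0] by simp
  next
    case False
    then have "lk \<mu> n \<noteq> 0" using i that n2 by (simp add: cpair_def)
    then show ?thesis using gm_distinct[of \<mu> "frag_cmul 2 (eps n)" 0 0] by (simp add: mon_cmul)
  qed
qed

lemma dg_orth:
  assumes i: "1 \<le> i" "i \<le> n" and c: "cp i \<mu> = 0" shows "dg i \<mu> = t i"
proof (cases "i < n")
  case True
  have ne: "(tmid p)\<^sup>2 \<noteq> 1" using gen_mono_ne(1)[of 0 0 2 0] by simp
  then show ?thesis using gm_orth(1)[OF i c True] True i
    by (simp add: dg_def t_simple_def field_simps power2_eq_square)
next
  case False
  then have n: "i = n" using i by simp
  have ne: "(t0 p * tn p)\<^sup>2 \<noteq> 1" using gen[of 1 1 0 0] by simp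
  then have d: "1 - 1 / (t0 p * tn p)\<^sup>2 \<noteq> 0" by (simp add: field_simps)
  have "tn p - 1 / tn p + (t0 p - 1 / t0 p) / (t0 p * tn p) = tn p * (1 - 1 / (t0 p * tn p)\<^sup>2)"
    by (simp add: field_simps power2_eq_square)
  then show ?thesis using gm_orth(2)[OF i c n] n n2 d by (simp add: dg_def t_simple_def)
qed

text \<open>By \<open>Y_fundamental\<close> only the operators \<open>Y\<close> at \<open>\<omega>\<^sub>k\<close> matter. For \<open>k \<noteq> i\<close> they commute with \<open>T\<^sub>i\<close>, and for \<open>k = i\<close>
  the relations \<open>om_relation\<close> and \<open>om_n_relation\<close> express \<open>Y T\<^sub>i E\<^sub>\<mu>\<close> through \<open>T\<^sub>i E\<^sub>\<mu>\<close> and \<open>E\<^sub>\<mu>\<close>. The number \<open>dg\<close> is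
  chosen so that the resulting triangular two-by-two matrix is diagonalized.\<close>

lemma intertwine:
  assumes i: "1 \<le> i" "i \<le> n" and \<mu>: "\<mu> \<in> Lam n" and \<nu>: "\<nu> \<in> Lam_plus n"
  defines "G \<equiv> T i (En \<mu>) - lscale (dg i \<mu>) (En \<mu>)"
  shows "Y \<nu> G = lscale (mon (pt i (gm \<mu>)) \<nu>) G"
proof (rule Y_fundamental[OF _ _ \<nu>])
  show "nzp (pt i (gm \<mu>))" by simp
  fix k assume k: "1 \<le> k" "k \<le> n"
  define E F where "E = En \<mu>" and "F = T i E"
  define g where "g j = mon (gm \<mu>) (om j)" for j
  have gnz: "g j \<noteq> 0" for j by (simp add: g_def)
  have kW: "tau (om j) \<in> affW" if "j \<le> n" for j using tau_W om_dominant that by blast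
  have YE: "Y (om j) E = lscale (g j) E" if "j \<le> n" for j unfolding E_def g_def using En(2)[OF \<mu>] om_dominant that by blast
  have YF: "Y (om j) F = lscale (g j) F" if "1 \<le> j" "j \<le> n" "j \<noteq> i" for j
    using T_Y_commute[OF i om_Lam[OF that(2)], of E] ip_om_simple[OF i that(1,2)] that YE[OF that(2)] i
    by (simp add: F_def T_lscale)
  have G: "G = F - lscale (dg i \<mu>) E" by (simp add: G_def F_def E_def)
  have chi: "mon (pt i (gm \<mu>)) (om k) = mon (gm \<mu>) (wl (s i) (om k))" by (rule mon_pt[OF i]) simp
  show "Y (om k) G = lscale (mon (pt i (gm \<mu>)) (om k)) G"
  proof (cases "k = i")
    case False
    then have "cp i (om k) = 0" using ip_om_simple[OF i k] cp_zero_iff i by auto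
    then have "wl (s i) (om k) = om k" using i by (simp add: wl_s)
    then have c: "mon (pt i (gm \<mu>)) (om k) = g k" unfolding chi by (simp add: g_def)
    show ?thesis unfolding c G using kW[OF k(2)] YE[OF k(2)] YF[OF k False]
      by (simp add: Tw_diff Tw_lscale lscale_diff mult.commute)
  next
    case ki: True
    have oi: "om i = om (i - 1) + eps i" using om_Suc[of "i - 1"] i by simp
    show ?thesis
    proof (cases "i < n")
      case True
      define h where "h = g (i - 1) * g (Suc i) / g i"
      have "cp i (om i) = 1" using True i by (simp add: cpair_def)
      then have "wl (s i) (om i) = om (i - 1) + om (Suc i) - om i"
        using oi i True by (simp add: wl_s simple_root_def om_Suc)
      then have c: "mon (pt i (gm \<mu>)) (om k) = h"
        using chi unfolding ki h_def g_def by (simp add: mon_diff mon_add)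
      have a: "mon (gm \<mu>) (fst (a i)) = g i / h"
      proof -
        have "fst (a i) = (om i - om (i - 1)) - (om (Suc i) - om i)"
          using i True oi by (simp add: simple_root_def om_Suc)
        then have "mon (gm \<mu>) (fst (a i)) = mon (gm \<mu>) ((om i - om (i - 1)) - (om (Suc i) - om i))" by simp
        also have "\<dots> = (g i / g (i - 1)) / (g (Suc i) / g i)"
          unfolding g_def by (simp only: mon_diff gam_nzp)
        finally show ?thesis by (simp add: h_def)
      qed
      have hnz: "h \<noteq> 0" by (simp add: h_def gnz)
      have ne: "g i \<noteq> h" using gm_simple_ne(1)[OF i True, of \<mu>] a hnz by auto
      let ?t = "tmid p - 1 / tmid p"
      have ti: "t i = tmid p" using i True by (simp add: t_simple_def)
      have dg: "dg i \<mu> * (g i - h) = ?t * g i"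
      proof -
        have nz: "g i - h \<noteq> 0" "g i \<noteq> 0" using ne gnz by simp_all
        have "1 - 1 / mon (gm \<mu>) (fst (a i)) = (g i - h) / g i"
          unfolding a using hnz nz(2) by (simp add: diff_divide_distrib)
        then have "dg i \<mu> = ?t / ((g i - h) / g i)" using True by (simp add: dg_def)
        then show ?thesis using nz by simp
      qed
      have "Y (om i) (Tinv i (Y (om i) E)) = Y (om (i - 1)) (Y (om (Suc i)) F)"
        unfolding F_def by (rule om_relation[OF i(1) True])
      also have "\<dots> = lscale (g (i - 1) * g (Suc i)) F"
      proof (cases "i = 1")
        case True
        then show ?thesis using YF[of "Suc i"] \<open>i < n\<close> by (simp add: tau_zero[unfolded id_def[symmetric]] g_def)
      next
        case False
        then show ?thesis using YF[of "Suc i"] YF[of "i - 1"] \<open>i < n\<close> i kW[of "i - 1"] by (simp add: Tw_lscale mult.commute)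
      qed
      also have "Y (om i) (Tinv i (Y (om i) E)) = lscale (g i) (Y (om i) F) - lscale (?t * g i * g i) E"
        using YE[OF i(2)] kW[OF i(2)] i ti
        by (simp add: Tinv_def T_lscale F_def Tw_diff Tw_lscale mult_ac)
      finally have "lscale (g i) (Y (om i) F) = lscale (g (i - 1) * g (Suc i)) F + lscale (?t * g i * g i) E"
        by (simp add: algebra_simps)
      then have "lscale (1 / g i) (lscale (g i) (Y (om i) F)) =
          lscale (1 / g i) (lscale (g (i - 1) * g (Suc i)) F + lscale (?t * g i * g i) E)" by simp
      then have "Y (om i) F = lscale h F + lscale (?t * g i) E"
        by (simp add: gnz lscale_add h_def mult_ac)
      then have "Y (om i) G = lscale h F + lscale (?t * g i - dg i \<mu> * g i) E"
        unfolding G using YE[OF i(2)] kW[OF i(2)] by (simp add: Tw_diff Tw_lscale lscale_diff_left)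
      also have "?t * g i - dg i \<mu> * g i = - (h * dg i \<mu>)" using dg by (simp add: algebra_simps)
      finally show ?thesis unfolding ki c[unfolded ki] G by (simp add: lscale_diff lscale_uminus)
    next
      case False
      then have n: "i = n" using i by simp
      obtain U where U: "\<And>f. Y (om n) f = T n (U (Y (om (n - 1)) f))"
          "\<And>f. U (U f) = lscale (t0 p - 1 / t0 p) (U f) + f"
          "\<And>f g. U (f + g) = U f + U g" "\<And>c f. U (lscale c f) = lscale c (U f)"
        using om_n_relation by blast
      define g' y where "g' = g (n - 1)" and "y = mon (gm \<mu>) (eps n)"
      have gn: "g n = g' * y" using oi n by (simp add: g_def g'_def y_def mon_add)
      have ynz: "y \<noteq> 0" unfolding y_def by (rule mon_nz) simp
      have g'nz: "g' \<noteq> 0" by (simp add: g'_def gnz)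
      let ?t = "tn p - 1 / tn p" and ?s = "t0 p - 1 / t0 p"
      have tn: "t n = tn p" using n2 by (simp add: t_simple_def)
      have "cp i (om i) = 1" using n i by (simp add: cpair_def)
      then have wom: "wl (s i) (om i) = om (n - 1) - eps n"
      proof -
        assume c1: "cp i (om i) = 1"
        have f: "fst (a i) = frag_cmul 2 (eps n)" using n n2 by (simp add: simple_root_def)
        have "wl (s i) (om i) = om i - frag_cmul (cp i (om i)) (fst (a i))" by (rule wl_s[OF i(2)])
        also have "\<dots> = (om (n - 1) + eps n) - frag_cmul 2 (eps n)" unfolding c1 f using oi n by simp
        also have "\<dots> = om (n - 1) - eps n" by (rule poly_mapping_eqI) (simp add: lookup_add lookup_minus)
        finally show ?thesis .
      qed
      have c: "mon (pt i (gm \<mu>)) (om k) = g' / y"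
        unfolding ki chi[unfolded ki] wom by (simp add: g'_def g_def y_def mon_diff)
      have YE': "Y (om (n - 1)) E = lscale g' E" using YE[of "n - 1"] by (simp add: g'_def)
      have YF': "Y (om (n - 1)) F = lscale g' F" using YF[of "n - 1"] n n2 by (simp add: g'_def)
      have "T n (lscale g' (U E)) = lscale (g' * y) E" using U(1)[of E] YE[of n] YE' by (simp add: U(4) gn)
      then have TUE: "T n (U E) = lscale y E"
      proof -
        assume "T n (lscale g' (U E)) = lscale (g' * y) E"
        then have "lscale g' (T n (U E)) = lscale g' (lscale y E)" by (simp add: T_lscale)
        then have "lscale (1 / g') (lscale g' (T n (U E))) = lscale (1 / g') (lscale g' (lscale y E))" by (rule arg_cong)
        then show ?thesis using g'nz by simp
      qed
      have "U E = Tinv n (T n (U E))" by (simp add: Tinv_T)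
      then have UE: "U E = lscale y (F - lscale ?t E)"
        unfolding TUE using n by (simp add: Tinv_def T_lscale F_def lscale_diff tn mult.commute)
      then have "lscale (1 / y) (U E) = F - lscale ?t E" using ynz by simp
      then have F: "F = lscale (1 / y) (U E) + lscale ?t E" by (simp add: algebra_simps)
      have "T n (U F) = T n (lscale (1 / y) (lscale ?s (U E) + E) + lscale ?t (U E))"
        by (subst F) (simp only: U(2-4))
      also have "\<dots> = lscale (1 / y) (lscale (?s * y) E + F) + lscale (?t * y) E"
        using n by (simp add: T_add T_lscale TUE F_def)
      also have "\<dots> = lscale (1 / y) F + lscale (?s + ?t * y) E"
        using ynz by (simp add: lscale_add lscale_add_left)
      finally have "Y (om n) F = lscale g' (lscale (1 / y) F + lscale (?s + ?t * y) E)"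
        using U(1)[of F] YF' n2 by (simp add: U(4) T_lscale)
      then have YG: "Y (om n) G = lscale g' (lscale (1 / y) F + lscale (?s + ?t * y - y * dg i \<mu>) E)"
        unfolding G using YE[of n] kW[of n]
        by (simp add: Tw_diff Tw_lscale lscale_add lscale_diff_left lscale_diff gn algebra_simps)
      have y2: "y\<^sup>2 \<noteq> 1" using gm_simple_ne(2)[OF i n, of \<mu>] by (simp add: y_def)
      have solve: "S + K * y - Z = - W" if "A = y * K + S" "A = Z - W" for A S K Z W :: complex
        using that by (metis add.commute add_diff_cancel_left' diff_diff_eq2 minus_diff_eq mult.commute diff_add_cancel)
      have "dg i \<mu> * (1 - 1 / y\<^sup>2) = ?t + ?s / y"
      proof -
        have "gm \<mu> n = y" by (simp add: y_def)
        moreover have "1 - 1 / y\<^sup>2 \<noteq> 0" using y2 ynz by (simp add: field_simps)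
        ultimately show ?thesis using n by (simp add: dg_def)
      qed
      then have "y * (dg i \<mu> * (1 - 1 / y\<^sup>2)) = y * ?t + ?s" using ynz by (simp add: field_simps)
      moreover have "y * (dg i \<mu> * (1 - 1 / y\<^sup>2)) = y * dg i \<mu> - dg i \<mu> / y"
        using ynz by (simp add: right_diff_distrib power2_eq_square)
      ultimately have "?s + ?t * y - y * dg i \<mu> = - (dg i \<mu> / y)"
        by (rule solve)
      then have "Y (om n) G = lscale (g' / y) G"
        unfolding YG by (simp add: G lscale_add lscale_diff lscale_uminus)
      then show ?thesis unfolding ki c[unfolded ki] using n by simp
    qed
  qed
qed

text \<open>Otherwise \<open>s\<^sub>i \<gamma>\<^sub>\<mu>\<close> would be a spectral point. Comparing the exponents of \<open>q\<close> it could only be \<open>\<gamma>\<^sub>\<mu>\<close>, but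
  \<open>\<gamma>\<^sub>\<mu>\<close> is not fixed by \<open>s\<^sub>i\<close>.\<close>

theorem T_En_orth:
  assumes i: "1 \<le> i" "i \<le> n" and \<mu>: "\<mu> \<in> Lam n" and c: "cp i \<mu> = 0"
  shows "T i (En \<mu>) = lscale (t i) (En \<mu>)"
proof -
  define G where "G = T i (En \<mu>) - lscale (t i) (En \<mu>)"
  have e: "Y \<nu> G = lscale (mon (pt i (gm \<mu>)) \<nu>) G" if "\<nu> \<in> Lam_plus n" for \<nu>
    using intertwine[OF i \<mu> that] dg_orth[OF i c] by (simp add: G_def)
  have "keys G \<subseteq> keys (T i (En \<mu>)) \<union> keys (lscale (t i) (En \<mu>))" unfolding G_def by (rule keys_minus)
  then have k: "keys G \<subseteq> Lam n" using keys_T_Lam[OF i(2) keys_En_Lam[OF \<mu>]] keys_lscale[of _ "En \<mu>"] keys_En_Lam[OF \<mu>] by blast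
  have "G = 0"
  proof (rule ccontr)
    assume "G \<noteq> 0"
    then obtain x where x: "x \<in> Lam n" "\<And>\<nu>. \<nu> \<in> Lam_plus n \<Longrightarrow> mon (gm x) \<nu> = mon (gm \<mu>) (wl (s i) \<nu>)"
      using joint_eigenvector[OF k e] mon_pt[OF i] by auto
    have "x = \<mu>"
    proof (rule ccontr)
      assume "x \<noteq> \<mu>"
      then obtain k where k: "k \<le> n" "ip x (om k) \<noteq> ip \<mu> (om k)"
        using dle_antisym[of x \<mu>] x(1) \<mu> unfolding dle_def by (metis ip_commute order_refl)
      have "wl (s i) \<mu> = \<mu>" using c i by (simp add: wl_s)
      then have "ip \<mu> (wl (s i) (om k)) = ip \<mu> (om k)" using ip_wl_s[OF i, of \<mu> "om k"] by simp
      then have "mon (gm x) (om k) \<noteq> mon (gm \<mu>) (wl (s i) (om k))" using k by (intro gm_distinct) simp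
      then show False using x(2)[OF om_dominant[OF k(1)]] by blast
    qed
    then have "mon (gm \<mu>) (om i) = mon (gm \<mu>) (wl (s i) (om i))" using x(2)[OF om_dominant[OF i(2)]] by simp
    moreover have "cp i (om i) = 1" using i by (simp add: cpair_def)
    ultimately have "mon (gm \<mu>) (om i) = mon (gm \<mu>) (om i) / mon (gm \<mu>) (fst (a i))"
      using i by (simp add: wl_s mon_diff)
    moreover have "mon (gm \<mu>) (om i) \<noteq> 0" "mon (gm \<mu>) (fst (a i)) \<noteq> 0" by simp_all
    ultimately have "mon (gm \<mu>) (fst (a i)) = 1" by (metis divide_cancel_left div_by_1)
    moreover have "mon (gm \<mu>) (fst (a i)) = (mon (gm \<mu>) (eps n))\<^sup>2" if "i = n"
      using that n2 by (simp add: simple_root_def mon_cmul)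
    ultimately show False using gm_simple_ne[OF i, of \<mu>] i by (cases "i < n") auto
  qed
  then show ?thesis by (simp add: G_def)
qed

text \<open>\<open>(T\<^sub>i - dg) E\<^sub>\<mu>\<close> is a multiple of \<open>E\<close> at \<open>s\<^sub>i \<mu>\<close>. The factor is its coefficient at \<open>s\<^sub>i \<mu>\<close>, which lies above \<open>\<mu>\<close> and
  is therefore reached only from the leading monomial of \<open>E\<^sub>\<mu>\<close>.\<close>

theorem T_En_up:
  assumes i: "1 \<le> i" "i \<le> n" and \<mu>: "\<mu> \<in> Lam n" and c: "cp i \<mu> < 0"
  shows "T i (En \<mu>) = lscale (dg i \<mu>) (En \<mu>) + lscale (t i) (En (wl (s i) \<mu>))"
proof -
  define z where "z = wl (s i) \<mu>"
  define G where "G = T i (En \<mu>) - lscale (dg i \<mu>) (En \<mu>)"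
  have sW: "s i \<in> affW" using i by simp
  have zL: "z \<in> Lam n" unfolding z_def by (rule wl_Lam[OF sW \<mu>])
  have zo: "z \<in> orbit n \<mu>" unfolding z_def by (rule affW_orbit[OF sW])
  have sz: "wl (s i) z = \<mu>" unfolding z_def by (rule wl_s_s[OF i])
  have cz: "cp i z = - cp i \<mu>" using i by (simp add: z_def wl_s)
  have up: "dle \<mu> z" using dle_s_down[OF i, of z] cz c sz by simp
  have ne: "z \<noteq> \<mu>" using cz c by auto
  have not_below: "z \<notin> below \<mu>"
  proof
    assume "z \<in> below \<mu>"
    then have "dle z \<mu>" using below_iff[OF \<mu>] low_not_orbit[OF \<mu>] zo by blast
    then show False using up dle_antisym ne zL \<mu> by blast
  qed
  have e: "Y \<nu> G = lscale (mon (pt i (gm \<mu>)) \<nu>) G" if "\<nu> \<in> Lam_plus n" for \<nu>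
    using intertwine[OF i \<mu> that] by (simp add: G_def)
  have "keys G \<subseteq> keys (T i (En \<mu>)) \<union> keys (lscale (dg i \<mu>) (En \<mu>))" unfolding G_def by (rule keys_minus)
  then have k: "keys G \<subseteq> Lam n" using keys_T_Lam[OF i(2) keys_En_Lam[OF \<mu>]] keys_lscale[of _ "En \<mu>"] keys_En_Lam[OF \<mu>] by blast
  have coeff: "lk (T i (En \<mu>)) z = t i"
  proof -
    have "lk (T i (En \<mu>)) z = (\<Sum>v\<in>keys (En \<mu>). lk (En \<mu>) v * lk (T i (xmon v)) z)"
      by (subst T_expand[OF i(2)]) (simp add: lookup_sum)
    also have "\<dots> = (\<Sum>v\<in>keys (En \<mu>). if v = \<mu> then t i else 0)"
    proof (rule sum.cong)
      fix v assume v: "v \<in> keys (En \<mu>)"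
      show "lk (En \<mu>) v * lk (T i (xmon v)) z = (if v = \<mu> then t i else 0)"
      proof (cases "v = \<mu>")
        case True
        obtain r where r: "keys r \<subseteq> low \<mu>" "T i (xmon \<mu>) =
           (if cp i \<mu> = 0 then lscale (t i) (xmon \<mu>)
            else if cp i \<mu> > 0 then lscale (inverse (t i)) (X (s i (\<mu>, 0)))
            else lscale (t i) (X (s i (\<mu>, 0))) + lscale (t i - inverse (t i)) (xmon \<mu>)) + r"
          using T_xmon'[OF \<mu> i(2)] by blast
        have "z \<notin> keys r" using r(1) low_not_orbit[OF \<mu>] zo by blast
        moreover have "X (s i (\<mu>, 0)) = xmon z" 
          using finW_snd[OF s_finW[OF i], of "(\<mu>, 0)"] by (simp add: z_def X_sg xmon_sg)
        ultimately have "lk (T i (xmon \<mu>)) z = t i"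
          unfolding r(2) using c ne by (simp add: lookup_add xmon_sg in_keys_iff lookup_single when_def)
        then show ?thesis using True lk_En[OF \<mu>] by simp
      next
        case False
        then have vb: "v \<in> below \<mu>" using keys_En[OF \<mu>] v by blast
        have vL: "v \<in> Lam n" using vb below_Lam by blast
        have "z \<notin> keys (T i (xmon v))"
        proof
          assume "z \<in> keys (T i (xmon v))"
          then consider "z = v" | "z = wl (s i) v" | "z \<in> low v" using keys_T_xmon[OF vL i(2)] by blast
          then show False
          proof cases
            case 1 then show False using vb not_below by simp
          next
            case 2 then have "v = \<mu>" using sz wl_s_s[OF i, of v] by simp
            then show False using False by simp
          next
            case 3
            have "low v \<subseteq> low \<mu>" using vb below_iff[OF \<mu>] low_trans low_orbit \<mu> by blast
            then show False using 3 low_not_orbit[OF \<mu>] zo by blast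
          qed
        qed
        then show ?thesis using False by (simp add: in_keys_iff)
      qed
    qed simp
    also have "\<dots> = t i" using lk_En[OF \<mu>] by (simp add: in_keys_iff)
    finally show ?thesis .
  qed
  have "lk (En \<mu>) z = 0" by (rule lk_En_0[OF \<mu> ne not_below])
  then have Gz: "lk G z = t i" using coeff by (simp add: G_def lookup_minus)
  then have "G \<noteq> 0" by auto
  then obtain x b where x: "x \<in> Lam n" "\<And>\<nu>. \<nu> \<in> Lam_plus n \<Longrightarrow> mon (gm x) \<nu> = mon (gm z) \<nu>" "G = lscale b (En x)"
    using joint_eigenvector[OF k e] mon_pt[OF i] gm_s[OF i, of \<mu>] c unfolding z_def by auto
  have "x = z"
  proof (rule ccontr)
    assume "x \<noteq> z"
    then obtain k where k: "k \<le> n" "ip x (om k) \<noteq> ip z (om k)"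
      using dle_antisym[of x z] x(1) zL unfolding dle_def by (metis ip_commute order_refl)
    then have "mon (gm x) (om k) \<noteq> mon (gm z) (om k)" by (intro gm_distinct)
    then show False using x(2)[OF om_dominant[OF k(1)]] by blast
  qed
  then have "b = t i" using Gz x(3) lk_En[OF zL] by simp
  then have "G = lscale (t i) (En z)" using x(3) \<open>x = z\<close> by simp
  then show ?thesis by (simp add: G_def z_def algebra_simps)
qed

end

section \<open>Minimal coset representatives\<close>

context rank
begin

lemma prod_list_braid_eq:
  "braid_eq is js \<Longrightarrow> (\<Prod>i\<leftarrow>is. t_simple p n i) = (\<Prod>i\<leftarrow>js. t_simple p n i)"
  by (induction rule: braid_eq.induct) (auto simp: t_simple_def braid3_def)

lemma t_elt_reduced: "reduced_expr n w is \<Longrightarrow> t_elt p n w = (\<Prod>i\<leftarrow>is. t_simple p n i)"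
  unfolding t_elt_def
  by (rule prod_list_braid_eq, rule reduced_words_braid_eq, rule some_reduced) (auto dest: reduced_affW)

lemma t_elt_id: "t_elt p n id = 1"
  using t_elt_reduced[of id "[]" p] by (simp add: reduced_expr_def)

lemma t_elt_asc:
  assumes "w \<in> affW" "i \<le> n" "\<not> desc w i" shows "t_elt p n (s i \<circ> w) = t_simple p n i * t_elt p n w"
proof -
  obtain "is" where r: "reduced_expr n w is" using reduced_exists assms(1) by blast
  have sw: "s i \<circ> w \<in> affW" by (rule comp_affW[OF s_affW[OF assms(2)] assms(1)])
  have "reduced_expr n (s i \<circ> w) (i # is)"
    by (rule reduced_cons[OF sw assms(2)]) (use desc_s[OF assms(1,2)] assms(3) r in \<open>simp_all only: s_s_comp[OF assms(2)] not_False_eq_True\<close>)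
  then show ?thesis using t_elt_reduced r by simp
qed

text \<open>Uniqueness of the shortest element is part of the definition, so that it can be established along
  with the element itself by induction over the orbit.\<close>

definition shortest :: "lattice_vec \<Rightarrow> lattice_vec \<Rightarrow> (affine_vec \<Rightarrow> affine_vec) \<Rightarrow> bool" where
  "shortest la \<mu> w \<longleftrightarrow> w \<in> finW n \<and> wl w la = \<mu> \<and> (\<forall>u\<in>finW n. wl u la = \<mu> \<longrightarrow> u = w \<or> len n w < len n u)"

lemma w_min_shortest:
  assumes "la \<in> Lam_plus n" "\<mu> \<in> orbit n la" "shortest la \<mu> w" shows "w_min n \<mu> = w"
proof -
  have d: "dr \<mu> = la" using dom_rep_eqI assms by blast
  have e: "u (la, 0) = (\<mu>, 0) \<longleftrightarrow> wl u la = \<mu>" if "u \<in> finW n" for u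
    using finW_snd[OF that, of "(la, 0)"] by (auto simp: prod_eq_iff)
  show ?thesis unfolding w_min_def d
  proof (rule the_equality)
    show "w \<in> finW n \<and> w (la, 0) = (\<mu>, 0) \<and> (\<forall>w'\<in>finW n. w' (la, 0) = (\<mu>, 0) \<longrightarrow> len n w \<le> len n w')"
      using assms(3) e unfolding shortest_def by (metis less_imp_le order_refl)
    fix u assume "u \<in> finW n \<and> u (la, 0) = (\<mu>, 0) \<and> (\<forall>w'\<in>finW n. w' (la, 0) = (\<mu>, 0) \<longrightarrow> len n u \<le> len n w')"
    then show "u = w" using assms(3) e unfolding shortest_def by (metis not_le)
  qed
qed

lemma shortest_id: "shortest la la id"
  unfolding shortest_def
proof (intro conjI ballI impI)
  fix u assume u: "u \<in> finW n" "wl u la = la"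
  show "u = id \<or> len n id < len n u" unfolding len_id using len_0 finW_affW u(1) by blast
qed simp_all

text \<open>The reflections that go down from the dominant weight lengthen the shortest element by one letter, so
  it is built up together with the path of \<open>orbit_induct\<close>.\<close>

lemma shortest_step:
  assumes la: "la \<in> Lam_plus n" and w: "shortest la \<nu> w" and i: "1 \<le> i" "i \<le> n" and c: "cp i \<nu> > 0"
  shows "shortest la (wl (s i) \<nu>) (s i \<circ> w)" "\<not> desc w i"
proof -
  have wf: "w \<in> finW n" "wl w la = \<nu>" using w by (auto simp: shortest_def)
  show nd: "\<not> desc w i" using asc_cp(2)[OF la wf(1) i] c wf(2) by auto
  have lw: "len n (s i \<circ> w) = Suc (len n w)" by (rule len_asc[OF finW_affW[OF wf(1)] i(2) nd])
  show "shortest la (wl (s i) \<nu>) (s i \<circ> w)"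
    unfolding shortest_def
  proof (intro conjI ballI impI)
    show "s i \<circ> w \<in> finW n" by (rule comp_finW[OF s_finW[OF i] wf(1)])
    show "wl (s i \<circ> w) la = wl (s i) \<nu>" unfolding wl_comp[OF s_affW[OF i(2)] finW_affW[OF wf(1)]] wf(2) ..
    fix u assume u: "u \<in> finW n" "wl u la = wl (s i) \<nu>"
    have uW: "u \<in> affW" by (rule finW_affW[OF u(1)])
    have "cp i (wl u la) < 0" unfolding u(2) using c i by (simp add: wl_s)
    then have d: "desc u i" using asc_cp(1)[OF la u(1) i] by force
    have lu: "len n u = Suc (len n (s i \<circ> u))" by (rule len_desc[OF uW i(2) d])
    have "s i \<circ> u \<in> finW n" by (rule comp_finW[OF s_finW[OF i] u(1)])
    moreover have "wl (s i \<circ> u) la = \<nu>"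
      unfolding wl_comp[OF s_affW[OF i(2)] uW] u(2) by (rule wl_s_s[OF i])
    ultimately have "s i \<circ> u = w \<or> len n w < len n (s i \<circ> u)" using w unfolding shortest_def by blast
    then show "u = s i \<circ> w \<or> len n (s i \<circ> w) < len n u"
    proof
      assume "s i \<circ> u = w"
      then have "s i \<circ> w = s i \<circ> (s i \<circ> u)" by (simp only:)
      then have e: "s i \<circ> w = u" by (simp only: s_s_comp[OF i(2)])
      show ?thesis unfolding e by simp
    qed (simp add: lw lu)
  qed
qed

lemma s_Sigma_pos:
  assumes i: "1 \<le> i" "i \<le> n" and \<alpha>: "\<alpha> \<in> Sigma_pos n" "\<alpha> \<noteq> fst (a i)"
  shows "wl (s i) \<alpha> \<in> Sigma_pos n" "wl (s i) \<alpha> \<noteq> fst (a i)"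
proof -
  have L: "bij_betw (wl (s i)) (long_pos n - {fst (a i)}) (long_pos n - {fst (a i)})"
    "bij_betw (wl (s i)) (mid_pos n - {fst (a i)}) (mid_pos n - {fst (a i)})"
    using wl_s_perm[OF i] by blast+
  then have "wl (s i) \<alpha> \<in> (long_pos n - {fst (a i)}) \<union> (mid_pos n - {fst (a i)})"
  proof (cases "\<alpha> \<in> long_pos n")
    case True
    then show ?thesis using \<alpha>(2) bij_betwE[OF L(1)] by blast
  next
    case False
    then have "\<alpha> \<in> mid_pos n - {fst (a i)}" using \<alpha> by (simp add: Sigma_pos_def)
    then show ?thesis using bij_betwE[OF L(2)] by blast
  qed
  then show "wl (s i) \<alpha> \<in> Sigma_pos n" "wl (s i) \<alpha> \<noteq> fst (a i)" by (auto simp: Sigma_pos_def)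
qed

lemma simple_Sigma_pos: "1 \<le> i \<Longrightarrow> i \<le> n \<Longrightarrow> fst (a i) \<in> Sigma_pos n"
  using simple_affroots[of i] fht_simple[of i] by (simp add: Sigma_pos_iff affroots_def)

text \<open>The index set of the product in the first formula for the coefficients.\<close>

definition negs :: "lattice_vec \<Rightarrow> lattice_vec set" where
  "negs \<mu> = {\<alpha> \<in> Sigma_pos n. ip \<mu> \<alpha> < 0}"

lemma finite_negs: "finite (negs \<mu>)"
  using finite_Sigma_pos by (simp add: negs_def)

lemma negs_step:
  assumes i: "1 \<le> i" "i \<le> n" and c: "cp i \<nu> > 0"
  shows "negs (wl (s i) \<nu>) = insert (fst (a i)) (wl (s i) ` negs \<nu>)" "fst (a i) \<notin> wl (s i) ` negs \<nu>"
    "inj_on (wl (s i)) (negs \<nu>)"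
proof -
  have pos: "ip \<nu> (fst (a i)) > 0" using cp_sign[OF i(2), of \<nu>] c by (simp add: sgn_if split: if_splits)
  then have na: "fst (a i) \<notin> negs \<nu>" by (simp add: negs_def)
  show "inj_on (wl (s i)) (negs \<nu>)" by (rule inj_on_inverseI[of _ "wl (s i)"]) (rule wl_s_s[OF i])
  show "fst (a i) \<notin> wl (s i) ` negs \<nu>" 
  proof
    assume "fst (a i) \<in> wl (s i) ` negs \<nu>"
    then obtain \<alpha> where "\<alpha> \<in> negs \<nu>" "fst (a i) = wl (s i) \<alpha>" by blast
    moreover from this have "\<alpha> \<noteq> fst (a i)" "\<alpha> \<in> Sigma_pos n" using na by (auto simp: negs_def)
    ultimately show False using s_Sigma_pos(2)[OF i] by metis
  qed
  show "negs (wl (s i) \<nu>) = insert (fst (a i)) (wl (s i) ` negs \<nu>)"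
  proof (intro equalityI subsetI)
    fix \<alpha> assume \<alpha>: "\<alpha> \<in> negs (wl (s i) \<nu>)"
    show "\<alpha> \<in> insert (fst (a i)) (wl (s i) ` negs \<nu>)"
    proof (cases "\<alpha> = fst (a i)")
      case False
      then have "wl (s i) \<alpha> \<in> negs \<nu>" using \<alpha> s_Sigma_pos(1)[OF i, of \<alpha>] ip_wl_s[OF i] by (simp add: negs_def)
      then have "wl (s i) (wl (s i) \<alpha>) \<in> wl (s i) ` negs \<nu>" by (rule imageI)
      then show ?thesis unfolding wl_s_s[OF i] by (rule insertI2)
    qed simp
  next
    fix \<alpha> assume "\<alpha> \<in> insert (fst (a i)) (wl (s i) ` negs \<nu>)"
    then show "\<alpha> \<in> negs (wl (s i) \<nu>)"
    proof (elim insertE imageE)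
      assume "\<alpha> = fst (a i)"
      then show ?thesis using simple_Sigma_pos[OF i] ip_wl_s[OF i] wl_s_simple[OF i] pos by (simp add: negs_def)
    next
      fix \<beta> assume \<beta>: "\<alpha> = wl (s i) \<beta>" "\<beta> \<in> negs \<nu>"
      then have "\<beta> \<noteq> fst (a i)" using na by auto
      then show ?thesis using \<beta> s_Sigma_pos(1)[OF i, of \<beta>] ip_wl_s[OF i] wl_s_s[OF i] by (simp add: negs_def)
    qed
  qed
qed

end

section \<open>The values of the functions \<open>v\<^sub>\<beta>\<close>\<close>

context params
begin

abbreviation "p' \<equiv> dual_params p"

lemma half_double: "Poly_Mapping.map (\<lambda>k. k div 2) (frag_cmul 2 e) = e" for e :: lattice_vec
  by (rule poly_mapping_eqI) (simp add: map.rep_eq when_def)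

lemma v_val_long:
  "e \<in> units \<Longrightarrow> nzp y \<Longrightarrow> v_val p' n (frag_cmul 2 e, 0) y =
    (1 - tn p * t0 p * mon y e) * (1 + tn p / t0 p * mon y e) / (1 - (mon y e)\<^sup>2)"
  by (simp add: v_val_def v_num_def long_roots_iff t_root_def t_half_root_def dual_params_def xaff_half_def half_double
      ev_mult ev_diff ev_add ev_lscale v_den_def xaff_def xmon_sg mon_cmul divide_inverse)

lemma v_val_mid:
  "\<alpha> \<in> mid_roots n \<Longrightarrow> nzp y \<Longrightarrow> v_val p' n (\<alpha>, 0) y = (1 - (tmid p)\<^sup>2 * mon y \<alpha>) / (1 - mon y \<alpha>)"
  using mid_not_long[of \<alpha>]
  by (simp add: v_val_def v_num_def t_root_def dual_params_def ev_diff ev_lscale v_den_def xaff_def xmon_sg)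

text \<open>\<open>v\<close> depends only on the length of the root and on the value of the monomial at the root. The sign \<open>k\<close> covers the
  passage from \<open>\<gamma>\<close> to its inverse.\<close>

lemma v_val_transport:
  assumes \<alpha>: "\<alpha> \<in> roots" and y: "nzp y" "nzp y'" and w: "w \<in> affW"
    and m: "\<And>v. mon y' (frag_cmul k (wl w v)) = mon y v" and k: "k = 1 \<or> k = - 1"
  shows "v_val p' n (frag_cmul k (wl w \<alpha>), 0) y' = v_val p' n (\<alpha>, 0) y"
proof (cases "\<alpha> \<in> long_roots n")
  case True
  then obtain e where e: "e \<in> units" "\<alpha> = frag_cmul 2 e" by (auto simp: long_roots_iff)
  have "wl w e \<in> units" using affW_units w e by blast
  then have "frag_cmul k (wl w e) \<in> units" using k units_uminus by auto
  moreover have "frag_cmul k (wl w \<alpha>) = frag_cmul 2 (frag_cmul k (wl w e))"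
    unfolding e(2) wl_lin(3)[OF w] by (simp add: mult.commute)
  ultimately show ?thesis using v_val_long[of "frag_cmul k (wl w e)" y'] v_val_long[of e y] e y m by simp
next
  case False
  then have am: "\<alpha> \<in> mid_roots n" using \<alpha> by (simp add: roots_iff)
  have "wl w \<alpha> \<in> roots" "wl w \<alpha> \<notin> long_roots n"
    using affW_roots[OF w, of "(\<alpha>, 0)"] affW_long_iff[OF w, of "(\<alpha>, 0)"] \<alpha> False by (auto simp: affroots_def)
  then have "wl w \<alpha> \<in> mid_roots n" by (simp add: roots_iff)
  then have "frag_cmul k (wl w \<alpha>) \<in> mid_roots n" using k by (auto simp: mid_roots_def)
  then show ?thesis using v_val_mid am y m by simp
qed

end

section \<open>The expansion coefficients\<close>

context generic
begin

text \<open>The link between the action of \<open>T\<^sub>i\<close> on the \<open>E\<^sub>\<mu>\<close> and the functions \<open>v\<close> for the dual parameters, under which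
  \<open>t\<^sub>0\<close> takes the place of the label of \<open>\<epsilon>\<^sub>n\<close>.\<close>

lemma dg_v:
  assumes i: "1 \<le> i" "i \<le> n"
  shows "v_val p' n (fst (a i), 0) (gm \<mu>) = 1 + t i * dg i \<mu>"
    "v_val p' n (- fst (a i), 0) (gm \<mu>) = (t i)\<^sup>2 - t i * dg i \<mu>"
proof -
  have "v_val p' n (fst (a i), 0) (gm \<mu>) = 1 + t i * dg i \<mu> \<and>
     v_val p' n (- fst (a i), 0) (gm \<mu>) = (t i)\<^sup>2 - t i * dg i \<mu>"
  proof (cases "i < n")
    case True
    define z where "z = mon (gm \<mu>) (fst (a i))"
    have z: "z \<noteq> 1" "z \<noteq> 0" using gm_simple_ne(1)[OF i True] by (auto simp: z_def)
    have m: "fst (a i) \<in> mid_roots n" "- fst (a i) \<in> mid_roots n"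
      using simple_mid[OF i(1) True] by (auto simp: mid_roots_def)
    have t: "t i = tmid p" using i True by (simp add: t_simple_def)
    have v: "v_val p' n (fst (a i), 0) (gm \<mu>) = (1 - (tmid p)\<^sup>2 * z) / (1 - z)"
      "v_val p' n (- fst (a i), 0) (gm \<mu>) = (1 - (tmid p)\<^sup>2 * (1 / z)) / (1 - 1 / z)"
      using v_val_mid[OF m(1), of "gm \<mu>"] v_val_mid[OF m(2), of "gm \<mu>"] by (simp_all add: z_def mon_uminus divide_inverse)
    have d: "dg i \<mu> = (tmid p - 1 / tmid p) / (1 - 1 / z)" using True by (simp add: dg_def z_def)
    define w where "w = 1 / z"
    have w: "1 - w \<noteq> 0" "w \<noteq> 0" "z = 1 / w" using z by (auto simp: w_def)
    have "tmid p * dg i \<mu> = ((tmid p)\<^sup>2 - 1) / (1 - w)"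
      unfolding d w_def by (simp add: right_diff_distrib power2_eq_square)
    moreover have "(1 - (tmid p)\<^sup>2 * z) / (1 - z) = 1 + ((tmid p)\<^sup>2 - 1) / (1 - w)"
    proof -
      have "(1 - (tmid p)\<^sup>2 * z) = - ((tmid p)\<^sup>2 - w) / w" "1 - z = - (1 - w) / w" using w by (simp_all add: field_simps)
      then have "(1 - (tmid p)\<^sup>2 * z) / (1 - z) = (- ((tmid p)\<^sup>2 - w) / w) / (- (1 - w) / w)" by (simp only:)
      also have "\<dots> = ((tmid p)\<^sup>2 - w) / (1 - w)"
      proof -
        have "- x / w / (- y / w) = x / y" for x y using w(2) by simp
        then show ?thesis .
      qed
      finally have "(1 - (tmid p)\<^sup>2 * z) / (1 - z) = ((tmid p)\<^sup>2 - w) / (1 - w)" .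
      then show ?thesis using w(1) by (simp add: field_simps)
    qed
    moreover have "(1 - (tmid p)\<^sup>2 * (1 / z)) / (1 - 1 / z) = (tmid p)\<^sup>2 - ((tmid p)\<^sup>2 - 1) / (1 - w)"
      unfolding w_def[symmetric] using w(1) by (simp add: field_simps)
    ultimately show ?thesis unfolding v t by simp
  next
    case False
    then have n: "i = n" using i by simp
    define y where "y = mon (gm \<mu>) (eps n)"
    have y: "y\<^sup>2 \<noteq> 1" using gm_simple_ne(2)[OF i n, of \<mu>] by (simp add: y_def)
    have y0: "y \<noteq> 0" unfolding y_def by (rule mon_nz) simp
    note y = y y0
    have e: "eps n \<in> units" "- eps n \<in> units" using n2 by (auto simp: units_def)
    have a: "fst (a i) = frag_cmul 2 (eps n)" "- fst (a i) = frag_cmul 2 (- eps n)" using n n2 by (auto simp: simple_root_def)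
    have t: "t i = tn p" using n n2 by (simp add: t_simple_def)
    have v: "v_val p' n (fst (a i), 0) (gm \<mu>) = (1 - tn p * t0 p * y) * (1 + tn p / t0 p * y) / (1 - y\<^sup>2)"
      unfolding a(1) y_def by (rule v_val_long[OF e(1)]) simp
    have v': "v_val p' n (- fst (a i), 0) (gm \<mu>) = (1 - tn p * t0 p * (1 / y)) * (1 + tn p / t0 p * (1 / y)) / (1 - (1 / y)\<^sup>2)"
      unfolding a(2) y_def using v_val_long[OF e(2), of "gm \<mu>"] by (simp add: mon_uminus divide_inverse)
    have d: "dg i \<mu> = (tn p - 1 / tn p + (t0 p - 1 / t0 p) / y) / (1 - 1 / y\<^sup>2)" using n by (simp add: dg_def y_def)
    have nz: "1 - y\<^sup>2 \<noteq> 0" "y\<^sup>2 - 1 \<noteq> 0" using y by auto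
    have d': "dg i \<mu> = (tn p - 1 / tn p + (t0 p - 1 / t0 p) / y) * y\<^sup>2 / (y\<^sup>2 - 1)"
      unfolding d using y nz by (simp add: field_simps)
    have v'': "v_val p' n (- fst (a i), 0) (gm \<mu>) = (y - tn p * t0 p) * (y + tn p / t0 p) / (y\<^sup>2 - 1)"
      unfolding v' using y nz by (simp add: field_simps power2_eq_square)
    have v1: "v_val p' n (fst (a i), 0) (gm \<mu>) = - ((1 - tn p * t0 p * y) * (1 + tn p / t0 p * y)) / (y\<^sup>2 - 1)"
      unfolding v using nz by (simp add: divide_simps) (simp add: algebra_simps)
    show ?thesis unfolding v1 v'' t d' using y nz
      by (simp add: divide_simps) (simp add: algebra_simps power2_eq_square)
  qed
  then show "v_val p' n (fst (a i), 0) (gm \<mu>) = 1 + t i * dg i \<mu>"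
    "v_val p' n (- fst (a i), 0) (gm \<mu>) = (t i)\<^sup>2 - t i * dg i \<mu>" by auto
qed

text \<open>The eigenvalue of \<open>T\<^sub>i\<close> for the sign \<open>\<sigma>\<close>. It forces the coefficients of \<open>E\<^sub>\<mu>\<close> and of \<open>E\<^bsub>s\<^sub>i \<mu>\<^esub>\<close> to have
  the quotient \<open>ratio\<close> when \<open>\<langle>\<mu>, a\<^sub>i\<rangle> < 0\<close>.\<close>

definition tev :: "int \<Rightarrow> nat \<Rightarrow> complex" where
  "tev \<sigma> i = (if \<sigma> = 1 then t i else - (1 / t i))"

definition ratio :: "int \<Rightarrow> nat \<Rightarrow> lattice_vec \<Rightarrow> complex" where
  "ratio \<sigma> i \<mu> = (tev \<sigma> i - t i + 1 / t i + dg i \<mu>) / t i"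

abbreviation "cf \<sigma> \<equiv> coeff_at_mu p n \<sigma>"

lemma dual_t_simple: "1 \<le> i \<Longrightarrow> i \<le> n \<Longrightarrow> t_simple p' n i = t i"
  by (simp add: t_simple_def dual_params_def)

lemma cf_dominant:
  assumes la: "la \<in> Lam_plus n" shows "cf \<sigma> la = 1"
proof -
  have w: "w_min n la = id" by (rule w_min_shortest[OF la orbit_refl shortest_id])
  have "negs la = {}" using dominant_roots[OF la] by (force simp: negs_def Sigma_pos_iff)
  then have e: "{\<alpha> \<in> Sigma_pos n. ip la \<alpha> < 0} = {}" by (simp add: negs_def)
  show ?thesis unfolding coeff_at_mu_def w len_id t_elt_id e by simp
qed

lemma shortest_exists:
  assumes "la \<in> Lam_plus n" "\<mu> \<in> orbit n la" shows "\<exists>w. shortest la \<mu> w"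
  using assms(2,1)
proof (induction rule: orbit_induct)
  case dominant show ?case by (rule exI, rule shortest_id)
next
  case (step i \<nu>) then show ?case using shortest_step(1)[OF assms(1)] by blast
qed

text \<open>Passing from \<open>\<nu>\<close> to \<open>s\<^sub>i \<nu>\<close> adds the single root \<open>a\<^sub>i\<close> to the index set and transports the other factors;
  the new factor and the new letter of \<open>w\<close> combine to the ratio.\<close>

lemma cf_step:
  assumes la: "la \<in> Lam_plus n" and \<nu>: "\<nu> \<in> orbit n la" and i: "1 \<le> i" "i \<le> n" and c: "cp i \<nu> > 0"
    and \<sigma>: "\<sigma> = 1 \<or> \<sigma> = - 1"
  shows "cf \<sigma> (wl (s i) \<nu>) = ratio \<sigma> i (wl (s i) \<nu>) * cf \<sigma> \<nu>"
proof -
  define z where "z = wl (s i) \<nu>"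
  obtain w where w: "shortest la \<nu> w" using shortest_exists[OF la \<nu>] by blast
  note S = shortest_step[OF la w i c]
  have wW: "w \<in> affW" using w finW_affW by (simp add: shortest_def)
  have zo: "z \<in> orbit n la" unfolding z_def by (rule orbit_s[OF \<nu> i])
  have m: "w_min n z = s i \<circ> w" "w_min n \<nu> = w"
    unfolding z_def using w_min_shortest[OF la zo[unfolded z_def] S(1)] w_min_shortest[OF la \<nu> w] by auto
  have l: "len n (s i \<circ> w) = Suc (len n w)" by (rule len_asc[OF wW i(2) S(2)])
  have te: "t_elt p' n (s i \<circ> w) = t i * t_elt p' n w"
    using t_elt_asc[OF wW i(2) S(2), of p'] dual_t_simple[OF i] by simp
  let ?V = "\<lambda>\<mu> \<alpha>. v_val p' n (frag_cmul \<sigma> \<alpha>, 0) (gm \<mu>)"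
  have tr: "?V z (wl (s i) \<beta>) = ?V \<nu> \<beta>" if "\<beta> \<in> negs \<nu>" for \<beta>
  proof -
    have \<beta>: "frag_cmul \<sigma> \<beta> \<in> roots" using that \<sigma> roots_uminus by (auto simp: negs_def Sigma_pos_iff)
    have "mon (gm z) (frag_cmul 1 (wl (s i) v)) = mon (gm \<nu>) v" for v
      unfolding z_def using gm_s[OF i, of \<nu> "wl (s i) v"] c wl_s_s[OF i, of v] by simp
    then have "v_val p' n (frag_cmul 1 (wl (s i) (frag_cmul \<sigma> \<beta>)), 0) (gm z) = v_val p' n (frag_cmul \<sigma> \<beta>, 0) (gm \<nu>)"
      using v_val_transport[OF \<beta> gam_nzp gam_nzp s_affW[OF i(2)]] by blast
    then show ?thesis using wl_lin(3)[OF s_affW[OF i(2)]] by simp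
  qed
  have P: "(\<Prod>\<alpha>\<in>negs z. ?V z \<alpha>) = ?V z (fst (a i)) * (\<Prod>\<alpha>\<in>negs \<nu>. ?V \<nu> \<alpha>)"
  proof -
    have "(\<Prod>\<alpha>\<in>negs z. ?V z \<alpha>) = ?V z (fst (a i)) * (\<Prod>\<alpha>\<in>wl (s i) ` negs \<nu>. ?V z \<alpha>)"
      using negs_step[OF i c] finite_negs[of \<nu>] by (simp add: z_def)
    also have "(\<Prod>\<alpha>\<in>wl (s i) ` negs \<nu>. ?V z \<alpha>) = (\<Prod>\<alpha>\<in>negs \<nu>. ?V \<nu> \<alpha>)"
      unfolding prod.reindex[OF negs_step(3)[OF i c]] using tr by (intro prod.cong) auto
    finally show ?thesis .
  qed
  have R: "ratio \<sigma> i z = of_int \<sigma> * t i powi (- 2) * ?V z (fst (a i))"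
    using \<sigma> dg_v[OF i, of z]
    by (auto simp: ratio_def tev_def power_int_minus field_simps power2_eq_square)
  show ?thesis
    unfolding coeff_at_mu_def z_def[symmetric] m l te negs_def[symmetric] P R
    by (simp add: power_int_mult_distrib mult_ac)
qed

text \<open>The map \<open>\<alpha> \<mapsto> - w \<alpha>\<close>, for the shortest \<open>w\<close> with \<open>w la = \<mu>\<close>, matches the two index sets, and \<open>\<gamma>\<^sub>\<mu> = w \<gamma>\<^bsub>la\<^esub>\<close>. Minimality
  of \<open>w\<close> enters because it inverts no root orthogonal to \<open>la\<close>.\<close>

theorem coeff_eq:
  assumes la: "la \<in> Lam_plus n" and \<mu>: "\<mu> \<in> orbit n la" and \<sigma>: "\<sigma> = 1 \<or> \<sigma> = - 1"
  shows "cf \<sigma> \<mu> = coeff_at_lambda p n \<sigma> la \<mu>"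
proof -
  have "\<exists>w. shortest la \<mu> w \<and> (\<forall>\<alpha>\<in>Sigma_pos n. fht (wl w \<alpha>) < 0 \<longrightarrow> ip la \<alpha> > 0) \<and>
      (\<forall>v. mon (gm \<mu>) (wl w v) = mon (gm la) v)"
    using \<mu> la
  proof (induction rule: orbit_induct)
    case dominant
    show ?case
    proof (intro exI[of _ id] conjI ballI allI impI)
      show "shortest la la id" by (rule shortest_id)
    qed (auto simp: Sigma_pos_iff)
  next
    case (step i \<nu>)
    then obtain w where w: "shortest la \<nu> w" "\<And>\<alpha>. \<alpha> \<in> Sigma_pos n \<Longrightarrow> fht (wl w \<alpha>) < 0 \<Longrightarrow> ip la \<alpha> > 0"
      "\<And>v. mon (gm \<nu>) (wl w v) = mon (gm la) v" by blast
    note i = step(1,2) and c = step(4)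
    have wf: "w \<in> finW n" "wl w la = \<nu>" using w(1) by (auto simp: shortest_def)
    have wW: "w \<in> affW" by (rule finW_affW[OF wf(1)])
    have cmp: "wl (s i \<circ> w) v = wl (s i) (wl w v)" for v by (rule wl_comp[OF s_affW[OF i(2)] wW])
    show ?case
    proof (intro exI[of _ "s i \<circ> w"] conjI ballI impI allI)
      show "shortest la (wl (s i) \<nu>) (s i \<circ> w)" by (rule shortest_step(1)[OF la w(1) i c])
      fix v show "mon (gm (wl (s i) \<nu>)) (wl (s i \<circ> w) v) = mon (gm la) v"
        unfolding cmp using gm_s[OF i, of \<nu> "wl (s i) (wl w v)"] c wl_s_s[OF i, of "wl w v"] w(3)[of v] by simp
    next
      fix \<alpha> assume \<alpha>: "\<alpha> \<in> Sigma_pos n" "fht (wl (s i \<circ> w) \<alpha>) < 0"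
      have r: "wl w \<alpha> \<in> roots" using affW_roots[OF wW, of "(\<alpha>, 0)"] \<alpha> by (simp add: affroots_def Sigma_pos_iff)
      show "ip la \<alpha> > 0"
      proof (cases "fht (wl w \<alpha>) < 0")
        case True then show ?thesis using w(2) \<alpha> by blast
      next
        case False
        then have "wl w \<alpha> \<in> Sigma_pos n" using r fht_roots(2)[OF r] by (simp add: Sigma_pos_iff)
        then have "wl w \<alpha> = fst (a i)" using s_Sigma_pos(1)[OF i, of "wl w \<alpha>"] \<alpha>(2) unfolding cmp by (auto simp: Sigma_pos_iff)
        then have "ip la \<alpha> = ip \<nu> (fst (a i))" using wl_ip[OF wW, of la \<alpha>] wf(2) by simp
        then show ?thesis using cp_sign[OF i(2), of \<nu>] c by (simp add: sgn_if split: if_splits)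
      qed
    qed
  qed
  then obtain w where w: "shortest la \<mu> w" "\<And>\<alpha>. \<alpha> \<in> Sigma_pos n \<Longrightarrow> fht (wl w \<alpha>) < 0 \<Longrightarrow> ip la \<alpha> > 0"
      "\<And>v. mon (gm \<mu>) (wl w v) = mon (gm la) v" by blast
  have m: "w_min n \<mu> = w" by (rule w_min_shortest[OF la \<mu> w(1)])
  have wf: "w \<in> finW n" "wl w la = \<mu>" using w(1) by (auto simp: shortest_def)
  have wW: "w \<in> affW" "inv w \<in> affW" using finW_affW[OF wf(1)] by auto
  define S where "S = {\<alpha> \<in> Sigma_pos n. wl w \<alpha> \<in> Sigma_neg n}"
  have rts: "wl u \<alpha> \<in> roots" if "u \<in> affW" "\<alpha> \<in> roots" for u \<alpha>
    using affW_roots[OF that(1), of "(\<alpha>, 0)"] that(2) by (simp add: affroots_def)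
  have bij: "bij_betw (\<lambda>\<alpha>. - wl w \<alpha>) S (negs \<mu>)"
  proof (rule bij_betw_byWitness[where f' = "\<lambda>\<beta>. - wl (inv w) \<beta>"])
    show "\<forall>\<alpha>\<in>S. - wl (inv w) (- wl w \<alpha>) = \<alpha>"
      using fst_affW_uminus[OF wW(2)] wl_inv[OF wW(1)] by simp
    have inv': "wl w (wl (inv w) v) = v" for v
      using wl_inv[OF wW(2), of v] affW_bij[OF wW(1)] by (simp add: inv_inv_eq)
    then show "\<forall>\<beta>\<in>negs \<mu>. - wl w (- wl (inv w) \<beta>) = \<beta>"
      using fst_affW_uminus[OF wW(1)] by simp
    show "(\<lambda>\<alpha>. - wl w \<alpha>) ` S \<subseteq> negs \<mu>"
    proof (rule image_subsetI)
      fix \<alpha> assume "\<alpha> \<in> S"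
      then have \<alpha>: "\<alpha> \<in> Sigma_pos n" "fht (wl w \<alpha>) < 0" "wl w \<alpha> \<in> roots" by (auto simp: S_def Sigma_neg_iff)
      have "ip \<mu> (wl w \<alpha>) > 0" using w(2)[OF \<alpha>(1,2)] wl_ip[OF wW(1), of la \<alpha>] wf(2) by simp
      then show "- wl w \<alpha> \<in> negs \<mu>" using \<alpha> roots_uminus by (simp add: negs_def Sigma_pos_iff)
    qed
    show "(\<lambda>\<beta>. - wl (inv w) \<beta>) ` negs \<mu> \<subseteq> S"
    proof (rule image_subsetI)
      fix \<beta> assume "\<beta> \<in> negs \<mu>"
      then have \<beta>: "\<beta> \<in> roots" "fht \<beta> > 0" "ip \<mu> \<beta> < 0" by (auto simp: negs_def Sigma_pos_iff)
      define \<alpha> where "\<alpha> = - wl (inv w) \<beta>"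
      have wa: "wl w \<alpha> = - \<beta>" unfolding \<alpha>_def fst_affW_uminus[OF wW(1)] inv' ..
      have r: "\<alpha> \<in> roots" unfolding \<alpha>_def by (intro roots_uminus rts wW \<beta>)
      have "ip la \<alpha> = - ip \<mu> \<beta>" using wl_ip[OF wW(1), of la \<alpha>] wa wf(2) by simp
      then have "ip la \<alpha> > 0" using \<beta> by simp
      then have "fht \<alpha> > 0"
        using dominant_roots[OF la roots_uminus[OF r]] fht_roots(2)[OF r] by force
      then show "\<alpha> \<in> S" using r wa \<beta> roots_uminus by (simp add: S_def Sigma_pos_iff Sigma_neg_iff)
    qed
  qed
  let ?g = "\<lambda>i. inverse (gm la i)"
  have gi: "nzp ?g" using gam_nzp[of la] by (simp add: nzp_def)
  have mg: "mon ?g v = mon (gm la) (- v)" for v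
    unfolding mon_uminus unfolding mon_def by (simp add: power_int_inverse prod_inversef[unfolded comp_def])
  have "(\<Prod>\<beta>\<in>negs \<mu>. v_val p' n (frag_cmul \<sigma> \<beta>, 0) (gm \<mu>)) =
      (\<Prod>\<alpha>\<in>S. v_val p' n (frag_cmul \<sigma> (- wl w \<alpha>), 0) (gm \<mu>))"
    by (rule prod.reindex_bij_betw[OF bij, symmetric])
  also have "\<dots> = (\<Prod>\<alpha>\<in>S. v_val p' n (frag_cmul \<sigma> \<alpha>, 0) ?g)"
  proof (rule prod.cong)
    fix \<alpha> assume "\<alpha> \<in> S"
    then have r: "frag_cmul \<sigma> \<alpha> \<in> roots" using \<sigma> roots_uminus by (auto simp: S_def Sigma_pos_iff)
    have "mon (gm \<mu>) (frag_cmul (- 1) (wl w v)) = mon ?g v" for v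
      using w(3)[of "- v"] fst_affW_uminus[OF wW(1), of v] unfolding mg by simp
    then have "v_val p' n (frag_cmul (- 1) (wl w (frag_cmul \<sigma> \<alpha>)), 0) (gm \<mu>) = v_val p' n (frag_cmul \<sigma> \<alpha>, 0) ?g"
      using v_val_transport[OF r gi gam_nzp wW(1)] by blast
    then show "v_val p' n (frag_cmul \<sigma> (- wl w \<alpha>), 0) (gm \<mu>) = v_val p' n (frag_cmul \<sigma> \<alpha>, 0) ?g"
      unfolding wl_lin(3)[OF wW(1)] by simp
  qed simp
  finally show ?thesis
    unfolding coeff_at_mu_def coeff_at_lambda_def m negs_def[symmetric] S_def[symmetric] by simp
qed

end

section \<open>The spaces spanned by eigenvectors\<close>

lemma subspace_keys: "laurent.subspace {f. keys f \<subseteq> S}"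
  unfolding laurent.subspace_def
proof (intro conjI ballI allI)
  show "0 \<in> {f :: laurent. keys f \<subseteq> S}" by simp
  fix f g :: laurent and c
  assume f: "f \<in> {f. keys f \<subseteq> S}"
  show "lscale c f \<in> {f. keys f \<subseteq> S}" using f keys_lscale[of c f] by auto
  assume g: "g \<in> {f. keys f \<subseteq> S}"
  show "f + g \<in> {f. keys f \<subseteq> S}" using f g Poly_Mapping.keys_add[of f g] by auto
qed

lemma span_xmon: "laurent.span (xmon ` S) = {f. keys f \<subseteq> S}"
proof (rule equalityI)
  show "laurent.span (xmon ` S) \<subseteq> {f. keys f \<subseteq> S}"
    by (rule laurent.span_minimal[OF _ subspace_keys]) (auto simp: xmon_sg)
  show "{f. keys f \<subseteq> S} \<subseteq> laurent.span (xmon ` S)"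
  proof
    fix f :: laurent assume f: "f \<in> {f. keys f \<subseteq> S}"
    have "f = (\<Sum>v\<in>keys f. lscale (lk f v) (xmon v))"
      using pm_decomp[of f] by (simp add: xmon_sg)
    also have "\<dots> \<in> laurent.span (xmon ` S)"
      using f by (intro laurent.span_sum laurent.span_scale laurent.span_base) auto
    finally show "f \<in> laurent.span (xmon ` S)" .
  qed
qed

lemma span_finite_image:
  assumes "finite I" shows "laurent.span (F ` I) = {\<Sum>i\<in>I. lscale (d i) (F i) |d. True}" (is "_ = ?R")
proof (rule equalityI)
  have mem: "(\<Sum>i\<in>I. lscale (d i) (F i)) \<in> ?R" for d by blast
  have "laurent.subspace ?R"
    unfolding laurent.subspace_def
  proof (intro conjI ballI allI)
    show "0 \<in> ?R" using mem[of "\<lambda>_. 0"] by simp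
    fix f c assume "f \<in> ?R"
    then obtain d where d: "f = (\<Sum>i\<in>I. lscale (d i) (F i))" by blast
    show "lscale c f \<in> ?R" using mem[of "\<lambda>i. c * d i"] unfolding d lscale_sum lscale_lscale .
    fix g assume "g \<in> ?R"
    then obtain d' where d': "g = (\<Sum>i\<in>I. lscale (d' i) (F i))" by blast
    show "f + g \<in> ?R"
      using mem[of "\<lambda>i. d i + d' i"] unfolding d d' lscale_add_left sum.distrib .
  qed
  moreover have "F ` I \<subseteq> ?R"
  proof (rule image_subsetI)
    fix j assume "j \<in> I"
    then have "(\<Sum>i\<in>I. lscale (if i = j then 1 else 0) (F i)) = F j"
      using assms by (simp add: if_distrib[of "\<lambda>c. lscale c _"] cong: if_cong)
    then show "F j \<in> ?R" using mem[of "\<lambda>i. if i = j then 1 else 0"] by metis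
  qed
  ultimately show "laurent.span (F ` I) \<subseteq> ?R" by (rule laurent.span_minimal[rotated])
  show "?R \<subseteq> laurent.span (F ` I)"
  proof
    fix f assume "f \<in> ?R"
    then obtain d where d: "f = (\<Sum>i\<in>I. lscale (d i) (F i))" by blast
    show "f \<in> laurent.span (F ` I)"
      unfolding d by (intro laurent.span_sum laurent.span_scale laurent.span_base imageI)
  qed
qed

context rank
begin

lemma lk_kappa: "lk (kappa n) j = (if 1 \<le> j \<and> j \<le> n then int (n + 1 - j) else 0)"
proof -
  have "lk (kappa n) j = (\<Sum>i=1..n. if i = j then int (n + 1 - i) else 0)"
    unfolding kappa_def lookup_sum by (rule sum.cong) auto
  then show ?thesis by simp
qed

lemma kappa_Lam: "kappa n \<in> Lam n"
  by (simp add: Lam_iff lk_kappa)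

lemma cp_kappa: "1 \<le> i \<Longrightarrow> i \<le> n \<Longrightarrow> cp i (kappa n) = 1"
  by (auto simp: cpair_def lk_kappa)

text \<open>Adding a large multiple of \<open>\<kappa>\<close>, which pairs to 1 with every simple coroot, makes any weight dominant.\<close>

lemma dominant_difference:
  assumes v: "v \<in> Lam n" shows "\<exists>\<mu>\<in>Lam_plus n. \<exists>\<nu>\<in>Lam_plus n. v = \<mu> - \<nu>"
proof -
  define N where "N = (\<Sum>i=1..n. \<bar>cp i v\<bar>)"
  define \<nu> where "\<nu> = frag_cmul N (kappa n)"
  have N: "\<bar>cp i v\<bar> \<le> N" if "1 \<le> i" "i \<le> n" for i
    unfolding N_def by (rule member_le_sum) (use that in auto)
  have "N \<ge> 0" unfolding N_def by (rule sum_nonneg) simp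
  then have "\<nu> \<in> Lam_plus n" by (auto simp: Lam_plus_iff \<nu>_def cp_kappa intro: Lam_cmul kappa_Lam)
  moreover have "v + \<nu> \<in> Lam_plus n"
    using N v by (force simp: Lam_plus_iff \<nu>_def cp_kappa intro: Lam_cmul kappa_Lam Lam_add)
  moreover have "v = (v + \<nu>) - \<nu>" by simp
  ultimately show ?thesis by blast
qed

lemma prec_monic_iff: "prec_monic n la f \<longleftrightarrow> keys (f - xmon la) \<subseteq> below la"
  unfolding prec_monic_def span_xmon below_def by simp

lemma prec_monic_lk:
  assumes "prec_monic n la f" shows "lk f la = 1"
proof -
  have "la \<notin> keys (f - xmon la)" using assms below_irrefl by (auto simp: prec_monic_iff)
  then have "lk (f - xmon la) la = 0" by (simp add: in_keys_iff)
  then show ?thesis by (simp add: lookup_minus xmon_sg)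
qed

end

context generic
begin

text \<open>On combinations of the \<open>E\<^sub>x\<close> the inverse of \<open>Y\<^sup>\<nu>\<close> divides by the eigenvalues, so the choice of the two
  dominant weights drops out.\<close>

lemma Y_op_sum:
  assumes v: "v \<in> Lam n" and S: "S \<subseteq> Lam n"
  shows "Y_op p n v (\<Sum>x\<in>S. lscale (d x) (En x)) = (\<Sum>x\<in>S. lscale (d x * mon (gm x) v) (En x))"
proof -
  define P where "P = (\<lambda>(\<mu>, \<nu>). \<mu> \<in> Lam_plus n \<and> \<nu> \<in> Lam_plus n \<and> v = \<mu> - \<nu>)"
  obtain \<mu> \<nu> where \<mu>\<nu>: "(SOME x. P x) = (\<mu>, \<nu>)" by fastforce
  have "\<exists>x. P x" using dominant_difference[OF v] by (auto simp: P_def)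
  then have "P (SOME x. P x)" by (rule someI_ex)
  then have P: "\<mu> \<in> Lam_plus n" "\<nu> \<in> Lam_plus n" "v = \<mu> - \<nu>" unfolding \<mu>\<nu> by (auto simp: P_def)
  note W = tau_W[OF P(1)] tau_W[OF P(2)]
  let ?f = "\<Sum>x\<in>S. lscale (d x) (En x)"
  define g where "g = (\<Sum>x\<in>S. lscale (d x / mon (gm x) \<nu>) (En x))"
  have En': "En x \<in> laurent_alg n" if "x \<in> S" for x using keys_En_Lam S that by (auto simp: laurent_alg_def)
  have "keys g \<subseteq> Lam n"
  proof -
    have "g \<in> {f. keys f \<subseteq> Lam n}" unfolding g_def
      using En' by (intro laurent.subspace_sum[OF subspace_keys] laurent.subspace_scale[OF subspace_keys])
        (auto simp: laurent_alg_def)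
    then show ?thesis by simp
  qed
  then have gA: "g \<in> laurent_alg n" by (simp add: laurent_alg_def)
  have Yg: "Y \<nu> g = ?f"
    unfolding g_def Tw_sum[OF W(2)] using S
    by (intro sum.cong) (auto simp: Tw_lscale[OF W(2)] En(2)[OF _ P(2)] subset_iff)
  obtain U where "\<And>f. U (Y \<nu> f) = f" using Tw_bij[OF W(2)] by blast
  then have inj: "inj_on (Y \<nu>) (laurent_alg n)" by (metis inj_onI)
  have inv: "inv_into (laurent_alg n) (Y \<nu>) ?f = g"
    unfolding Yg[symmetric] by (rule inv_into_f_f[OF inj gA])
  have "Y_op p n v ?f = Y \<mu> (inv_into (laurent_alg n) (Y \<nu>) ?f)"
    unfolding Y_op_def P_def[symmetric] \<mu>\<nu> by simp
  also have "\<dots> = (\<Sum>x\<in>S. lscale (d x * mon (gm x) v) (En x))"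
    unfolding inv unfolding g_def Tw_sum[OF W(1)] using S
    by (intro sum.cong) (auto simp: Tw_lscale[OF W(1)] En(2)[OF _ P(1)] subset_iff P(3) mon_diff)
  finally show ?thesis .
qed

lemma fY_sum:
  assumes f: "f \<in> laurent_alg n" and S: "S \<subseteq> Lam n"
  shows "fY p n f (\<Sum>x\<in>S. lscale (d x) (En x)) = (\<Sum>x\<in>S. lscale (d x * ev f (gm x)) (En x))"
proof -
  have "fY p n f (\<Sum>x\<in>S. lscale (d x) (En x)) =
      (\<Sum>v\<in>keys f. lscale (lk f v) (\<Sum>x\<in>S. lscale (d x * mon (gm x) v) (En x)))"
    unfolding fY_def using f Y_op_sum[OF _ S] by (intro sum.cong) (auto simp: laurent_alg_def)
  also have "\<dots> = (\<Sum>v\<in>keys f. \<Sum>x\<in>S. lscale (lk f v * (d x * mon (gm x) v)) (En x))"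
    unfolding lscale_sum lscale_lscale ..
  also have "\<dots> = (\<Sum>x\<in>S. \<Sum>v\<in>keys f. lscale (lk f v * (d x * mon (gm x) v)) (En x))"
    by (rule sum.swap)
  also have "\<dots> = (\<Sum>x\<in>S. lscale (d x * ev f (gm x)) (En x))"
    unfolding laurent.scale_sum_left[symmetric] ev_def sum_distrib_left by (simp only: mult.left_commute)
  finally show ?thesis .
qed

lemma fY_En: "f \<in> laurent_alg n \<Longrightarrow> x \<in> Lam n \<Longrightarrow> fY p n f (En x) = lscale (ev f (gm x)) (En x)"
  using fY_sum[of f "{x}" "\<lambda>_. 1"] by simp

lemma En_coeffs_eq:
  assumes "finite M" "M \<subseteq> Lam n"
    "(\<Sum>x\<in>M. lscale (d x) (En x)) = (\<Sum>x\<in>M. lscale (d' x) (En x))" "x \<in> M"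
  shows "d x = d' x"
proof -
  have "(\<Sum>x\<in>M. lscale (d x - d' x) (En x)) = 0"
    unfolding lscale_diff_left sum_subtractf using assms(3) by simp
  then show ?thesis using En_independent[OF assms(1,2), of "\<lambda>x. d x - d' x"] assms(4) by simp
qed

lemma prec_monic_En: "la \<in> Lam n \<Longrightarrow> prec_monic n la (En la)"
  unfolding prec_monic_iff by (rule En(1))

text \<open>Some coordinate takes different values at two given spectral points, so the expansion of a candidate
  in the basis has only the term of \<open>E\<close> at \<open>la\<close>.\<close>

lemma Pns_En:
  assumes la: "la \<in> Lam n" shows "Pns p n la = En la"
  unfolding Pns_def
proof (rule the_equality)
  show "En la \<in> laurent_alg n \<and> prec_monic n la (En la) \<and>
      (\<forall>f\<in>laurent_alg n. fY p n f (En la) = lscale (ev f (gm la)) (En la))"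
    using la fY_En keys_En_Lam prec_monic_En by (simp add: laurent_alg_def)
  fix P assume P: "P \<in> laurent_alg n \<and> prec_monic n la P \<and>
      (\<forall>f\<in>laurent_alg n. fY p n f P = lscale (ev f (gm la)) P)"
  let ?S = "insert la (below la)"
  have cl: "closed ?S" by (rule closed_down[OF la])
  have S: "finite ?S" "?S \<subseteq> Lam n" using la finite_below[OF la] below_Lam by auto
  have "keys P \<subseteq> ?S"
  proof -
    have "P = (P - xmon la) + xmon la" by simp
    then have "keys P \<subseteq> keys (P - xmon la) \<union> keys (xmon la)" using Poly_Mapping.keys_add by metis
    then show ?thesis using P by (auto simp: prec_monic_iff xmon_sg split: if_splits)
  qed
  then obtain d where d: "P = (\<Sum>x\<in>?S. lscale (d x) (En x))" using En_expand[OF cl] by blast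
  have d0: "d x = 0" if x: "x \<in> below la" for x
  proof -
    have xL: "x \<in> Lam n" by (rule below_Lam[OF x])
    have "x \<noteq> la" using below_irrefl x by auto
    then obtain i where i: "1 \<le> i" "i \<le> n" "lk x i \<noteq> lk la i" using Lam_eqI[OF xL la] by blast
    have "xmon (eps i) \<in> laurent_alg n" using Lam_eps[OF i(1,2)] by (simp add: laurent_alg_def xmon_sg)
    then have "fY p n (xmon (eps i)) P = lscale (ev (xmon (eps i)) (gm la)) P"
        "fY p n (xmon (eps i)) P = (\<Sum>x\<in>?S. lscale (d x * ev (xmon (eps i)) (gm x)) (En x))"
      using P fY_sum[OF _ S(2)] unfolding d by blast+
    then have "(\<Sum>x\<in>?S. lscale (d x * ev (xmon (eps i)) (gm x)) (En x)) =
        (\<Sum>x\<in>?S. lscale (ev (xmon (eps i)) (gm la) * d x) (En x))"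
      unfolding d lscale_sum lscale_lscale by simp
    then have "d x * ev (xmon (eps i)) (gm x) = ev (xmon (eps i)) (gm la) * d x"
      by (rule En_coeffs_eq[OF S]) (use x in simp)
    moreover have "mon (gm x) (eps i) \<noteq> mon (gm la) (eps i)"
      by (rule gm_distinct) (use i(3) in simp)
    ultimately show ?thesis by (simp add: xmon_sg)
  qed
  have "P = lscale (d la) (En la) + (\<Sum>x\<in>below la. lscale (d x) (En x))"
    unfolding d using finite_below[OF la] below_irrefl by simp
  also have "(\<Sum>x\<in>below la. lscale (d x) (En x)) = 0" by (rule sum.neutral) (simp add: d0)
  finally have Pd: "P = lscale (d la) (En la)" by simp
  moreover have "d la = 1" using prec_monic_lk[of la P] P lk_En[OF la] Pd by simp
  ultimately show "P = En la" by simp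
qed

text \<open>Apply \<open>T\<^sub>i\<close> to \<open>T_En_up\<close> and use the quadratic relation.\<close>

lemma T_En_down:
  assumes i: "1 \<le> i" "i \<le> n" and z: "z \<in> Lam n" and c: "cp i z > 0"
  defines "\<mu> \<equiv> wl (s i) z"
  shows "T i (En z) = lscale (t i - 1 / t i - dg i \<mu>) (En z) +
    lscale ((t i - dg i \<mu>) * (1 / t i + dg i \<mu>) / t i) (En \<mu>)"
proof -
  have \<mu>: "\<mu> \<in> Lam n" "cp i \<mu> < 0" "wl (s i) \<mu> = z"
    unfolding \<mu>_def using wl_Lam[OF s_affW[OF i(2)] z] c i wl_s_s[OF i] by (auto simp: wl_s)
  let ?t = "t i" and ?d = "dg i \<mu>"
  have up: "T i (En \<mu>) = lscale ?d (En \<mu>) + lscale ?t (En z)" using T_En_up[OF i \<mu>(1,2)] \<mu>(3) by simp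
  have "lscale ?d (T i (En \<mu>)) + lscale ?t (T i (En z)) = T i (T i (En \<mu>))"
    by (subst up) (simp add: up T_add[OF i(2)] T_lscale[OF i(2)])
  also have "\<dots> = lscale (?t - 1 / ?t) (T i (En \<mu>)) + En \<mu>" by (rule T_quadratic[OF i(2)])
  finally have "lscale ?t (T i (En z)) = lscale (?t - 1 / ?t - ?d) (T i (En \<mu>)) + En \<mu>"
    by (simp add: lscale_diff_left algebra_simps)
  then have "lscale (1 / ?t) (lscale ?t (T i (En z))) =
      lscale (1 / ?t) (lscale (?t - 1 / ?t - ?d) (lscale ?d (En \<mu>) + lscale ?t (En z)) + lscale 1 (En \<mu>))"
    unfolding up by simp
  also have "\<dots> = lscale (1 / ?t * ((?t - 1 / ?t - ?d) * ?d + 1)) (En \<mu>) + lscale (1 / ?t * ((?t - 1 / ?t - ?d) * ?t)) (En z)"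
    by (simp only: lscale_add lscale_lscale lscale_add_left distrib_left add_ac)
  also have "1 / ?t * ((?t - 1 / ?t - ?d) * ?t) = ?t - 1 / ?t - ?d" by simp
  also have "1 / ?t * ((?t - 1 / ?t - ?d) * ?d + 1) = (?t - ?d) * (1 / ?t + ?d) / ?t"
    by (simp add: field_simps)
  finally show ?thesis by (simp add: add.commute)
qed

text \<open>Comparing coefficients of \<open>E\<^sub>x\<close> on both sides, the eigenvalue equation couples only \<open>x\<close> and
  \<open>s\<^sub>i x\<close>; on such a pair it is a linear system of rank one, because \<open>T\<^sub>i\<close> has both eigenvalues there.\<close>

lemma T_eigen_iff:
  assumes M: "finite M" "M \<subseteq> Lam n" "\<And>x. x \<in> M \<Longrightarrow> wl (s i) x \<in> M" and i: "1 \<le> i" "i \<le> n"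
    and \<sigma>: "\<sigma> = 1 \<or> \<sigma> = - 1"
  shows "T i (\<Sum>x\<in>M. lscale (d x) (En x)) = lscale (tev \<sigma> i) (\<Sum>x\<in>M. lscale (d x) (En x)) \<longleftrightarrow>
    (\<forall>x\<in>M. (cp i x = 0 \<longrightarrow> t i * d x = tev \<sigma> i * d x) \<and>
      (cp i x < 0 \<longrightarrow> d x = ratio \<sigma> i x * d (wl (s i) x)))"
    (is "?L \<longleftrightarrow> (\<forall>x\<in>M. ?C x)")
proof -
  let ?r = "wl (s i)" and ?t = "t i"
  define A where "A x = (if cp i x > 0 then ?t - 1 / ?t - dg i (?r x) else dg i x)" for x
  define B where "B x = (if cp i x > 0 then (?t - dg i (?r x)) * (1 / ?t + dg i (?r x)) / ?t
    else if cp i x = 0 then 0 else ?t)" for x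
  have T: "T i (En x) = lscale (A x) (En x) + lscale (B x) (En (?r x))" if "x \<in> M" for x
  proof -
    have x: "x \<in> Lam n" using M(2) that by blast
    consider "cp i x > 0" | "cp i x = 0" | "cp i x < 0" by linarith
    then show ?thesis
    proof cases
      case 1 then show ?thesis using T_En_down[OF i x] by (simp add: A_def B_def)
    next
      case 2 then show ?thesis using T_En_orth[OF i x] dg_orth[OF i] by (simp add: A_def B_def)
    next
      case 3 then show ?thesis using T_En_up[OF i x] by (simp add: A_def B_def)
    qed
  qed
  have rr: "?r (?r x) = x" for x by (rule wl_s_s[OF i])
  have cr: "cp i (?r x) = - cp i x" for x using i by (simp add: wl_s)
  have "T i (\<Sum>x\<in>M. lscale (d x) (En x)) = (\<Sum>x\<in>M. lscale (d x) (T i (En x)))"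
    by (simp only: T_sum[OF i(2)] T_lscale[OF i(2)])
  also have "\<dots> = (\<Sum>x\<in>M. lscale (d x * A x) (En x) + lscale (d x * B x) (En (?r x)))"
    by (rule sum.cong) (simp_all add: T lscale_add)
  also have "\<dots> = (\<Sum>x\<in>M. lscale (d x * A x) (En x)) + (\<Sum>x\<in>M. lscale (d x * B x) (En (?r x)))"
    by (rule sum.distrib)
  also have "(\<Sum>x\<in>M. lscale (d x * B x) (En (?r x))) = (\<Sum>x\<in>M. lscale (d (?r x) * B (?r x)) (En x))"
    by (rule sum.reindex_bij_witness[of _ ?r ?r]) (simp_all only: rr M(3))
  also have "(\<Sum>x\<in>M. lscale (d x * A x) (En x)) + \<dots> = (\<Sum>x\<in>M. lscale (d x * A x + d (?r x) * B (?r x)) (En x))"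
    unfolding lscale_add_left sum.distrib ..
  finally have Tf: "T i (\<Sum>x\<in>M. lscale (d x) (En x)) = (\<Sum>x\<in>M. lscale (d x * A x + d (?r x) * B (?r x)) (En x))" .
  have "?L \<longleftrightarrow> (\<Sum>x\<in>M. lscale (d x * A x + d (?r x) * B (?r x)) (En x)) = (\<Sum>x\<in>M. lscale (tev \<sigma> i * d x) (En x))"
    unfolding Tf lscale_sum lscale_lscale ..
  also have "\<dots> \<longleftrightarrow> (\<forall>x\<in>M. d x * A x + d (?r x) * B (?r x) = tev \<sigma> i * d x)"
  proof
    assume e: "(\<Sum>x\<in>M. lscale (d x * A x + d (?r x) * B (?r x)) (En x)) = (\<Sum>x\<in>M. lscale (tev \<sigma> i * d x) (En x))"
    show "\<forall>x\<in>M. d x * A x + d (?r x) * B (?r x) = tev \<sigma> i * d x"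
      using En_coeffs_eq[OF M(1,2) e] by (rule ballI)
  next
    assume h: "\<forall>x\<in>M. d x * A x + d (?r x) * B (?r x) = tev \<sigma> i * d x"
    show "(\<Sum>x\<in>M. lscale (d x * A x + d (?r x) * B (?r x)) (En x)) = (\<Sum>x\<in>M. lscale (tev \<sigma> i * d x) (En x))"
      by (rule sum.cong) (simp_all only: bspec[OF h])
  qed
  also have "\<dots> \<longleftrightarrow> (\<forall>x\<in>M. ?C x)"
  proof -
    \<comment> \<open>The equation at the upper point of a pair is the ratio.\<close>
    have down: "d z * A z + d (?r z) * B (?r z) = tev \<sigma> i * d z \<longleftrightarrow> d (?r z) = ratio \<sigma> i (?r z) * d z"
      if "cp i z > 0" for z
    proof -
      have AB: "A z = ?t - 1 / ?t - dg i (?r z)" "B (?r z) = ?t" using that cr[of z] by (auto simp: A_def B_def)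
      have "d z * A z + d (?r z) * B (?r z) = tev \<sigma> i * d z \<longleftrightarrow>
          d (?r z) * ?t = (tev \<sigma> i - ?t + 1 / ?t + dg i (?r z)) * d z"
        unfolding AB by (auto simp: algebra_simps)
      also have "\<dots> \<longleftrightarrow> d (?r z) = (tev \<sigma> i - ?t + 1 / ?t + dg i (?r z)) * d z / ?t"
        using t_nz[of i] by (metis nonzero_mult_div_cancel_right nonzero_eq_divide_eq)
      finally show ?thesis by (simp add: ratio_def)
    qed
    \<comment> \<open>The equation at the lower point then holds, since either eigenvalue is a root of the quadratic polynomial of \<open>T\<^sub>i\<close>.\<close>
    have up: "d x * A x + d (?r x) * B (?r x) = tev \<sigma> i * d x"
      if c: "cp i x < 0" and e: "d x = ratio \<sigma> i x * d (?r x)" for x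
    proof -
      have AB: "A x = dg i x" "B (?r x) = (?t - dg i x) * (1 / ?t + dg i x) / ?t"
        using c cr[of x] rr[of x] by (auto simp: A_def B_def)
      have k: "(tev \<sigma> i - dg i x) * (tev \<sigma> i - ?t + 1 / ?t + dg i x) = (?t - dg i x) * (1 / ?t + dg i x)"
        by (simp add: tev_def algebra_simps)
      have "(tev \<sigma> i - dg i x) * d x = (tev \<sigma> i - dg i x) * (tev \<sigma> i - ?t + 1 / ?t + dg i x) / ?t * d (?r x)"
        by (subst e) (simp add: ratio_def)
      also have "\<dots> = B (?r x) * d (?r x)" unfolding k AB ..
      finally show ?thesis unfolding AB(1) by (simp add: algebra_simps)
    qed
    have zero: "d x * A x + d (?r x) * B (?r x) = tev \<sigma> i * d x \<longleftrightarrow> ?t * d x = tev \<sigma> i * d x"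
      if "cp i x = 0" for x
      using that cr[of x] dg_orth[OF i that] by (simp add: A_def B_def mult.commute)
    show ?thesis
    proof
      assume h: "\<forall>x\<in>M. d x * A x + d (?r x) * B (?r x) = tev \<sigma> i * d x"
      show "\<forall>x\<in>M. ?C x"
      proof (intro ballI conjI impI)
        fix x assume x: "x \<in> M"
        show "?t * d x = tev \<sigma> i * d x" if "cp i x = 0" using zero[OF that] h x by blast
        assume c: "cp i x < 0"
        have pos: "cp i (?r x) > 0" using c cr[of x] by simp
        have "d (?r (?r x)) = ratio \<sigma> i (?r (?r x)) * d (?r x)"
          by (rule iffD1[OF down[OF pos] bspec[OF h M(3)[OF x]]])
        then show "d x = ratio \<sigma> i x * d (?r x)" unfolding rr .
      qed
    next
      assume h: "\<forall>x\<in>M. ?C x"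
      show "\<forall>x\<in>M. d x * A x + d (?r x) * B (?r x) = tev \<sigma> i * d x"
      proof
        fix x assume x: "x \<in> M"
        consider "cp i x > 0" | "cp i x = 0" | "cp i x < 0" by linarith
        then show "d x * A x + d (?r x) * B (?r x) = tev \<sigma> i * d x"
        proof cases
          case 1
          have "cp i (?r x) < 0" using 1 cr[of x] by simp
          then have "d (?r x) = ratio \<sigma> i (?r x) * d x" using h M(3)[OF x] rr[of x] by metis
          then show ?thesis using down[OF 1] by blast
        next
          case 2 then show ?thesis using zero h x by blast
        next
          case 3 then show ?thesis using up h x by blast
        qed
      qed
    qed
  qed
  finally show ?thesis .
qed

section \<open>The solutions of the eigenvalue equations\<close>

text \<open>The expansion that is to be identified with \<open>P\<^sup>+\<close> and \<open>P\<^sup>-\<close>, for \<open>\<sigma> = 1\<close> and \<open>\<sigma> = - 1\<close>.\<close>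

definition Q :: "int \<Rightarrow> lattice_vec \<Rightarrow> laurent" where
  "Q \<sigma> la = (\<Sum>x\<in>orbit n la. lscale (cf \<sigma> x) (En x))"

context
  fixes la assumes la: "la \<in> Lam_plus n"
begin

lemma orbit_facts: "finite (orbit n la)" "orbit n la \<subseteq> Lam n"
  using finite_orbit orbit_Lam Lam_plus_Lam[OF la] by auto

lemma A_orb_eq: "A_orb p n la = {\<Sum>x\<in>orbit n la. lscale (d x) (En x) |d. True}"
proof -
  have "Pns p n ` orbit n la = En ` orbit n la"
    using orbit_facts(2) by (intro image_cong) (auto intro: Pns_En)
  then show ?thesis unfolding A_orb_def using span_finite_image[OF orbit_facts(1)] by simp
qed

text \<open>All coefficients are determined by the one at \<open>la\<close> along the paths of \<open>orbit_induct\<close>. On a wall the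
  eigenvalue has to be \<open>t\<^sub>i\<close> or the coefficient vanishes.\<close>

lemma eigen_unique:
  assumes \<sigma>: "\<sigma> = 1 \<or> \<sigma> = - 1" and f: "f = (\<Sum>x\<in>orbit n la. lscale (d x) (En x))"
    and T: "\<And>i. 1 \<le> i \<Longrightarrow> i \<le> n \<Longrightarrow> T i f = lscale (tev \<sigma> i) f"
  shows "f = lscale (d la) (Q \<sigma> la)" "\<And>i. 1 \<le> i \<Longrightarrow> i \<le> n \<Longrightarrow> cp i la = 0 \<Longrightarrow> t i * d la = tev \<sigma> i * d la"
proof -
  have C: "\<forall>x\<in>orbit n la. (cp i x = 0 \<longrightarrow> t i * d x = tev \<sigma> i * d x) \<and>
      (cp i x < 0 \<longrightarrow> d x = ratio \<sigma> i x * d (wl (s i) x))" if i: "1 \<le> i" "i \<le> n" for i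
    using T_eigen_iff[OF orbit_facts orbit_s[OF _ i] i \<sigma>, of d] T[OF i] unfolding f by blast
  show "t i * d la = tev \<sigma> i * d la" if "1 \<le> i" "i \<le> n" "cp i la = 0" for i
    using C[OF that(1,2)] that(3) orbit_refl by blast
  have dx: "d x = d la * cf \<sigma> x" if "x \<in> orbit n la" for x
    using that la
  proof (induction rule: orbit_induct)
    case dominant
    show ?case using cf_dominant[OF la] by simp
  next
    case (step i \<nu>)
    note i = step(1,2)
    have "cp i (wl (s i) \<nu>) < 0" using step(4) i by (simp add: wl_s)
    then have "d (wl (s i) \<nu>) = ratio \<sigma> i (wl (s i) \<nu>) * d (wl (s i) (wl (s i) \<nu>))"
      using C[OF i] orbit_s[OF step(3) i] by blast
    also have "wl (s i) (wl (s i) \<nu>) = \<nu>" by (rule wl_s_s[OF i])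
    finally show ?case using cf_step[OF la step(3) i step(4) \<sigma>] step(5) by (simp add: mult_ac)
  qed
  have "f = (\<Sum>x\<in>orbit n la. lscale (d la * cf \<sigma> x) (En x))"
    unfolding f
  proof (rule sum.cong)
    fix x assume "x \<in> orbit n la"
    then show "lscale (d x) (En x) = lscale (d la * cf \<sigma> x) (En x)"
      by (rule arg_cong[OF dx, of _ "\<lambda>c. lscale c (En x)"])
  qed simp
  then show "f = lscale (d la) (Q \<sigma> la)" unfolding Q_def lscale_sum lscale_lscale .
qed

lemma Q_eigen:
  assumes \<sigma>: "\<sigma> = 1 \<or> \<sigma> = - 1" and i: "1 \<le> i" "i \<le> n"
    and reg: "\<sigma> = 1 \<or> (\<forall>x\<in>orbit n la. cp i x \<noteq> 0)"
  shows "T i (Q \<sigma> la) = lscale (tev \<sigma> i) (Q \<sigma> la)"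
proof -
  have "cf \<sigma> x = ratio \<sigma> i x * cf \<sigma> (wl (s i) x)" if "x \<in> orbit n la" "cp i x < 0" for x
  proof -
    have "cp i (wl (s i) x) > 0" using that i by (simp add: wl_s)
    from cf_step[OF la orbit_s[OF that(1) i] i this \<sigma>] show ?thesis unfolding wl_s_s[OF i] .
  qed
  moreover have "t i * cf \<sigma> x = tev \<sigma> i * cf \<sigma> x" if "x \<in> orbit n la" "cp i x = 0" for x
    using reg that by (auto simp: tev_def)
  ultimately show ?thesis
    unfolding Q_def using T_eigen_iff[OF orbit_facts orbit_s[OF _ i] i \<sigma>, of "cf \<sigma>"] by blast
qed

lemma orbit_below: "x \<in> orbit n la \<Longrightarrow> x = la \<or> x \<in> below la"
  using orbit_dle[OF la] below_iff[OF Lam_plus_Lam[OF la]] by blast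

lemma la_not_below: "x \<in> orbit n la \<Longrightarrow> la \<notin> below x"
  using orbit_below below_trans[OF _ Lam_plus_Lam[OF la], of x la] below_irrefl orbit_facts(2) Lam_plus_Lam[OF la]
  by blast

lemma lk_Q: "lk (Q \<sigma> la) la = 1"
proof -
  have "lk (Q \<sigma> la) la = (\<Sum>x\<in>orbit n la. cf \<sigma> x * lk (En x) la)"
    unfolding Q_def lookup_sum lk_lscale ..
  also have "\<dots> = (\<Sum>x\<in>orbit n la. if x = la then 1 else 0)"
  proof (rule sum.cong)
    fix x assume x: "x \<in> orbit n la"
    then have xL: "x \<in> Lam n" using orbit_facts(2) by blast
    show "cf \<sigma> x * lk (En x) la = (if x = la then 1 else 0)"
      using lk_En_0[OF xL _ la_not_below[OF x]] lk_En[OF xL] cf_dominant[OF la] by auto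
  qed simp
  finally show ?thesis using orbit_facts(1) by simp
qed

lemma keys_Q: "keys (Q \<sigma> la) \<subseteq> insert la (below la)"
proof -
  have "Q \<sigma> la \<in> {f. keys f \<subseteq> insert la (below la)}"
    unfolding Q_def
  proof (intro laurent.subspace_sum[OF subspace_keys] laurent.subspace_scale[OF subspace_keys])
    fix x assume x: "x \<in> orbit n la"
    then have xL: "x \<in> Lam n" using orbit_facts(2) by blast
    have "insert x (below x) \<subseteq> insert la (below la)"
      using orbit_below[OF x] below_trans[OF xL Lam_plus_Lam[OF la]] by blast
    then show "En x \<in> {f. keys f \<subseteq> insert la (below la)}" using keys_En[OF xL] by blast
  qed
  then show ?thesis by simp
qed

lemma prec_monic_Q: "prec_monic n la (Q \<sigma> la)"
  unfolding prec_monic_iff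
proof
  fix x assume x: "x \<in> keys (Q \<sigma> la - xmon la)"
  then have "x \<noteq> la" using lk_Q[of \<sigma>] by (auto simp: in_keys_iff lookup_minus xmon_sg)
  moreover have "x \<in> insert la (below la)"
    using x keys_minus[of "Q \<sigma> la" "xmon la"] keys_Q[of \<sigma>] by (auto simp: xmon_sg split: if_splits)
  ultimately show "x \<in> below la" by blast
qed

lemma Q_A_orb: "lscale c (Q \<sigma> la) \<in> A_orb p n la"
  unfolding A_orb_eq Q_def lscale_sum lscale_lscale mem_Collect_eq
  by (intro exI[of _ "\<lambda>x. c * cf \<sigma> x"] conjI TrueI) simp

theorem A_plus_eq: "A_plus p n la = laurent.span {Q 1 la}"
proof (rule equalityI)
  show "A_plus p n la \<subseteq> laurent.span {Q 1 la}"
  proof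
    fix f assume f: "f \<in> A_plus p n la"
    then obtain d where d: "f = (\<Sum>x\<in>orbit n la. lscale (d x) (En x))" unfolding A_plus_def A_orb_eq by blast
    have "f = lscale (d la) (Q 1 la)"
      by (rule eigen_unique(1)[OF _ d]) (use f in \<open>auto simp: A_plus_def tev_def\<close>)
    then show "f \<in> laurent.span {Q 1 la}" by (auto intro: laurent.span_scale laurent.span_base)
  qed
  have "lscale c (Q 1 la) \<in> A_plus p n la" for c
    using Q_A_orb[of c 1] Q_eigen[of 1] by (auto simp: A_plus_def tev_def T_lscale mult.commute)
  then show "laurent.span {Q 1 la} \<subseteq> A_plus p n la" unfolding laurent.span_singleton by blast
qed

lemma A_minus_sub: "f \<in> A_minus p n la \<Longrightarrow> \<exists>c. f = lscale c (Q (- 1) la) \<and>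
    (\<forall>i. 1 \<le> i \<longrightarrow> i \<le> n \<longrightarrow> cp i la = 0 \<longrightarrow> t i * c = - (1 / t i) * c)"
proof -
  assume f: "f \<in> A_minus p n la"
  then obtain d where d: "f = (\<Sum>x\<in>orbit n la. lscale (d x) (En x))" unfolding A_minus_def A_orb_eq by blast
  have T: "T i f = lscale (tev (- 1) i) f" if "1 \<le> i" "i \<le> n" for i
    using f that by (simp add: A_minus_def tev_def lscale_uminus divide_inverse)
  have "f = lscale (d la) (Q (- 1) la)" by (rule eigen_unique(1)[OF _ d T]) simp_all
  moreover have "t i * d la = - (1 / t i) * d la" if "1 \<le> i" "i \<le> n" "cp i la = 0" for i
    using eigen_unique(2)[of "- 1", OF _ d T that] by (simp add: tev_def)
  ultimately show ?thesis by blast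
qed

lemma not_plusplus:
  assumes "la \<notin> Lam_plusplus n" shows "\<exists>i. 1 \<le> i \<and> i \<le> n \<and> cp i la = 0"
proof (rule ccontr)
  assume neg: "\<not> (\<exists>i. 1 \<le> i \<and> i \<le> n \<and> cp i la = 0)"
  have "cp i (la - kappa n) \<ge> 0" if "1 \<le> i" "i \<le> n" for i
  proof -
    have "cp i la \<noteq> 0" "cp i la \<ge> 0" using neg la that Lam_plus_iff[of la] by blast+
    then show ?thesis using cp_kappa[OF that] by simp
  qed
  then have "la - kappa n \<in> Lam_plus n"
    using kappa_Lam Lam_plus_Lam[OF la] Lam_diff by (simp add: Lam_plus_iff)
  moreover have "la = kappa n + (la - kappa n)" by simp
  ultimately show False using assms unfolding Lam_plusplus_def by blast
qed

lemma t_sq_ne: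
  assumes "1 \<le> i" "i \<le> n" shows "t i \<noteq> - (1 / t i)"
proof
  assume "t i = - (1 / t i)"
  then have "t i * t i = - (1 / t i) * t i" by simp
  then have "t i * t i = - 1" by simp
  moreover have "t i * t i \<noteq> - 1"
    using gen_mono_ne(2)[of 0 0 2 0] gen_mono_ne(2)[of 0 2 0 0] n2 assms
    by (auto simp: t_simple_def power2_eq_square split: if_splits)
  ultimately show False by simp
qed

text \<open>\<open>la\<close> lies on a wall, where \<open>T\<^sub>i\<close> acts by \<open>t\<^sub>i \<noteq> - 1/t\<^sub>i\<close>; this kills the coefficient at \<open>la\<close> and with it all
  others.\<close>

lemma A_minus_trivial:
  assumes "la \<notin> Lam_plusplus n" shows "A_minus p n la = {0}"
proof -
  obtain i where i: "1 \<le> i" "i \<le> n" "cp i la = 0" using not_plusplus[OF assms] by blast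
  have "f = 0" if f: "f \<in> A_minus p n la" for f
  proof -
    obtain c where c: "f = lscale c (Q (- 1) la)" "t i * c = - (1 / t i) * c"
      using A_minus_sub[OF f] i by blast
    then have "c = 0" using t_sq_ne[OF i(1,2)] by (metis mult_right_cancel)
    then show ?thesis using c(1) by simp
  qed
  moreover have "0 \<in> A_minus p n la"
    using Q_A_orb[of 0 1] by (auto simp: A_minus_def)
  ultimately show ?thesis by blast
qed

end

text \<open>No root is orthogonal to \<open>la\<close>, and this property is invariant under \<open>W\<close>.\<close>

lemma plusplus_regular:
  assumes la: "la \<in> Lam_plusplus n"
  shows "la \<in> Lam_plus n" "x \<in> orbit n la \<Longrightarrow> 1 \<le> i \<Longrightarrow> i \<le> n \<Longrightarrow> cp i x \<noteq> 0"
proof -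
  obtain \<mu> where \<mu>: "\<mu> \<in> Lam_plus n" "la = kappa n + \<mu>" using la by (auto simp: Lam_plusplus_def)
  have "kappa n \<in> Lam_plus n" using kappa_Lam by (auto simp: Lam_plus_iff cp_kappa)
  then show lp: "la \<in> Lam_plus n" unfolding \<mu>(2) using \<mu>(1) by (rule Lam_plus_add)
  have kp: "ip (kappa n) \<alpha> > 0" if "\<alpha> \<in> Sigma_pos n" for \<alpha>
    using that by (auto simp: Sigma_pos_def long_pos_def mid_pos_def lk_kappa)
  have pos: "ip la \<alpha> > 0" if "\<alpha> \<in> Sigma_pos n" for \<alpha>
    using kp[OF that] dominant_roots[OF \<mu>(1), of \<alpha>] that by (simp add: \<mu>(2) Sigma_pos_iff)
  assume x: "x \<in> orbit n la" and i: "1 \<le> i" "i \<le> n"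
  have "ip x \<alpha> \<noteq> 0" if "\<alpha> \<in> roots" for \<alpha>
    using x lp that
  proof (induction arbitrary: \<alpha> rule: orbit_induct)
    case dominant
    then consider "\<alpha> \<in> Sigma_pos n" | "- \<alpha> \<in> Sigma_pos n"
      using fht_roots(2)[of \<alpha>] roots_uminus[of \<alpha>] by (fastforce simp: Sigma_pos_iff)
    then show ?case using pos[of \<alpha>] pos[of "- \<alpha>"] by cases auto
  next
    case (step i \<nu>)
    have "wl (s i) \<alpha> \<in> roots"
      using affW_roots[OF s_affW[OF step(2)], of "(\<alpha>, 0)"] step(6) by (simp add: affroots_def)
    then show ?case using step(5) ip_wl_s[OF step(1,2)] by simp
  qed
  moreover have "fst (a i) \<in> roots" using simple_Sigma_pos[OF i] by (simp add: Sigma_pos_iff)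
  ultimately show "cp i x \<noteq> 0" using cp_zero_iff[OF i(2)] by blast
qed

theorem A_minus_eq:
  assumes la: "la \<in> Lam_plusplus n" shows "A_minus p n la = laurent.span {Q (- 1) la}"
proof (rule equalityI)
  note lp = plusplus_regular(1)[OF la]
  show "A_minus p n la \<subseteq> laurent.span {Q (- 1) la}"
  proof
    fix f assume "f \<in> A_minus p n la"
    then show "f \<in> laurent.span {Q (- 1) la}" using A_minus_sub[OF lp] laurent.span_singleton by fastforce
  qed
  have "lscale c (Q (- 1) la) \<in> A_minus p n la" for c
    using Q_A_orb[OF lp, of c "- 1"] Q_eigen[OF lp, of "- 1"] plusplus_regular(2)[OF la]
    by (auto simp: A_minus_def tev_def T_lscale mult.commute lscale_uminus divide_inverse)
  then show "laurent.span {Q (- 1) la} \<subseteq> A_minus p n la" unfolding laurent.span_singleton by blast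
qed

lemma monic_multiple:
  assumes la: "la \<in> Lam_plus n" and P: "P = lscale c (Q \<sigma> la)" "lk P la = 1" shows "P = Q \<sigma> la"
  using P lk_Q[OF la] by simp

lemma A_minus_monic:
  assumes la: "la \<in> Lam_plusplus n"
  shows "P \<in> A_minus p n la \<and> prec_monic n la P \<longleftrightarrow> P = Q (- 1) la"
proof
  note lp = plusplus_regular(1)[OF la]
  show "P = Q (- 1) la" if "P \<in> A_minus p n la \<and> prec_monic n la P"
    using A_minus_sub[OF lp, of P] monic_multiple[OF lp] prec_monic_lk that by blast
  show "P \<in> A_minus p n la \<and> prec_monic n la P" if "P = Q (- 1) la"
    unfolding that A_minus_eq[OF la] using prec_monic_Q[OF lp] by (simp add: laurent.span_base)
qed

lemma A_minus_dim:
  assumes la: "la \<in> Lam_plusplus n" shows "laurent.dim (A_minus p n la) = 1"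
proof -
  have "Q (- 1) la \<noteq> 0" using lk_Q[OF plusplus_regular(1)[OF la], of "- 1"] by auto
  then have "laurent.independent {Q (- 1) la}" by simp
  then show ?thesis unfolding A_minus_eq[OF la] laurent.dim_span using laurent.dim_eq_card_independent by fastforce
qed

end

section \<open>Invariant polynomials\<close>

context params
begin

lemma act_id: "act p id f = f"
proof (induction f rule: pm_induct)
  case (sg v c) then show ?case by (simp add: act_sg xmon_sg)
qed (simp_all add: act_add)

lemma invariants_iff:
  "f \<in> invariants p n \<longleftrightarrow> f \<in> laurent_alg n \<and> (\<forall>i. 1 \<le> i \<longrightarrow> i \<le> n \<longrightarrow> act p (s i) f = f)" (is "?L \<longleftrightarrow> ?R")
proof
  show ?R if ?L using that s_finW by (simp add: invariants_def)
  assume r: ?R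
  have "act p w f = f" if "w \<in> finW n" for w
    using that
  proof (induction rule: finW_asc_induct)
    case id show ?case by (rule act_id)
  next
    case (step i w)
    show ?case unfolding act_comp[OF s_affW[OF step(2)] finW_affW[OF step(3)]] step(5) using r step(1,2) by blast
  qed
  then show ?L using r by (simp add: invariants_def)
qed

lemma lk_act:
  assumes i: "1 \<le> i" "i \<le> n" shows "lk (act p (s i) f) x = lk f (wl (s i) x)"
proof (induction f rule: pm_induct)
  case (sg v c)
  have "s i (v, 0) = (wl (s i) v, 0)" using i by (simp add: prod_eq_iff snd_s snd_simple)
  then have "X (s i (v, 0)) = X (wl (s i) v, 0)" by (rule arg_cong)
  then have "act p (s i) (sg v c) = lscale c (xmon (wl (s i) v))" by (simp only: act_sg X_zero)
  moreover have "wl (s i) v = x \<longleftrightarrow> v = wl (s i) x" using wl_s_s[OF i] by metis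
  ultimately show ?case by (simp add: xmon_sg lookup_single when_def)
qed (simp_all add: act_add lookup_add)

lemma invariant_lookup:
  assumes f: "f \<in> invariants p n" and x: "x \<in> orbit n la" "la \<in> Lam_plus n" shows "lk f x = lk f la"
  using x
proof (induction rule: orbit_induct)
  case dominant show ?case by simp
next
  case (step i \<nu>)
  have "lk f (wl (s i) \<nu>) = lk (act p (s i) f) \<nu>" by (rule lk_act[OF step(1,2), symmetric])
  then show ?case using f step by (simp add: invariants_iff)
qed

lemma v_num_nz: 
  assumes i: "1 \<le> i" "i \<le> n" shows "v_num p n (a i) \<noteq> 0"
proof
  assume "v_num p n (a i) = 0"
  then have "lk (v_num p n (a i)) 0 = 0" by simp
  moreover have "fst (a i) \<noteq> 0" using ip_simple_pos[OF i(2)] by auto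
  moreover have "eps n \<noteq> 0" using lk_eps[of n n] by force
  ultimately show False using i
    by (auto simp: v_num_simple lookup_add lookup_minus X_sg half_def lookup_single when_def split: if_splits)
qed

text \<open>The defining equation of \<open>T\<^sub>i\<close> has the factor \<open>s\<^sub>i f - f\<close>, and the numerator of \<open>v\<close> is not a zero divisor.\<close>

lemma T_invariant:
  assumes i: "1 \<le> i" "i \<le> n" shows "T i f = lscale (t i) f \<longleftrightarrow> act p (s i) f = f"
proof
  assume T: "T i f = lscale (t i) f"
  obtain g where g: "v_den p (a i) * g = v_num p n (a i) * (act p (s i) f - f)"
    "T i f = lscale (t i) f + lscale (inverse (t i)) g" using T_ex[OF i(2)] by blast
  have "lscale (inverse (t i)) g = 0" using T g(2) by simp
  then have "g = 0" by (simp add: laurent.scale_eq_0_iff)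
  then show "act p (s i) f = f" using g(1) v_num_nz[OF i] by simp
next
  assume "act p (s i) f = f"
  then show "T i f = lscale (t i) f" using T_char[OF i(2), of 0 f] by simp
qed

lemma orbit_finite: "\<mu> \<in> Lam_plus n \<Longrightarrow> finite (orbit n \<mu>)"
  by (rule finite_orbit[OF Lam_plus_Lam])

lemma lk_orbit_sum: "\<mu> \<in> Lam_plus n \<Longrightarrow> lk (orbit_sum n \<mu>) x = (if x \<in> orbit n \<mu> then 1 else 0)"
  using orbit_finite[of \<mu>] by (simp add: orbit_sum_def lookup_sum xmon_sg lookup_single when_def)

lemma keys_orbit_sum: "\<mu> \<in> Lam_plus n \<Longrightarrow> keys (orbit_sum n \<mu>) = orbit n \<mu>"
  by (auto simp: in_keys_iff lk_orbit_sum split: if_splits)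

lemma orbit_sum_invariant: "\<mu> \<in> Lam_plus n \<Longrightarrow> orbit_sum n \<mu> \<in> invariants p n"
  unfolding invariants_iff laurent_alg_def
proof (intro conjI allI impI)
  assume \<mu>: "\<mu> \<in> Lam_plus n"
  show "orbit_sum n \<mu> \<in> {f. keys f \<subseteq> Lam n}"
    using keys_orbit_sum[OF \<mu>] orbit_Lam[OF _ Lam_plus_Lam[OF \<mu>]] by auto
  fix i assume i: "1 \<le> i" "i \<le> n"
  have "wl (s i) x \<in> orbit n \<mu> \<longleftrightarrow> x \<in> orbit n \<mu>" for x
    using orbit_s[OF _ i, of x \<mu>] orbit_s[OF _ i, of "wl (s i) x" \<mu>] wl_s_s[OF i, of x] by auto
  then show "act p (s i) (orbit_sum n \<mu>) = orbit_sum n \<mu>"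
    by (intro poly_mapping_eqI) (simp only: lk_act[OF i] lk_orbit_sum[OF \<mu>])
qed

lemma invariants_diff: "f \<in> invariants p n \<Longrightarrow> g \<in> invariants p n \<Longrightarrow> f - g \<in> invariants p n"
  using keys_minus[of f g] by (auto simp: invariants_iff laurent_alg_def act_diff)

text \<open>The coefficients are constant on orbits, so the orbits can be summed separately.\<close>

lemma invariant_span:
  assumes f: "f \<in> invariants p n" and k: "\<And>x. x \<in> keys f \<Longrightarrow> dr x \<in> M"
  shows "f \<in> laurent.span (orbit_sum n ` M)"
proof -
  let ?M = "dr ` keys f"
  have kL: "keys f \<subseteq> Lam n" using f by (simp add: invariants_def laurent_alg_def)
  have M: "\<mu> \<in> Lam_plus n" if "\<mu> \<in> ?M" for \<mu> using that kL dom_rep(2) by blast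
  have "f = (\<Sum>\<mu>\<in>?M. lscale (lk f \<mu>) (orbit_sum n \<mu>))"
  proof (rule poly_mapping_eqI)
    fix x
    have "lk (\<Sum>\<mu>\<in>?M. lscale (lk f \<mu>) (orbit_sum n \<mu>)) x = (\<Sum>\<mu>\<in>?M. lk f \<mu> * (if x \<in> orbit n \<mu> then 1 else 0))"
      unfolding lookup_sum lk_lscale using M by (intro sum.cong) (simp_all add: lk_orbit_sum)
    also have "\<dots> = (\<Sum>\<mu>\<in>?M. if \<mu> = dr x then lk f x else 0)"
    proof (rule sum.cong)
      fix \<mu> assume \<mu>: "\<mu> \<in> ?M"
      show "lk f \<mu> * (if x \<in> orbit n \<mu> then 1 else 0) = (if \<mu> = dr x then lk f x else 0)"
      proof (cases "x \<in> orbit n \<mu>")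
        case True
        then show ?thesis using dom_rep_eqI[OF M[OF \<mu>] True] invariant_lookup[OF f True M[OF \<mu>]] by simp
      next
        case False
        have "lk f x = 0" if "\<mu> = dr x"
        proof (rule ccontr)
          assume "lk f x \<noteq> 0"
          then have "x \<in> Lam n" using kL by (auto simp: in_keys_iff)
          then show False using dom_rep(1) orbit_sym False that by blast
        qed
        then show ?thesis using False by auto
      qed
    qed simp
    also have "\<dots> = lk f x"
      by (auto simp: in_keys_iff)
    finally show "lk f x = lk (\<Sum>\<mu>\<in>?M. lscale (lk f \<mu>) (orbit_sum n \<mu>)) x" ..
  qed
  also have "\<dots> \<in> laurent.span (orbit_sum n ` M)"
    using k by (intro laurent.span_sum laurent.span_scale laurent.span_base imageI) blast
  finally show ?thesis .
qed

text \<open>The spectral points of one orbit form one orbit of points.\<close>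

lemma ev_invariant_gm:
  assumes f: "f \<in> invariants p n" and x: "x \<in> orbit n la" "la \<in> Lam_plus n" shows "ev f (gm x) = ev f (gm la)"
  using x
proof (induction rule: orbit_induct)
  case dominant show ?case by simp
next
  case (step i \<nu>)
  have m: "mon (gm (wl (s i) \<nu>)) v = mon (pt i (gm \<nu>)) v" for v
    using gm_s[OF step(1,2), of \<nu> v] mon_pt[OF step(1,2), of "gm \<nu>" v] step(4) by simp
  have "ev f (gm (wl (s i) \<nu>)) = ev f (pt i (gm \<nu>))" unfolding ev_def m ..
  also have "\<dots> = ev (act p (s i) f) (gm \<nu>)" by (rule ev_act[OF step(2), symmetric]) simp
  also have "act p (s i) f = f" using f step(1,2) by (simp add: invariants_iff)
  finally show ?case using step(5) by simp
qed

text \<open>The invariants \<open>\<Prod>\<^sub>j (c - x\<^sub>j - 1/x\<^sub>j)\<close>, as \<open>c\<close> varies, determine the coordinates of a point up to order and inversion.\<close>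

definition sep :: "complex \<Rightarrow> laurent" where
  "sep c = (\<Prod>j=1..n. sg 0 c - sg (eps j) 1 - sg (- eps j) 1)"

lemma ev_sep: "nzp y \<Longrightarrow> ev (sep c) y = (\<Prod>j=1..n. c - y j - 1 / y j)"
  by (simp add: sep_def ev_prod ev_diff mon_uminus divide_inverse)

lemma keys_mult_Lam: "keys f \<subseteq> Lam n \<Longrightarrow> keys g \<subseteq> Lam n \<Longrightarrow> keys (f * g :: laurent) \<subseteq> Lam n"
  using Poly_Mapping.keys_mult[of f g] by blast

lemma keys_sep: "keys (sep c) \<subseteq> Lam n"
proof -
  let ?f = "\<lambda>j. sg 0 c - sg (eps j) 1 - sg (- eps j) 1 :: laurent"
  have k: "keys (?f j) \<subseteq> Lam n" if "j \<in> {1..n}" for j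
  proof -
    have "keys (?f j) \<subseteq> {0} \<union> {eps j} \<union> {- eps j}"
      using keys_minus[of "sg 0 c - sg (eps j) 1" "sg (- eps j) 1"] keys_minus[of "sg 0 c :: laurent" "sg (eps j) 1"]
      by (auto split: if_splits)
    moreover have "eps j \<in> Lam n" "- eps j \<in> Lam n" using that by (auto intro!: Lam_uminus Lam_eps)
    ultimately show ?thesis by auto
  qed
  have "keys (prod ?f A) \<subseteq> Lam n" if "finite A" "A \<subseteq> {1..n}" for A
    using that
  proof (induction A rule: finite_induct)
    case (insert j A)
    then show ?case using keys_mult_Lam[OF k[of j]] by simp
  qed simp
  then show ?thesis unfolding sep_def by blast
qed

lemma sep_invariant: "sep c \<in> invariants p n"
  unfolding invariants_iff
proof (intro conjI allI impI)
  show "sep c \<in> laurent_alg n" using keys_sep by (simp add: laurent_alg_def)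
  fix i assume i: "1 \<le> i" "i \<le> n"
  show "act p (s i) (sep c) = sep c"
  proof (rule laurent_eq_by_values[of "{}"])
    fix y assume y: "nzp y"
    have "ev (act p (s i) (sep c)) y = (\<Prod>j=1..n. c - pt i y j - 1 / pt i y j)"
      using ev_act[OF i(2) y] ev_sep[of "pt i y" c] y by simp
    also have "\<dots> = (\<Prod>j=1..n. c - y j - 1 / y j)"
    proof (cases "i < n")
      case True
      let ?\<sigma> = "\<lambda>j. if j = i then Suc i else if j = Suc i then i else j"
      show ?thesis
        by (rule prod.reindex_bij_witness[of _ ?\<sigma> ?\<sigma>]) (use True i in \<open>auto simp: pt_def\<close>)
    next
      case False
      show ?thesis by (rule prod.cong) (use False i in \<open>auto simp: pt_def\<close>)
    qed
    finally show "ev (act p (s i) (sep c)) y = ev (sep c) y" using ev_sep[OF y] by simp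
  qed auto
qed

lemma rho_dominant:
  assumes \<mu>: "\<mu> \<in> Lam_plus n" and k: "1 \<le> k" "k \<le> n"
  shows "lk (rho_l n \<mu>) k = 1" "lk (rho_m n \<mu>) k = 2 * int (n - k)"
proof -
  have c: "0 \<le> lk \<mu> i" "1 \<le> i \<Longrightarrow> i \<le> j \<Longrightarrow> j \<le> n \<Longrightarrow> lk \<mu> j \<le> lk \<mu> i" for i j
  proof -
    show "0 \<le> lk \<mu> i" using \<mu> by (cases "lk \<mu> i = 0") (auto simp: Lam_plus_def Lam_iff)
    show "lk \<mu> j \<le> lk \<mu> i" if "1 \<le> i" "i \<le> j" "j \<le> n" using \<mu> that by (simp add: Lam_plus_def)
  qed
  show "lk (rho_l n \<mu>) k = 1" using k c(1)[of k] by (simp add: lk_rho_l sgn1_def)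
  have "{(i, j). 1 \<le> i \<and> i < j \<and> j \<le> n} = (SIGMA i:{1..n}. {i<..n})" by auto
  then have "lk (rho_m n \<mu>) k = (\<Sum>(i, j)\<in>(SIGMA i:{1..n}. {i<..n}). if i = k then 2 else 0)"
    unfolding rho_m_def lookup_sum
  proof (intro sum.cong)
    fix x assume "x \<in> (SIGMA i:{1..n}. {i<..n})"
    then obtain i j where x: "x = (i, j)" "1 \<le> i" "i < j" "j \<le> n" by auto
    have "sgn1 (lk \<mu> i - lk \<mu> j) = 1" "sgn1 (lk \<mu> i + lk \<mu> j) = 1"
      using c(2)[of i j] c(1)[of i] c(1)[of j] x by (auto simp: sgn1_def)
    then show "lk (case x of (i, j) \<Rightarrow> frag_cmul (sgn1 (lk \<mu> i - lk \<mu> j)) (eps i - eps j) +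
        frag_cmul (sgn1 (lk \<mu> i + lk \<mu> j)) (eps i + eps j)) k = (case x of (i, j) \<Rightarrow> if i = k then 2 else 0)"
      unfolding x(1) by (simp only: prod.case frag_cmul_one lookup_add lookup_minus lk_eps) simp
  qed
  also have "\<dots> = (\<Sum>i=1..n. \<Sum>j\<in>{i<..n}. if i = k then 2 else 0)" by (rule sum.Sigma[symmetric]) auto
  also have "\<dots> = (\<Sum>i=1..n. if i = k then 2 * int (n - i) else 0)" by (rule sum.cong) auto
  finally show "lk (rho_m n \<mu>) k = 2 * int (n - k)" using k by simp
qed

end

context generic
begin

text \<open>Take \<open>c = z + 1/z\<close> for the coordinate \<open>z\<close> of \<open>\<gamma>\<close> at \<open>la\<close> at a position where \<open>la\<close> and \<open>\<mu>\<close> differ. The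
  coordinate of \<open>\<gamma>\<^sub>\<mu>\<close> at this position has a different exponent of \<open>q\<close>, any other one has a
  different exponent of \<open>t\<close>, and none is inverse to \<open>z\<close> because all
  contain the factor \<open>t\<^sub>0 t\<^sub>n\<close>.\<close>

lemma invariants_separate:
  assumes la: "la \<in> Lam_plus n" and \<mu>: "\<mu> \<in> Lam_plus n" "\<mu> \<noteq> la"
  shows "\<exists>f\<in>invariants p n. ev f (gm \<mu>) \<noteq> ev f (gm la)"
proof -
  obtain j where j: "1 \<le> j" "j \<le> n" "lk \<mu> j \<noteq> lk la j"
    using Lam_eqI[OF Lam_plus_Lam[OF \<mu>(1)] Lam_plus_Lam[OF la]] \<mu>(2) by blast
  have g: "gm \<nu> k = (t0 p * tn p) powi 1 * tmid p powi (2 * int (n - k)) * q powi lk \<nu> k"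
    if "\<nu> \<in> Lam_plus n" "1 \<le> k" "k \<le> n" for \<nu> k
    unfolding gam_def using rho_dominant[OF that] by simp
  define z where "z = gm la j"
  have znz: "z \<noteq> 0" using gam_nzp[of la] by (simp add: z_def nzp_def)
  have ne: "z + 1 / z - gm \<mu> k - 1 / gm \<mu> k \<noteq> 0" if k: "1 \<le> k" "k \<le> n" for k
  proof
    define w where "w = gm \<mu> k"
    assume "z + 1 / z - gm \<mu> k - 1 / gm \<mu> k = 0"
    moreover have wnz: "w \<noteq> 0" using gam_nzp[of \<mu>] by (simp add: w_def nzp_def)
    ultimately have "(z - w) * (z * w - 1) = 0" using znz unfolding w_def[symmetric] by (simp add: field_simps)
    then consider "w = z" | "z * w = 1" by auto
    then show False
    proof cases
      case 1
      define d e where "d = 2 * int (n - k) - 2 * int (n - j)" and "e = lk \<mu> k - lk la j"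
      have "(d, e) \<noteq> (0, 0)" using j k by (cases "k = j") (auto simp: d_def e_def)
      moreover have "tmid p powi d * q powi e = w / z"
        unfolding w_def z_def g[OF \<mu>(1) k] g[OF la j(1,2)] by (simp add: d_def e_def power_int_diff)
      ultimately show False using gen_mono_ne(1)[of 0 0 d e] 1 znz by auto
    next
      case 2
      define d e where "d = 2 * int (n - k) + 2 * int (n - j)" and "e = lk \<mu> k + lk la j"
      have "t0 p powi 2 * tn p powi 2 * tmid p powi d * q powi e = z * w"
        unfolding w_def z_def g[OF \<mu>(1) k] g[OF la j(1,2)]
        by (simp add: d_def e_def power_int_add power2_eq_square power_int_mult_distrib)
      then show False using gen_mono_ne(1)[of 2 2 d e] 2 by auto
    qed
  qed
  have "ev (sep (z + 1 / z)) (gm \<mu>) \<noteq> 0" using ne by (simp add: ev_sep)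
  moreover have "ev (sep (z + 1 / z)) (gm la) = 0"
    using j by (auto simp: ev_sep z_def intro!: bexI[of _ j])
  ultimately show ?thesis using sep_invariant by metis
qed

lemma Q_invariant:
  assumes la: "la \<in> Lam_plus n" shows "Q 1 la \<in> invariants p n"
proof -
  have "act p (s i) (Q 1 la) = Q 1 la" if "1 \<le> i" "i \<le> n" for i
    using Q_eigen[OF la, of 1 i] that T_invariant[OF that] by (simp add: tev_def)
  moreover have "keys (Q 1 la) \<subseteq> Lam n" using keys_Q[OF la] below_Lam Lam_plus_Lam[OF la] by blast
  ultimately show ?thesis by (simp add: invariants_iff laurent_alg_def)
qed

lemma low_dominant:
  assumes la: "la \<in> Lam_plus n" and x: "x \<in> low la"
  shows "dr x \<in> Lam_plus n" "dom_less n (dr x) la" "dr x \<noteq> la" "x \<in> Lam n"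
proof -
  have d: "dr la = la" by (rule dom_rep_eqI[OF la orbit_refl])
  show xL: "x \<in> Lam n" using x by (simp add: low_def)
  show "dr x \<in> Lam_plus n" by (rule dom_rep(2)[OF xL])
  show "dr x \<noteq> la" using x d by (simp add: low_def)
  then show "dom_less n (dr x) la"
    using x d dom_le_dle[OF dr_Lam[OF xL] Lam_plus_Lam[OF la]] by (simp add: low_def dom_less_def)
qed

lemma dominant_low:
  assumes la: "la \<in> Lam_plus n" and \<mu>: "\<mu> \<in> Lam_plus n" "dom_less n \<mu> la"
  shows "orbit n \<mu> \<subseteq> low la"
proof
  fix x assume x: "x \<in> orbit n \<mu>"
  have "dr la = la" "dr x = \<mu>" by (rule dom_rep_eqI[OF la orbit_refl], rule dom_rep_eqI[OF \<mu>(1) x])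
  then show "x \<in> low la"
    using \<mu> dom_le_dle[OF Lam_plus_Lam[OF \<mu>(1)] Lam_plus_Lam[OF la]] orbit_Lam[OF x Lam_plus_Lam[OF \<mu>(1)]]
    by (simp add: low_def dom_less_def)
qed

text \<open>For uniqueness, a candidate is supported on the lower set generated by the orbit. Invariant functions of
  \<open>Y\<close> remove the \<open>E\<^sub>x\<close> of lower orbits from its expansion, after which \<open>eigen_unique\<close> applies.\<close>

theorem Pplus_Q:
  assumes la: "la \<in> Lam_plus n" shows "Pplus p n la = Q 1 la"
  unfolding Pplus_def
proof (rule the_equality)
  note laL = Lam_plus_Lam[OF la]
  let ?M = "{\<mu> \<in> Lam_plus n. dom_less n \<mu> la}"
  have inv: "f \<in> laurent_alg n" if "f \<in> invariants p n" for f using that by (simp add: invariants_def)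
  have "Q 1 la - orbit_sum n la \<in> laurent.span (orbit_sum n ` ?M)"
  proof (rule invariant_span)
    show D: "Q 1 la - orbit_sum n la \<in> invariants p n"
      by (rule invariants_diff[OF Q_invariant[OF la] orbit_sum_invariant[OF la]])
    fix x assume x: "x \<in> keys (Q 1 la - orbit_sum n la)"
    have "x \<notin> orbit n la"
    proof
      assume "x \<in> orbit n la"
      then have "lk (Q 1 la - orbit_sum n la) x = lk (Q 1 la - orbit_sum n la) la"
        by (rule invariant_lookup[OF D _ la])
      then show False using x lk_Q[OF la, of 1] lk_orbit_sum[OF la, of la] by (simp add: in_keys_iff lookup_minus)
    qed
    moreover from this have "x \<in> keys (Q 1 la)" using x by (simp add: in_keys_iff lookup_minus lk_orbit_sum[OF la])
    ultimately have "x \<in> low la" using keys_Q[OF la, of 1] below_iff[OF laL, of x] orbit_refl[of la] by blast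
    then show "dr x \<in> ?M" using low_dominant[OF la] by blast
  qed
  moreover have "fY p n f (Q 1 la) = lscale (ev f (gm la)) (Q 1 la)" if f: "f \<in> invariants p n" for f
    unfolding Q_def fY_sum[OF inv[OF f] orbit_facts(2)[OF la]] lscale_sum lscale_lscale
  proof (rule sum.cong)
    fix x assume "x \<in> orbit n la"
    then have e: "ev f (gm x) = ev f (gm la)" by (rule ev_invariant_gm[OF f _ la])
    show "lscale (cf 1 x * ev f (gm x)) (En x) = lscale (ev f (gm la) * cf 1 x) (En x)"
      unfolding e by (simp only: mult.commute)
  qed simp
  ultimately show "Q 1 la \<in> invariants p n \<and> Q 1 la - orbit_sum n la \<in> laurent.span (orbit_sum n ` ?M) \<and>
      (\<forall>f\<in>invariants p n. fY p n f (Q 1 la) = lscale (ev f (gm la)) (Q 1 la))"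
    using Q_invariant[OF la] by blast
  fix P assume P: "P \<in> invariants p n \<and> P - orbit_sum n la \<in> laurent.span (orbit_sum n ` ?M) \<and>
      (\<forall>f\<in>invariants p n. fY p n f P = lscale (ev f (gm la)) P)"
  have "laurent.span (orbit_sum n ` ?M) \<subseteq> {f. keys f \<subseteq> low la}"
    by (rule laurent.span_minimal[OF _ subspace_keys]) (use keys_orbit_sum dominant_low[OF la] in auto)
  then have kP: "keys (P - orbit_sum n la) \<subseteq> low la" using P by blast
  define S where "S = (\<Union>x\<in>orbit n la. insert x (below x))"
  have cl: "closed S" unfolding S_def
    by (rule closed_UN[OF orbit_facts(1)[OF la]]) (use closed_down orbit_facts(2)[OF la] in blast)
  then have SL: "finite S" "S \<subseteq> Lam n" by (auto simp: closed_def)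
  have oS: "orbit n la \<subseteq> S" by (auto simp: S_def)
  have Slow: "x \<in> low la" if "x \<in> S" "x \<notin> orbit n la" for x
  proof -
    obtain y where y: "y \<in> orbit n la" "x \<in> below y" using \<open>x \<in> S\<close> \<open>x \<notin> orbit n la\<close> by (auto simp: S_def)
    have yL: "y \<in> Lam n" using orbit_Lam[OF y(1) laL] .
    have "x \<notin> orbit n y" using orbit_eq[OF y(1)] that(2) by blast
    then show ?thesis using y(2) below_iff[OF yL] low_orbit[OF y(1) laL] by blast
  qed
  have "keys P \<subseteq> S"
  proof
    fix x assume x: "x \<in> keys P"
    show "x \<in> S"
    proof (cases "x \<in> orbit n la")
      case True then show ?thesis using oS by blast
    next
      case False
      then have "x \<in> keys (P - orbit_sum n la)" using x by (simp add: in_keys_iff lookup_minus lk_orbit_sum[OF la])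
      then have "x \<in> below la" using kP below_iff[OF laL] by blast
      then show ?thesis unfolding S_def using orbit_refl by blast
    qed
  qed
  then obtain d where d: "P = (\<Sum>x\<in>S. lscale (d x) (En x))" using En_expand[OF cl] by blast
  have d0: "d x = 0" if x: "x \<in> S - orbit n la" for x
  proof -
    have xl: "x \<in> low la" using Slow x by blast
    obtain f where f: "f \<in> invariants p n" "ev f (gm (dr x)) \<noteq> ev f (gm la)"
      using invariants_separate[OF la] low_dominant[OF la xl] by blast
    have "ev f (gm x) = ev f (gm (dr x))"
      using ev_invariant_gm[OF f(1) orbit_sym[OF dom_rep(1)]] low_dominant[OF la xl] by blast
    then have ne: "ev f (gm x) \<noteq> ev f (gm la)" using f(2) by simp
    have "fY p n f P = lscale (ev f (gm la)) P" using P f(1) by blast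
    then have "(\<Sum>x\<in>S. lscale (d x * ev f (gm x)) (En x)) = (\<Sum>x\<in>S. lscale (ev f (gm la) * d x) (En x))"
      unfolding d fY_sum[OF inv[OF f(1)] SL(2)] lscale_sum lscale_lscale .
    then have "d x * ev f (gm x) = ev f (gm la) * d x"
      by (rule En_coeffs_eq[OF SL]) (use x in blast)
    then show ?thesis using ne by auto
  qed
  have d': "P = (\<Sum>x\<in>orbit n la. lscale (d x) (En x))"
    unfolding d by (rule sum.mono_neutral_right[OF SL(1) oS]) (use d0 in auto)
  have "T i P = lscale (tev 1 i) P" if "1 \<le> i" "i \<le> n" for i
    using T_invariant[OF that] P that by (simp add: tev_def invariants_iff)
  then have "P = lscale (d la) (Q 1 la)" by (intro eigen_unique(1)[OF la _ d']) auto
  moreover have "lk P la = 1"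
  proof -
    have "la \<notin> low la" using low_not_orbit[OF laL] orbit_refl by blast
    then have "lk (P - orbit_sum n la) la = 0" using kP by (auto simp: in_keys_iff)
    then show ?thesis using lk_orbit_sum[OF la, of la] by (simp add: lookup_minus)
  qed
  ultimately show "P = Q 1 la" by (rule monic_multiple[OF la])
qed

end

section \<open>Genericity\<close>

text \<open>The exponents of the positive part of \<open>2(b, c, d, e)\<close>, placed at the coordinates \<open>t\<^sub>0, t\<^sub>n, t, q\<close> of a
  parameter point. Together with the negative part they turn \<open>(t\<^sub>0\<^sup>b t\<^sub>n\<^sup>c t\<^sup>d q\<^sup>e)\<^sup>2 = 1\<close> into a polynomial equation.\<close>

definition posexp :: "int \<times> int \<times> int \<times> int \<Rightarrow> nat \<Rightarrow>\<^sub>0 nat" where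
  "posexp = (\<lambda>(b, c, d, e). sg 0 (nat (2 * e)) + sg 1 (nat (2 * b)) + sg 2 (nat (2 * d)) + sg 3 (nat (2 * c)))"

definition binomial :: "int \<times> int \<times> int \<times> int \<Rightarrow> (nat \<Rightarrow>\<^sub>0 nat) \<Rightarrow>\<^sub>0 complex" where
  "binomial k = sg (posexp k) 1 - sg (posexp (- k)) 1"

lemma lk_posexp: "lk (posexp (b, c, d, e)) i =
    (if i = 0 then nat (2 * e) else if i = 1 then nat (2 * b) else if i = 2 then nat (2 * d)
     else if i = 3 then nat (2 * c) else 0)"
  by (simp add: posexp_def lookup_add lookup_single when_def)

lemma keys_posexp: "keys (posexp k) \<subseteq> {0, 1, 2, 3}"
  by (cases k) (auto simp: in_keys_iff lk_posexp split: if_splits)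

lemma posexp_ne: "k \<noteq> 0 \<Longrightarrow> posexp k \<noteq> posexp (- k)"
proof
  assume k: "k \<noteq> 0" and e: "posexp k = posexp (- k)"
  obtain b c d e where K: "k = (b, c, d, e)" by (cases k)
  have E: "lk (posexp (b, c, d, e)) i = lk (posexp (- b, - c, - d, - e)) i" for i using e K by simp
  have z: "x = 0" if "nat (2 * x) = nat (- (2 * x))" for x :: int using that by arith
  have "e = 0" by (rule z) (use E[of 0] in \<open>simp add: lk_posexp\<close>)
  moreover have "b = 0" by (rule z) (use E[of 1] in \<open>simp add: lk_posexp\<close>)
  moreover have "d = 0" by (rule z) (use E[of 2] in \<open>simp add: lk_posexp\<close>)
  moreover have "c = 0" by (rule z) (use E[of 3] in \<open>simp add: lk_posexp\<close>)
  ultimately show False using k by (simp add: K zero_prod_def)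
qed

lemma keys_binomial: "k \<noteq> 0 \<Longrightarrow> keys (binomial k) = {posexp k, posexp (- k)}"
  using posexp_ne[of k]
  by (auto simp: binomial_def in_keys_iff lookup_minus lookup_single when_def split: if_splits)

lemma mpoly_eval_binomial:
  assumes k: "k \<noteq> 0" 
  shows "mpoly_eval (binomial k) z = (\<Prod>i\<in>{0, 1, 2, 3}. (z ! i) ^ lk (posexp k) i) - (\<Prod>i\<in>{0, 1, 2, 3}. (z ! i) ^ lk (posexp (- k)) i)"
proof -
  have m: "(\<Prod>i\<in>keys (posexp k). (z ! i) ^ lk (posexp k) i) = (\<Prod>i\<in>{0, 1, 2, 3}. (z ! i) ^ lk (posexp k) i)" for k
    by (rule prod.mono_neutral_left[OF _ keys_posexp]) (auto simp: in_keys_iff)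
  have "lk (binomial k) (posexp k) = 1" "lk (binomial k) (posexp (- k)) = - 1"
    using posexp_ne[OF k] by (auto simp: binomial_def lookup_minus lookup_single when_def)
  then show ?thesis
    unfolding mpoly_eval_def keys_binomial[OF k] using posexp_ne[OF k] by (simp add: m)
qed

lemma powi_square:
  fixes x :: complex
  assumes "x \<noteq> 0" shows "(x powi k)\<^sup>2 = x ^ nat (2 * k) / x ^ nat (2 * (- k))"
proof (cases "k \<ge> 0")
  case True
  then show ?thesis by (simp add: power_int_def power_mult[symmetric] nat_mult_distrib mult.commute)
next
  case False
  then have "nat (2 * - k) = 2 * nat (- k)" by (simp add: nat_mult_distrib)
  then show ?thesis using False assms
    by (simp add: power_int_def power_mult[symmetric] power_inverse divide_inverse mult.commute)
qed

definition torsion_locus :: "int \<times> int \<times> int \<times> int \<Rightarrow> complex list set" where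
  "torsion_locus k = {z. length z = 6 \<and> mpoly_eval (binomial k) z = 0}"

lemma hypersurface_torsion_locus:
  assumes k: "k \<noteq> 0" shows "proper_hypersurface (torsion_locus k)"
  unfolding proper_hypersurface_def torsion_locus_def
proof (intro exI[of _ "binomial k"] conjI)
  show "binomial k \<noteq> 0" using keys_binomial[OF k] by auto
  show "\<forall>m\<in>keys (binomial k). keys m \<subseteq> {..<6}"
    unfolding keys_binomial[OF k] using keys_posexp[of k] keys_posexp[of "- k"] by auto
qed simp

lemma generic_intro:
  assumes n: "2 \<le> n" and p: "nonzero_params p"
    and g: "\<And>k. k \<noteq> 0 \<Longrightarrow> param_point p \<notin> torsion_locus k"
  shows "generic n p"
proof
  show "2 \<le> n" by (rule n)
  show "nonzero_params p" by (rule p)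
  have nz: "t0 p \<noteq> 0" "tn p \<noteq> 0" "tmid p \<noteq> 0" "qpar p \<noteq> 0"
    using p by (simp_all add: nonzero_params_def qpar_def)
  fix b c d e :: int assume k: "(b, c, d, e) \<noteq> (0, 0, 0, 0)"
  then have k': "(b, c, d, e) \<noteq> 0" by (simp add: zero_prod_def)
  show "(t0 p powi b * tn p powi c * tmid p powi d * qpar p powi e)\<^sup>2 \<noteq> 1"
  proof
    assume "(t0 p powi b * tn p powi c * tmid p powi d * qpar p powi e)\<^sup>2 = 1"
    then have "t0 p ^ nat (2 * b) * tn p ^ nat (2 * c) * tmid p ^ nat (2 * d) * qpar p ^ nat (2 * e) =
        t0 p ^ nat (2 * - b) * tn p ^ nat (2 * - c) * tmid p ^ nat (2 * - d) * qpar p ^ nat (2 * - e)"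
      unfolding power_mult_distrib powi_square[OF nz(1)] powi_square[OF nz(2)] powi_square[OF nz(3)] powi_square[OF nz(4)]
      using nz by (simp add: divide_simps split: if_splits)
    then have "mpoly_eval (binomial (b, c, d, e)) (param_point p) = 0"
      unfolding mpoly_eval_binomial[OF k'] by (simp add: lk_posexp param_point_def eval_nat_numeral mult_ac)
    then show False using g[OF k'] by (simp add: torsion_locus_def param_point_def)
  qed
qed

theorem theorem6p6:
  fixes n :: nat
  assumes "n \<ge> 2"
  shows "\<exists>HS :: complex list set set. countable HS \<and> (\<forall>H\<in>HS. proper_hypersurface H) \<and>
    (\<forall>p :: kparams. nonzero_params p \<and> param_point p \<notin> \<Union>HS \<longrightarrow>
      (\<forall>la\<in>Lam_plus n. A_plus p n la = laurent.span {Pplus p n la}) \<and>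
      (\<forall>la\<in>Lam_plus n.
         (la \<in> Lam_plusplus n \<longrightarrow> laurent.dim (A_minus p n la) = 1) \<and>
         (la \<notin> Lam_plusplus n \<longrightarrow> A_minus p n la = {0})) \<and>
      (\<forall>la\<in>Lam_plusplus n. \<exists>!P. P \<in> A_minus p n la \<and> prec_monic n la P) \<and>
      (\<forall>la\<in>Lam_plus n.
         Pplus p n la = (\<Sum>\<mu>\<in>orbit n la. lscale (coeff_at_mu p n 1 \<mu>) (Pns p n \<mu>)) \<and>
         (\<forall>\<mu>\<in>orbit n la. coeff_at_mu p n 1 \<mu> = coeff_at_lambda p n 1 la \<mu>)) \<and>
      (\<forall>la\<in>Lam_plusplus n.
         Pminus p n la = (\<Sum>\<mu>\<in>orbit n la. lscale (coeff_at_mu p n (- 1) \<mu>) (Pns p n \<mu>)) \<and>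
         (\<forall>\<mu>\<in>orbit n la. coeff_at_mu p n (- 1) \<mu> = coeff_at_lambda p n (- 1) la \<mu>)))"
proof (intro exI[of _ "torsion_locus ` (- {0})"] conjI allI impI)
  show "countable (torsion_locus ` (- {0}))" by simp
  show "\<forall>H\<in>torsion_locus ` (- {0}). proper_hypersurface H" using hypersurface_torsion_locus by auto
  fix p assume p: "nonzero_params p \<and> param_point p \<notin> \<Union> (torsion_locus ` (- {0}))"
  interpret generic n p by (rule generic_intro) (use assms p in auto)
  have Q: "Q \<sigma> la = (\<Sum>\<mu>\<in>orbit n la. lscale (coeff_at_mu p n \<sigma> \<mu>) (Pns p n \<mu>))" if "la \<in> Lam_plus n" for \<sigma> la
    unfolding Q_def using orbit_facts(2)[OF that] by (intro sum.cong) (auto simp: Pns_En)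
  have M: "Pminus p n la = Q (- 1) la" if "la \<in> Lam_plusplus n" for la
    unfolding Pminus_def A_minus_monic[OF that] by simp
  show "\<forall>la\<in>Lam_plus n. A_plus p n la = laurent.span {Pplus p n la}"
    using A_plus_eq Pplus_Q by simp
  show "\<forall>la\<in>Lam_plus n.
         (la \<in> Lam_plusplus n \<longrightarrow> laurent.dim (A_minus p n la) = 1) \<and>
         (la \<notin> Lam_plusplus n \<longrightarrow> A_minus p n la = {0})"
    using A_minus_dim A_minus_trivial by blast
  show "\<forall>la\<in>Lam_plusplus n. \<exists>!P. P \<in> A_minus p n la \<and> prec_monic n la P"
    using A_minus_monic by simp
  show "\<forall>la\<in>Lam_plus n.
         Pplus p n la = (\<Sum>\<mu>\<in>orbit n la. lscale (coeff_at_mu p n 1 \<mu>) (Pns p n \<mu>)) \<and>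
         (\<forall>\<mu>\<in>orbit n la. coeff_at_mu p n 1 \<mu> = coeff_at_lambda p n 1 la \<mu>)"
    using Pplus_Q Q coeff_eq by auto
  show "\<forall>la\<in>Lam_plusplus n.
         Pminus p n la = (\<Sum>\<mu>\<in>orbit n la. lscale (coeff_at_mu p n (- 1) \<mu>) (Pns p n \<mu>)) \<and>
         (\<forall>\<mu>\<in>orbit n la. coeff_at_mu p n (- 1) \<mu> = coeff_at_lambda p n (- 1) la \<mu>)"
    using M Q plusplus_regular(1) coeff_eq by auto
qed

end
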